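(* Let $\alpha\in(1/2,1)$ and let $X,X_1,X_2,\ldots$ be i.i.d. nonnegative nonarithmetic random variables with distribution function $F$. Let $c,(k_n),\ell_1,A,\ell,\delta,M_R,\gamma,g_\lambda$ be as in the context, and assume that for all sufficiently large $x$ $$1-F(x)=\frac{\ell(x)}{x^{\alpha}}\,[M_R(\delta(x))+h_R(x)],$$ where $h_R$ is right-continuous and $\lim_{n\to\infty}h_R(A_{k_n}x)=0$ for every continuity point $x>0$ of $M_R$. Put $U(y)=\sum_{n=0}^\infty F^{*n}(y)$ (the renewal function, $F^{*n}$ being the $n$-fold convolution power) and $B(x)=x^\alpha\ell(x)^{-1}$. Then for every $h>0$ $$\lim_{y\to\infty}\left| \frac{y^{1-\alpha}\ell(y)}{2h}\bigl(U(y+h)-U(y-h)\bigr)-\alpha\int_0^\infty g_{\gamma(B(y)x^{-\alpha})}(x)\,x^{-\alpha}\,\mathrm dx\right|=0 .$$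
   Context: A random variable is arithmetic if it is concentrated on $h\mathbb Z$ for some $h>0$, and nonarithmetic otherwise. Setting: $c>1$; $(k_n)_{n\ge1}$ is a strictly increasing sequence of positive integers with $k_{n+1}/k_n\to c$. $\ell_1:[1,\infty)\to(0,\infty)$ is slowly varying at infinity, $A(x)=A_x=x^{1/\alpha}\ell_1(x)$, and for large $x$ the slowly varying function $\ell$ is defined by $x^{-\alpha}\ell(x)=\sup\{t\in(0,1]: t^{-1/\alpha}\ell_1(1/t)>x\}$. (Then $A$ and $B(y)=y^\alpha/\ell(y)$ are asymptotic inverses of each other.) For all large $x$ there is a unique $k_n$ with $A_{k_n}\le x<A_{k_{n+1}}$, and $\delta(x)=x/A_{k_n}$. $M_R:(0,\infty)\to(0,\infty)$ is bounded, bounded away from $0$, right-continuous, not constant, satisfies $M_R(c^{1/\alpha}x)=M_R(x)$ for all $x>0$, and $x\mapsto M_R(x)x^{-\alpha}$ is nonincreasing. Position parameter: $\gamma(x)=\gamma_x=x/k_n$ where $k_{n-1}<x\le k_n$ (with the convention $k_0=0$). For $\lambda>0$ let $\Lambda_\lambda$ be the measure on $(0,\infty)$ with $\Lambda_\lambda((x,\infty))=x^{-\alpha}M_R(\lambda^{1/\alpha}x)$, $x>0$, and let $V_\lambda$ be the (nonnegative, semistable) random variable with characteristic function $\mathbb E e^{\mathrm itV_\lambda}=\exp\{\int_0^\infty(e^{\mathrm itx}-1)\Lambda_\lambda(\mathrm dx)\}$ (no centering is used when $\alpha<1$). $G_\lambda$ denotes its distribution function and $g_\lambda$ its (smooth)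 density. Note $G_{c\lambda}=G_\lambda$. *)

theory Defs
  imports "HOL-Probability.Probability"
begin

definition arithmetic_rv :: "'a measure \<Rightarrow> ('a \<Rightarrow> real) \<Rightarrow> bool" where
  "arithmetic_rv P X \<longleftrightarrow> (\<exists>d>0. AE \<omega> in P. \<exists>m::int. X \<omega> = of_int m * d)"

(* Only the values on [1,\<infinity>) matter. Measurability is part of slow variation. *)
definition slowly_varying :: "(real \<Rightarrow> real) \<Rightarrow> bool" where
  "slowly_varying l \<longleftrightarrow>
     l \<in> borel_measurable (restrict_space borel {1..}) \<and>
     (\<forall>x\<ge>1. 0 < l x) \<and>
     (\<forall>r>0. ((\<lambda>x. l (r * x) / l x) \<longlongrightarrow> 1) at_top)"

definition norming :: "real \<Rightarrow> (real \<Rightarrow> real) \<Rightarrow> real \<Rightarrow> real" where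
  "norming \<alpha> l1 x = x powr (1/\<alpha>) * l1 x"

definition ell :: "real \<Rightarrow> (real \<Rightarrow> real) \<Rightarrow> real \<Rightarrow> real" where
  "ell \<alpha> l1 x = x powr \<alpha> * Sup {t \<in> {0<..1}. t powr (-1/\<alpha>) * l1 (1/t) > x}"

definition asym_inv :: "real \<Rightarrow> (real \<Rightarrow> real) \<Rightarrow> real \<Rightarrow> real" where
  "asym_inv \<alpha> l1 y = y powr \<alpha> / ell \<alpha> l1 y"

(* The index n is unique only for large x; smaller x play no role. *)
definition delta :: "real \<Rightarrow> (real \<Rightarrow> real) \<Rightarrow> (nat \<Rightarrow> nat) \<Rightarrow> real \<Rightarrow> real" where
  "delta \<alpha> l1 k x =
     x / norming \<alpha> l1 (k (THE n. 1 \<le> n \<and> norming \<alpha> l1 (k n) \<le> x \<and> x < norming \<alpha> l1 (k (n + 1))))"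

(* Intended for k with k 0 = 0. *)
definition position :: "(nat \<Rightarrow> nat) \<Rightarrow> real \<Rightarrow> real" where
  "position k x = x / k (THE n. 1 \<le> n \<and> k (n - 1) < x \<and> x \<le> k n)"

(* The measure on (0,\<infinity>) with tail T, as a Borel measure on the line that vanishes on {..0}. *)
definition tail_measure :: "(real \<Rightarrow> real) \<Rightarrow> real measure" where
  "tail_measure T =
     (THE N. sets N = sets borel \<and> emeasure N {..0} = 0 \<and> (\<forall>x>0. emeasure N {x<..} = ennreal (T x)))"

definition levy_measure :: "real \<Rightarrow> (real \<Rightarrow> real) \<Rightarrow> real \<Rightarrow> real measure" where
  "levy_measure \<alpha> MR s = tail_measure (\<lambda>x. x powr (-\<alpha>) * MR (s powr (1/\<alpha>) * x))"

(* The distribution of V_s, determined by its characteristic function. *)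
definition semistable_law :: "real \<Rightarrow> (real \<Rightarrow> real) \<Rightarrow> real \<Rightarrow> real measure" where
  "semistable_law \<alpha> MR s =
     (THE V. real_distribution V \<and>
        (\<forall>t. char V t = exp (CLINT x | levy_measure \<alpha> MR s. iexp (t * x) - 1)))"

(* The continuous version of the density; continuity makes it unique pointwise. *)
definition semistable_density :: "real \<Rightarrow> (real \<Rightarrow> real) \<Rightarrow> real \<Rightarrow> real \<Rightarrow> real" where
  "semistable_density \<alpha> MR s =
     (THE g. continuous_on UNIV g \<and> (\<forall>x. 0 \<le> g x) \<and>
        semistable_law \<alpha> MR s = density lborel (\<lambda>x. ennreal (g x)))"

fun conv_power :: "real measure \<Rightarrow> nat \<Rightarrow> real measure" where
  "conv_power \<mu> 0 = return borel 0"
| "conv_power \<mu> (Suc n) = convolution \<mu> (conv_power \<mu> n)"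

definition renewal_function :: "real measure \<Rightarrow> real \<Rightarrow> real" where
  "renewal_function \<mu> y = (\<Sum>n. cdf (conv_power \<mu> n) y)"

lemma tail_measure_unique:
  fixes T :: "real \<Rightarrow> real"
  assumes N: "sets N = sets borel" "emeasure N {..0} = 0" "\<And>x. x > 0 \<Longrightarrow> emeasure N {x<..} = ennreal (T x)"
  assumes N': "sets N' = sets borel" "emeasure N' {..0} = 0" "\<And>x. x > 0 \<Longrightarrow> emeasure N' {x<..} = ennreal (T x)"
  shows "N = N'"
proof (rule measure_eqI)
  show "sets N = sets N'" using N(1) N'(1) by simp
  fix S assume "S \<in> sets N"
  then have S: "S \<in> sets borel" using N(1) by simp
  define R where "R n = {1 / real (Suc n)<..}" for n
  have Rpos: "0 < 1 / real (Suc n)" for n by simp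
  have eqd: "density N (indicator (R n)) = density N' (indicator (R n))" for n
  proof (rule measure_eqI_lessThan)
    show "sets (density N (indicator (R n))) = sets borel"
      "sets (density N' (indicator (R n))) = sets borel"
      using N(1) N'(1) by auto
    have e: "emeasure (density K (indicator (R n))) {x<..} = ennreal (T (max x (1 / real (Suc n))))"
      if "sets K = sets borel" "\<And>x. x > 0 \<Longrightarrow> emeasure K {x<..} = ennreal (T x)" for K x
    proof -
      have "R n \<inter> {x<..} = {max x (1 / real (Suc n))<..}" by (auto simp: R_def)
      then show ?thesis
        using that(1) that(2)[of "max x (1 / real (Suc n))"] Rpos[of n]
        by (subst emeasure_restricted) (simp_all add: R_def less_max_iff_disj)
    qed
    show "emeasure (density N (indicator (R n))) {x<..} < \<infinity>" for x
      using e[OF N(1,3)] by simp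
    show "emeasure (density N (indicator (R n))) {x<..} = emeasure (density N' (indicator (R n))) {x<..}" for x
      using e[OF N(1,3)] e[OF N'(1,3)] by simp
  qed
  have lim: "emeasure K S = (SUP n. emeasure (density K (indicator (R n))) S)"
    if K: "sets K = sets borel" "emeasure K {..0} = 0" for K
  proof -
    have r: "emeasure (density K (indicator (R n))) S = emeasure K (R n \<inter> S)" for n
      using K S by (intro emeasure_restricted) (auto simp: R_def)
    have "mono R"
      unfolding R_def mono_def
    proof (intro allI impI subsetI)
      fix m n :: nat and x :: real assume "m \<le> n" "x \<in> {1 / real (Suc m)<..}"
      moreover from \<open>m \<le> n\<close> have "1 / real (Suc n) \<le> 1 / real (Suc m)" by (simp add: field_simps)
      ultimately show "x \<in> {1 / real (Suc n)<..}" by auto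
    qed
    then have inc: "incseq (\<lambda>n. R n \<inter> S)" by (auto simp: mono_def)
    have "R n \<inter> S \<in> sets K" for n using K S by (auto simp: R_def)
    then have "(SUP n. emeasure K (R n \<inter> S)) = emeasure K (\<Union>n. R n \<inter> S)"
      using inc by (intro SUP_emeasure_incseq) blast+
    also have "(\<Union>n. R n \<inter> S) = S \<inter> {0<..}"
    proof -
      have "\<exists>n. 1 / real (Suc n) < x" if "x > 0" for x :: real
        using reals_Archimedean[OF that] by (auto simp: inverse_eq_divide)
      moreover have "x > 0" if "1 / real (Suc n) < x" for n and x :: real
        using that Rpos[of n] by linarith
      ultimately show ?thesis by (auto simp: R_def simp del: of_nat_Suc)
    qed
    also have "emeasure K (S \<inter> {0<..}) = emeasure K S"
    proof (rule emeasure_eq_AE)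
      have "{..0} \<in> null_sets K" using K by (auto simp: null_sets_def)
      from AE_not_in[OF this] show "AE x in K. (x \<in> S \<inter> {0<..}) = (x \<in> S)"
        by eventually_elim auto
    qed (use K S in auto)
    finally show ?thesis by (simp add: r)
  qed
  show "emeasure N S = emeasure N' S"
    using lim[OF N(1,2)] lim[OF N'(1,2)] by (simp add: eqd)
qed

lemma tail_measure_exists:
  fixes T :: "real \<Rightarrow> real"
  assumes mono: "\<And>x y. 0 < x \<Longrightarrow> x \<le> y \<Longrightarrow> T y \<le> T x"
    and rc: "\<And>x. 0 < x \<Longrightarrow> continuous (at_right x) T"
    and zero: "filterlim T at_top (at_right 0)"
    and inf: "(T \<longlongrightarrow> 0) at_top"
  shows "\<exists>N. sets N = sets borel \<and> emeasure N {..0} = 0 \<and> (\<forall>x>0. emeasure N {x<..} = ennreal (T x))"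
proof -
  define Q where "Q u = Sup {x. 0 < x \<and> T x > u}" for u
  have Tnn: "0 \<le> T x" if "x > 0" for x
  proof (rule tendsto_upperbound[OF inf])
    show "\<forall>\<^sub>F y in at_top. T y \<le> T x"
      using eventually_ge_at_top[of x] by eventually_elim (rule mono[OF that])
  qed simp
  have key: "x < Q u \<longleftrightarrow> u < T x" if x: "0 < x" and u: "0 < u" for x u
  proof -
    have "eventually (\<lambda>z. T z > u) (at_right 0)" using zero by (simp add: filterlim_at_top_dense)
    then have "eventually (\<lambda>z. T z > u \<and> 0 < z) (at_right 0)"
      using eventually_at_right_less[of 0] by eventually_elim auto
    then obtain z where z: "T z > u" "0 < z"
      using eventually_happens'[of "at_right (0::real)"] by auto
    have "eventually (\<lambda>z. T z < u) at_top" using inf u by (rule order_tendstoD)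
    then obtain b where b: "\<And>y. y \<ge> b \<Longrightarrow> T y < u" by (auto simp: eventually_at_top_linorder)
    have bdd: "bdd_above {x. 0 < x \<and> T x > u}"
    proof (rule bdd_aboveI[of _ b])
      fix y assume "y \<in> {x. 0 < x \<and> T x > u}"
      then show "y \<le> b" using b[of y] by (cases "y \<le> b") auto
    qed
    have "x < Q u \<longleftrightarrow> (\<exists>y>x. 0 < y \<and> T y > u)"
      unfolding Q_def using z by (subst less_cSup_iff[OF _ bdd]) auto
    also have "\<dots> \<longleftrightarrow> u < T x"
    proof
      assume "\<exists>y>x. 0 < y \<and> T y > u"
      then show "u < T x" using mono[OF x] by (meson less_imp_le less_le_trans)
    next
      assume "u < T x"
      then have "eventually (\<lambda>y. u < T y) (at_right x)"
        using rc[OF x] by (auto simp: continuous_within intro: order_tendstoD)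
      then have "eventually (\<lambda>y. u < T y \<and> x < y) (at_right x)"
        using eventually_at_right_less[of x] by eventually_elim auto
      then obtain y where "u < T y" "x < y"
        using eventually_happens'[of "at_right x"] by auto
      then show "\<exists>y>x. 0 < y \<and> T y > u" using x by force
    qed
    finally show ?thesis .
  qed
  define L where "L = restrict_space lborel {0::real<..}"
  have spL: "space L = {0<..}" by (simp add: L_def space_restrict_space)
  have Qpos: "0 < Q u" if "0 < u" for u
  proof -
    have "eventually (\<lambda>z. T z > u) (at_right 0)" using zero by (simp add: filterlim_at_top_dense)
    then have "eventually (\<lambda>z. T z > u \<and> 0 < z) (at_right 0)"
      using eventually_at_right_less[of 0] by eventually_elim auto
    then obtain z where z: "T z > u" "0 < z"
      using eventually_happens'[of "at_right (0::real)"] by auto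
    then show ?thesis using key[of z u] that by linarith
  qed
  have pre: "{u \<in> space L. x < Q u} = (if 0 < x then {0<..<T x} else {0<..})" for x
  proof (cases "0 < x")
    case True
    then show ?thesis using key[OF True] by (auto simp: spL)
  next
    case False
    have "x < Q u" if "0 < u" for u using Qpos[OF that] False by linarith
    with False show ?thesis by (auto simp: spL)
  qed
  have meas: "Q \<in> borel_measurable L"
    unfolding borel_measurable_iff_greater
  proof
    fix a
    have "{0<..<T a} \<in> sets L" "{0<..} \<in> sets L"
      by (auto simp: L_def sets_restrict_space_iff)
    then show "{w \<in> space L. a < Q w} \<in> sets L" by (simp add: pre)
  qed
  show ?thesis
  proof (intro exI[of _ "distr L borel Q"] conjI allI impI)
    show "sets (distr L borel Q) = sets borel" by simp
    have "Q -` {..0} \<inter> space L = {}" using Qpos by (force simp: spL)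
    then show "emeasure (distr L borel Q) {..0} = 0"
      using meas by (simp add: emeasure_distr)
    fix x :: real assume x: "0 < x"
    have "Q -` {x<..} \<inter> space L = {0<..<T x}" using pre[of x] x by auto
    moreover have "emeasure L {0<..<T x} = ennreal (T x)"
      using Tnn[OF x] unfolding L_def by (subst emeasure_restrict_space) auto
    ultimately show "emeasure (distr L borel Q) {x<..} = ennreal (T x)"
      using meas by (simp add: emeasure_distr)
  qed
qed

lemma tail_measure:
  fixes T :: "real \<Rightarrow> real"
  assumes "\<And>x y. 0 < x \<Longrightarrow> x \<le> y \<Longrightarrow> T y \<le> T x"
    and "\<And>x. 0 < x \<Longrightarrow> continuous (at_right x) T"
    and "filterlim T at_top (at_right 0)"
    and "(T \<longlongrightarrow> 0) at_top"
  shows "sets (tail_measure T) = sets borel"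
    and "emeasure (tail_measure T) {..0} = 0"
    and "0 < x \<Longrightarrow> emeasure (tail_measure T) {x<..} = ennreal (T x)"
proof -
  have "\<exists>!N. sets N = sets borel \<and> emeasure N {..0} = 0 \<and> (\<forall>x>0. emeasure N {x<..} = ennreal (T x))"
    using tail_measure_exists[OF assms] tail_measure_unique[of _ T] by blast
  from theI'[OF this]
  show "sets (tail_measure T) = sets borel"
    and "emeasure (tail_measure T) {..0} = 0"
    and "0 < x \<Longrightarrow> emeasure (tail_measure T) {x<..} = ennreal (T x)"
    unfolding tail_measure_def by blast+
qed

end

theory Submission
  imports Defs
begin

text \<open>
  Let \<open>\<phi>\<close> be the characteristic function of the law and \<open>B\<close> the generalised inverse of the norming
  function. Only subsequences \<open>y\<close> along which \<open>B (y j) / k (N j)\<close> converges to some \<open>\<lambda>\<close> need to be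
  considered. Along these the rescaled exponents \<open>B (y j) * (1 - \<phi> (u / y j))\<close> converge to
  \<open>- \<psi>\<^sub>\<lambda> u\<close>, where \<open>\<psi>\<^sub>\<lambda>\<close> is the exponent of the semistable variable of index \<open>\<lambda>\<close>.
  The integral of \<open>fourier \<sigma>\<close>, centred at \<open>y\<close>, against the renewal measure is
  \<open>\<integral> exp (- i t y) \<sigma> t / (1 - \<phi> t) dt\<close>. In this oscillating integral the
  integrand is replaced by half its difference with its translate by \<open>pi / y\<close>; after rescaling the difference decays like
  \<open>\<bar>u\<bar> powr (- 2 * \<alpha>)\<close>, which is integrable at infinity exactly because \<open>\<alpha> > 1/2\<close>, and dominated
  convergence applies, the dominating function coming from Potter bounds. The limit is \<open>\<sigma> 0\<close> times
  a constant that the substitution \<open>s = x powr (- \<alpha>)\<close> in \<open>1 / w = \<integral> exp (- s * w) ds\<close>, together with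
  Fourier inversion and the scaling \<open>\<psi>\<^sub>\<kappa> u = x powr (- \<alpha>) * \<psi>\<^sub>\<lambda> (x * u)\<close> for
  \<open>\<kappa> = \<lambda> * x powr (- \<alpha>)\<close>, identifies with the potential integral of the semistable
  densities. Levy's continuity theorem for the Fejer kernel passes from smooth test functions to
  intervals. On the other side, \<open>\<gamma> (B y * x powr (- \<alpha>))\<close> converges to
  \<open>\<lambda> * x powr (- \<alpha>)\<close> up to a power of \<open>c\<close>, which the densities do not see.
\<close>

section \<open>Slowly varying functions and the generalised inverse of the norming function\<close>

text \<open>\<open>MR\<close> oscillates, so the normalised renewal increments need not converge;
  they have limit points indexed by \<lambda>. Three obstacles shape the proof. First,
  \<open>A\<close> need not be monotone, and \<open>hR\<close> is controlled only at fixed multiples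
  of \<open>A (k n)\<close>; quasi-monotonicity of \<open>A\<close> and monotonicity of the tail
  carry limits to other arguments, outside a countable exceptional set. Second, nonarithmeticity
  keeps \<open>1 - char M t\<close> away from 0 on compact sets that avoid 0, with no uniform bound
  at infinity. Hence the transforms of test functions are compactly supported. Abel summation needs
  nonnegative test functions, so characters enter only through
  \<open>1 + Re (z * iexp (\<theta> * x))\<close> times a Fejer kernel. Third, the reciprocal
  exponents are not integrable at infinity; the same half-period difference is used before the
  limit, in the limit and for the densities, so that all three have integrable majorants and Fubini
  applies. The semistable laws themselves are obtained from the given law, as weak limits of
  normalised sums.\<close>

lemma additive_uniform_convergence:
  fixes h :: "real \<Rightarrow> real"
  assumes [measurable]: "h \<in> borel_measurable borel"
    and lim: "\<And>s. 0 \<le> s \<Longrightarrow> ((\<lambda>x. h (x + s) - h x) \<longlongrightarrow> 0) at_top"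
    and "0 < \<epsilon>"
  shows "\<forall>\<^sub>F x in at_top. \<forall>s\<in>{0..1}. \<bar>h (x + s) - h x\<bar> < \<epsilon>"
\<comment> \<open>Steinhaus argument: the shifts that are good for \<open>x n\<close>, and the
  translate by \<open>s n\<close> of those good for \<open>x n + s n\<close>, each have measure more
  than 3/2 inside an interval of length 3. They meet, and a common shift shows that
  \<open>s n\<close> was good for \<open>x n\<close>.\<close>
proof (rule ccontr)
  assume "\<not> ?thesis"
  then have "\<forall>n::nat. \<exists>x\<ge>real n. \<exists>s\<in>{0..1}. \<epsilon> \<le> \<bar>h (x + s) - h x\<bar>"
    by (force simp: eventually_at_top_linorder not_less)
  then obtain x s where x: "\<And>n. real n \<le> x n" and s: "\<And>n. 0 \<le> s n" "\<And>n. s n \<le> 1"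
    and bad: "\<And>n. \<epsilon> \<le> \<bar>h (x n + s n) - h (x n)\<bar>"
    by (metis atLeastAtMost_iff)
  \<comment> \<open>Good from index n on, so that the sets increase to \<open>{0..2}\<close> and
    their measures converge by continuity from below.\<close>
  define V where "V y n = {r \<in> {0..2}. \<forall>m\<ge>n. \<bar>h (y m + r) - h (y m)\<bar> < \<epsilon>/2}" for y :: "nat \<Rightarrow> real" and n
  have V_lim: "(\<lambda>n. measure lebesgue (V y n)) \<longlonglongrightarrow> 2" if y: "\<And>n. real n \<le> y n" for y
  proof -
    have "V y n \<in> sets borel" for n unfolding V_def by measurable
    then have Vm: "range (V y) \<subseteq> sets lebesgue" by auto
    have U: "(\<Union>n. V y n) = {0..2}"
    proof (intro antisym subsetI)
      fix r :: real assume r: "r \<in> {0..2}"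
      have "filterlim y at_top sequentially"
        by (rule filterlim_at_top_mono[OF filterlim_real_sequentially]) (use y in auto)
      then have "(\<lambda>n. h (y n + r) - h (y n)) \<longlonglongrightarrow> 0"
        using filterlim_compose[OF lim[of r]] r by auto
      then have "\<forall>\<^sub>F n in sequentially. \<bar>h (y n + r) - h (y n)\<bar> < \<epsilon>/2"
        using \<open>0 < \<epsilon>\<close> by (auto dest!: tendstoD[of _ _ _ "\<epsilon>/2"] simp: dist_real_def)
      then show "r \<in> (\<Union>n. V y n)"
        using r by (auto simp: V_def eventually_sequentially)
    qed (auto simp: V_def)
    have "(\<lambda>n. measure lebesgue (V y n)) \<longlonglongrightarrow> measure lebesgue (\<Union>n. V y n)"
      by (rule Lim_measure_incseq[OF Vm]) (simp_all add: U, auto simp: V_def incseq_def)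
    then show ?thesis by (simp add: U)
  qed
  define y where "y n = x n + s n" for n
  have y: "real n \<le> y n" for n using x[of n] s(1)[of n] by (simp add: y_def)
  have "\<forall>\<^sub>F n in sequentially. 3/2 < measure lebesgue (V x n)"
    "\<forall>\<^sub>F n in sequentially. 3/2 < measure lebesgue (V y n)"
    using order_tendstoD(1)[OF V_lim[OF x], of "3/2"] order_tendstoD(1)[OF V_lim[OF y], of "3/2"] by simp_all
  then have "\<forall>\<^sub>F n in sequentially. 3/2 < measure lebesgue (V x n) \<and> 3/2 < measure lebesgue (V y n)"
    by eventually_elim auto
  then obtain n where n: "3/2 < measure lebesgue (V x n)" "3/2 < measure lebesgue (V y n)"
    by (auto simp: eventually_sequentially)
  have Vlm: "V z n \<in> lmeasurable" for z
  proof (rule bounded_set_imp_lmeasurable)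
    show "bounded (V z n)" by (rule bounded_subset[of "{0..2}"]) (auto simp: V_def)
    have "V z n \<in> sets borel" unfolding V_def by measurable
    then show "V z n \<in> sets lebesgue" by simp
  qed
  let ?W = "(+) (s n) ` V y n"
  have W: "?W \<in> lmeasurable" "measure lebesgue ?W = measure lebesgue (V y n)"
    using Vlm[of y] by (auto simp: measurable_translation measure_translation)
  have "V x n \<inter> ?W \<noteq> {}"
  proof
    assume disj: "V x n \<inter> ?W = {}"
    have "measure lebesgue (V x n) + measure lebesgue ?W = measure lebesgue (V x n \<union> ?W)"
      using Vlm[of x] W disj by (subst measure_Union) (auto simp: fmeasurable_def)
    also have "\<dots> \<le> measure lebesgue {0..3::real}"
    proof (rule measure_mono_fmeasurable)
      show "V x n \<union> ?W \<subseteq> {0..3}" using s[of n] by (auto simp: V_def)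
      show "V x n \<union> ?W \<in> sets lebesgue" using Vlm[of x] W by (auto simp: fmeasurable_def)
    qed auto
    finally show False using n W by simp
  qed
  then obtain r where r: "r \<in> V y n" "s n + r \<in> V x n" by auto
  then have "\<bar>h (x n + (s n + r)) - h (x n)\<bar> < \<epsilon>/2" "\<bar>h (x n + s n + r) - h (x n + s n)\<bar> < \<epsilon>/2"
    by (auto simp: V_def y_def)
  then show False using bad[of n] unfolding add.assoc by linarith
qed

lemma slowly_varying_uniform:
  assumes l: "slowly_varying l" and "0 < \<epsilon>"
  shows "\<exists>v0\<ge>1. \<forall>v w. v0 \<le> v \<longrightarrow> v \<le> w \<longrightarrow> w \<le> 2 * v \<longrightarrow> \<bar>ln (l w) - ln (l v)\<bar> < \<epsilon>"
proof -
  \<comment> \<open>\<open>max 0\<close> keeps the argument of \<open>l\<close> in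
    \<open>{1..}\<close>, where measurability and positivity are available.\<close>
  define h where "h x = ln (l (exp (max 0 x)))" for x :: real
  have lm: "l \<in> borel_measurable (restrict_space borel {1..})" and lpos: "\<And>x. 1 \<le> x \<Longrightarrow> 0 < l x"
    and lr: "\<And>r. 0 < r \<Longrightarrow> ((\<lambda>x. l (r * x) / l x) \<longlongrightarrow> 1) at_top"
    using l by (auto simp: slowly_varying_def)
  have "(\<lambda>x::real. exp (max 0 x)) \<in> borel \<rightarrow>\<^sub>M restrict_space borel {1..}"
    by (intro measurable_restrict_space2) auto
  from measurable_compose[OF this lm] have hm: "h \<in> borel_measurable borel"
    unfolding h_def by measurable
  have "((\<lambda>x. h (x + s) - h x) \<longlongrightarrow> 0) at_top" if s: "0 \<le> s" for s
  proof -
    have "((\<lambda>x. ln (l (exp s * exp x) / l (exp x))) \<longlongrightarrow> ln 1) at_top"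
      by (intro tendsto_ln filterlim_compose[OF lr exp_at_top]) auto
    moreover have "\<forall>\<^sub>F x in at_top. ln (l (exp s * exp x) / l (exp x)) = h (x + s) - h x"
      using eventually_ge_at_top[of 0]
    proof eventually_elim
      fix x :: real assume x: "0 \<le> x"
      have "1 \<le> exp x" "1 \<le> exp s * exp x" using x s by (auto simp: exp_add[symmetric])
      then show "ln (l (exp s * exp x) / l (exp x)) = h (x + s) - h x"
        using x s lpos[of "exp x"] lpos[of "exp s * exp x"]
        by (simp add: h_def max_def ln_div exp_add mult.commute)
    qed
    ultimately show ?thesis by (auto simp: tendsto_cong)
  qed
  from additive_uniform_convergence[OF hm this \<open>0 < \<epsilon>\<close>]
  obtain x0 where x0: "\<And>x s. x0 \<le> x \<Longrightarrow> 0 \<le> s \<Longrightarrow> s \<le> 1 \<Longrightarrow> \<bar>h (x + s) - h x\<bar> < \<epsilon>"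
    unfolding eventually_at_top_linorder by (metis atLeastAtMost_iff)
  show ?thesis
  proof (intro exI[of _ "exp (max 0 x0)"] conjI allI impI)
    fix v w assume v: "exp (max 0 x0) \<le> v" and vw: "v \<le> w" "w \<le> 2 * v"
    have v1: "1 \<le> v" by (rule order_trans[OF _ v]) simp
    have "max 0 x0 \<le> ln v" using v v1 by (subst ln_ge_iff) auto
    moreover have "ln w - ln v \<le> ln 2"
      using vw v1 ln_mult[of 2 v] ln_le_cancel_iff[of w "2 * v"] by auto
    \<comment> \<open>A factor of at most 2 is an additive shift of at most \<open>ln 2\<close>,
      inside the unit interval of the additive lemma.\<close>
    moreover have "ln 2 < (1::real)" using exp_ge_add_one_self[of 1] ln_less_cancel_iff[of 2 "exp 1"] e_less_272
      by (metis exp_gt_zero ln_2_less_1)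
    moreover have "ln v \<le> ln w" using vw v1 by simp
    ultimately have "\<bar>h (ln v + (ln w - ln v)) - h (ln v)\<bar> < \<epsilon>" by (intro x0) auto
    moreover have "0 \<le> ln v" using v1 by simp
    ultimately show "\<bar>ln (l w) - ln (l v)\<bar> < \<epsilon>" using v1 vw by (simp add: h_def)
  qed auto
qed


section \<open>Growth of the norming function and its generalised inverse\<close>

locale slowly_varying_norming =
  fixes \<alpha> :: real and l1 :: "real \<Rightarrow> real"
  assumes alpha_pos: "0 < \<alpha>" and l1: "slowly_varying l1"
begin

abbreviation "A \<equiv> norming \<alpha> l1"
abbreviation "B \<equiv> asym_inv \<alpha> l1"

lemma A_pos: "1 \<le> u \<Longrightarrow> 0 < A u"
  using l1 by (auto simp: norming_def slowly_varying_def)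

lemma ln_A: "1 \<le> u \<Longrightarrow> ln (A u) = ln u / \<alpha> + ln (l1 u)"
  using l1 by (subst norming_def, subst ln_mult) (auto simp: slowly_varying_def ln_powr)

lemma A_ratio:
  assumes "0 < r" shows "((\<lambda>u. A (r * u) / A u) \<longlongrightarrow> r powr (1/\<alpha>)) at_top"
proof -
  have "((\<lambda>u. r powr (1/\<alpha>) * (l1 (r * u) / l1 u)) \<longlongrightarrow> r powr (1/\<alpha>) * 1) at_top"
    using l1 assms by (intro tendsto_intros) (auto simp: slowly_varying_def)
  moreover have "\<forall>\<^sub>F u in at_top. r powr (1/\<alpha>) * (l1 (r * u) / l1 u) = A (r * u) / A u"
    using eventually_gt_at_top[of 0]
    by eventually_elim (use assms in \<open>simp add: norming_def powr_mult\<close>)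
  ultimately show ?thesis by (simp add: tendsto_cong)
qed

text \<open>The rate is halved so that errors do not accumulate: each doubling gains more than the
  weaker rate asks for, and the surplus absorbs the error of that doubling. A single
  \<open>\<epsilon>\<close> is lost overall.\<close>

lemma A_growth:
  assumes "0 < \<epsilon>"
  shows "\<exists>v0\<ge>1. \<forall>v w. v0 \<le> v \<longrightarrow> v \<le> w \<longrightarrow> ln (A v) + (ln w - ln v) / (2 * \<alpha>) - \<epsilon> \<le> ln (A w)"
proof -
  \<comment> \<open>The second bound gives
    \<open>ln 2 / \<alpha> - e \<ge> ln 2 / (2 * \<alpha>)\<close>, the surplus needed in the
    induction.\<close>
  define e where "e = min \<epsilon> (ln 2 / (2 * \<alpha>))"
  have e: "0 < e" "e \<le> \<epsilon>" "e \<le> ln 2 / (2 * \<alpha>)" using assms alpha_pos by (auto simp: e_def)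
  obtain v0 where v0: "1 \<le> v0"
    and close: "\<And>v w. v0 \<le> v \<Longrightarrow> v \<le> w \<Longrightarrow> w \<le> 2 * v \<Longrightarrow> \<bar>ln (l1 w) - ln (l1 v)\<bar> < e"
    using slowly_varying_uniform[OF l1 e(1)] by blast
  have one: "ln (A v) + (ln w - ln v) / \<alpha> - e \<le> ln (A w)" if "v0 \<le> v" "v \<le> w" "w \<le> 2 * v" for v w
    using close[OF that] that v0 by (auto simp: ln_A diff_divide_distrib)
  have "ln (A v) + (ln w - ln v) / (2 * \<alpha>) - e \<le> ln (A w)" if "v0 \<le> v" "v \<le> w" "w \<le> 2 ^ n * v" for v w and n :: nat
    using that
  proof (induction n arbitrary: w)
    case 0
    then have "w = v" by simp
    then show ?case using e by simp
  next
    case (Suc n)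
    show ?case
    proof (cases "w \<le> 2 * v")
      case True
      have "(ln w - ln v) / (2 * \<alpha>) \<le> (ln w - ln v) / \<alpha>"
        using alpha_pos Suc.prems v0 by (intro divide_left_mono) auto
      then show ?thesis using one[OF Suc.prems(1,2) True] by linarith
    next
      case False
      have IH: "ln (A v) + (ln (w/2) - ln v) / (2 * \<alpha>) - e \<le> ln (A (w/2))"
        using Suc False by (intro Suc.IH) auto
      have lw: "ln w - ln (w/2) = ln 2" using False Suc.prems v0 by (simp add: ln_div)
      have "ln (A (w/2)) + ln 2 / \<alpha> - e \<le> ln (A w)"
        using one[of "w/2" w] False Suc.prems v0 lw by auto
      moreover have "ln 2 / \<alpha> - e \<ge> ln 2 / (2 * \<alpha>)" using e by (simp add: field_simps)
      moreover have "(ln w - ln v) / (2 * \<alpha>) = (ln (w/2) - ln v) / (2 * \<alpha>) + ln 2 / (2 * \<alpha>)"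
        using lw by (simp add: add_divide_distrib[symmetric] diff_divide_distrib[symmetric])
      ultimately show ?thesis using IH by linarith
    qed
  qed
  moreover have "\<exists>n::nat. w \<le> 2 ^ n * v" if "v0 \<le> v" for v w
  proof -
    obtain n where "w / v < 2 ^ n" using real_arch_pow[of 2 "w / v"] by auto
    then show ?thesis using that v0 by (intro exI[of _ n]) (simp add: field_simps)
  qed
  ultimately have "ln (A v) + (ln w - ln v) / (2 * \<alpha>) - e \<le> ln (A w)" if "v0 \<le> v" "v \<le> w" for v w
    using that by metis
  then show ?thesis using v0 e(2) by (intro exI[of _ v0]) (smt (verit))
qed

lemma A_at_top: "filterlim A at_top at_top"
proof -
  obtain v0 where v0: "1 \<le> v0"
    and g: "\<And>w. v0 \<le> w \<Longrightarrow> ln (A v0) + (ln w - ln v0) / (2 * \<alpha>) - 1 \<le> ln (A w)"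
    using A_growth[of 1] by auto
  have "filterlim (\<lambda>w. (ln (A v0) - ln v0 / (2 * \<alpha>) - 1) + (1/(2 * \<alpha>)) * ln w) at_top at_top"
    using alpha_pos
    by (intro filterlim_tendsto_add_at_top[OF tendsto_const]
        filterlim_tendsto_pos_mult_at_top[OF tendsto_const _ ln_at_top]) auto
  then have "filterlim (\<lambda>w. ln (A w)) at_top at_top"
    by (rule filterlim_at_top_mono)
      (rule eventually_mono[OF eventually_ge_at_top[of v0]], drule g, simp add: diff_divide_distrib algebra_simps)
  from filterlim_compose[OF exp_at_top this] show ?thesis
    by (rule filterlim_cong[THEN iffD1, rotated -1, OF _ refl refl])
      (rule eventually_mono[OF eventually_ge_at_top[of 1]], simp add: A_pos)
qed

text \<open>Substitute for monotonicity of \<open>A\<close>, with a factor as close to 1 as desired;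
  every comparison of values of \<open>A\<close> at different arguments rests on it.\<close>

lemma A_quasi_mono:
  assumes "1 < r" shows "\<exists>v0\<ge>1. \<forall>v w. v0 \<le> v \<longrightarrow> v \<le> w \<longrightarrow> A v \<le> r * A w"
proof -
  obtain v0 where v0: "1 \<le> v0"
    and g: "\<And>v w. v0 \<le> v \<Longrightarrow> v \<le> w \<Longrightarrow> ln (A v) + (ln w - ln v) / (2 * \<alpha>) - ln r \<le> ln (A w)"
    using A_growth[of "ln r"] assms by auto
  have "A v \<le> r * A w" if vw: "v0 \<le> v" "v \<le> w" for v w
  proof -
    have "0 \<le> (ln w - ln v) / (2 * \<alpha>)" using v0 vw alpha_pos by simp
    then have "ln (A v) \<le> ln r + ln (A w)" using g[OF vw] by linarith
    then have "ln (A v) \<le> ln (r * A w)" using A_pos[of w] v0 vw assms by (simp add: ln_mult)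
    then show ?thesis using A_pos[of w] A_pos[of v] v0 vw assms by (subst (asm) ln_le_cancel_iff) auto
  qed
  then show ?thesis using v0 by blast
qed

text \<open>In the variable \<open>u = 1 / t\<close> this is the set of \<open>u \<ge> 1\<close>
  with \<open>y < A u\<close>. Hence \<open>B y\<close>, the reciprocal of the supremum, is the
  first passage point of \<open>A\<close> above the level y.\<close>

definition level_set :: "real \<Rightarrow> real set" where
  "level_set y = {t \<in> {0<..1}. t powr (-1/\<alpha>) * l1 (1/t) > y}"

lemma level_set_iff: "t \<in> level_set y \<longleftrightarrow> 0 < t \<and> t \<le> 1 \<and> y < A (1/t)"
  by (auto simp: level_set_def norming_def powr_divide powr_minus_divide)

lemma B_eq: "0 < y \<Longrightarrow> B y = 1 / Sup (level_set y)"
  by (simp add: asym_inv_def ell_def level_set_def)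

lemma level_set_nonempty: "level_set y \<noteq> {}"
proof -
  have "\<forall>\<^sub>F u in at_top. y < A u \<and> 1 \<le> u"
    using A_at_top eventually_ge_at_top[of 1]
    by (auto simp: filterlim_at_top_dense intro: eventually_conj)
  then obtain u where "y < A u" "1 \<le> u" by (auto simp: eventually_at_top_linorder)
  then have "1/u \<in> level_set y" by (auto simp: level_set_iff)
  then show ?thesis by auto
qed

lemma level_set_bdd: "bdd_above (level_set y)"
  by (rule bdd_aboveI[of _ 1]) (auto simp: level_set_iff)

lemma Sup_level_set: "0 < Sup (level_set y)" "Sup (level_set y) \<le> 1"
proof -
  obtain t where t: "t \<in> level_set y" using level_set_nonempty by auto
  then have "t \<le> Sup (level_set y)" by (rule cSup_upper[OF _ level_set_bdd])
  with t show "0 < Sup (level_set y)" by (auto simp: level_set_iff)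
  show "Sup (level_set y) \<le> 1" by (rule cSup_least[OF level_set_nonempty]) (auto simp: level_set_iff)
qed

lemma B_ge_1: "0 < y \<Longrightarrow> 1 \<le> B y"
  using Sup_level_set by (simp add: B_eq)

lemma B_leI: "0 < y \<Longrightarrow> 1 \<le> u \<Longrightarrow> y < A u \<Longrightarrow> B y \<le> u"
  using cSup_upper[OF _ level_set_bdd, of "1/u" y] Sup_level_set[of y]
  by (simp add: B_eq level_set_iff field_simps)

lemma A_le_below_B: "0 < y \<Longrightarrow> 1 \<le> u \<Longrightarrow> u < B y \<Longrightarrow> A u \<le> y"
  using B_leI by (meson not_le)

lemma B_lessD:
  assumes "0 < y" "B y < u" shows "\<exists>v\<ge>1. v < u \<and> y < A v"
proof -
  have u: "0 < u" using assms B_ge_1[of y] by linarith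
  then have "1/u < Sup (level_set y)" using assms Sup_level_set[of y] by (simp add: B_eq field_simps)
  then obtain t where "t \<in> level_set y" "1/u < t"
    using less_cSup_iff[OF level_set_nonempty level_set_bdd] by blast
  then show ?thesis using u by (intro exI[of _ "1/t"]) (auto simp: level_set_iff field_simps)
qed

lemma B_mono: "0 < x \<Longrightarrow> x \<le> y \<Longrightarrow> B x \<le> B y"
proof -
  assume "0 < x" "x \<le> y"
  then have "Sup (level_set y) \<le> Sup (level_set x)"
    by (intro cSup_subset_mono level_set_nonempty level_set_bdd) (auto simp: level_set_iff)
  then show ?thesis using \<open>0 < x\<close> \<open>x \<le> y\<close> Sup_level_set[of y] by (simp add: B_eq frac_le)
qed

end

text \<open>Slow variation alone does not make \<open>B\<close> unbounded: \<open>l1\<close> may be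
  unbounded on a bounded interval, and then \<open>B\<close> is bounded. For the laws considered
  here unboundedness is derived from the tail.\<close>

locale slowly_varying_norming_unbounded = slowly_varying_norming +
  assumes B_at_top: "filterlim B at_top at_top"
begin

text \<open>\<open>A (s' * u)\<close> is about \<open>s' powr (1/\<alpha>) * A u\<close>, hence
  above or below \<open>A u * z\<close> according to whether \<open>s'\<close> exceeds
  \<open>z powr \<alpha>\<close>. The lower bound is the harder half, because a nonmonotone
  \<open>A\<close> might pass the level before \<open>s' * u\<close>.\<close>

lemma B_A_ratio:
  assumes z: "0 < z" shows "((\<lambda>u. B (A u * z) / u) \<longlongrightarrow> z powr \<alpha>) at_top"
proof (rule order_tendstoI)
  fix s assume s: "z powr \<alpha> < s"
  define s' where "s' = (z powr \<alpha> + s) / 2"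
  have "0 < z powr \<alpha> + s" using z s by (intro add_pos_pos) (auto intro: le_less_trans[of 0 "z powr \<alpha>"])
  then have s': "z powr \<alpha> < s'" "s' < s" "0 < s'" using s by (simp_all add: s'_def)
  have "z < s' powr (1/\<alpha>)"
    using powr_less_mono2[of "1/\<alpha>" "z powr \<alpha>" s'] s' alpha_pos z by (simp add: powr_powr)
  from order_tendstoD(1)[OF A_ratio[OF s'(3)] this]
  show "\<forall>\<^sub>F u in at_top. B (A u * z) / u < s"
    using eventually_ge_at_top[of "max 1 (1/s')"]
  proof eventually_elim
    case (elim u)
    then have u: "1 \<le> u" "1 \<le> s' * u" using s' by (auto simp: field_simps)
    have "A u * z < A (s' * u)" using elim A_pos[OF u(1)] by (simp add: field_simps)
    then have "B (A u * z) \<le> s' * u" using z A_pos[OF u(1)] u by (intro B_leI) auto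
    also have "\<dots> < s * u" using s' u by simp
    finally show ?case using u by (simp add: field_simps)
  qed
next
  fix s assume s: "s < z powr \<alpha>"
  define s' where "s' = (z powr \<alpha> + max s 0) / 2"
  have s': "s' < z powr \<alpha>" "s < s'" "0 < s'" using s z by (auto simp: s'_def add_pos_nonneg)
  have sz: "s' powr (1/\<alpha>) < z"
    using powr_less_mono2[of "1/\<alpha>" s' "z powr \<alpha>"] s' alpha_pos z by (simp add: powr_powr)
  define r where "r = z / s' powr (1/\<alpha>)"
  have r: "1 < r" using sz s' by (simp add: r_def)
  \<comment> \<open>The gap r is split evenly: one factor pays for the missing monotonicity of
    \<open>A\<close>, the other for the convergence of the ratio.\<close>
  define r2 where "r2 = sqrt r"
  have r2: "1 < r2" "r2 * r2 = r" using r by (auto simp: r2_def)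
  obtain v0 where v0: "1 \<le> v0" and qm: "\<And>v w. v0 \<le> v \<Longrightarrow> v \<le> w \<Longrightarrow> A v \<le> r2 * A w"
    using A_quasi_mono[OF r2(1)] by blast
  obtain Y where Y: "\<And>y. Y \<le> y \<Longrightarrow> v0 < B y"
    using B_at_top by (auto simp: filterlim_at_top_dense eventually_at_top_linorder)
  have "filterlim (\<lambda>u. A u * z) at_top at_top"
    using filterlim_tendsto_pos_mult_at_top[OF tendsto_const z A_at_top] by (simp add: mult.commute)
  then have "\<forall>\<^sub>F u in at_top. Y \<le> A u * z" by (simp add: filterlim_at_top)
  moreover have "\<forall>\<^sub>F u in at_top. A (s' * u) / A u < r2 * s' powr (1/\<alpha>)"
    using order_tendstoD(2)[OF A_ratio[OF s'(3)], of "r2 * s' powr (1/\<alpha>)"] r2 s' by simp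
  ultimately show "\<forall>\<^sub>F u in at_top. s < B (A u * z) / u"
    using eventually_ge_at_top[of "max 1 (1/s')"]
  proof eventually_elim
    case (elim u)
    then have u: "1 \<le> u" "1 \<le> s' * u" using s' by (auto simp: field_simps)
    have Az: "0 < A u * z" using A_pos[OF u(1)] z by simp
    have "s' * u \<le> B (A u * z)"
    proof (rule ccontr)
      assume "\<not> ?thesis"
      with B_lessD[OF Az, of "s' * u"] obtain v where v: "1 \<le> v" "v < s' * u" "A u * z < A v" by auto
      \<comment> \<open>Quasi-monotonicity starts at \<open>v0\<close>. Smaller v lie below
        \<open>B (A u * z)\<close>, since \<open>B\<close> is unbounded, and therefore cannot exceed
        the level.\<close>
      have "v0 < v"
      proof (rule ccontr)
        assume "\<not> v0 < v"
        then have "A v \<le> A u * z" using Y[OF elim(1)] v by (intro A_le_below_B Az) auto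
        then show False using v by simp
      qed
      then have "A v \<le> r2 * A (s' * u)" using v by (intro qm) auto
      also have "\<dots> < r2 * (r2 * s' powr (1/\<alpha>) * A u)"
        using elim r2 A_pos[OF u(1)] by (intro mult_strict_left_mono) (auto simp: field_simps)
      also have "\<dots> = A u * z" using r2 s' by (simp add: r_def field_simps)
      finally show False using v by simp
    qed
    moreover have "s * u < s' * u" using u s' by simp
    ultimately have "s * u < B (A u * z)" by linarith
    then show ?case using u by (simp add: field_simps)
  qed
qed

text \<open>The level y is squeezed between values of \<open>A\<close> at two points within factors
  \<open>1 - \<eta>\<close> and \<open>1 + \<eta>\<close> of \<open>B y\<close>; monotonicity of
  \<open>B\<close> then reduces everything to \<open>B_A_ratio\<close>.\<close>

lemma B_ratio:
  assumes \<rho>: "0 < \<rho>" shows "((\<lambda>y. B (\<rho> * y) / B y) \<longlongrightarrow> \<rho> powr \<alpha>) at_top"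
proof -
  have main: "\<forall>\<^sub>F y in at_top. (1 - \<eta>) * (\<rho> powr \<alpha> - \<eta>) \<le> B (\<rho> * y) / B y
      \<and> B (\<rho> * y) / B y \<le> (1 + \<eta>) * (\<rho> powr \<alpha> + \<eta>)"
    if \<eta>: "0 < \<eta>" "\<eta> < 1" "\<eta> < \<rho> powr \<alpha>" for \<eta>
  proof -
    have "\<forall>\<^sub>F u in at_top. \<rho> powr \<alpha> - \<eta> < B (A u * \<rho>) / u \<and> B (A u * \<rho>) / u < \<rho> powr \<alpha> + \<eta>"
      using order_tendstoD[OF B_A_ratio[OF \<rho>]] \<eta> by (intro eventually_conj) auto
    then obtain U where U: "\<And>u. U \<le> u \<Longrightarrow> \<rho> powr \<alpha> - \<eta> < B (A u * \<rho>) / u \<and> B (A u * \<rho>) / u < \<rho> powr \<alpha> + \<eta>"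
      by (auto simp: eventually_at_top_linorder)
    have "\<forall>\<^sub>F y in at_top. max 1 U / (1 - \<eta>) \<le> B y"
      using B_at_top by (simp add: filterlim_at_top)
    then show ?thesis
      using eventually_gt_at_top[of 0]
    proof eventually_elim
      case (elim y)
      have By: "max 1 U \<le> (1 - \<eta>) * B y" using elim \<eta> by (simp add: field_simps)
      have By1: "1 \<le> B y" using B_ge_1 elim by simp
      define u where "u = (1 - \<eta>) * B y"
      have u: "1 \<le> u" "U \<le> u" "u < B y" using By By1 \<eta> by (auto simp: u_def algebra_simps)
      have "A u \<le> y" using A_le_below_B elim u by simp
      then have "B (A u * \<rho>) \<le> B (\<rho> * y)"
        using A_pos[OF u(1)] \<rho> by (intro B_mono) (auto simp: mult.commute)
      moreover have "(\<rho> powr \<alpha> - \<eta>) * u \<le> B (A u * \<rho>)"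
        using U[OF u(2)] u by (simp add: field_simps)
      ultimately have lo: "(1 - \<eta>) * (\<rho> powr \<alpha> - \<eta>) * B y \<le> B (\<rho> * y)"
        by (simp add: u_def algebra_simps)
      obtain v where v: "1 \<le> v" "v < (1 + \<eta>) * B y" "y < A v"
        using B_lessD[of y "(1 + \<eta>) * B y"] elim By1 \<eta> by auto
      have "B y \<le> v" using B_leI elim v by simp
      then have Uv: "U \<le> v" using u by linarith
      have "B (\<rho> * y) \<le> B (A v * \<rho>)"
        using elim \<rho> v by (intro B_mono) (auto simp: mult.commute)
      also have "\<dots> \<le> (\<rho> powr \<alpha> + \<eta>) * v" using U[OF Uv] v by (simp add: field_simps)
      also have "\<dots> \<le> (\<rho> powr \<alpha> + \<eta>) * ((1 + \<eta>) * B y)"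
        using v \<rho> \<eta> by (intro mult_left_mono) auto
      finally have "B (\<rho> * y) \<le> (1 + \<eta>) * (\<rho> powr \<alpha> + \<eta>) * B y" by (simp add: algebra_simps)
      with lo show ?case using By1 by (simp add: field_simps)
    qed
  qed
  have at0: "\<forall>\<^sub>F \<eta> in at_right 0. 0 < \<eta> \<and> \<eta> < 1 \<and> \<eta> < \<rho> powr \<alpha>"
    using \<rho> eventually_at_right_real[of 0 "min 1 (\<rho> powr \<alpha>)"] by (auto elim!: eventually_mono)
  show ?thesis
  proof (rule order_tendstoI)
    fix s assume s: "s < \<rho> powr \<alpha>"
    have "((\<lambda>\<eta>. (1 - \<eta>) * (\<rho> powr \<alpha> - \<eta>)) \<longlongrightarrow> (1 - 0) * (\<rho> powr \<alpha> - 0)) (at_right 0)"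
      by (intro tendsto_intros)
    then have "\<forall>\<^sub>F \<eta> in at_right 0. s < (1 - \<eta>) * (\<rho> powr \<alpha> - \<eta>)"
      using s by (intro order_tendstoD) auto
    then obtain \<eta> where \<eta>: "0 < \<eta>" "\<eta> < 1" "\<eta> < \<rho> powr \<alpha>" "s < (1 - \<eta>) * (\<rho> powr \<alpha> - \<eta>)"
      using eventually_happens'[OF trivial_limit_at_right_real eventually_conj[OF at0]] by blast
    show "\<forall>\<^sub>F y in at_top. s < B (\<rho> * y) / B y"
      using main[OF \<eta>(1-3)] by eventually_elim (use \<eta> in linarith)
  next
    fix s assume s: "\<rho> powr \<alpha> < s"
    have "((\<lambda>\<eta>. (1 + \<eta>) * (\<rho> powr \<alpha> + \<eta>)) \<longlongrightarrow> (1 + 0) * (\<rho> powr \<alpha> + 0)) (at_right 0)"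
      by (intro tendsto_intros)
    then have "\<forall>\<^sub>F \<eta> in at_right 0. (1 + \<eta>) * (\<rho> powr \<alpha> + \<eta>) < s"
      using s by (intro order_tendstoD) auto
    then obtain \<eta> where \<eta>: "0 < \<eta>" "\<eta> < 1" "\<eta> < \<rho> powr \<alpha>" "(1 + \<eta>) * (\<rho> powr \<alpha> + \<eta>) < s"
      using eventually_happens'[OF trivial_limit_at_right_real eventually_conj[OF at0]] by blast
    show "\<forall>\<^sub>F y in at_top. B (\<rho> * y) / B y < s"
      using main[OF \<eta>(1-3)] by eventually_elim (use \<eta> in linarith)
  qed
qed

text \<open>Bounds for one doubling are iterated up to a power of 2 next to r. The strict gaps
  between \<alpha> and the exponents make each doubling bound exact, so only the rounding of r costs
  a constant.\<close>

lemma Potter: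
  assumes \<beta>: "0 < \<beta>2" "\<beta>2 < \<alpha>" "\<alpha> < \<beta>1"
  shows "\<exists>C\<ge>1. \<exists>y0>0. \<forall>y\<ge>y0. \<forall>r\<ge>1. B (r * y) \<le> C * r powr \<beta>1 * B y \<and> r powr \<beta>2 * B y \<le> C * B (r * y)"
proof -
  have "\<forall>\<^sub>F y in at_top. 2 powr \<beta>2 < B (2 * y) / B y \<and> B (2 * y) / B y < 2 powr \<beta>1"
    using order_tendstoD[OF B_ratio[of 2]] \<beta> by (intro eventually_conj) auto
  then obtain y1 where y1: "\<And>y. y1 \<le> y \<Longrightarrow> 2 powr \<beta>2 < B (2 * y) / B y \<and> B (2 * y) / B y < 2 powr \<beta>1"
    by (auto simp: eventually_at_top_linorder)
  define y0 where "y0 = max 1 y1"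
  have y0: "0 < y0" "y1 \<le> y0" by (auto simp: y0_def)
  have step: "2 powr \<beta>2 * B y \<le> B (2 * y)" "B (2 * y) \<le> 2 powr \<beta>1 * B y" if "y0 \<le> y" for y
    using y1[of y] y0 that B_ge_1[of y] by (auto simp: field_simps)
  have iter: "2 powr (\<beta>2 * real n) * B y \<le> B (2 ^ n * y) \<and> B (2 ^ n * y) \<le> 2 powr (\<beta>1 * real n) * B y"
    if y: "y0 \<le> y" for y n
  proof (induction n)
    case (Suc n)
    have "y \<le> 2 ^ n * y" using y y0 by simp
    then have y': "y0 \<le> 2 ^ n * y" using y by linarith
    have "2 powr (\<beta>2 * real (Suc n)) * B y = 2 powr \<beta>2 * (2 powr (\<beta>2 * real n) * B y)"
      by (simp add: powr_add[symmetric] algebra_simps)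
    also have "\<dots> \<le> 2 powr \<beta>2 * B (2 ^ n * y)" using Suc by (intro mult_left_mono) auto
    also have "\<dots> \<le> B (2 * (2 ^ n * y))" by (rule step[OF y'])
    finally have 1: "2 powr (\<beta>2 * real (Suc n)) * B y \<le> B (2 ^ Suc n * y)" by (simp add: mult.assoc)
    have "B (2 * (2 ^ n * y)) \<le> 2 powr \<beta>1 * B (2 ^ n * y)" by (rule step[OF y'])
    also have "\<dots> \<le> 2 powr \<beta>1 * (2 powr (\<beta>1 * real n) * B y)" using Suc by (intro mult_left_mono) auto
    also have "\<dots> = 2 powr (\<beta>1 * real (Suc n)) * B y" by (simp add: powr_add[symmetric] algebra_simps)
    finally show ?case using 1 by (simp add: mult.assoc)
  qed simp
  have "B (r * y) \<le> 2 powr \<beta>1 * r powr \<beta>1 * B y \<and> r powr \<beta>2 * B y \<le> 2 powr \<beta>1 * B (r * y)"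
    if y: "y0 \<le> y" and r: "1 \<le> r" for y r
  proof -
    define n where "n = nat \<lfloor>log 2 r\<rfloor>"
    have "\<lfloor>log 2 r\<rfloor> = int n" using r by (simp add: n_def)
    then have n: "2 ^ n \<le> r" "r < 2 ^ Suc n"
      using floor_log_eq_powr_iff[of r 2 "int n"] r by (auto simp: powr_add powr_realpow mult.commute)
    have By: "0 < B y" using B_ge_1[of y] y y0 by simp
    have "B (r * y) \<le> B (2 ^ Suc n * y)" using n y y0 r by (intro B_mono mult_right_mono) auto
    also have "\<dots> \<le> 2 powr (\<beta>1 * real (Suc n)) * B y" using iter[OF y] by blast
    also have "2 powr (\<beta>1 * real (Suc n)) = 2 powr \<beta>1 * (2 ^ n) powr \<beta>1"
      by (simp add: powr_realpow[symmetric] powr_powr powr_add[symmetric] algebra_simps)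
    also have "\<dots> \<le> 2 powr \<beta>1 * r powr \<beta>1" using n \<beta> by (intro mult_left_mono powr_mono2) auto
    finally have 1: "B (r * y) \<le> 2 powr \<beta>1 * r powr \<beta>1 * B y" using By by simp
    have "r powr \<beta>2 \<le> (2 ^ Suc n) powr \<beta>2" using n r \<beta> by (intro powr_mono2) auto
    also have "\<dots> = 2 powr \<beta>2 * 2 powr (\<beta>2 * real n)"
      by (simp add: powr_mult powr_realpow[symmetric] powr_powr mult.commute)
    finally have "r powr \<beta>2 * B y \<le> 2 powr \<beta>2 * (2 powr (\<beta>2 * real n) * B y)" using By by simp
    also have "\<dots> \<le> 2 powr \<beta>2 * B (2 ^ n * y)" using iter[OF y] by (intro mult_left_mono) auto
    also have "\<dots> \<le> 2 powr \<beta>2 * B (r * y)" using n y y0 by (intro mult_left_mono B_mono mult_right_mono) auto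
    also have "\<dots> \<le> 2 powr \<beta>1 * B (r * y)" using \<beta> B_ge_1[of "r * y"] y y0 r by (intro mult_right_mono) auto
    finally show ?thesis using 1 by simp
  qed
  then show ?thesis using y0 \<beta> by (intro exI[of _ "2 powr \<beta>1"]) (auto simp: ge_one_powr_ge_zero)
qed

text \<open>In contrast to the Potter bounds, x may be arbitrarily small: once \<open>y * x\<close>
  is below \<open>y0\<close>, the trivial bound \<open>B (y * x) \<ge> 1\<close> is enough.\<close>

lemma B_scaled_ge:
  assumes \<beta>: "0 < \<beta>2" "\<beta>2 < \<alpha>" "\<alpha> < \<beta>1"
  shows "\<exists>C>0. \<exists>y0>0. \<forall>y\<ge>y0. \<forall>x>0. B y \<le> C * max (x powr -\<beta>1) (x powr -\<beta>2) * B (y * x)"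
proof -
  obtain C y0 where C: "1 \<le> C" and y0: "0 < y0"
    and P: "\<And>y r. y0 \<le> y \<Longrightarrow> 1 \<le> r \<Longrightarrow> B (r * y) \<le> C * r powr \<beta>1 * B y"
      "\<And>y r. y0 \<le> y \<Longrightarrow> 1 \<le> r \<Longrightarrow> r powr \<beta>2 * B y \<le> C * B (r * y)"
    using Potter[OF \<beta>] by blast
  \<comment> \<open>The factor \<open>B y0\<close> pays for the range
    \<open>y * x < y0\<close>.\<close>
  define C' where "C' = C * B y0"
  have By0: "1 \<le> B y0" using B_ge_1 y0 by simp
  have C': "C \<le> C'" "0 < C'" using C By0 by (auto simp: C'_def)
  have "B y \<le> C' * max (x powr -\<beta>1) (x powr -\<beta>2) * B (y * x)" if y: "y0 \<le> y" and x: "0 < x" for y x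
  proof (cases "1 \<le> x")
    case True
    have "B y \<le> C * x powr -\<beta>2 * B (y * x)"
      using P(2)[OF y True] x by (simp add: powr_minus field_simps)
    also have "\<dots> \<le> C' * max (x powr -\<beta>1) (x powr -\<beta>2) * B (y * x)"
      using C C' B_ge_1[of "y * x"] y y0 x by (intro mult_right_mono mult_mono) auto
    finally show ?thesis .
  next
    case x1: False
    have "B y \<le> C' * x powr -\<beta>1 * B (y * x)"
    proof (cases "y0 \<le> y * x")
      case True
      have "B y \<le> C * (1/x) powr \<beta>1 * B (y * x)"
        using P(1)[OF True, of "1/x"] x x1 by (simp add: field_simps)
      also have "\<dots> \<le> C' * (1/x) powr \<beta>1 * B (y * x)"
        using C' B_ge_1[of "y * x"] y y0 x by (intro mult_right_mono) auto
      finally show ?thesis using x by (simp add: powr_minus_divide powr_divide)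
    next
      case False
      then have "y / y0 \<le> 1/x" using x y0 by (simp add: field_simps)
      then have "(y / y0) powr \<beta>1 \<le> (1/x) powr \<beta>1" using y y0 \<beta> by (intro powr_mono2) auto
      moreover have "B y \<le> C * (y / y0) powr \<beta>1 * B y0"
        using P(1)[of y0 "y / y0"] y y0 by simp
      ultimately have "B y \<le> C * (1/x) powr \<beta>1 * B y0"
        using C By0 by (meson mult_left_mono mult_right_mono order_trans le_numeral_extra zero_le_one)
      also have "\<dots> = C' * x powr -\<beta>1 * 1" using x by (simp add: powr_minus_divide powr_divide C'_def)
      also have "\<dots> \<le> C' * x powr -\<beta>1 * B (y * x)"
        using C' B_ge_1[of "y * x"] y y0 x by (intro mult_left_mono) auto
      finally show ?thesis .
    qed
    also have "\<dots> \<le> C' * max (x powr -\<beta>1) (x powr -\<beta>2) * B (y * x)"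
      using C C' B_ge_1[of "y * x"] y y0 x by (intro mult_right_mono mult_mono) auto
    finally show ?thesis .
  qed
  then show ?thesis using y0 C'(2) by blast
qed

text \<open>The restriction \<open>\<delta> \<le> y * x\<close> cannot be dropped: as x tends to 0
  the left side stays at least 1 and the right side vanishes.\<close>

lemma B_scaled_le:
  assumes \<beta>: "0 < \<beta>2" "\<beta>2 < \<alpha>" "\<alpha> < \<beta>1" and \<delta>: "0 < \<delta>"
  shows "\<exists>C>0. \<exists>y0>0. \<forall>y\<ge>y0. \<forall>x>0. \<delta> \<le> y * x \<longrightarrow> B (y * x) \<le> C * max (x powr \<beta>1) (x powr \<beta>2) * B y"
proof -
  obtain C y0 where C: "1 \<le> C" and y0: "0 < y0"
    and P: "\<And>y r. y0 \<le> y \<Longrightarrow> 1 \<le> r \<Longrightarrow> B (r * y) \<le> C * r powr \<beta>1 * B y"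
      "\<And>y r. y0 \<le> y \<Longrightarrow> 1 \<le> r \<Longrightarrow> r powr \<beta>2 * B y \<le> C * B (r * y)"
    using Potter[OF \<beta>] by blast
  \<comment> \<open>For \<open>\<delta> \<le> y * x < y0\<close> the value \<open>B (y * x)\<close>
    is replaced by \<open>B y0\<close>, and \<open>y0 / y\<close> is at most
    \<open>(y0 / \<delta>) * x\<close>.\<close>
  define K where "K = max 1 ((y0/\<delta>) powr \<beta>2)"
  have K: "1 \<le> K" "(y0/\<delta>) powr \<beta>2 \<le> K" by (auto simp: K_def)
  have "B (y * x) \<le> (C * K) * max (x powr \<beta>1) (x powr \<beta>2) * B y"
    if y: "y0 \<le> y" and x: "0 < x" and d: "\<delta> \<le> y * x" for y x
  proof -
    have By: "0 < B y" using B_ge_1[of y] y y0 by simp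
    have "\<exists>b\<in>{\<beta>1, \<beta>2}. B (y * x) \<le> (C * K) * x powr b * B y"
    proof (cases "1 \<le> x")
      case True
      have "B (y * x) \<le> C * 1 * x powr \<beta>1 * B y" using P(1)[OF y True] by (simp add: mult.commute)
      also have "\<dots> \<le> C * K * x powr \<beta>1 * B y" using K C By by (intro mult_right_mono mult_left_mono) auto
      finally show ?thesis by blast
    next
      case x1: False
      have "B (y * x) \<le> C * K * x powr \<beta>2 * B y"
      proof (cases "y0 \<le> y * x")
        case True
        have "(1/x) powr \<beta>2 * B (y * x) \<le> C * B y"
          using P(2)[OF True, of "1/x"] x x1 by simp
        then have "B (y * x) \<le> C * 1 * x powr \<beta>2 * B y" using x by (simp add: powr_divide field_simps)
        also have "\<dots> \<le> C * K * x powr \<beta>2 * B y" using K C By by (intro mult_right_mono mult_left_mono) auto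
        finally show ?thesis .
      next
        case False
        have "B (y * x) \<le> B y0" using False d \<delta> by (intro B_mono) auto
        also have "\<dots> \<le> C * (y0 / y) powr \<beta>2 * B y"
          using P(2)[of y0 "y / y0"] y y0 by (simp add: powr_divide field_simps)
        also have "\<dots> \<le> C * ((y0/\<delta>) * x) powr \<beta>2 * B y"
        proof (intro mult_right_mono mult_left_mono powr_mono2)
          show "y0 / y \<le> y0 / \<delta> * x" using d y y0 \<delta> by (simp add: field_simps)
        qed (use \<beta> y y0 C By in auto)
        also have "\<dots> = C * (y0/\<delta>) powr \<beta>2 * x powr \<beta>2 * B y"
          using x y0 \<delta> by (subst powr_mult) auto
        also have "\<dots> \<le> C * K * x powr \<beta>2 * B y" using K C By by (intro mult_right_mono mult_left_mono) auto
        finally show ?thesis .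
      qed
      then show ?thesis by blast
    qed
    then obtain b where b: "b \<in> {\<beta>1, \<beta>2}" "B (y * x) \<le> (C * K) * x powr b * B y" by blast
    note b(2)
    also have "(C * K) * x powr b * B y \<le> (C * K) * max (x powr \<beta>1) (x powr \<beta>2) * B y"
      using b(1) K C By by (intro mult_right_mono mult_left_mono) auto
    finally show ?thesis .
  qed
  moreover have "0 < C * K" using K C by simp
  ultimately show ?thesis using y0 by blast
qed

end

section \<open>Semistable tails\<close>

context slowly_varying_norming
begin

text \<open>Quasi-monotonicity traps \<open>A (r n * u n)\<close> between multiples of
  \<open>A\<close> at the fixed ratios \<open>\<rho> / \<theta>\<close> and
  \<open>\<rho> * \<theta>\<close>, to which \<open>A_ratio\<close> applies.\<close>

lemma A_ratio_seq:
  assumes u: "filterlim u at_top F" and r: "(r \<longlongrightarrow> \<rho>) F" and \<rho>: "0 < \<rho>"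
  shows "((\<lambda>n. A (r n * u n) / A (u n)) \<longlongrightarrow> \<rho> powr (1/\<alpha>)) F"
proof (rule order_tendstoI)
  fix s assume s: "s < \<rho> powr (1/\<alpha>)"
  \<comment> \<open>One \<theta> comes from the change of ratio, the other is the factor in
    quasi-monotonicity; both are removed by letting \<theta> tend to 1.\<close>
  define f where "f \<theta> = (\<rho> / \<theta>) powr (1/\<alpha>) / \<theta>" for \<theta> :: real
  have "(f \<longlongrightarrow> (\<rho> / 1) powr (1/\<alpha>) / 1) (at_right 1)"
    unfolding f_def using \<rho> by (intro tendsto_intros) auto
  then have "\<forall>\<^sub>F \<theta> in at_right 1. s < f \<theta>" using s by (intro order_tendstoD) auto
  with eventually_at_right_less[of 1] have "\<forall>\<^sub>F \<theta> in at_right 1. 1 < \<theta> \<and> s < f \<theta>"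
    by eventually_elim auto
  then obtain \<theta> where \<theta>: "1 < \<theta>" "s < f \<theta>"
    using eventually_happens'[OF trivial_limit_at_right_real] by blast
  obtain v0 where v0: "1 \<le> v0" and qm: "\<And>v w. v0 \<le> v \<Longrightarrow> v \<le> w \<Longrightarrow> A v \<le> \<theta> * A w"
    using A_quasi_mono[OF \<theta>(1)] by blast
  have \<rho>\<theta>: "0 < \<rho> / \<theta>" "\<rho> / \<theta> < \<rho>" using \<theta> \<rho> by (auto simp: field_simps)
  have "s * \<theta> < (\<rho> / \<theta>) powr (1/\<alpha>)" using \<theta> by (simp add: f_def field_simps)
  then have "\<forall>\<^sub>F n in F. s * \<theta> < A (\<rho> / \<theta> * u n) / A (u n)"
    by (intro order_tendstoD(1)[OF filterlim_compose[OF A_ratio[OF \<rho>\<theta>(1)] u]])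
  moreover have "\<forall>\<^sub>F n in F. \<rho> / \<theta> < r n" using r \<rho>\<theta>(2) by (rule order_tendstoD)
  moreover have "\<forall>\<^sub>F n in F. max 1 (v0 / (\<rho> / \<theta>)) \<le> u n" using u unfolding filterlim_at_top by blast
  ultimately show "\<forall>\<^sub>F n in F. s < A (r n * u n) / A (u n)"
  proof eventually_elim
    case (elim n)
    then have "1 \<le> u n" "v0 / (\<rho> / \<theta>) \<le> u n" by auto
    then have u1: "1 \<le> u n" "v0 \<le> \<rho> / \<theta> * u n"
      using \<rho>\<theta>(1) by (simp_all only: pos_divide_le_eq mult.commute)
    have "A (\<rho> / \<theta> * u n) \<le> \<theta> * A (r n * u n)"
      using elim u1 by (intro qm mult_right_mono) auto
    moreover have "s * \<theta> * A (u n) < A (\<rho> / \<theta> * u n)" using elim A_pos[OF u1(1)] by (simp add: field_simps)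
    ultimately have "\<theta> * (s * A (u n)) < \<theta> * A (r n * u n)" by (simp add: mult_ac)
    then show ?case using \<theta> A_pos[OF u1(1)] by (simp add: field_simps)
  qed
next
  fix s assume s: "\<rho> powr (1/\<alpha>) < s"
  define f where "f \<theta> = (\<rho> * \<theta>) powr (1/\<alpha>) * \<theta>" for \<theta> :: real
  have "(f \<longlongrightarrow> (\<rho> * 1) powr (1/\<alpha>) * 1) (at_right 1)"
    unfolding f_def using \<rho> by (intro tendsto_intros) auto
  then have "\<forall>\<^sub>F \<theta> in at_right 1. f \<theta> < s" using s by (intro order_tendstoD) auto
  with eventually_at_right_less[of 1] have "\<forall>\<^sub>F \<theta> in at_right 1. 1 < \<theta> \<and> f \<theta> < s"
    by eventually_elim auto
  then obtain \<theta> where \<theta>: "1 < \<theta>" "f \<theta> < s"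
    using eventually_happens'[OF trivial_limit_at_right_real] by blast
  obtain v0 where v0: "1 \<le> v0" and qm: "\<And>v w. v0 \<le> v \<Longrightarrow> v \<le> w \<Longrightarrow> A v \<le> \<theta> * A w"
    using A_quasi_mono[OF \<theta>(1)] by blast
  have \<rho>\<theta>: "0 < \<rho> * \<theta>" "\<rho> < \<rho> * \<theta>" "0 < \<rho> / 2" "\<rho> / 2 < \<rho>" using \<theta> \<rho> by auto
  have "(\<rho> * \<theta>) powr (1/\<alpha>) < s / \<theta>" using \<theta> by (simp add: f_def field_simps)
  then have "\<forall>\<^sub>F n in F. A (\<rho> * \<theta> * u n) / A (u n) < s / \<theta>"
    by (intro order_tendstoD(2)[OF filterlim_compose[OF A_ratio[OF \<rho>\<theta>(1)] u]])
  moreover have "\<forall>\<^sub>F n in F. r n < \<rho> * \<theta>" "\<forall>\<^sub>F n in F. \<rho> / 2 < r n"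
    using order_tendstoD(2)[OF r \<rho>\<theta>(2)] order_tendstoD(1)[OF r \<rho>\<theta>(4)] by auto
  moreover have "\<forall>\<^sub>F n in F. max 1 (v0 / (\<rho> / 2)) \<le> u n" using u unfolding filterlim_at_top by blast
  ultimately show "\<forall>\<^sub>F n in F. A (r n * u n) / A (u n) < s"
  proof eventually_elim
    case (elim n)
    then have u1: "1 \<le> u n" "v0 \<le> \<rho> / 2 * u n"
      using \<rho>\<theta> by (auto simp: pos_divide_le_eq mult.commute)
    have "\<rho> / 2 * u n \<le> r n * u n" using elim u1 by (intro mult_right_mono) auto
    with u1 have "v0 \<le> r n * u n" by linarith
    then have "A (r n * u n) \<le> \<theta> * A (\<rho> * \<theta> * u n)"
      using elim u1 by (intro qm mult_right_mono) auto
    also have "\<dots> < \<theta> * (s / \<theta> * A (u n))" using elim A_pos[OF u1(1)] \<theta>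
      by (intro mult_strict_left_mono) (auto simp: field_simps)
    finally show ?case using \<theta> A_pos[OF u1(1)] by (simp add: field_simps)
  qed
qed

end

locale semistable_tail = slowly_varying_norming \<alpha> l1
  for \<alpha> :: real and l1 :: "real \<Rightarrow> real" +
  fixes c :: real and k :: "nat \<Rightarrow> nat" and MR hR T :: "real \<Rightarrow> real"
  assumes c: "1 < c"
    and k: "k 0 = 0" "strict_mono k" "(\<lambda>n. real (k (n + 1)) / real (k n)) \<longlonglongrightarrow> c"
    and MR_pos: "\<And>x. 0 < x \<Longrightarrow> 0 < MR x"
    and MR_periodic: "\<And>x. 0 < x \<Longrightarrow> MR (c powr (1/\<alpha>) * x) = MR x"
    and MR_mono: "antimono_on {0<..} (\<lambda>x. MR x * x powr (-\<alpha>))"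
    and T_mono: "\<And>x y. x \<le> y \<Longrightarrow> T y \<le> T x"
    and T_nonneg: "\<And>x. 0 \<le> T x" and T_le_1: "\<And>x. T x \<le> 1"
    and T_lim: "(T \<longlongrightarrow> 0) at_top"
    and T_tail: "\<forall>\<^sub>F x in at_top. T x = ell \<alpha> l1 x / x powr \<alpha> * (MR (delta \<alpha> l1 k x) + hR x)"
    and hR_lim: "\<And>x. 0 < x \<Longrightarrow> isCont MR x \<Longrightarrow> (\<lambda>n. hR (norming \<alpha> l1 (k n) * x)) \<longlonglongrightarrow> 0"
begin

lemma k_ge: "n \<le> k n"
  using k(2) by (rule strict_mono_imp_increasing)

lemma k_pos: "1 \<le> n \<Longrightarrow> 0 < k n"
  using k_ge[of n] by simp

lemma k_at_top: "filterlim (\<lambda>n. real (k n)) at_top sequentially"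
  by (rule filterlim_at_top_mono[OF filterlim_real_sequentially]) (simp add: k_ge)

lemma k_shift: "(\<lambda>n. real (k (n + p)) / real (k n)) \<longlonglongrightarrow> c ^ p"
proof (induction p)
  case 0
  have "\<forall>\<^sub>F n in sequentially. 1 = real (k (n + 0)) / real (k n)"
    using eventually_ge_at_top[of 1] by eventually_elim (use k_pos in force)
  then show ?case by (simp add: tendsto_eventually)
next
  case (Suc p)
  have "(\<lambda>n. real (k (n + p + 1)) / real (k (n + p)) * (real (k (n + p)) / real (k n))) \<longlonglongrightarrow> c * c ^ p"
    by (intro tendsto_mult Suc LIMSEQ_ignore_initial_segment[OF k(3)])
  moreover have "\<forall>\<^sub>F n in sequentially. real (k (n + p + 1)) / real (k (n + p)) * (real (k (n + p)) / real (k n))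
      = real (k (n + Suc p)) / real (k n)"
    using eventually_ge_at_top[of 1]
  proof eventually_elim
    case (elim n)
    then have "0 < k (n + p)" by (intro k_pos) simp
    then show ?case by simp
  qed
  ultimately show ?case unfolding power_Suc by (rule Lim_transform_eventually)
qed

lemma k_shift_int: "(\<lambda>n. real (k (nat (int n + m))) / real (k n)) \<longlonglongrightarrow> c powr m"
proof (cases "0 \<le> m")
  case True
  then obtain p where p: "m = int p" using zero_le_imp_eq_int by blast
  have "nat (int n + m) = n + p" for n by (simp add: p nat_int_add)
  then show ?thesis using k_shift[of p] c by (simp add: p powr_realpow)
next
  case False
  then obtain p where p: "m = - int p" by (metis nle_le int_cases4 zle_int of_nat_0 neg_le_0_iff_le zero_le_imp_eq_int add.inverse_inverse)
  have "(\<lambda>n. 1 / (real (k (n + p)) / real (k n))) \<longlonglongrightarrow> 1 / c ^ p"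
    using c by (intro tendsto_divide k_shift tendsto_const) auto
  then have "(\<lambda>n. real (k (nat (int (n + p) + m))) / real (k (n + p))) \<longlonglongrightarrow> c powr m"
    using c by (simp add: p powr_minus powr_realpow inverse_eq_divide)
  then show ?thesis by (rule LIMSEQ_offset)
qed

lemma A_k_ratio: "(\<lambda>n. A (k (n + 1)) / A (k n)) \<longlonglongrightarrow> c powr (1/\<alpha>)"
proof -
  have "(\<lambda>n. A (real (k (n + 1)) / real (k n) * real (k n)) / A (k n)) \<longlonglongrightarrow> c powr (1/\<alpha>)"
    using c by (intro A_ratio_seq k_at_top k(3)) auto
  moreover have "\<forall>\<^sub>F n in sequentially. A (real (k (n + 1)) / real (k n) * real (k n)) / A (k n) = A (k (n + 1)) / A (k n)"
    using eventually_ge_at_top[of 1] by eventually_elim (use k_pos in force)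
  ultimately show ?thesis by (rule Lim_transform_eventually)
qed

lemma A_k_at_top: "filterlim (\<lambda>n. A (k n)) at_top sequentially"
  using filterlim_compose[OF A_at_top k_at_top] .

text \<open>This is the range of multiples in which \<open>A (k n) * z\<close> is bracketed by the
  indices n and n + 1, which resolves the definite description in \<open>delta\<close>.\<close>

lemma delta_A_k:
  assumes z: "1 < z" "z < c powr (1/\<alpha>)"
  shows "\<forall>\<^sub>F n in sequentially. delta \<alpha> l1 k (A (k n) * z) = z"
proof -
  have "1 < c powr (1/\<alpha>)" using z by simp
  then have "\<forall>\<^sub>F n in sequentially. 1 < A (k (n + 1)) / A (k n)"
    by (intro order_tendstoD(1)[OF A_k_ratio])
  then have "\<forall>\<^sub>F n in sequentially. A (k n) < A (k (n + 1))"
    using eventually_ge_at_top[of 1]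
    by eventually_elim (use A_pos k_pos in \<open>auto simp: field_simps Suc_le_eq\<close>)
  then obtain N where N: "\<And>n. N \<le> n \<Longrightarrow> A (k n) < A (k (n + 1))"
    by (auto simp: eventually_sequentially)
  have mono: "A (k m) \<le> A (k n)" if "N \<le> m" "m \<le> n" for m n
    using that(2,1) by (induction rule: dec_induct) (use N in \<open>auto intro: order_trans less_imp_le\<close>)
  \<comment> \<open>The sequence \<open>A (k m)\<close> is increasing only from N on. For uniqueness
    of the bracket the early indices are ruled out separately, by taking \<open>A (k n)\<close>
    above all their values.\<close>
  define M where "M = Max ((\<lambda>m. A (k m)) ` {..N+1})"
  have M: "A (k m) \<le> M" if "m \<le> N + 1" for m using that by (auto simp: M_def)
  have "\<forall>\<^sub>F n in sequentially. z < A (k (n + 1)) / A (k n)"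
    by (rule order_tendstoD(1)[OF A_k_ratio z(2)])
  moreover have "\<forall>\<^sub>F n in sequentially. M \<le> A (k n)"
    using A_k_at_top by (simp add: filterlim_at_top)
  ultimately show ?thesis
    using eventually_ge_at_top[of "N + 1"]
  proof eventually_elim
    case (elim n)
    have An: "0 < A (k n)" using elim k_pos[of n] by (intro A_pos) auto
    let ?P = "\<lambda>m. 1 \<le> m \<and> A (k m) \<le> A (k n) * z \<and> A (k n) * z < A (k (m + 1))"
    have "(THE m. ?P m) = n"
    proof (rule the_equality)
      show "?P n" using elim An z by (auto simp: field_simps)
    next
      fix m assume m: "?P m"
      show "m = n"
      proof (rule ccontr)
        assume "m \<noteq> n"
        then consider "m < N" | "N \<le> m" "m < n" | "n < m" by linarith
        then show False
        proof cases
          case 1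
          then have "A (k (m + 1)) \<le> A (k n)" using M[of "m + 1"] elim by linarith
          also have "\<dots> \<le> A (k n) * z" using An z by simp
          finally show False using m by simp
        next
          case 2
          then have "A (k (m + 1)) \<le> A (k n)" by (intro mono) auto
          also have "\<dots> \<le> A (k n) * z" using An z by simp
          finally show False using m by simp
        next
          case 3
          then have "A (k (n + 1)) \<le> A (k m)" using elim by (intro mono) auto
          moreover have "A (k n) * z < A (k (n + 1))" using elim An by (simp add: field_simps)
          ultimately show False using m by linarith
        qed
      qed
    qed
    then show ?case using An by (simp add: delta_def)
  qed
qed

text \<open>The tail of the Levy measure with parameter 1; it is the limit of
  \<open>k n * T (A (k n) * z)\<close> at continuity points z between 1 and
  \<open>c powr (1/\<alpha>)\<close>.\<close>

definition limit_tail :: "real \<Rightarrow> real" where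
  "limit_tail x = x powr (-\<alpha>) * MR x"

lemma limit_tail_mono: "0 < x \<Longrightarrow> x \<le> y \<Longrightarrow> limit_tail y \<le> limit_tail x"
  using MR_mono by (auto simp: monotone_on_def limit_tail_def mult.commute)

lemma isCont_limit_tail_iff: "0 < x \<Longrightarrow> isCont limit_tail x \<longleftrightarrow> isCont MR x"
proof
  assume x: "0 < x" and "isCont limit_tail x"
  then have "isCont (\<lambda>x. limit_tail x * x powr \<alpha>) x"
    by (intro continuous_intros) auto
  moreover have "\<forall>\<^sub>F z in nhds x. limit_tail z * z powr \<alpha> = MR z"
    by (rule eventually_mono[OF eventually_nhds_in_open[of "{0<..}" x]])
      (use x in \<open>auto simp: limit_tail_def powr_minus\<close>)
  ultimately show "isCont MR x" by (simp add: isCont_cong)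
next
  assume "0 < x" "isCont MR x" then show "isCont limit_tail x"
    unfolding limit_tail_def[abs_def] by (intro continuous_intros) auto
qed

text \<open>\<open>MR\<close> is not monotone, but \<open>limit_tail\<close> is, and a continuous
  positive factor does not change the discontinuities.\<close>

lemma countable_discont: "countable {x. 0 < x \<and> \<not> isCont MR x}"
proof -
  have "mono_on {0<..} (\<lambda>x. - limit_tail x)"
    using limit_tail_mono by (auto simp: mono_on_def)
  from mono_on_ctble_discont[OF this]
  have ctble: "countable {x \<in> {0<..}. \<not> isCont (\<lambda>x. - limit_tail x) x}"
    by (simp add: at_within_open[of _ "{0<..}"] cong: conj_cong)
  moreover have "isCont limit_tail x" if "isCont (\<lambda>x. - limit_tail x) x" for x
    using continuous_minus[OF that] by simp
  ultimately have "{x. 0 < x \<and> \<not> isCont MR x} \<subseteq> {x \<in> {0<..}. \<not> isCont (\<lambda>x. - limit_tail x) x}"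
    using isCont_limit_tail_iff by blast
  then show ?thesis by (rule countable_subset) (rule ctble)
qed

lemma ex_isCont:
  assumes "0 \<le> a" "a < b" shows "\<exists>z. a < z \<and> z < b \<and> isCont MR z"
  using open_minus_countable[OF countable_discont, of "{a<..<b}"] assms by auto

text \<open>Here \<open>delta\<close> returns exactly z, so the product is \<open>MR z\<close> plus
  the error at a fixed multiple of \<open>A (k n)\<close>, which is the situation covered by the
  hypothesis on \<open>hR\<close>.\<close>

lemma T_A_k:
  assumes z: "1 < z" "z < c powr (1/\<alpha>)" "isCont MR z"
  shows "(\<lambda>n. B (A (k n) * z) * T (A (k n) * z)) \<longlonglongrightarrow> MR z"
proof -
  have top: "filterlim (\<lambda>n. A (k n) * z) at_top sequentially"
    using filterlim_tendsto_pos_mult_at_top[OF tendsto_const _ A_k_at_top, of z] z by (simp add: mult.commute)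
  have "(\<lambda>n. MR z + hR (A (k n) * z)) \<longlonglongrightarrow> MR z + 0"
    using z by (intro tendsto_intros hR_lim) auto
  moreover have "\<forall>\<^sub>F n in sequentially. MR z + hR (A (k n) * z) = B (A (k n) * z) * T (A (k n) * z)"
    using delta_A_k[OF z(1,2)] eventually_compose_filterlim[OF T_tail top]
      eventually_compose_filterlim[OF eventually_gt_at_top[of 0] top]
  proof eventually_elim
    case (elim n)
    have "0 < Sup (level_set (A (k n) * z))" by (rule Sup_level_set)
    moreover have "ell \<alpha> l1 (A (k n) * z) / (A (k n) * z) powr \<alpha> = Sup (level_set (A (k n) * z))"
      using elim(3) unfolding ell_def level_set_def
      by (subst nonzero_mult_div_cancel_left) auto
    ultimately show ?case using elim by (simp add: B_eq)
  qed
  ultimately show ?thesis unfolding add_0_right by (rule Lim_transform_eventually)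
qed

text \<open>Along \<open>A (k n) * z\<close> the product of \<open>B\<close> and \<open>T\<close>
  stays near \<open>MR z > 0\<close> while \<open>T\<close> tends to 0. So \<open>B\<close> is
  unbounded on this sequence, and it is monotone.\<close>

lemma B_at_top: "filterlim B at_top at_top"
proof -
  have "1 < c powr (1/\<alpha>)" using c alpha_pos by (intro gr_one_powr) auto
  then obtain z where z: "1 < z" "z < c powr (1/\<alpha>)" "isCont MR z" using ex_isCont[of 1] by auto
  have top: "filterlim (\<lambda>n. A (k n) * z) at_top sequentially"
    using filterlim_tendsto_pos_mult_at_top[OF tendsto_const _ A_k_at_top, of z] z by (simp add: mult.commute)
  have M: "0 < MR z" using MR_pos z by simp
  show ?thesis
    unfolding filterlim_at_top
  proof
    fix Z :: real
    define e where "e = MR z / 2 / max 1 Z"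
    have e: "0 < e" using M by (simp add: e_def)
    have "\<forall>\<^sub>F n in sequentially. T (A (k n) * z) < e"
      using order_tendstoD(2)[OF filterlim_compose[OF T_lim top] e] .
    moreover have "\<forall>\<^sub>F n in sequentially. MR z / 2 < B (A (k n) * z) * T (A (k n) * z)"
      using M by (intro order_tendstoD(1)[OF T_A_k[OF z]]) auto
    moreover have "\<forall>\<^sub>F n in sequentially. 0 < A (k n) * z"
      using eventually_compose_filterlim[OF eventually_gt_at_top[of 0] top] .
    ultimately have "\<forall>\<^sub>F n in sequentially. 0 < A (k n) * z \<and> Z \<le> B (A (k n) * z)"
    proof eventually_elim
      case (elim n)
      have "MR z / 2 < B (A (k n) * z) * e"
        using elim B_ge_1[of "A (k n) * z"]
        by (intro less_le_trans[OF elim(2)] mult_left_mono) auto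
      then have "max 1 Z < B (A (k n) * z)" using M by (simp add: e_def field_simps)
      then show ?case using elim by simp
    qed
    then obtain n where n: "0 < A (k n) * z" "Z \<le> B (A (k n) * z)" by (auto simp: eventually_sequentially)
    show "\<forall>\<^sub>F y in at_top. Z \<le> B y"
      using eventually_ge_at_top[of "A (k n) * z"]
      by eventually_elim (use n B_mono in \<open>auto intro: order_trans\<close>)
  qed
qed

sublocale slowly_varying_norming_unbounded \<alpha> l1
  by unfold_locales (rule B_at_top)

lemma k_T_A_k:
  assumes z: "1 < z" "z < c powr (1/\<alpha>)" "isCont MR z"
  shows "(\<lambda>n. k n * T (A (k n) * z)) \<longlonglongrightarrow> limit_tail z"
proof -
  have "(\<lambda>n. B (A (k n) * z) * T (A (k n) * z) / (B (A (k n) * z) / k n)) \<longlonglongrightarrow> MR z / z powr \<alpha>"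
    using z by (intro tendsto_divide T_A_k filterlim_compose[OF B_A_ratio k_at_top]) auto
  moreover have "\<forall>\<^sub>F n in sequentially. B (A (k n) * z) * T (A (k n) * z) / (B (A (k n) * z) / k n) = k n * T (A (k n) * z)"
    using eventually_ge_at_top[of 1]
  proof eventually_elim
    case (elim n)
    have "0 < A (k n) * z" using A_pos[of "k n"] k_pos[OF elim] z by simp
    then show ?case using B_ge_1[of "A (k n) * z"] by simp
  qed
  ultimately have "(\<lambda>n. k n * T (A (k n) * z)) \<longlonglongrightarrow> MR z / z powr \<alpha>"
    by (rule Lim_transform_eventually)
  then show ?thesis by (simp add: limit_tail_def powr_minus_divide)
qed

text \<open>The hypothesis on \<open>hR\<close> only concerns fixed multiples of \<open>A (k n)\<close>; monotonicity of \<open>T\<close>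
  carries the limit over to sequences that are merely asymptotic to such multiples.\<close>
lemma B_T_limit:
  assumes N: "filterlim N at_top sequentially" and v: "\<And>j. 0 < v j"
    and \<kappa>: "(\<lambda>j. B (v j) / k (N j)) \<longlonglongrightarrow> \<kappa>" "1 < \<kappa>" "\<kappa> < c"
    and cont: "isCont MR (\<kappa> powr (1/\<alpha>))"
  shows "(\<lambda>j. B (v j) * T (v j)) \<longlonglongrightarrow> MR (\<kappa> powr (1/\<alpha>))"
proof -
  \<comment> \<open>\<open>v j\<close> is asymptotic to \<open>\<zeta> * A (k (N j))\<close>: by
    monotonicity of \<open>B\<close>, an order of the values of \<open>B\<close> forces the order of
    the arguments, which gives \<open>lower\<close> and \<open>upper\<close>.\<close>
  define \<zeta> where "\<zeta> = \<kappa> powr (1/\<alpha>)"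
  have \<zeta>: "1 < \<zeta>" "\<zeta> < c powr (1/\<alpha>)" "\<zeta> powr \<alpha> = \<kappa>"
    using \<kappa> alpha_pos by (auto simp: \<zeta>_def powr_powr intro: gr_one_powr powr_less_mono2)
  have contG: "isCont limit_tail \<zeta>" using cont isCont_limit_tail_iff[of \<zeta>] \<zeta>(1) by (simp only: \<zeta>_def)
  have kN: "filterlim (\<lambda>j. real (k (N j))) at_top sequentially"
    using filterlim_compose[OF k_at_top N] .
  have N1: "\<forall>\<^sub>F j in sequentially. 1 \<le> N j" using N by (simp add: filterlim_at_top)
  have lower: "\<forall>\<^sub>F j in sequentially. A (k (N j)) * z < v j" if z: "0 < z" "z < \<zeta>" for z
  proof -
    have "(\<lambda>j. B (v j) / k (N j) - B (A (k (N j)) * z) / k (N j)) \<longlonglongrightarrow> \<kappa> - z powr \<alpha>"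
      by (intro tendsto_diff \<kappa> filterlim_compose[OF B_A_ratio kN] z)
    moreover have "0 < \<kappa> - z powr \<alpha>"
      using powr_less_mono2[OF alpha_pos _ z(2)] z \<zeta> by simp
    ultimately have "\<forall>\<^sub>F j in sequentially. 0 < B (v j) / k (N j) - B (A (k (N j)) * z) / k (N j)"
      by (rule order_tendstoD)
    with N1 show ?thesis
    proof eventually_elim
      case (elim j)
      then have "B (A (k (N j)) * z) < B (v j)" using k_pos[of "N j"]
        by (simp add: diff_divide_distrib[symmetric] zero_less_divide_iff)
      then show ?case using B_mono[OF v] by (meson not_le)
    qed
  qed
  have upper: "\<forall>\<^sub>F j in sequentially. v j < A (k (N j)) * z" if z: "\<zeta> < z" for z
  proof -
    have "(\<lambda>j. B (A (k (N j)) * z) / k (N j) - B (v j) / k (N j)) \<longlonglongrightarrow> z powr \<alpha> - \<kappa>"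
      using z \<zeta> by (intro tendsto_diff \<kappa> filterlim_compose[OF B_A_ratio kN]) auto
    moreover have "0 < z powr \<alpha> - \<kappa>"
      using powr_less_mono2[OF alpha_pos _ z] z \<zeta> by simp
    ultimately have "\<forall>\<^sub>F j in sequentially. 0 < B (A (k (N j)) * z) / k (N j) - B (v j) / k (N j)"
      by (rule order_tendstoD)
    with N1 show ?thesis
    proof eventually_elim
      case (elim j)
      then have lt: "B (v j) < B (A (k (N j)) * z)" using k_pos[of "N j"]
        by (simp add: diff_divide_distrib[symmetric] zero_less_divide_iff)
      have "0 < A (k (N j)) * z" using elim k_pos[of "N j"] A_pos[of "k (N j)"] z \<zeta> by simp
      then show ?case using B_mono[of "A (k (N j)) * z" "v j"] lt by (meson not_le)
    qed
  qed
  have "(\<lambda>j. k (N j) * T (v j)) \<longlonglongrightarrow> limit_tail \<zeta>"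
  proof (rule order_tendstoI)
    fix s assume s: "limit_tail \<zeta> < s"
    have "\<forall>\<^sub>F z in at \<zeta>. limit_tail z < s"
      using contG s by (intro order_tendstoD(2)) (auto simp: isCont_def)
    then obtain d where d: "0 < d" "\<And>z. z \<noteq> \<zeta> \<Longrightarrow> dist z \<zeta> < d \<Longrightarrow> limit_tail z < s"
      by (auto simp: eventually_at)
    \<comment> \<open>A continuity point close to \<zeta> from below; the bound by 1 keeps it in the
      window of \<open>k_T_A_k\<close>.\<close>
    have "\<exists>z. max 1 (\<zeta> - d) < z \<and> z < \<zeta> \<and> isCont MR z"
      by (intro ex_isCont) (use \<zeta> d in \<open>auto simp: le_max_iff_disj\<close>)
    then obtain z where z: "max 1 (\<zeta> - d) < z" "z < \<zeta>" "isCont MR z" by blast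
    have "limit_tail z < s" using z d(2)[of z] by (auto simp: dist_real_def)
    then have "\<forall>\<^sub>F j in sequentially. k (N j) * T (A (k (N j)) * z) < s"
      using z \<zeta> by (intro order_tendstoD(2)[OF filterlim_compose[OF k_T_A_k N]]) auto
    with lower[of z] z have "\<forall>\<^sub>F j in sequentially. A (k (N j)) * z < v j \<and> k (N j) * T (A (k (N j)) * z) < s"
      by (auto intro: eventually_conj)
    then show "\<forall>\<^sub>F j in sequentially. k (N j) * T (v j) < s"
    proof eventually_elim
      case (elim j)
      then have "k (N j) * T (v j) \<le> k (N j) * T (A (k (N j)) * z)" by (intro mult_left_mono T_mono) auto
      then show ?case using elim by linarith
    qed
  next
    fix s assume s: "s < limit_tail \<zeta>"
    have "\<forall>\<^sub>F z in at \<zeta>. s < limit_tail z"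
      using contG s by (intro order_tendstoD(1)) (auto simp: isCont_def)
    then obtain d where d: "0 < d" "\<And>z. z \<noteq> \<zeta> \<Longrightarrow> dist z \<zeta> < d \<Longrightarrow> s < limit_tail z"
      by (auto simp: eventually_at)
    obtain z where z: "\<zeta> < z" "z < min (c powr (1/\<alpha>)) (\<zeta> + d)" "isCont MR z"
      using ex_isCont[of \<zeta> "min (c powr (1/\<alpha>)) (\<zeta> + d)"] \<zeta> d by auto
    have "s < limit_tail z" using z d(2)[of z] by (auto simp: dist_real_def)
    then have "\<forall>\<^sub>F j in sequentially. s < k (N j) * T (A (k (N j)) * z)"
      using z \<zeta> by (intro order_tendstoD(1)[OF filterlim_compose[OF k_T_A_k N]]) auto
    with upper[of z] z have "\<forall>\<^sub>F j in sequentially. v j < A (k (N j)) * z \<and> s < k (N j) * T (A (k (N j)) * z)"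
      by (auto intro: eventually_conj)
    then show "\<forall>\<^sub>F j in sequentially. s < k (N j) * T (v j)"
    proof eventually_elim
      case (elim j)
      then have "k (N j) * T (A (k (N j)) * z) \<le> k (N j) * T (v j)" by (intro mult_left_mono T_mono) auto
      then show ?case using elim by linarith
    qed
  qed
  then have "(\<lambda>j. B (v j) / k (N j) * (k (N j) * T (v j))) \<longlonglongrightarrow> \<kappa> * limit_tail \<zeta>"
    by (intro tendsto_mult \<kappa>)
  moreover have "\<forall>\<^sub>F j in sequentially. B (v j) / k (N j) * (k (N j) * T (v j)) = B (v j) * T (v j)"
    using N1 by eventually_elim (use k_pos in force)
  ultimately have "(\<lambda>j. B (v j) * T (v j)) \<longlonglongrightarrow> \<kappa> * limit_tail \<zeta>"
    by (rule Lim_transform_eventually)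
  moreover have "\<kappa> * limit_tail \<zeta> = MR \<zeta>" using \<zeta> \<kappa> by (simp add: limit_tail_def powr_minus)
  ultimately show ?thesis by (simp add: \<zeta>_def)
qed

lemma MR_periodic_int:
  assumes "0 < x" shows "MR (c powr (of_int m / \<alpha>) * x) = MR x"
proof -
  have nat: "MR (c powr (real n / \<alpha>) * x) = MR x" if "0 < x" for n x
  proof (induction n)
    case (Suc n)
    have "c powr (real (Suc n) / \<alpha>) * x = c powr (1/\<alpha>) * (c powr (real n / \<alpha>) * x)"
      using c by (simp add: powr_add[symmetric] add_divide_distrib add.commute)
    then show ?case using MR_periodic[of "c powr (real n / \<alpha>) * x"] Suc that c
      by (simp only: zero_less_mult_iff) simp
  qed (use c in simp)
  show ?thesis
  proof (cases "0 \<le> m")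
    case True
    then show ?thesis using nat[OF assms, of "nat m"] by simp
  next
    case False
    have "MR (c powr (real (nat (-m)) / \<alpha>) * (c powr (of_int m / \<alpha>) * x)) = MR (c powr (of_int m / \<alpha>) * x)"
      using assms c by (intro nat) auto
    moreover have "c powr (real (nat (-m)) / \<alpha>) * (c powr (of_int m / \<alpha>) * x) = x"
      using False c by (simp add: mult.assoc[symmetric] powr_add[symmetric] add_divide_distrib[symmetric])
    ultimately show ?thesis by simp
  qed
qed

lemma isCont_MR_periodic_int:
  assumes x: "0 < x" and cont: "isCont MR (c powr (of_int m / \<alpha>) * x)"
  shows "isCont MR x"
proof -
  have "isCont (\<lambda>x. MR (c powr (of_int m / \<alpha>) * x)) x"
    by (rule isCont_o2[where f = "\<lambda>x. c powr (of_int m / \<alpha>) * x", OF _ cont]) (intro continuous_intros)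
  moreover have "\<forall>\<^sub>F z in nhds x. MR (c powr (of_int m / \<alpha>) * z) = MR z"
    by (rule eventually_mono[OF eventually_nhds_in_open[of "{0<..}" x]])
      (use x MR_periodic_int in auto)
  ultimately show ?thesis by (simp add: isCont_cong)
qed

text \<open>Shifting the index \<open>N j\<close> by m multiplies the limiting ratio by
  \<open>c powr (-m)\<close> and moves it into the window between 1 and c; periodicity of
  \<open>MR\<close> undoes the shift. The excluded x are those that would land on the boundary of
  the window.\<close>

lemma B_T_scaled_limit:
  assumes y: "filterlim y at_top sequentially" "\<And>j. 0 < y j"
    and N: "filterlim N at_top sequentially"
    and lam: "(\<lambda>j. B (y j) / k (N j)) \<longlonglongrightarrow> lam" "0 < lam"
    and x: "0 < x" "isCont MR (lam powr (1/\<alpha>) * x)" "\<And>m::int. lam * x powr \<alpha> \<noteq> c powr m"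
  shows "(\<lambda>j. B (y j) * T (y j * x)) \<longlonglongrightarrow> x powr (-\<alpha>) * MR (lam powr (1/\<alpha>) * x)"
proof -
  define m where "m = \<lfloor>log c (lam * x powr \<alpha>)\<rfloor>"
  define \<kappa> where "\<kappa> = lam * x powr \<alpha> * c powr (-m)"
  have p: "0 < lam * x powr \<alpha>" using lam x by simp
  have "c powr m \<le> lam * x powr \<alpha>" "lam * x powr \<alpha> < c powr (m + 1)"
    using floor_log_eq_powr_iff[OF p c, of m] by (auto simp: m_def)
  with x(3)[of m] have \<kappa>: "1 < \<kappa>" "\<kappa> < c" using c by (auto simp: \<kappa>_def powr_minus powr_add field_simps)
  define N' where "N' j = nat (int (N j) + m)" for j
  have "filterlim (\<lambda>n. nat (int n + m)) at_top sequentially"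
    unfolding filterlim_at_top
  proof
    fix Z show "\<forall>\<^sub>F n in sequentially. Z \<le> nat (int n + m)"
      using eventually_ge_at_top[of "Z + nat \<bar>m\<bar>"] by eventually_elim auto
  qed
  from filterlim_compose[OF this N] have N': "filterlim N' at_top sequentially" unfolding N'_def .
  have N1: "\<forall>\<^sub>F j in sequentially. 1 \<le> N j" using N by (simp add: filterlim_at_top)
  have N1': "\<forall>\<^sub>F j in sequentially. 1 \<le> N' j" using N' by (simp add: filterlim_at_top)
  have r: "(\<lambda>j. B (y j * x) / B (y j)) \<longlonglongrightarrow> x powr \<alpha>"
    using filterlim_compose[OF B_ratio[OF x(1)] y(1)] by (simp add: mult.commute)
  have "(\<lambda>j. B (y j * x) / B (y j) * (B (y j) / k (N j)) / (k (N' j) / k (N j))) \<longlonglongrightarrow> x powr \<alpha> * lam / c powr m"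
    unfolding N'_def using c by (intro tendsto_intros r lam filterlim_compose[OF k_shift_int N]) auto
  moreover have "\<forall>\<^sub>F j in sequentially. B (y j * x) / B (y j) * (B (y j) / k (N j)) / (k (N' j) / k (N j)) = B (y j * x) / k (N' j)"
    using N1 N1'
  proof eventually_elim
    case (elim j)
    then show ?case using k_pos[of "N j"] k_pos[of "N' j"] B_ge_1[OF y(2), of j] by simp
  qed
  ultimately have "(\<lambda>j. B (y j * x) / k (N' j)) \<longlonglongrightarrow> x powr \<alpha> * lam / c powr m"
    by (rule Lim_transform_eventually)
  also have "x powr \<alpha> * lam / c powr m = \<kappa>" by (simp add: \<kappa>_def powr_minus field_simps)
  finally have lim: "(\<lambda>j. B (y j * x) / k (N' j)) \<longlonglongrightarrow> \<kappa>" .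
  have z: "lam powr (1/\<alpha>) * x = c powr (of_int m / \<alpha>) * \<kappa> powr (1/\<alpha>)"
    using alpha_pos lam x c by (simp add: \<kappa>_def powr_mult powr_powr powr_add[symmetric] mult_ac)
  have "(\<lambda>j. B (y j * x) * T (y j * x)) \<longlonglongrightarrow> MR (\<kappa> powr (1/\<alpha>))"
    using y x \<kappa> isCont_MR_periodic_int[of "\<kappa> powr (1/\<alpha>)" m] z by (intro B_T_limit[OF N' _ lim]) auto
  then have "(\<lambda>j. B (y j * x) * T (y j * x) / (B (y j * x) / B (y j))) \<longlonglongrightarrow> MR (\<kappa> powr (1/\<alpha>)) / x powr \<alpha>"
    using x by (intro tendsto_divide r) auto
  moreover have "B (y j * x) * T (y j * x) / (B (y j * x) / B (y j)) = B (y j) * T (y j * x)" for j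
    using B_ge_1[of "y j * x"] y(2)[of j] x by simp
  moreover have "MR (\<kappa> powr (1/\<alpha>)) = MR (lam powr (1/\<alpha>) * x)"
    using MR_periodic_int[of "\<kappa> powr (1/\<alpha>)" m] \<kappa> z by simp
  ultimately show ?thesis by (simp add: powr_minus_divide)
qed

lemma ex_k_bracket:
  assumes "1 \<le> x" shows "\<exists>n. real (k n) \<le> x \<and> x < real (k (n + 1))"
proof -
  have fin: "finite {n. real (k n) \<le> x}"
  proof (rule finite_subset[of _ "{..nat \<lfloor>x\<rfloor>}"])
    show "{n. real (k n) \<le> x} \<subseteq> {..nat \<lfloor>x\<rfloor>}"
    proof safe
      fix n assume "real (k n) \<le> x"
      then have "real n \<le> x" using k_ge[of n] by (meson of_nat_le_iff order_trans)
      then show "n \<le> nat \<lfloor>x\<rfloor>" by (simp add: le_nat_floor)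
    qed
  qed simp
  have ne: "0 \<in> {n. real (k n) \<le> x}" using k(1) assms by simp
  define n where "n = Max {n. real (k n) \<le> x}"
  have "n \<in> {n. real (k n) \<le> x}" unfolding n_def using Max_in fin ne by blast
  moreover have "\<not> real (k (n + 1)) \<le> x"
    using Max_ge[OF fin, of "n + 1"] by (auto simp: n_def)
  ultimately show ?thesis by (intro exI[of _ n]) auto
qed

text \<open>\<open>T\<close> is known only on the grid \<open>A (k n) * z\<close> for one fixed z.
  Monotonicity interpolates between the grid points n - 1 and n + 1, at the price of the ratio of
  the corresponding \<open>k\<close>, which is eventually below
  \<open>2 * c\<^sup>2\<close>.\<close>

lemma T_bounds: "\<exists>b>0. \<exists>a>0. \<exists>y0>0. \<forall>y\<ge>y0. a \<le> B y * T y \<and> B y * T y \<le> b"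
proof -
  have c1: "1 < c powr (1/\<alpha>)" using c alpha_pos by (intro gr_one_powr) auto
  then obtain z where z: "1 < z" "z < c powr (1/\<alpha>)" "isCont MR z" using ex_isCont[of 1] by auto
  \<comment> \<open>Together with \<open>1 < z powr \<alpha>\<close> this places
    \<open>B (A (k n) * z)\<close> between \<open>k n\<close> and \<open>k (n + 1)\<close> for large
    n.\<close>
  have zc: "z powr \<alpha> < c" using powr_less_mono2[OF alpha_pos _ z(2)] z c alpha_pos by (simp add: powr_powr)
  have z\<alpha>: "1 < z powr \<alpha>" using z alpha_pos by (intro gr_one_powr) auto
  define l where "l = limit_tail z"
  have l: "0 < l" using MR_pos z by (simp add: l_def limit_tail_def)
  have kT: "(\<lambda>n. k n * T (A (k n) * z)) \<longlonglongrightarrow> l" unfolding l_def by (rule k_T_A_k[OF z])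
  have "\<forall>\<^sub>F n in sequentially. l / 2 < k n * T (A (k n) * z) \<and> k n * T (A (k n) * z) < 2 * l
      \<and> B (A (k n) * z) / k n < c \<and> 1 < B (A (k n) * z) / k n
      \<and> B (A (k n) * z) / k n < real (k (n + 1)) / k n \<and> real (k (n + 2)) / k n < 2 * c\<^sup>2 \<and> 1 \<le> n"
  proof (intro eventually_conj)
    have lim: "(\<lambda>n. B (A (k n) * z) / k n) \<longlonglongrightarrow> z powr \<alpha>"
      using z by (intro filterlim_compose[OF B_A_ratio k_at_top]) auto
    show "\<forall>\<^sub>F n in sequentially. B (A (k n) * z) / k n < c" "\<forall>\<^sub>F n in sequentially. 1 < B (A (k n) * z) / k n"
      using order_tendstoD[OF lim] zc z\<alpha> by auto
    have "(\<lambda>n. real (k (n + 1)) / k n - B (A (k n) * z) / k n) \<longlonglongrightarrow> c - z powr \<alpha>"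
      by (intro tendsto_diff k lim)
    then have "\<forall>\<^sub>F n in sequentially. 0 < real (k (n + 1)) / k n - B (A (k n) * z) / k n"
      using zc by (intro order_tendstoD(1)) auto
    then show "\<forall>\<^sub>F n in sequentially. B (A (k n) * z) / k n < real (k (n + 1)) / k n"
      by eventually_elim auto
    show "\<forall>\<^sub>F n in sequentially. real (k (n + 2)) / k n < 2 * c\<^sup>2"
      using c by (intro order_tendstoD(2)[OF k_shift[of 2]]) auto
  qed (use l order_tendstoD(1)[OF kT, of "l/2"] order_tendstoD(2)[OF kT, of "2 * l"] eventually_ge_at_top in simp_all)
  then obtain n0 where n0: "\<And>n. n0 \<le> n \<Longrightarrow> l / 2 < k n * T (A (k n) * z) \<and> k n * T (A (k n) * z) < 2 * l
      \<and> B (A (k n) * z) / k n < c \<and> 1 < B (A (k n) * z) / k n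
      \<and> B (A (k n) * z) / k n < real (k (n + 1)) / k n \<and> real (k (n + 2)) / k n < 2 * c\<^sup>2 \<and> 1 \<le> n"
    by (auto simp: eventually_sequentially)
  obtain y0 where y0: "0 < y0" "\<And>y. y0 \<le> y \<Longrightarrow> real (k (n0 + 2)) \<le> B y"
  proof -
    have "\<forall>\<^sub>F y in at_top. real (k (n0 + 2)) \<le> B y" using B_at_top unfolding filterlim_at_top by blast
    then obtain Y where "\<And>y. Y \<le> y \<Longrightarrow> real (k (n0 + 2)) \<le> B y" by (auto simp: eventually_at_top_linorder)
    then show ?thesis by (intro that[of "max 1 Y"]) auto
  qed
  have "l / (4 * c\<^sup>2) \<le> B y * T y \<and> B y * T y \<le> 4 * c\<^sup>2 * l" if y: "y0 \<le> y" for y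
  proof -
    have ypos: "0 < y" using y y0 by simp
    obtain n where n: "real (k n) \<le> B y" "B y < real (k (n + 1))"
      using ex_k_bracket[OF B_ge_1[OF ypos]] by blast
    have "n0 + 2 < n + 1"
    proof -
      have "real (k (n0 + 2)) < real (k (n + 1))" using y0(2)[OF y] n by linarith
      then show ?thesis using strict_mono_less[OF k(2)] by simp
    qed
    then have nn: "n0 \<le> n - 1" "n - 1 + 1 = n" "n - 1 + 2 = n + 1" "n0 \<le> n + 1" by auto
    \<comment> \<open>\<open>B y\<close> lies between \<open>k n\<close> and
      \<open>k (n + 1)\<close>, so the grid point of index n - 1 is at most y and that of index n +
      1 is at least y.\<close>
    define p where "p = n - 1"
    have kp: "0 < k p" using n0[of p] nn k_pos[of p] by (simp add: p_def)
    have Ap: "0 < A (k p) * z" using kp A_pos[of "k p"] z by simp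
    have "B (A (k p) * z) < real (k n)" using n0[of p] nn kp by (simp add: p_def field_simps)
    then have "A (k p) * z \<le> y" using B_mono[of y "A (k p) * z"] ypos n by force
    then have "T y \<le> T (A (k p) * z)" by (rule T_mono)
    moreover have "B y \<le> 2 * c\<^sup>2 * k p" using n n0[of p] nn kp by (simp add: p_def field_simps)
    ultimately have "B y * T y \<le> 2 * c\<^sup>2 * k p * T (A (k p) * z)"
      using T_nonneg B_ge_1[OF ypos] by (intro mult_mono) auto
    also have "\<dots> \<le> 2 * c\<^sup>2 * (2 * l)"
      using n0[of p] nn c by (simp add: p_def mult.assoc)
    finally have up: "B y * T y \<le> 4 * c\<^sup>2 * l" by simp
    define q where "q = n + 1"
    have kq: "0 < k q" by (auto simp: q_def intro: k_pos)
    have "real (k q) < B (A (k q) * z)" using n0[of q] nn kq by (simp add: q_def field_simps)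
    then have "y \<le> A (k q) * z" using B_mono[of "A (k q) * z" y] n A_pos[of "k q"] kq z by (force simp: q_def)
    then have "T (A (k q) * z) \<le> T y" by (rule T_mono)
    moreover have "k q / (2 * c\<^sup>2) \<le> B y"
    proof -
      have "real (k q) \<le> 2 * c\<^sup>2 * k p" using n0[of p] nn kp by (simp add: p_def q_def field_simps)
      also have "\<dots> \<le> 2 * c\<^sup>2 * k n" using strict_mono_less_eq[OF k(2), of p n] c by (simp add: p_def)
      also have "\<dots> \<le> 2 * c\<^sup>2 * B y" using n(1) by (intro mult_left_mono) auto
      finally show ?thesis using c by (simp add: field_simps)
    qed
    ultimately have "k q / (2 * c\<^sup>2) * T (A (k q) * z) \<le> B y * T y"
      using T_nonneg B_ge_1[OF ypos] by (intro mult_mono) auto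
    moreover have "(l / 2) / (2 * c\<^sup>2) \<le> k q * T (A (k q) * z) / (2 * c\<^sup>2)"
      using n0[of q] nn c by (intro divide_right_mono) (auto simp: q_def)
    ultimately show ?thesis using up by simp
  qed
  moreover have "0 < 4 * c\<^sup>2 * l" "0 < l / (4 * c\<^sup>2)" using l c by auto
  ultimately show ?thesis using y0(1) by blast
qed

end

section \<open>Fourier inversion and the Fejer kernel\<close>

lemma AE_lborel_continuous_eq:
  fixes f g :: "real \<Rightarrow> real"
  assumes "continuous_on UNIV f" "continuous_on UNIV g" and AE: "AE x in lborel. f x = g x"
  shows "f = g"
proof (rule ccontr)
  assume "f \<noteq> g"
  then obtain x0 where "f x0 \<noteq> g x0" by auto
  define S where "S = {x. f x \<noteq> g x}"
  have "open S" unfolding S_def using assms by (intro open_Collect_neq)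
  then obtain d where d: "0 < d" "ball x0 d \<subseteq> S"
    using \<open>f x0 \<noteq> g x0\<close> by (auto simp: open_contains_ball S_def)
  have "S \<in> null_sets lborel"
    using AE \<open>open S\<close> by (subst (asm) AE_iff_null) (auto simp: S_def)
  then have "emeasure lborel (ball x0 d) = 0"
    using d emeasure_mono[of "ball x0 d" S lborel] \<open>open S\<close> by (auto simp: null_sets_def)
  then show False using d by (simp add: ball_eq_greaterThanLessThan)
qed

text \<open>Stated with the coercions pushed to the leaves, which is the simplifier's normal form.\<close>
lemma norm_iexp_mult [simp]:
  "cmod (exp (\<i> * (complex_of_real s * complex_of_real t)) * z) = cmod z"
  "cmod (exp (- (\<i> * (complex_of_real s * complex_of_real t))) * z) = cmod z"
  using norm_exp_i_times[of "s * t"] norm_exp_i_times[of "- (s * t)"] by (simp_all add: norm_mult)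

lemma integrable_iexp_mult [intro]:
  fixes f :: "real \<Rightarrow> complex"
  assumes "integrable lborel f" shows "integrable lborel (\<lambda>t. iexp (t * x) * f t)"
  using assms by (intro Bochner_Integration.integrable_bound[OF assms]) (auto simp: borel_measurable_integrable)

definition fourier :: "(real \<Rightarrow> complex) \<Rightarrow> real \<Rightarrow> complex" where
  "fourier f x = (CLBINT t. iexp (t * x) * f t)"

lemma norm_fourier_le: "cmod (fourier f x) \<le> (LBINT t. cmod (f t))"
  unfolding fourier_def by (rule order_trans[OF integral_norm_bound]) simp

lemma isCont_fourier:
  assumes f: "integrable lborel f" shows "isCont (fourier f) x"
  unfolding continuous_at_sequentially
proof safe
  fix X assume X: "X \<longlonglongrightarrow> x"
  have [measurable]: "f \<in> borel_measurable borel" using f by (simp add: borel_measurable_integrable)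
  show "(fourier f \<circ> X) \<longlonglongrightarrow> fourier f x"
    unfolding comp_def fourier_def
    by (rule integral_dominated_convergence[where w = "\<lambda>t. cmod (f t)"])
      (use f X in \<open>auto intro!: tendsto_intros\<close>)
qed

lemma integral_iexp_Icc:
  assumes "a \<le> b" "t \<noteq> 0"
  shows "(CLBINT x. indicator {a..b} x *\<^sub>R iexp (- (t * x))) = (iexp (- (t * a)) - iexp (- (t * b))) / (\<i> * t)"
proof -
  have "(CLBINT x. indicator {a..b} x *\<^sub>R iexp (- (t * x))) =
      iexp (- (t * b)) / (- \<i> * t) - iexp (- (t * a)) / (- \<i> * t)"
  proof (rule integral_FTC_Icc[OF assms(1)])
    fix x
    have "((\<lambda>x. exp (- \<i> * t * x) / (- \<i> * t)) has_field_derivative exp (- \<i> * t * x)) (at (of_real x))"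
      using assms by (auto intro!: derivative_eq_intros)
    then have "((\<lambda>x. exp (- \<i> * t * of_real x) / (- \<i> * t)) has_vector_derivative exp (- \<i> * t * x)) (at x within {a..b})"
      by (rule has_vector_derivative_real_field[THEN has_vector_derivative_at_within])
    then show "((\<lambda>x. iexp (- (t * x)) / (- \<i> * t)) has_vector_derivative iexp (- (t * x))) (at x within {a..b})"
      by (simp add: mult.assoc)
  qed (intro continuous_intros)
  then show ?thesis using assms by (simp add: field_simps)
qed

text \<open>Levy inversion expresses the mass by integrals over growing symmetric intervals.
  Integrability of the characteristic function removes the truncation, and Fubini recognises the
  transform of an interval.\<close>

lemma (in real_distribution) measure_Ioc_fourier:
  assumes int: "integrable lborel (char M)" and ab: "a \<le> b"
    and atoms: "measure M {a} = 0" "measure M {b} = 0"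
  shows "measure M {a<..b} = (LBINT x. indicator {a..b} x * (Re (fourier (char M) (-x)) / (2 * pi)))"
proof -
  define \<phi> where "\<phi> = char M"
  have [measurable]: "\<phi> \<in> borel_measurable borel" by (simp add: \<phi>_def)
  have int\<phi>: "integrable lborel \<phi>" using int by (simp add: \<phi>_def)
  define F where "F t = (CLBINT x. indicator {a..b} x *\<^sub>R iexp (- (t * x))) * \<phi> t" for t
  have prod: "integrable (lborel \<Otimes>\<^sub>M lborel) (\<lambda>(t, x). indicator {a..b} x *\<^sub>R (iexp (- (t * x)) * \<phi> t))"
  proof (rule lborel_pair.Fubini_integrable)
    have "(\<integral>x. cmod (indicator {a..b} x *\<^sub>R (iexp (- (t * x)) * \<phi> t)) \<partial>lborel) = cmod (\<phi> t) * (b - a)" for t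
    proof -
      have "(\<integral>x. cmod (indicator {a..b} x *\<^sub>R (iexp (- (t * x)) * \<phi> t)) \<partial>lborel) = (\<integral>x. cmod (\<phi> t) * indicator {a..b} x \<partial>lborel)"
        by (intro Bochner_Integration.integral_cong) (auto simp: indicator_def)
      then show ?thesis using ab by simp
    qed
    then show "integrable lborel (\<lambda>t. \<integral>x. cmod (case (t, x) of (t, x) \<Rightarrow> indicator {a..b} x *\<^sub>R (iexp (- (t * x)) * \<phi> t)) \<partial>lborel)"
      using int\<phi> by simp
    show "AE t in lborel. integrable lborel (\<lambda>x. case (t, x) of (t, x) \<Rightarrow> indicator {a..b} x *\<^sub>R (iexp (- (t * x)) * \<phi> t))"
    proof (rule AE_I2)
      fix t
      have "continuous_on {a..b} (\<lambda>x. iexp (- (t * x)) * \<phi> t)" by (intro continuous_intros)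
      then show "integrable lborel (\<lambda>x. case (t, x) of (t, x) \<Rightarrow> indicator {a..b} x *\<^sub>R (iexp (- (t * x)) * \<phi> t))"
        using borel_integrable_compact[of "{a..b}"] by simp
    qed
  qed measurable
  have F_eq: "F t = (CLBINT x. indicator {a..b} x *\<^sub>R (iexp (- (t * x)) * \<phi> t))" for t
    unfolding F_def by (subst integral_mult_left_zero[symmetric]) simp
  have F_int: "integrable lborel F"
    using lborel_pair.integrable_fst'[OF prod] by (simp add: F_eq[abs_def])
  have "(\<lambda>n. CLBINT t=-(real n)..real n. F t) \<longlonglongrightarrow> (CLBINT t. F t)"
  proof -
    have "(CLBINT t=-(real n)..real n. F t) = (CLBINT t. indicator {- real n<..<real n} t *\<^sub>R F t)" for n
      by (simp add: interval_lebesgue_integral_def set_lebesgue_integral_def)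
    moreover have "(\<lambda>n. CLBINT t. indicator {- real n<..<real n} t *\<^sub>R F t) \<longlonglongrightarrow> (CLBINT t. F t)"
    proof (rule integral_dominated_convergence[where w = "\<lambda>t. cmod (F t)"])
      show "AE t in lborel. (\<lambda>n. indicator {- real n<..<real n} t *\<^sub>R F t) \<longlonglongrightarrow> F t"
      proof (rule AE_I2)
        fix t :: real
        obtain N :: nat where "\<bar>t\<bar> < real N" using reals_Archimedean2 by blast
        then have "t \<in> {- real n<..<real n}" if "N \<le> n" for n
          using of_nat_mono[OF that, where 'a = real] by auto
        then have "\<forall>\<^sub>F n in sequentially. indicator {- real n<..<real n} t *\<^sub>R F t = F t"
          by (intro eventually_mono[OF eventually_ge_at_top[of N]]) simp
        then show "(\<lambda>n. indicator {- real n<..<real n} t *\<^sub>R F t) \<longlonglongrightarrow> F t" by (rule tendsto_eventually)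
      qed
    qed (use F_int in \<open>auto simp: borel_measurable_integrable split: split_indicator\<close>)
    ultimately show ?thesis by simp
  qed
  moreover have "(CLBINT t=-(real n)..real n. F t) =
      (CLBINT t=-(real n)..real n. (iexp (- (t * a)) - iexp (- (t * b))) / (\<i> * t) * \<phi> t)" for n
  proof (rule interval_integral_cong_AE)
    have "AE t in lborel. t \<noteq> (0::real)" by (rule AE_lborel_singleton)
    then have "AE t in lborel. F t = (iexp (- (t * a)) - iexp (- (t * b))) / (\<i> * t) * \<phi> t"
      by eventually_elim (simp add: F_def integral_iexp_Icc[OF ab] del: of_real_mult of_real_minus)
    then show "AE t\<in>einterval (min (ereal (- real n)) (real n)) (max (ereal (- real n)) (real n)) in lborel.
        F t = (iexp (- (t * a)) - iexp (- (t * b))) / (\<i> * t) * \<phi> t"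
      by eventually_elim simp
    show "F \<in> borel_measurable borel" using F_int by (simp add: borel_measurable_integrable)
  qed measurable
  ultimately have "(\<lambda>n. 1 / (2 * pi) * (CLBINT t=-(real n)..real n. (iexp (- (t * a)) - iexp (- (t * b))) / (\<i> * t) * \<phi> t))
      \<longlonglongrightarrow> complex_of_real (1 / (2 * pi)) * (CLBINT t. F t)"
    by (intro tendsto_intros) auto
  with Levy_Inversion[OF ab atoms] have "complex_of_real (measure M {a<..b}) = complex_of_real (1 / (2 * pi)) * (CLBINT t. F t)"
    unfolding \<phi>_def by (intro LIMSEQ_unique) auto
  also have "(CLBINT t. F t) = (CLBINT x. CLBINT t. indicator {a..b} x *\<^sub>R (iexp (- (t * x)) * \<phi> t))"
    unfolding F_eq by (rule lborel_pair.Fubini_integral[OF prod, symmetric])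
  also have "\<dots> = (CLBINT x. indicator {a..b} x *\<^sub>R fourier \<phi> (-x))"
    by (simp add: fourier_def)
  finally have "complex_of_real (measure M {a<..b}) = (CLBINT x. complex_of_real (1 / (2 * pi)) * (indicator {a..b} x *\<^sub>R fourier \<phi> (-x)))"
    by (simp only: integral_mult_right_zero)
  moreover have "integrable lborel (\<lambda>x. complex_of_real (1 / (2 * pi)) * (indicator {a..b} x *\<^sub>R fourier \<phi> (-x)))"
  proof (intro integrable_mult_right)
    have "continuous_on {a..b} (\<lambda>x. fourier \<phi> (-x))"
      by (intro continuous_at_imp_continuous_on ballI isCont_o2[OF _ isCont_fourier] int\<phi> continuous_intros)
    then show "integrable lborel (\<lambda>x. indicator {a..b} x *\<^sub>R fourier \<phi> (-x))"
      by (intro borel_integrable_compact) auto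
  qed
  ultimately have "measure M {a<..b} = Re (CLBINT x. complex_of_real (1 / (2 * pi)) * (indicator {a..b} x *\<^sub>R fourier \<phi> (-x)))"
    and int2: "integrable lborel (\<lambda>x. complex_of_real (1 / (2 * pi)) * (indicator {a..b} x *\<^sub>R fourier \<phi> (-x)))"
    by (metis Re_complex_of_real, blast)
  note this(1)
  also have "Re (CLBINT x. complex_of_real (1 / (2 * pi)) * (indicator {a..b} x *\<^sub>R fourier \<phi> (-x))) = (LBINT x. Re (complex_of_real (1 / (2 * pi)) * (indicator {a..b} x *\<^sub>R fourier \<phi> (-x))))"
    by (rule integral_Re[symmetric, OF int2])
  also have "\<dots> = (LBINT x. indicator {a..b} x * (Re (fourier \<phi> (-x)) / (2 * pi)))"
    by (intro Bochner_Integration.integral_cong refl) (auto simp flip: of_real_mult simp: Re_divide_of_real)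
  finally show ?thesis by (simp add: \<phi>_def)
qed

text \<open>The interval formula is available only for endpoints that are not atoms. Such endpoints
  are dense, and boundedness of \<open>g\<close> first excludes atoms altogether; continuity then
  yields nonnegativity from nonnegative interval masses.\<close>

lemma (in real_distribution) density_fourier:
  assumes int: "integrable lborel (char M)"
  defines "g \<equiv> \<lambda>x. Re (fourier (char M) (-x)) / (2 * pi)"
  shows "continuous_on UNIV g" "\<And>x. 0 \<le> g x" "M = density lborel (\<lambda>x. ennreal (g x))"
proof -
  have cont: "isCont g x" for x
    unfolding g_def
    by (intro isCont_divide bounded_linear.isCont[OF bounded_linear_Re] isCont_o2[where f = uminus, OF _ isCont_fourier] int) auto
  then show contg: "continuous_on UNIV g" by (intro continuous_at_imp_continuous_on) auto
  have [measurable]: "g \<in> borel_measurable borel" by (rule borel_measurable_continuous_onI[OF contg])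
  define C where "C = (LBINT t. cmod (char M t)) / (2 * pi)"
  have bound: "\<bar>g x\<bar> \<le> C" for x
    using norm_fourier_le[of "char M" "-x"] abs_Re_le_cmod[of "fourier (char M) (-x)"]
    by (auto simp: g_def C_def intro!: divide_right_mono)
  have intg: "integrable lborel (\<lambda>x. indicator {a..b} x * g x)" for a b
    using borel_integrable_compact[of "{a..b}" g] contg continuous_on_subset by auto
  have ctble: "countable {x. measure M {x} \<noteq> 0}" by (rule countable_support)
  have Ioc: "measure M {a<..b} = (LBINT x. indicator {a..b} x * g x)" if "a \<le> b" "measure M {a} = 0" "measure M {b} = 0" for a b
    unfolding g_def by (rule measure_Ioc_fourier[OF int that])
  have between: "\<exists>z. a < z \<and> z < b \<and> measure M {z} = 0" if "a < b" for a b
    using open_minus_countable[OF ctble, of "{a<..<b}"] that by auto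
  have no_atom: "measure M {x} = 0" for x
  proof (rule ccontr)
    assume ne: "measure M {x} \<noteq> 0"
    define p where "p = measure M {x}"
    have p: "0 < p" using ne measure_nonneg[of M "{x}"] unfolding p_def by linarith
    have C0: "0 \<le> C" using bound[of 0] by linarith
    \<comment> \<open>Chosen so that an interval of length at most \<open>2 * d\<close> has mass at
      most \<open>p / 2\<close>; the \<open>+ 1\<close> avoids division by 0.\<close>
    define d where "d = p / (4 * (C + 1))"
    have d: "0 < d" using p C0 by (simp add: d_def)
    obtain a b where ab: "x - d < a" "a < x" "x < b" "b < x + d" "measure M {a} = 0" "measure M {b} = 0"
      using between[of "x - d" x] between[of x "x + d"] d by auto
    have "p \<le> measure M {a<..b}" unfolding p_def using ab by (intro finite_measure_mono) auto
    also have "\<dots> = (LBINT x. indicator {a..b} x * g x)" using ab by (intro Ioc) auto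
    also have "\<dots> \<le> (LBINT x. indicator {a..b} x * C)"
    proof (intro integral_mono intg)
      show "integrable lborel (\<lambda>x. indicator {a..b} x * C)"
        by (intro integrable_mult_left integrable_real_indicator) (auto simp: emeasure_lborel_Icc_eq)
      show "indicator {a..b} z * g z \<le> indicator {a..b} z * C" for z
        using bound[of z] by (intro mult_left_mono) auto
    qed
    also have "\<dots> = (b - a) * C" using ab by simp
    also have "\<dots> \<le> (2 * d) * C" using ab C0 by (intro mult_right_mono) auto
    also have "\<dots> \<le> 2 * d * (C + 1)" using d by simp
    also have "\<dots> = p / 2" using C0 by (simp add: d_def field_simps add_eq_0_iff)
    also have "\<dots> < p" using p by simp
    finally show False by simp
  qed
  show nonneg: "0 \<le> g x" for x
  proof (rule ccontr)
    assume "\<not> 0 \<le> g x"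
    then have "\<forall>\<^sub>F z in nhds x. g z < 0"
      using cont[of x] by (intro order_tendstoD(2)) (auto simp: isCont_def tendsto_at_iff_tendsto_nhds)
    then obtain d where d: "0 < d" "\<And>z. dist z x < d \<Longrightarrow> g z < 0"
      by (auto simp: eventually_nhds_metric)
    have neg: "g z < 0" if "z \<in> {x..x + d/2}" for z using that d by (intro d(2)) (auto simp: dist_real_def)
    have "0 \<le> measure M {x<..x + d/2}" by simp
    also have "\<dots> = (LBINT z. indicator {x..x + d/2} z * g z)" using d no_atom by (intro Ioc) auto
    finally have "(LBINT z. - (indicator {x..x + d/2} z * g z)) \<le> 0" by simp
    moreover have "AE z in lborel. 0 \<le> - (indicator {x..x + d/2} z * g z)"
      using neg by (auto simp: indicator_def less_imp_le)
    ultimately have "(LBINT z. - (indicator {x..x + d/2} z * g z)) = 0"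
      using integral_nonneg_AE[where M = lborel and f = "\<lambda>z. - (indicator {x..x + d/2} z * g z)"] by linarith
    then have "AE z in lborel. indicator {x..x + d/2} z * g z = 0"
      using integral_nonneg_eq_0_iff_AE[where M = lborel and f = "\<lambda>z. - (indicator {x..x + d/2} z * g z)"]
        intg neg by (simp add: less_imp_le indicator_def)
    then have "AE z in lborel. z \<notin> {x..x + d/2}"
      by eventually_elim (use neg in \<open>force simp: indicator_def\<close>)
    then have "emeasure lborel {x..x + d/2} = 0" by (subst (asm) AE_iff_null_sets[symmetric]) auto
    then show False using d by simp
  qed
  have Ioc_emeasure: "emeasure M {a<..b} = emeasure (density lborel (\<lambda>x. ennreal (g x))) {a<..b}" for a b
  proof (cases "a \<le> b")
    case True
    have "AE x in lborel. ennreal (g x) * indicator {a<..b} x = ennreal (indicator {a..b} x * g x)"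
      using AE_lborel_singleton[of a] by eventually_elim (auto split: split_indicator)
    then have "emeasure (density lborel (\<lambda>x. ennreal (g x))) {a<..b} = (\<integral>\<^sup>+x. ennreal (indicator {a..b} x * g x) \<partial>lborel)"
      by (subst emeasure_density) (auto intro!: nn_integral_cong_AE)
    also have "\<dots> = ennreal (measure M {a<..b})"
      using True no_atom nonneg by (subst nn_integral_eq_integral[OF intg]) (auto simp: Ioc)
    finally show ?thesis by (simp add: emeasure_eq_measure)
  qed simp
  show "M = density lborel (\<lambda>x. ennreal (g x))"
  proof (rule measure_eqI_generator_eq[where E = "range (\<lambda>(a, b). {a<..b::real})" and \<Omega> = UNIV and A = "\<lambda>n. {- real n<..real n}"])
    show "Int_stable (range (\<lambda>(a, b). {a<..b::real}))"
      by (auto simp: Int_stable_def image_iff)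
    show "sets M = sigma_sets UNIV (range (\<lambda>(a, b). {a<..b::real}))"
      "sets (density lborel (\<lambda>x. ennreal (g x))) = sigma_sets UNIV (range (\<lambda>(a, b). {a<..b::real}))"
      by (simp_all add: borel_sigma_sets_Ioc)
    show "(\<Union>i. {- real i<..real i}) = UNIV"
    proof (intro set_eqI iffI UNIV_I)
      fix x :: real
      obtain N :: nat where "\<bar>x\<bar> < real N" using reals_Archimedean2 by blast
      then show "x \<in> (\<Union>i. {- real i<..real i})" by (intro UN_I[of N]) auto
    qed
    show "emeasure M {- real i<..real i} \<noteq> \<infinity>" for i by (simp add: emeasure_eq_measure)
  qed (use Ioc_emeasure in force)+
qed


section \<open>The tent function and the Fejer kernel\<close>

definition tent :: "real \<Rightarrow> real \<Rightarrow> real" where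
  "tent a t = max 0 (1 - \<bar>t\<bar> / a)"

text \<open>The Fourier transform of \<open>tent a\<close>, with its removable singularity at 0
  filled in.\<close>

definition fejer :: "real \<Rightarrow> real \<Rightarrow> real" where
  "fejer a x = (if x = 0 then a else 2 * (1 - cos (a * x)) / (a * x\<^sup>2))"

lemma continuous_tent [continuous_intros]:
  assumes "continuous_on S f" shows "continuous_on S (\<lambda>t. tent a (f t))"
  unfolding tent_def divide_inverse by (intro continuous_intros assms)

lemma borel_measurable_tent [measurable]: "tent a \<in> borel_measurable borel"
  by (intro borel_measurable_continuous_onI continuous_intros)

lemma tent_nonneg: "0 \<le> tent a t" and tent_le_1: "0 < a \<Longrightarrow> tent a t \<le> 1"
  by (auto simp: tent_def)

lemma tent_outside: "0 < a \<Longrightarrow> a \<le> \<bar>t\<bar> \<Longrightarrow> tent a t = 0"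
  by (auto simp: tent_def)

lemma tent_even: "tent a (-t) = tent a t"
  by (simp add: tent_def)

lemma tent_0 [simp]: "tent a 0 = 1"
  by (simp add: tent_def)

lemma tent_lipschitz: "0 < a \<Longrightarrow> \<bar>tent a s - tent a t\<bar> \<le> \<bar>s - t\<bar> / a"
proof -
  assume a: "0 < a"
  have "\<bar>tent a s - tent a t\<bar> \<le> \<bar>\<bar>s\<bar> / a - \<bar>t\<bar> / a\<bar>" unfolding tent_def by linarith
  also have "\<dots> = \<bar>\<bar>s\<bar> - \<bar>t\<bar>\<bar> / a" using a by (simp add: diff_divide_distrib[symmetric] abs_divide)
  also have "\<dots> \<le> \<bar>s - t\<bar> / a" using a by (intro divide_right_mono) auto
  finally show ?thesis .
qed

lemma integrable_tent: "0 < a \<Longrightarrow> integrable lborel (tent a)"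
proof -
  assume a: "0 < a"
  have "integrable lborel (\<lambda>t. indicator {-a..a} t *\<^sub>R tent a t)"
    by (intro borel_integrable_compact continuous_intros) auto
  moreover have "(\<lambda>t. indicator {-a..a} t *\<^sub>R tent a t) = tent a"
    using tent_outside[OF a] by (force simp: indicator_def)
  ultimately show ?thesis by simp
qed

lemma fourier_tent:
  assumes a: "0 < a" shows "fourier (\<lambda>t. of_real (tent a t)) x = of_real (fejer a x)"
proof -
  let ?f = "\<lambda>t. iexp (t * x) * of_real (tent a t)"
  have int: "integrable lborel (\<lambda>t. indicator {p..q} t *\<^sub>R ?f t)" for p q
    by (intro borel_integrable_compact continuous_intros) auto
  have "fourier (\<lambda>t. of_real (tent a t)) x = (CLBINT t. indicator {-a..0} t *\<^sub>R ?f t + indicator {0..a} t *\<^sub>R ?f t)"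
    unfolding fourier_def
  proof (rule integral_cong_AE)
    show "AE t in lborel. ?f t = indicator {-a..0} t *\<^sub>R ?f t + indicator {0..a} t *\<^sub>R ?f t"
      using AE_lborel_singleton[of 0]
    proof eventually_elim
      case (elim t)
      then show ?case using tent_outside[OF a, of t] by (auto simp: indicator_def)
    qed
  qed measurable
  also have "\<dots> = (CLBINT t. indicator {-a..0} t *\<^sub>R ?f t) + (CLBINT t. indicator {0..a} t *\<^sub>R ?f t)"
    by (intro Bochner_Integration.integral_add int)
  also have "\<dots> = of_real (fejer a x)"
  proof (cases "x = 0")
    case True
    have 1: "(CLBINT t. indicator {-a..0} t *\<^sub>R ?f t) = of_real (0 + 0\<^sup>2 / (2 * a)) - of_real (-a + (-a)\<^sup>2 / (2 * a))"
    proof (rule integral_FTC_Icc)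
      fix t assume t: "-a \<le> t" "t \<le> 0"
      have "((\<lambda>t. t + t\<^sup>2 / (2 * a)) has_real_derivative 1 + t / a) (at t within {-a..0})"
        using a by (auto intro!: derivative_eq_intros)
      moreover have "tent a t = 1 + t / a" using t a by (simp add: tent_def field_simps)
      ultimately show "((\<lambda>t. of_real (t + t\<^sup>2 / (2 * a))) has_vector_derivative ?f t) (at t within {-a..0})"
        using True by (simp only: has_real_derivative_iff_has_vector_derivative mult_zero_right of_real_0 exp_zero mult_1
            has_vector_derivative_of_real)
    qed (use a in \<open>auto intro!: continuous_intros\<close>)
    have 2: "(CLBINT t. indicator {0..a} t *\<^sub>R ?f t) = of_real (a - a\<^sup>2 / (2 * a)) - of_real (0 - 0\<^sup>2 / (2 * a))"
    proof (rule integral_FTC_Icc)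
      fix t assume t: "0 \<le> t" "t \<le> a"
      have "((\<lambda>t. t - t\<^sup>2 / (2 * a)) has_real_derivative 1 - t / a) (at t within {0..a})"
        using a by (auto intro!: derivative_eq_intros)
      moreover have "tent a t = 1 - t / a" using t a by (simp add: tent_def field_simps)
      ultimately show "((\<lambda>t. of_real (t - t\<^sup>2 / (2 * a))) has_vector_derivative ?f t) (at t within {0..a})"
        using True by (simp only: has_real_derivative_iff_has_vector_derivative mult_zero_right of_real_0 exp_zero mult_1
            has_vector_derivative_of_real)
    qed (use a in \<open>auto intro!: continuous_intros\<close>)
    show ?thesis unfolding 1 2 using True a by (simp add: fejer_def power2_eq_square)
  next
    case False
    define w where "w = \<i> * complex_of_real x"
    have w: "w \<noteq> 0" "w\<^sup>2 = - (of_real x)\<^sup>2" using False by (auto simp: w_def power_mult_distrib)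
    have ex: "iexp (t * x) = exp (w * of_real t)" for t by (simp add: w_def mult_ac)
    \<comment> \<open>\<open>G1\<close> and \<open>G2\<close> are the antiderivatives by parts on
      the two sides of the kink. Their \<open>1 / w\<close> terms at 0 cancel, which leaves only the
      terms with \<open>w\<^sup>2\<close>.\<close>
    define G1 where "G1 t = (1 + t / of_real a) * exp (w * t) / w - exp (w * t) / (of_real a * w\<^sup>2)" for t :: complex
    define G2 where "G2 t = (1 - t / of_real a) * exp (w * t) / w + exp (w * t) / (of_real a * w\<^sup>2)" for t :: complex
    have 1: "(CLBINT t. indicator {-a..0} t *\<^sub>R ?f t) =
      G1 (of_real 0)
      - G1 (of_real (-a))"
    proof (rule integral_FTC_Icc[where F = "\<lambda>t. G1 (of_real t)"])
      fix t assume t: "-a \<le> t" "t \<le> 0"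
      have "(G1 has_field_derivative
          (1 + of_real t / a) * exp (w * of_real t)) (at (of_real t))"
        unfolding G1_def using a w(1) by (auto intro!: derivative_eq_intros simp: field_simps power2_eq_square)
      moreover have "complex_of_real (tent a t) = 1 + of_real t / a" using t a by (simp add: tent_def field_simps)
      ultimately show "((\<lambda>t. G1 (of_real t)) has_vector_derivative ?f t) (at t within {-a..0})"
        by (intro has_vector_derivative_real_field[THEN has_vector_derivative_at_within]) (simp only: ex mult.commute)
    qed (use a in \<open>auto intro!: continuous_intros\<close>)
    have 2: "(CLBINT t. indicator {0..a} t *\<^sub>R ?f t) =
      G2 (of_real a)
      - G2 (of_real 0)"
    proof (rule integral_FTC_Icc[where F = "\<lambda>t. G2 (of_real t)"])
      fix t assume t: "0 \<le> t" "t \<le> a"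
      have "(G2 has_field_derivative
          (1 - of_real t / a) * exp (w * of_real t)) (at (of_real t))"
        unfolding G2_def using a w(1) by (auto intro!: derivative_eq_intros simp: field_simps power2_eq_square)
      moreover have "complex_of_real (tent a t) = 1 - of_real t / a" using t a by (simp add: tent_def field_simps)
      ultimately show "((\<lambda>t. G2 (of_real t)) has_vector_derivative ?f t) (at t within {0..a})"
        by (intro has_vector_derivative_real_field[THEN has_vector_derivative_at_within]) (simp only: ex mult.commute)
    qed (use a in \<open>auto intro!: continuous_intros\<close>)
    have "(G1 (of_real 0) - G1 (of_real (-a))) + (G2 (of_real a) - G2 (of_real 0)) =
        ((exp (w * a) + exp (w * - a)) - 2) / (a * w\<^sup>2)"
      using a w(1) by (simp add: G1_def G2_def diff_divide_distrib add_divide_distrib)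
    moreover have "exp (w * a) + exp (w * - a) = complex_of_real (2 * cos (a * x))"
      by (simp add: w_def exp_minus[symmetric] cos_exp_eq cos_of_real[symmetric] mult_ac)
    ultimately have sum4: "(G1 (of_real 0) - G1 (of_real (-a))) + (G2 (of_real a) - G2 (of_real 0)) =
        (complex_of_real (2 * cos (a * x)) - 2) / (a * w\<^sup>2)" by simp
    have "(CLBINT t. indicator {-a..0} t *\<^sub>R ?f t) + (CLBINT t. indicator {0..a} t *\<^sub>R ?f t)
        = (complex_of_real (2 * cos (a * x)) - 2) / (a * w\<^sup>2)"
      unfolding 1 2 by (simp only: sum4)
    then show ?thesis using False a by (simp add: w fejer_def field_simps)
  qed
  finally show ?thesis .
qed

lemma isCont_fejer: "0 < a \<Longrightarrow> isCont (fejer a) x"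
proof -
  assume a: "0 < a"
  have "isCont (\<lambda>x. Re (fourier (\<lambda>t. of_real (tent a t)) x)) x"
    by (intro bounded_linear.isCont[OF bounded_linear_Re] isCont_fourier) (use integrable_tent[OF a] in simp)
  then show ?thesis by (simp add: fourier_tent[OF a])
qed

lemma borel_measurable_fejer [measurable]: "0 < a \<Longrightarrow> fejer a \<in> borel_measurable borel"
  by (intro borel_measurable_continuous_onI continuous_at_imp_continuous_on ballI isCont_fejer)

lemma fejer_nonneg: "0 < a \<Longrightarrow> 0 \<le> fejer a x"
  by (auto simp: fejer_def)

lemma fejer_even: "fejer a (-x) = fejer a x"
  by (simp add: fejer_def)

lemma fejer_pos:
  assumes a: "0 < a" and x: "\<bar>x\<bar> \<le> 1 / a" shows "0 < fejer a x"
proof (cases "x = 0")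
  case False
  have "\<bar>a * x\<bar> \<le> 1" using a x by (simp add: abs_mult field_simps)
  then have "cos \<bar>a * x\<bar> < cos 0" using a False pi_gt3 by (intro cos_monotone_0_pi) auto
  then show ?thesis using False a by (simp add: fejer_def)
qed (use a in \<open>simp add: fejer_def\<close>)

lemma fejer_le: "0 < a \<Longrightarrow> fejer a x \<le> a"
proof -
  assume a: "0 < a"
  have "fejer a x = Re (fourier (\<lambda>t. of_real (tent a t)) x)" by (simp add: fourier_tent[OF a])
  also have "\<dots> \<le> (LBINT t. tent a t)"
    using norm_fourier_le[of "\<lambda>t. of_real (tent a t)" x] complex_Re_le_cmod[of "fourier (\<lambda>t. of_real (tent a t)) x"]
    by (simp add: tent_nonneg)
  also have "\<dots> = Re (fourier (\<lambda>t. of_real (tent a t)) 0)" by (simp add: fourier_def)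
  also have "\<dots> = a" by (simp only: fourier_tent[OF a]) (simp add: fejer_def)
  finally show ?thesis .
qed

text \<open>The value at \<open>0\<close> is \<open>0 powr (-a) = 0\<close>, so bounds by \<open>two_power\<close> have to exclude that point.\<close>
definition two_power :: "real \<Rightarrow> real \<Rightarrow> real \<Rightarrow> real" where
  "two_power a b x = (if \<bar>x\<bar> \<le> 1 then \<bar>x\<bar> powr (-a) else \<bar>x\<bar> powr (-b))"

lemma two_power_nonneg: "0 \<le> two_power a b x"
  by (simp add: two_power_def)

lemma borel_measurable_two_power [measurable]: "two_power a b \<in> borel_measurable borel"
  unfolding two_power_def[abs_def] by measurable

lemma integrable_two_power:
  assumes a: "a < 1" and b: "1 < b" shows "integrable lborel (two_power a b)"
proof -
  define f where "f x = indicator {0<..1} x * x powr (-a) + indicator {1..} x * x powr (-b)" for x :: real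
  have "(\<lambda>x. x powr (-a)) absolutely_integrable_on {0<..1}"
    using a by (intro nonnegative_absolutely_integrable_1 integrable_on_powr_from_0') auto
  then have 1: "integrable lborel (\<lambda>x. indicator {0<..1} x *\<^sub>R (x powr (-a)))"
    unfolding set_integrable_def by (subst (asm) integrable_completion) measurable
  have "(\<lambda>x. x powr (-b)) absolutely_integrable_on {1..}"
    using b has_integral_powr_to_inf[of "-b" 1] by (intro nonnegative_absolutely_integrable_1) (auto simp: has_integral_integrable_integral)
  then have 2: "integrable lborel (\<lambda>x. indicator {1..} x *\<^sub>R (x powr (-b)))"
    unfolding set_integrable_def by (subst (asm) integrable_completion) measurable
  have f: "integrable lborel f" unfolding f_def using Bochner_Integration.integrable_add[OF 1 2] by simp
  then have f': "integrable lborel (\<lambda>x. f (-x))"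
    using lborel_integrable_real_affine[of f "-1" 0] by simp
  show ?thesis
  proof (rule Bochner_Integration.integrable_bound[OF Bochner_Integration.integrable_add[OF f f']])
    show "AE x in lborel. norm (two_power a b x) \<le> norm (f x + f (- x))"
      by (rule AE_I2) (auto simp: two_power_def f_def indicator_def)
  qed measurable
qed

lemma integrable_fejer:
  assumes a: "0 < a" shows "integrable lborel (fejer a)"
proof (rule Bochner_Integration.integrable_bound)
  \<comment> \<open>The kernel is at most \<open>a\<close> near 0 and at most
    \<open>4 / (a * x\<^sup>2)\<close> elsewhere; the exponent 1/2 is just an integrable one for the
    unit interval.\<close>
  show "integrable lborel (\<lambda>x. (a + 4 / a) * two_power (1/2) 2 x)"
    by (intro integrable_mult_right integrable_two_power) auto
  show "AE x in lborel. norm (fejer a x) \<le> norm ((a + 4 / a) * two_power (1/2) 2 x)"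
    using AE_lborel_singleton[of 0]
  proof eventually_elim
    case (elim x)
    have "fejer a x \<le> (a + 4 / a) * two_power (1/2) 2 x"
    proof (cases "\<bar>x\<bar> \<le> 1")
      case True
      have "1 \<le> two_power (1/2) 2 x"
        using True elim powr_mono2'[of "-1/2" "\<bar>x\<bar>" 1] by (simp add: two_power_def)
      then have "(a + 4 / a) * 1 \<le> (a + 4 / a) * two_power (1/2) 2 x" using a by (intro mult_left_mono) auto
      moreover have "fejer a x \<le> (a + 4 / a) * 1" using fejer_le[OF a, of x] a by (simp add: add_increasing2)
      ultimately show ?thesis by (rule order_trans[rotated])
    next
      case False
      have tp: "two_power (1/2) 2 x = 1 / x\<^sup>2" using False by (simp add: two_power_def powr_minus_divide)
      have "2 * (1 - cos (a * x)) \<le> 4" using abs_cos_le_one[of "a * x"] by (smt (verit))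
      from divide_right_mono[OF this, of "a * x\<^sup>2"] have "fejer a x \<le> 4 / (a * x\<^sup>2)"
        using a elim by (simp add: fejer_def)
      also have "\<dots> \<le> (a + 4 / a) * two_power (1/2) 2 x" using a by (simp add: tp add_divide_distrib)
      finally show ?thesis .
    qed
    then show ?case using fejer_nonneg[OF a] two_power_nonneg[of "1/2" 2 x] a by (simp add: abs_of_nonneg)
  qed
qed (use a in measurable)

text \<open>Fourier inversion applied to the triangular density, whose characteristic function is
  a multiple of the Fejer kernel.\<close>
lemma Re_fourier_fejer:
  assumes a: "0 < a" shows "Re (fourier (\<lambda>x. of_real (fejer a x)) t) = 2 * pi * tent a t"
proof -
  define M where "M = density lborel (\<lambda>t. ennreal (tent a t / a))"
  have int: "integrable lborel (\<lambda>t. tent a t / a)" using integrable_tent[OF a] by simp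
  have char_M: "char M x = of_real (fejer a x / a)" for x
  proof -
    have "char M x = (CLBINT t. (tent a t / a) *\<^sub>R iexp (x * t))"
      unfolding char_def M_def using a by (subst integral_density) (auto simp: tent_nonneg)
    also have "\<dots> = (CLBINT t. (iexp (t * x) * of_real (tent a t)) / of_real a)"
      by (intro Bochner_Integration.integral_cong) (auto simp: scaleR_conv_of_real mult_ac)
    also have "\<dots> = fourier (\<lambda>t. of_real (tent a t)) x / of_real a"
      unfolding fourier_def by (rule integral_divide_zero)
    finally show ?thesis by (simp add: fourier_tent[OF a])
  qed
  have "(LBINT t. tent a t) = Re (fourier (\<lambda>t. of_real (tent a t)) 0)" by (simp add: fourier_def)
  also have "\<dots> = a" by (simp only: fourier_tent[OF a]) (simp add: fejer_def)
  finally have "(LBINT t. tent a t / a) = 1" using a by simp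
  then have "emeasure M (space M) = 1"
    unfolding M_def using int a by (simp add: emeasure_density nn_integral_eq_integral tent_nonneg)
  then interpret real_distribution M
    by (intro real_distribution.intro prob_spaceI) (auto simp: real_distribution_axioms_def M_def)
  have intc: "integrable lborel (char M)"
    unfolding char_M[abs_def] using integrable_fejer[OF a] by simp
  define g where "g = (\<lambda>x. Re (fourier (char M) (-x)) / (2 * pi))"
  have g: "continuous_on UNIV g" "\<And>x. 0 \<le> g x" "M = density lborel (\<lambda>x. ennreal (g x))"
    unfolding g_def by (rule density_fourier[OF intc])+
  have [measurable]: "g \<in> borel_measurable borel" by (rule borel_measurable_continuous_onI[OF g(1)])
  have "density lborel (\<lambda>t. ennreal (tent a t / a)) = density lborel (\<lambda>x. ennreal (g x))"
    using g(3) by (simp only: M_def[symmetric])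
  then have "AE x in lborel. ennreal (tent a x / a) = ennreal (g x)"
    by (subst (asm) sigma_finite_measure.density_unique_iff[OF sigma_finite_lborel]) measurable
  then have "AE x in lborel. tent a x / a = g x"
    by eventually_elim (use g(2) a in \<open>auto simp: tent_nonneg\<close>)
  then have eq: "(\<lambda>x. tent a x / a) = g"
    using a by (intro AE_lborel_continuous_eq g(1)) (auto intro!: continuous_intros)
  have "fourier (char M) t = fourier (\<lambda>x. of_real (fejer a x)) t / of_real a"
    unfolding fourier_def char_M by (subst integral_divide_zero[symmetric]) simp
  then have "Re (fourier (\<lambda>x. of_real (fejer a x)) t) / a = Re (fourier (char M) t)" by simp
  also have "\<dots> = 2 * pi * (tent a t / a)"
    using fun_cong[OF eq, of "-t"] by (simp add: g_def tent_even)
  finally show ?thesis using a by simp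
qed

lemma fourier_fejer:
  assumes a: "0 < a" shows "fourier (\<lambda>x. of_real (fejer a x)) t = of_real (2 * pi * tent a t)"
proof -
  let ?f = "\<lambda>x. sin (x * t) * fejer a x"
  have "(LBINT x. ?f x) = (LBINT x. ?f (-x))"
    using lborel_integral_real_affine[of "-1" ?f 0] by simp
  also have "\<dots> = - (LBINT x. ?f x)" by (simp add: fejer_even)
  finally have 0: "(LBINT x. ?f x) = 0" by simp
  have "Im (fourier (\<lambda>x. of_real (fejer a x)) t) = (LBINT x. Im (iexp (x * t) * of_real (fejer a x)))"
    unfolding fourier_def using integrable_fejer[OF a] by (intro integral_Im[symmetric] integrable_iexp_mult) auto
  also have "\<dots> = 0" using 0 by (simp add: Im_exp)
  finally show ?thesis using Re_fourier_fejer[OF a] by (simp add: complex_eq_iff)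
qed

section \<open>Levy-type exponents of measures on the half-line\<close>

lemma norm_iexp_minus_1_le: "cmod (iexp x - 1) \<le> \<bar>x\<bar>" "cmod (iexp x - 1) \<le> 2"
proof -
  show "cmod (iexp x - 1) \<le> \<bar>x\<bar>" using iexp_approx1[of x 0] by simp
  show "cmod (iexp x - 1) \<le> 2" using norm_triangle_ineq4[of "iexp x" 1] by simp
qed

lemma norm_iexp_minus_1_le_min: "0 \<le> y \<Longrightarrow> cmod (iexp (t * y) - 1) \<le> 2 * min 1 (\<bar>t\<bar> * y)"
proof -
  assume "0 \<le> y"
  then have "cmod (iexp (t * y) - 1) \<le> \<bar>t\<bar> * y" "0 \<le> \<bar>t\<bar> * y"
    using norm_iexp_minus_1_le(1)[of "t * y"] by (simp_all only: abs_mult abs_of_nonneg mult_nonneg_nonneg abs_ge_zero)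
  then show ?thesis using norm_iexp_minus_1_le(2)[of "t * y"] by linarith
qed

text \<open>Covers both the law of the summands, where \<open>exponent\<close> is
  \<open>char M - 1\<close>, and the Levy measures, which have infinite mass near 0. Integrability
  of the tail at 0 is the same as integrability of \<open>min r x\<close>.\<close>

locale halfline_measure = sigma_finite_measure N for N :: "real measure" +
  fixes T :: "real \<Rightarrow> real"
  assumes sets_N [measurable_cong, simp]: "sets N = sets borel"
    and emeasure_neg: "emeasure N {..<0} = 0"
    and emeasure_tail: "0 < x \<Longrightarrow> emeasure N {x<..} = ennreal (T x)"
    and T_nonneg: "0 < x \<Longrightarrow> 0 \<le> T x"
    and T_integrable: "0 < r \<Longrightarrow> integrable lborel (\<lambda>x. indicator {0<..r} x * T x)"
begin

sublocale lborel_N: pair_sigma_finite lborel N ..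

lemma space_N [simp]: "space N = UNIV"
  using sets_eq_imp_space_eq[OF sets_N] by simp

lemma AE_nonneg: "AE x in N. 0 \<le> x"
proof (rule AE_I')
  show "{..<0} \<in> null_sets N" by (simp add: null_sets_def emeasure_neg)
qed auto

text \<open>By Fubini this is the integral of \<open>min r x\<close>, the truncated mean.\<close>

definition cum_tail :: "real \<Rightarrow> real" where
  "cum_tail r = (LBINT x. indicator {0<..r} x * T x)"

text \<open>Layer cake formula: for \<open>x \<ge> 0\<close>, \<open>min 1 (s * x)\<close> is s
  times the length of the part of \<open>{0<..1/s}\<close> below x.\<close>

lemma nn_integral_min:
  assumes s: "0 < s"
  shows "(\<integral>\<^sup>+x. ennreal (min 1 (s * x)) \<partial>N) = ennreal (s * cum_tail (1/s))"
proof -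
  have "(\<integral>\<^sup>+x. ennreal (min 1 (s * x)) \<partial>N) =
      (\<integral>\<^sup>+x. \<integral>\<^sup>+u. ennreal s * indicator {0<..1/s} u * indicator {(u, x). u < x} (u, x) \<partial>lborel \<partial>N)"
  proof (rule nn_integral_cong_AE)
    show "AE x in N. ennreal (min 1 (s * x)) =
        (\<integral>\<^sup>+u. ennreal s * indicator {0<..1/s} u * indicator {(u, x). u < x} (u, x) \<partial>lborel)"
      using AE_nonneg
    proof eventually_elim
      case (elim x)
      have "(\<integral>\<^sup>+u. ennreal s * indicator {0<..1/s} u * indicator {(u, x). u < x} (u, x) \<partial>lborel)
          = (\<integral>\<^sup>+u. ennreal s * indicator ({0<..1/s} \<inter> {..<x}) u \<partial>lborel)"
        by (intro nn_integral_cong) (auto simp: indicator_def)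
      also have "\<dots> = ennreal s * emeasure lborel ({0<..1/s} \<inter> {..<x})"
        by (intro nn_integral_cmult_indicator) auto
      also have "emeasure lborel ({0<..1/s} \<inter> {..<x}) = ennreal (min (1/s) x)"
      proof (cases "x \<le> 1/s")
        case True
        then have "{0<..1/s} \<inter> {..<x} = {0<..<x}" by auto
        then show ?thesis using True elim by simp
      next
        case False
        then have "{0<..1/s} \<inter> {..<x} = {0<..1/s}" by auto
        then show ?thesis using False s by simp
      qed
      also have "ennreal s * ennreal (min (1/s) x) = ennreal (min 1 (s * x))"
        using s elim by (simp add: ennreal_mult[symmetric] min_def field_simps)
      finally show ?case by simp
    qed
  qed
  also have "\<dots> = (\<integral>\<^sup>+u. \<integral>\<^sup>+x. ennreal s * indicator {0<..1/s} u * indicator {(u, x). u < x} (u, x) \<partial>N \<partial>lborel)"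
    by (intro lborel_N.Fubini') measurable
  also have "\<dots> = (\<integral>\<^sup>+u. ennreal (s * (indicator {0<..1/s} u * T u)) \<partial>lborel)"
  proof (intro nn_integral_cong)
    fix u :: real
    have "(\<integral>\<^sup>+x. ennreal s * indicator {0<..1/s} u * indicator {(u, x). u < x} (u, x) \<partial>N)
        = (\<integral>\<^sup>+x. ennreal s * indicator {0<..1/s} u * indicator {u<..} x \<partial>N)"
      by (intro nn_integral_cong) (auto simp: indicator_def)
    also have "\<dots> = ennreal s * indicator {0<..1/s} u * emeasure N {u<..}"
      by (intro nn_integral_cmult_indicator) auto
    also have "\<dots> = ennreal (s * (indicator {0<..1/s} u * T u))"
      using s by (auto simp: indicator_def emeasure_tail T_nonneg ennreal_mult)
    finally show "(\<integral>\<^sup>+x. ennreal s * indicator {0<..1/s} u * indicator {(u, x). u < x} (u, x) \<partial>N)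
        = ennreal (s * (indicator {0<..1/s} u * T u))" .
  qed
  also have "\<dots> = ennreal (LBINT u. s * (indicator {0<..1/s} u * T u))"
    using s T_integrable T_nonneg
    by (intro nn_integral_eq_integral) (auto simp: indicator_def)
  finally show ?thesis by (simp add: cum_tail_def)
qed

lemma cum_tail_nonneg: "0 \<le> cum_tail r"
  unfolding cum_tail_def by (intro integral_nonneg_AE AE_I2) (auto simp: indicator_def T_nonneg)

lemma has_bochner_integral_min:
  assumes s: "0 < s"
  shows "has_bochner_integral N (\<lambda>x. min 1 (s * x)) (s * cum_tail (1/s))"
proof (rule has_bochner_integral_nn_integral)
  show "AE x in N. 0 \<le> min 1 (s * x)" using AE_nonneg by eventually_elim (use s in auto)
qed (use s in \<open>auto simp: nn_integral_min cum_tail_nonneg\<close>)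

definition exponent :: "real \<Rightarrow> complex" where
  "exponent t = (CLINT x|N. iexp (t * x) - 1)"

lemma integrable_iexp_minus_1: "integrable N (\<lambda>x. iexp (t * x) - 1)"
proof (cases "t = 0")
  case False
  have "integrable N (\<lambda>x. 2 * min 1 (\<bar>t\<bar> * x))"
    using has_bochner_integral_min[of "\<bar>t\<bar>"] False by (intro integrable_mult_right) (auto simp: has_bochner_integral_iff)
  then show ?thesis
  proof (rule Bochner_Integration.integrable_bound)
    show "AE x in N. norm (iexp (t * x) - 1) \<le> norm (2 * min 1 (\<bar>t\<bar> * x))"
      using AE_nonneg
      by eventually_elim (rule order_trans[OF norm_iexp_minus_1_le_min], auto)
  qed measurable
qed simp

text \<open>A common factor of modulus 1 splits off, so the truncated mean at scale
  \<open>1 / \<bar>s\<bar>\<close> is a modulus of continuity that does not depend on t.\<close>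

lemma exponent_diff:
  assumes s: "s \<noteq> 0"
  shows "cmod (exponent (t + s) - exponent t) \<le> 2 * (\<bar>s\<bar> * cum_tail (1/\<bar>s\<bar>))"
proof -
  have "exponent (t + s) - exponent t = (CLINT x|N. iexp ((t + s) * x) - iexp (t * x))"
    unfolding exponent_def
    by (subst Bochner_Integration.integral_diff[symmetric, OF integrable_iexp_minus_1 integrable_iexp_minus_1]) simp
  also have "cmod \<dots> \<le> (LINT x|N. 2 * min 1 (\<bar>s\<bar> * x))"
  proof (rule order_trans[OF integral_norm_bound integral_mono_AE])
    show "integrable N (\<lambda>x. cmod (iexp ((t + s) * x) - iexp (t * x)))"
      by (rule integrable_norm)
        (use Bochner_Integration.integrable_diff[OF integrable_iexp_minus_1[of "t + s"] integrable_iexp_minus_1[of t]] in simp)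
    show "integrable N (\<lambda>x. 2 * min 1 (\<bar>s\<bar> * x))"
      using has_bochner_integral_min[of "\<bar>s\<bar>"] s by (intro integrable_mult_right) (auto simp: has_bochner_integral_iff)
    show "AE x in N. norm (iexp ((t + s) * x) - iexp (t * x)) \<le> 2 * min 1 (\<bar>s\<bar> * x)"
      using AE_nonneg
    proof eventually_elim
      case (elim x)
      have "iexp ((t + s) * x) - iexp (t * x) = iexp (t * x) * (iexp (s * x) - 1)"
        by (simp add: algebra_simps exp_add)
      then have "cmod (iexp ((t + s) * x) - iexp (t * x)) = cmod (iexp (s * x) - 1)"
        using norm_exp_i_times[of "t * x"] by (simp only: norm_mult mult_1)
      also have "\<dots> \<le> 2 * min 1 (\<bar>s\<bar> * x)" by (rule norm_iexp_minus_1_le_min[OF elim])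
      finally show ?case .
    qed
  qed
  also have "\<dots> = 2 * (\<bar>s\<bar> * cum_tail (1/\<bar>s\<bar>))"
    using has_bochner_integral_min[of "\<bar>s\<bar>"] s by (simp add: has_bochner_integral_iff)
  finally show ?thesis .
qed

lemma Re_exponent: "Re (exponent t) = - (LINT x|N. 1 - cos (t * x))"
proof -
  have "Re (exponent t) = (LINT x|N. Re (iexp (t * x) - 1))"
    unfolding exponent_def by (intro integral_Re[symmetric] integrable_iexp_minus_1)
  also have "\<dots> = (LINT x|N. - (1 - cos (t * x)))"
    by (intro Bochner_Integration.integral_cong) (auto simp: Re_exp)
  finally show ?thesis by (simp only: Bochner_Integration.integral_minus)
qed

lemma integrable_one_minus_cos: "integrable N (\<lambda>x. 1 - cos (t * x))"
  using integrable_Re[OF integrable_iexp_minus_1[of t], THEN Bochner_Integration.integrable_minus]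
  by (simp add: Re_exp)

text \<open>Only the mass between \<open>\<kappa> / \<bar>t\<bar>\<close> and
  \<open>1 / \<bar>t\<bar>\<close> is kept. There \<open>\<bar>t\<bar> * x\<close> lies between
  \<kappa> and 1, where the cosine is decreasing.\<close>

lemma exponent_Re_lower:
  assumes t: "t \<noteq> 0" and \<kappa>: "0 < \<kappa>" "\<kappa> < 1"
  shows "(1 - cos \<kappa>) * (T (\<kappa>/\<bar>t\<bar>) - T (1/\<bar>t\<bar>)) \<le> - Re (exponent t)"
proof -
  let ?I = "{\<kappa>/\<bar>t\<bar><..1/\<bar>t\<bar>}"
  have fin: "emeasure N {\<kappa>/\<bar>t\<bar><..} = ennreal (T (\<kappa>/\<bar>t\<bar>))" "emeasure N {1/\<bar>t\<bar><..} = ennreal (T (1/\<bar>t\<bar>))"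
    using t \<kappa> by (auto intro!: emeasure_tail)
  have le: "\<kappa>/\<bar>t\<bar> \<le> 1/\<bar>t\<bar>" using t \<kappa> by (intro divide_right_mono) auto
  have Idiff: "?I = {\<kappa>/\<bar>t\<bar><..} - {1/\<bar>t\<bar><..}" by auto
  have em: "emeasure N ?I = ennreal (T (\<kappa>/\<bar>t\<bar>) - T (1/\<bar>t\<bar>))"
    unfolding Idiff using fin le t by (subst emeasure_Diff) (auto simp: ennreal_minus T_nonneg)
  have "T (1/\<bar>t\<bar>) \<le> T (\<kappa>/\<bar>t\<bar>)"
    using emeasure_mono[of "{1/\<bar>t\<bar><..}" "{\<kappa>/\<bar>t\<bar><..}" N] fin le t \<kappa> by (auto simp: T_nonneg)
  then have me: "measure N ?I = T (\<kappa>/\<bar>t\<bar>) - T (1/\<bar>t\<bar>)" by (simp add: measure_def em)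
  have "(1 - cos \<kappa>) * (T (\<kappa>/\<bar>t\<bar>) - T (1/\<bar>t\<bar>)) = (LINT x|N. (1 - cos \<kappa>) * indicator ?I x)"
    by (simp add: me)
  also have "\<dots> \<le> (LINT x|N. 1 - cos (t * x))"
  proof (rule integral_mono)
    show "integrable N (\<lambda>x. (1 - cos \<kappa>) * indicator ?I x)"
      by (intro integrable_mult_right integrable_real_indicator) (auto simp: em)
    fix x
    show "(1 - cos \<kappa>) * indicator ?I x \<le> 1 - cos (t * x)"
    proof (cases "x \<in> ?I")
      case True
      then have x: "\<kappa> < \<bar>t\<bar> * x" "\<bar>t\<bar> * x \<le> 1" using t by (auto simp: field_simps)
      then have "cos (\<bar>t\<bar> * x) \<le> cos \<kappa>" using \<kappa> pi_gt3 by (intro cos_monotone_0_pi_le) auto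
      moreover have "cos (\<bar>t\<bar> * x) = cos (t * x)" by (cases "0 \<le> t") auto
      ultimately show ?thesis using True by simp
    qed simp
  qed (rule integrable_one_minus_cos)
  finally show ?thesis by (simp add: Re_exponent)
qed

text \<open>Integration by parts in the form of Fubini: it expresses the exponent through the tail
  function alone, so that convergence or scaling of tails passes to exponents. The full integral
  over u need not converge absolutely, hence the cut at R, which affects only the mass beyond
  R.\<close>

lemma exponent_truncate:
  assumes R: "0 < R"
  shows "cmod (exponent t - (CLBINT u. indicator {0<..R} u *\<^sub>R (\<i> * t * iexp (t * u) * T u))) \<le> 2 * T R"
proof -
  define h where "h = (\<lambda>(u, x). indicator {0<..R} u *\<^sub>R (indicator {(u, x). u < x} (u, x) *\<^sub>R (\<i> * t * iexp (t * u))))"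
  have hm [measurable]: "h \<in> borel_measurable (lborel \<Otimes>\<^sub>M N)" unfolding h_def by measurable
  have inner: "(\<integral>x. indicator {(u, x). u < x} (u, x) *\<^sub>R z \<partial>N) = T u *\<^sub>R z" if "0 < u" for u and z :: "'b :: {banach, second_countable_topology}"
  proof -
    have "(\<integral>x. indicator {(u, x). u < x} (u, x) *\<^sub>R z \<partial>N) = (\<integral>x. indicator {u<..} x *\<^sub>R z \<partial>N)"
      by (intro Bochner_Integration.integral_cong) (auto simp: indicator_def)
    also have "\<dots> = measure N {u<..} *\<^sub>R z"
      by (subst integral_scaleR_left) (auto simp: emeasure_tail that)
    finally show ?thesis using that by (simp add: measure_def emeasure_tail T_nonneg)
  qed
  have int_h: "integrable (lborel \<Otimes>\<^sub>M N) h"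
  proof (rule lborel_N.Fubini_integrable[OF hm])
    have "(\<integral>x. norm (h (u, x)) \<partial>N) = \<bar>t\<bar> * (indicator {0<..R} u * T u)" for u
    proof (cases "0 < u")
      case True
      have "(\<integral>x. norm (h (u, x)) \<partial>N) = (\<integral>x. indicator {(u, x). u < x} (u, x) *\<^sub>R (indicator {0<..R} u * \<bar>t\<bar>) \<partial>N)"
        by (intro Bochner_Integration.integral_cong) (auto simp: h_def norm_mult indicator_def)
      then show ?thesis using inner[OF True, of "indicator {0<..R} u * \<bar>t\<bar>"] by simp
    qed (simp add: h_def)
    then show "integrable lborel (\<lambda>u. \<integral>x. norm (h (u, x)) \<partial>N)"
      using T_integrable[OF R] by simp
    show "AE u in lborel. integrable N (\<lambda>x. h (u, x))"
    proof (rule AE_I2)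
      fix u
      show "integrable N (\<lambda>x. h (u, x))"
      proof (cases "0 < u")
        case True
        have "(\<lambda>x. h (u, x)) = (\<lambda>x. indicator {u<..} x *\<^sub>R (indicator {0<..R} u *\<^sub>R (\<i> * t * iexp (t * u))))"
          by (auto simp: h_def indicator_def)
        then show ?thesis using True by (auto simp: emeasure_tail)
      qed (simp add: h_def)
    qed
  qed
  \<comment> \<open>For \<open>x \<le> R\<close> this is the integrand of \<open>exponent\<close>
    itself; beyond R it is frozen at its value at R, and there the two differ by at most 2.\<close>
  have inner_u: "(CLBINT u. h (u, x)) = iexp (t * min x R) - 1" if "0 \<le> x" for x
  proof -
    have "(CLBINT u. h (u, x)) = (CLBINT u. indicator {0..min x R} u *\<^sub>R (\<i> * t * iexp (t * u)))"
    proof (rule integral_cong_AE)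
      have "(\<lambda>u. h (u, x)) = (\<lambda>u. indicator {0<..R} u *\<^sub>R (indicator {..<x} u *\<^sub>R (\<i> * t * iexp (t * u))))"
        by (auto simp: h_def indicator_def)
      moreover have "(\<lambda>u. indicator {0<..R} u *\<^sub>R (indicator {..<x} u *\<^sub>R (\<i> * t * iexp (t * u)))) \<in> borel_measurable borel"
        by measurable
      ultimately have "(\<lambda>u. h (u, x)) \<in> borel_measurable borel" by metis
      then show "(\<lambda>u. h (u, x)) \<in> borel_measurable lborel" by simp
      show "AE u in lborel. h (u, x) = indicator {0..min x R} u *\<^sub>R (\<i> * t * iexp (t * u))"
        using AE_lborel_singleton[of 0] AE_lborel_singleton[of x]
        by eventually_elim (auto simp: h_def indicator_def)
    qed measurable
    also have "\<dots> = iexp (t * min x R) - iexp (t * 0)"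
    proof (rule integral_FTC_Icc)
      fix u
      have "((\<lambda>u. exp (\<i> * t * u)) has_field_derivative \<i> * t * exp (\<i> * t * of_real u)) (at (of_real u))"
        by (auto intro!: derivative_eq_intros)
      then have "((\<lambda>u. exp (\<i> * t * of_real u)) has_vector_derivative \<i> * t * exp (\<i> * t * of_real u)) (at u within {0..min x R})"
        by (rule has_vector_derivative_real_field[THEN has_vector_derivative_at_within])
      then show "((\<lambda>u. iexp (t * u)) has_vector_derivative \<i> * t * iexp (t * u)) (at u within {0..min x R})"
        by (simp add: mult.assoc)
    qed (use that R in \<open>auto intro!: continuous_intros\<close>)
    finally show ?thesis by simp
  qed
  have fub: "(CLBINT u. indicator {0<..R} u *\<^sub>R (\<i> * t * iexp (t * u) * T u)) = (CLINT x|N. (CLBINT u. h (u, x)))"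
  proof -
    have "(CLBINT u. indicator {0<..R} u *\<^sub>R (\<i> * t * iexp (t * u) * T u)) = (CLBINT u. (CLINT x|N. h (u, x)))"
    proof (intro Bochner_Integration.integral_cong refl)
      fix u
      show "indicator {0<..R} u *\<^sub>R (\<i> * t * iexp (t * u) * T u) = (CLINT x|N. h (u, x))"
      proof (cases "0 < u")
        case True
        have "(CLINT x|N. h (u, x)) = indicator {0<..R} u *\<^sub>R (CLINT x|N. indicator {(u, x). u < x} (u, x) *\<^sub>R (\<i> * t * iexp (t * u)))"
          by (simp only: h_def prod.case integral_scaleR_right)
        then show ?thesis using inner[OF True, of "\<i> * t * iexp (t * u)"] by (auto simp add: scaleR_conv_of_real mult_ac)
      qed (simp add: h_def)
    qed
    also have "\<dots> = (CLINT x|N. (CLBINT u. h (u, x)))"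
      using lborel_N.Fubini_integral[of "\<lambda>u x. h (u, x)"] int_h by simp
    finally show ?thesis .
  qed
  have int_inner: "integrable N (\<lambda>x. CLBINT u. h (u, x))"
    using lborel_N.integrable_snd[of "\<lambda>u x. h (u, x)"] int_h by simp
  have "exponent t - (CLINT x|N. (CLBINT u. h (u, x))) = (CLINT x|N. iexp (t * x) - 1 - (CLBINT u. h (u, x)))"
    unfolding exponent_def
    by (rule Bochner_Integration.integral_diff[symmetric, OF integrable_iexp_minus_1 int_inner])
  also have "cmod \<dots> \<le> (LINT x|N. 2 * indicator {R<..} x)"
  proof (rule order_trans[OF integral_norm_bound integral_mono_AE])
    show "integrable N (\<lambda>x. cmod (iexp (t * x) - 1 - (CLBINT u. h (u, x))))"
      by (rule integrable_norm[OF Bochner_Integration.integrable_diff[OF integrable_iexp_minus_1 int_inner]])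
    show "integrable N (\<lambda>x. 2 * indicator {R<..} x :: real)"
      using R by (intro integrable_mult_right integrable_real_indicator) (auto simp: emeasure_tail)
    show "AE x in N. norm (iexp (t * x) - 1 - (CLBINT u. h (u, x))) \<le> 2 * indicator {R<..} x"
      using AE_nonneg
    proof eventually_elim
      case (elim x)
      have "cmod (iexp (t * x) - iexp (t * R)) \<le> 2"
        using norm_triangle_ineq4[of "iexp (t * x)" "iexp (t * R)"] norm_exp_i_times[of "t * x"] norm_exp_i_times[of "t * R"] by simp
      then show ?case by (cases "x \<le> R") (simp_all add: inner_u[OF elim] min_def indicator_def)
    qed
  qed
  also have "\<dots> = 2 * T R" using R by (simp add: measure_def emeasure_tail T_nonneg)
  finally show ?thesis unfolding fub .
qed

end

section \<open>The renewal measure of a transient law\<close>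

lemma real_distribution_convolution:
  assumes "real_distribution M" "real_distribution N" shows "real_distribution (convolution M N)"
proof -
  interpret M: real_distribution M by fact
  interpret N: real_distribution N by fact
  interpret pair_prob_space M N ..
  show ?thesis
    unfolding convolution_def real_distribution_def real_distribution_axioms_def
    by (intro conjI prob_space_distr) auto
qed

lemma char_convolution:
  assumes "real_distribution M" "real_distribution N"
  shows "char (convolution M N) t = char M t * char N t"
proof -
  interpret M: real_distribution M by fact
  interpret N: real_distribution N by fact
  interpret pair_prob_space M N ..
  have "integrable (M \<Otimes>\<^sub>M N) (\<lambda>(x, y). iexp (t * x) * iexp (t * y))"
    by (rule integrable_const_bound[where B = 1]) (auto simp: norm_mult)
  from integral_fst'[OF this]
  have "(CLINT z|M \<Otimes>\<^sub>M N. case z of (x, y) \<Rightarrow> iexp (t * x) * iexp (t * y)) = (CLINT x|M. iexp (t * x) * char N t)"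
    by (simp add: char_def)
  then show ?thesis
    unfolding char_def convolution_def
    by (subst integral_distr) (auto simp: case_prod_beta' algebra_simps exp_add)
qed

lemma real_distribution_conv_power:
  "real_distribution M \<Longrightarrow> real_distribution (conv_power M n)"
proof (induction n)
  case 0
  show ?case
    by (auto simp: real_distribution_def real_distribution_axioms_def intro: prob_space_return)
next
  case (Suc n)
  then show ?case by (simp add: real_distribution_convolution)
qed

lemma char_conv_power:
  assumes "real_distribution M" shows "char (conv_power M n) t = char M t ^ n"
proof (induction n)
  case 0
  show ?case by (simp add: char_def integral_return)
next
  case (Suc n)
  then show ?case
    by (simp add: char_convolution[OF assms real_distribution_conv_power[OF assms]])
qed

lemma AE_nonneg_conv_power:
  assumes M: "real_distribution M" and nonneg: "AE x in M. 0 \<le> x"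
  shows "AE x in conv_power M n. 0 \<le> x"
proof (induction n)
  case 0
  show ?case unfolding conv_power.simps by (subst AE_return) auto
next
  case (Suc n)
  interpret M: real_distribution M by fact
  interpret N: real_distribution "conv_power M n" by (rule real_distribution_conv_power[OF M])
  interpret pair_prob_space M "conv_power M n" ..
  have "AE x in M. AE y in conv_power M n. 0 \<le> x + y"
    using nonneg by eventually_elim (use Suc in eventually_elim, auto)
  then have "AE z in M \<Otimes>\<^sub>M conv_power M n. 0 \<le> (case z of (x, y) \<Rightarrow> x + y)"
    using predE[where M = "M \<Otimes>\<^sub>M conv_power M n" and P = "\<lambda>z. 0 \<le> (case z of (x, y) \<Rightarrow> x + y)"]
    by (intro AE_pair_measure) simp_all
  then show ?case
    unfolding conv_power.simps convolution_def by (subst AE_distr_iff) auto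
qed

text \<open>The sum of all convolution powers: binding the counting measure to a sequence of
  measures adds them up.\<close>

definition renewal_measure :: "real measure \<Rightarrow> real measure" where
  "renewal_measure M = count_space UNIV \<bind> conv_power M"

context real_distribution
begin

lemma conv_power_measurable: "conv_power M \<in> count_space UNIV \<rightarrow>\<^sub>M subprob_algebra borel"
proof -
  have "conv_power M n \<in> space (subprob_algebra borel)" for n
  proof -
    interpret N: real_distribution "conv_power M n"
      by (rule real_distribution_conv_power) unfold_locales
    show ?thesis by (simp add: space_subprob_algebra N.subprob_space_axioms)
  qed
  then show ?thesis by simp
qed

lemma sets_renewal_measure [measurable_cong, simp]: "sets (renewal_measure M) = sets borel"
  unfolding renewal_measure_def by (rule sets_bind[OF sets_kernel[OF conv_power_measurable]]) auto

lemma space_renewal_measure [simp]: "space (renewal_measure M) = UNIV"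
  using sets_eq_imp_space_eq[OF sets_renewal_measure] by simp

lemma nn_integral_renewal_measure:
  assumes "f \<in> borel_measurable borel"
  shows "(\<integral>\<^sup>+x. f x \<partial>renewal_measure M) = (\<Sum>n. \<integral>\<^sup>+x. f x \<partial>conv_power M n)"
  unfolding renewal_measure_def
  by (subst nn_integral_bind[OF assms conv_power_measurable]) (simp add: nn_integral_count_space_nat)

end

text \<open>Formally, \<open>1 / (1 - char M)\<close> is the Fourier transform of the renewal measure.\<close>
locale transient_law = real_distribution M for M +
  assumes nonneg: "AE x in M. 0 \<le> x"
    and char_ne_1: "\<And>t. t \<noteq> 0 \<Longrightarrow> char M t \<noteq> 1"
    and integrable_inverse: "\<And>R. integrable lborel (\<lambda>t. indicator {-R..R} t / cmod (1 - char M t))"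
begin

text \<open>The Abel denominators stay above half the limiting one, uniformly in r, because
  \<open>1 - r\<close> is itself at most \<open>cmod (1 - r * char M t)\<close>. This supplies the
  majorant for letting r tend to 1.\<close>

lemma norm_one_minus_le:
  fixes r :: real
  assumes "0 \<le> r" "r \<le> 1" shows "cmod (1 - char M t) \<le> 2 * cmod (1 - r * char M t)"
proof -
  have 1: "cmod (of_real r * char M t) \<le> r"
    using cmod_char_le_1[of t] assms mult_left_mono[of "cmod (char M t)" 1 r] by (simp add: norm_mult)
  have "1 - char M t = (1 - r * char M t) - of_real (1 - r) * char M t" by (simp add: algebra_simps)
  then have "cmod (1 - char M t) \<le> cmod (1 - r * char M t) + cmod (of_real (1 - r) * char M t)"
    by (metis norm_triangle_ineq4)
  also have "cmod (of_real (1 - r) * char M t) \<le> 1 - r"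
    using cmod_char_le_1[of t] assms mult_left_mono[of "cmod (char M t)" 1 "1 - r"]
    unfolding norm_mult norm_of_real by simp
  also have "1 - r \<le> cmod (1 - r * char M t)"
    using norm_triangle_ineq2[of 1 "r * char M t"] 1 by simp
  finally show ?thesis by simp
qed

text \<open>Abel summation: the geometric weights \<open>r ^ n\<close> make the Fourier transform of the renewal
  measure an honest function, and nonnegativity of \<open>f\<close> lets \<open>r\<close> tend to \<open>1\<close>.\<close>
lemma sums_conv_power_fourier:
  fixes \<sigma> :: "real \<Rightarrow> complex" and f :: "real \<Rightarrow> real"
  assumes int: "integrable lborel \<sigma>" and bdd: "\<And>t. cmod (\<sigma> t) \<le> C" and supp: "\<And>t. R < \<bar>t\<bar> \<Longrightarrow> \<sigma> t = 0"
    and f: "\<And>x. complex_of_real (f x) = fourier \<sigma> x" and f_nonneg: "\<And>x. 0 \<le> f x"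
  shows "(\<lambda>n. \<integral>x. f (x - y) \<partial>conv_power M n) sums Re (CLBINT t. iexp (- (t * y)) * \<sigma> t / (1 - char M t))"
      (is "?a sums Re ?S")
    and Im_renewal_fourier: "Im (CLBINT t. iexp (- (t * y)) * \<sigma> t / (1 - char M t)) = 0"
proof -
  have M: "real_distribution M" by unfold_locales
  have [measurable]: "\<sigma> \<in> borel_measurable borel" using int by (simp add: borel_measurable_integrable)
  have a_eq: "complex_of_real (?a n) = (CLBINT t. iexp (- (t * y)) * \<sigma> t * char M t ^ n)" for n
  proof -
    interpret N: real_distribution "conv_power M n" by (rule real_distribution_conv_power[OF M])
    interpret P: pair_sigma_finite lborel "conv_power M n" ..
    have "complex_of_real (?a n) = (CLINT x|conv_power M n. (CLBINT t. iexp (t * (x - y)) * \<sigma> t))"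
      by (simp add: integral_complex_of_real[symmetric] f fourier_def del: of_real_mult)
    also have "\<dots> = (CLBINT t. (CLINT x|conv_power M n. iexp (t * (x - y)) * \<sigma> t))"
    proof (rule P.Fubini_integral)
      show "integrable (lborel \<Otimes>\<^sub>M conv_power M n) (\<lambda>(t, x). iexp (t * (x - y)) * \<sigma> t)"
      proof (rule P.Fubini_integrable)
        have "(\<integral>x. norm (case (t, x) of (t, x) \<Rightarrow> iexp (t * (x - y)) * \<sigma> t) \<partial>conv_power M n) = cmod (\<sigma> t)" for t
          using N.prob_space by (simp add: norm_mult)
        then show "integrable lborel (\<lambda>t. \<integral>x. norm (case (t, x) of (t, x) \<Rightarrow> iexp (t * (x - y)) * \<sigma> t) \<partial>conv_power M n)"
          using int by simp
        show "AE t in lborel. integrable (conv_power M n) (\<lambda>x. case (t, x) of (t, x) \<Rightarrow> iexp (t * (x - y)) * \<sigma> t)"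
          by (auto intro!: AE_I2 N.integrable_const_bound[where B = "cmod (\<sigma> _)"] simp: norm_mult)
      qed measurable
    qed
    also have "\<dots> = (CLBINT t. iexp (- (t * y)) * \<sigma> t * char M t ^ n)"
    proof (intro Bochner_Integration.integral_cong refl)
      fix t
      have "(CLINT x|conv_power M n. iexp (t * (x - y)) * \<sigma> t) = (CLINT x|conv_power M n. (iexp (- (t * y)) * \<sigma> t) * iexp (t * x))"
        by (intro Bochner_Integration.integral_cong) (auto simp: algebra_simps exp_diff exp_minus field_simps)
      also have "\<dots> = (iexp (- (t * y)) * \<sigma> t) * char (conv_power M n) t"
        unfolding char_def by (rule integral_mult_right_zero)
      finally show "(CLINT x|conv_power M n. iexp (t * (x - y)) * \<sigma> t) = iexp (- (t * y)) * \<sigma> t * char M t ^ n"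
        by (simp only: char_conv_power[OF M])
    qed
    finally show ?thesis .
  qed
  define s where "s r = (CLBINT t. iexp (- (t * y)) * \<sigma> t / (1 - of_real r * char M t))" for r :: real
  have s_sums: "(\<lambda>n. complex_of_real (r ^ n * ?a n)) sums s r" if r: "0 \<le> r" "r < 1" for r
  proof -
    have nrm: "cmod (of_real r * char M t) \<le> r" for t
      using cmod_char_le_1[of t] r mult_left_mono[of "cmod (char M t)" 1 r] by (simp add: norm_mult)
    define F where "F n t = iexp (- (t * y)) * \<sigma> t * (of_real r * char M t) ^ n" for n t
    have nF: "cmod (F n t) \<le> r ^ n * cmod (\<sigma> t)" for n t
    proof -
      have "cmod (F n t) = cmod (\<sigma> t) * cmod (of_real r * char M t) ^ n" by (simp add: F_def norm_mult norm_power)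
      also have "\<dots> \<le> cmod (\<sigma> t) * r ^ n" using nrm by (intro mult_left_mono power_mono) auto
      finally show ?thesis by (simp add: mult.commute)
    qed
    have Fm [measurable]: "F n \<in> borel_measurable borel" for n unfolding F_def by measurable
    have Fint: "integrable lborel (F n)" for n
      by (rule Bochner_Integration.integrable_bound[of _ "\<lambda>t. r ^ n * cmod (\<sigma> t)"]) (use int nF r in auto)
    have "(\<lambda>n. CLBINT t. F n t) sums (CLBINT t. (\<Sum>n. F n t))"
    proof (rule sums_integral)
      show "AE t in lborel. summable (\<lambda>n. norm (F n t))"
      proof (rule AE_I2)
        fix t show "summable (\<lambda>n. norm (F n t))"
          by (rule summable_comparison_test'[of "\<lambda>n. r ^ n * cmod (\<sigma> t)" 0])
            (use r nF in \<open>auto intro!: summable_mult2 summable_geometric\<close>)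
      qed
      show "summable (\<lambda>n. \<integral>t. norm (F n t) \<partial>lborel)"
      proof (rule summable_comparison_test'[of "\<lambda>n. r ^ n * (\<integral>t. cmod (\<sigma> t) \<partial>lborel)" 0])
        fix n
        have "(\<integral>t. norm (F n t) \<partial>lborel) \<le> (\<integral>t. r ^ n * cmod (\<sigma> t) \<partial>lborel)"
          using Fint int nF by (intro integral_mono) auto
        then show "norm (\<integral>t. norm (F n t) \<partial>lborel) \<le> r ^ n * (\<integral>t. cmod (\<sigma> t) \<partial>lborel)"
          by simp
      qed (use r in \<open>auto intro!: summable_mult2 summable_geometric\<close>)
    qed (rule Fint)
    moreover have "(CLBINT t. F n t) = complex_of_real (r ^ n * ?a n)" for n
    proof -
      have "(CLBINT t. F n t) = (CLBINT t. of_real (r ^ n) * (iexp (- (t * y)) * \<sigma> t * char M t ^ n))"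
        by (intro Bochner_Integration.integral_cong) (auto simp: F_def power_mult_distrib)
      also have "\<dots> = of_real (r ^ n) * complex_of_real (?a n)"
        unfolding a_eq by (rule integral_mult_right_zero)
      finally show ?thesis by simp
    qed
    moreover have "(\<Sum>n. F n t) = iexp (- (t * y)) * \<sigma> t / (1 - of_real r * char M t)" for t
    proof -
      have "cmod (of_real r * char M t) < 1" using nrm[of t] r by linarith
      then have "(\<lambda>n. (of_real r * char M t) ^ n) sums (1 / (1 - of_real r * char M t))"
        by (rule geometric_sums)
      then have "F_sum sums (iexp (- (t * y)) * \<sigma> t * (1 / (1 - of_real r * char M t)))"
        if "F_sum = (\<lambda>n. F n t)" for F_sum
        unfolding that F_def by (rule sums_mult)
      then show ?thesis by (simp add: sums_iff)
    qed
    ultimately show ?thesis by (simp add: s_def)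
  qed
  define r where "r m = 1 - 1 / (real m + 2)" for m :: nat
  have r: "0 \<le> r m" "r m < 1" for m by (auto simp: r_def)
  have r_lim: "r \<longlonglongrightarrow> 1"
  proof -
    have "(\<lambda>m. 1 - inverse (real (m + 1 + 1))) \<longlonglongrightarrow> 1 - 0"
      by (intro tendsto_diff tendsto_const LIMSEQ_ignore_initial_segment[OF LIMSEQ_inverse_real_of_nat_add[of 0], simplified])
        (use LIMSEQ_ignore_initial_segment[OF LIMSEQ_inverse_real_of_nat, of 1] in \<open>simp add: algebra_simps\<close>)
    then show ?thesis by (simp add: r_def[abs_def] inverse_eq_divide algebra_simps)
  qed
  have s_lim: "(\<lambda>m. s (r m)) \<longlonglongrightarrow> ?S"
    unfolding s_def
  proof (rule integral_dominated_convergence[where w = "\<lambda>t. 2 * C * (indicator {-R..R} t / cmod (1 - char M t))"])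
    show "integrable lborel (\<lambda>t. 2 * C * (indicator {-R..R} t / cmod (1 - char M t)))"
      by (intro integrable_mult_right integrable_inverse)
    show "AE t in lborel. (\<lambda>m. iexp (- (t * y)) * \<sigma> t / (1 - of_real (r m) * char M t)) \<longlonglongrightarrow> iexp (- (t * y)) * \<sigma> t / (1 - char M t)"
      using AE_lborel_singleton[of 0]
    proof eventually_elim
      case (elim t)
      have "(\<lambda>m. iexp (- (t * y)) * \<sigma> t / (1 - of_real (r m) * char M t)) \<longlonglongrightarrow> iexp (- (t * y)) * \<sigma> t / (1 - of_real 1 * char M t)"
        using char_ne_1[OF elim] by (intro tendsto_intros r_lim) auto
      then show ?case by simp
    qed
    fix m
    show "AE t in lborel. norm (iexp (- (t * y)) * \<sigma> t / (1 - of_real (r m) * char M t))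
        \<le> 2 * C * (indicator {-R..R} t / cmod (1 - char M t))"
      using AE_lborel_singleton[of 0]
    proof eventually_elim
      case (elim t)
      show ?case
      proof (cases "\<bar>t\<bar> \<le> R")
        case True
        have pos: "0 < cmod (1 - char M t)" using char_ne_1[OF elim] by auto
        have le: "cmod (1 - char M t) \<le> 2 * cmod (1 - of_real (r m) * char M t)"
          using r[of m] by (intro norm_one_minus_le) auto
        have C0: "0 \<le> C" using bdd[of 0] norm_ge_zero order_trans by blast
        have "norm (iexp (- (t * y)) * \<sigma> t / (1 - of_real (r m) * char M t)) = cmod (\<sigma> t) / cmod (1 - of_real (r m) * char M t)"
          by (simp add: norm_mult norm_divide)
        also have "\<dots> \<le> C / (cmod (1 - char M t) / 2)"
          using bdd[of t] pos le C0 by (intro frac_le) auto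
        finally show ?thesis using True by (simp add: indicator_def abs_le_iff mult.commute)
      next
        case False
        have "0 \<le> C" using bdd[of 0] norm_ge_zero order_trans by blast
        then show ?thesis using False supp[of t] by simp
      qed
    qed
  qed measurable
  then have sr_lim: "(\<lambda>m. Re (s (r m))) \<longlonglongrightarrow> Re ?S" by (rule tendsto_Re)
  have sr_sums: "(\<lambda>n. r m ^ n * ?a n) sums Re (s (r m))" for m
    using sums_Re[OF s_sums[OF r, of m]] by simp
  have a_nonneg: "0 \<le> ?a n" for n by (intro integral_nonneg_AE AE_I2 f_nonneg)
  \<comment> \<open>For fixed N the weights tend to 1, and the rest of each Abel sum may be dropped
    because its terms are nonnegative.\<close>
  have part: "(\<Sum>n<N. ?a n) \<le> Re ?S" for N
  proof (rule LIMSEQ_le)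
    have "(\<lambda>m. \<Sum>n<N. r m ^ n * ?a n) \<longlonglongrightarrow> (\<Sum>n<N. 1 ^ n * ?a n)"
      by (intro tendsto_intros r_lim)
    then show "(\<lambda>m. \<Sum>n<N. r m ^ n * ?a n) \<longlonglongrightarrow> (\<Sum>n<N. ?a n)" by simp
    show "\<exists>K. \<forall>m\<ge>K. (\<Sum>n<N. r m ^ n * ?a n) \<le> Re (s (r m))"
    proof (intro exI[of _ 0] allI impI)
      fix m
      have "(\<Sum>n<N. r m ^ n * ?a n) \<le> (\<Sum>n. r m ^ n * ?a n)"
        using sr_sums[of m] a_nonneg r by (intro sum_le_suminf) (auto simp: sums_iff)
      then show "(\<Sum>n<N. r m ^ n * ?a n) \<le> Re (s (r m))" using sr_sums[of m] by (simp add: sums_iff)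
    qed
  qed (rule sr_lim)
  have summ: "summable ?a"
    by (rule bounded_imp_summable[OF a_nonneg, where B = "Re ?S"])
      (use part[of "Suc _"] in \<open>simp add: lessThan_Suc_atMost\<close>)
  have "suminf ?a \<le> Re ?S"
    by (rule suminf_le_const[OF summ part])
  moreover have "Re ?S \<le> suminf ?a"
  proof (rule tendsto_upperbound[OF sr_lim])
    show "\<forall>\<^sub>F m in sequentially. Re (s (r m)) \<le> suminf ?a"
    proof (intro always_eventually allI)
      fix m
      have "(\<Sum>n. r m ^ n * ?a n) \<le> suminf ?a"
        using summ sr_sums[of m] r[of m] a_nonneg
        by (intro suminf_le) (auto simp: sums_iff power_le_one intro!: mult_left_le_one_le)
      then show "Re (s (r m)) \<le> suminf ?a" using sr_sums[of m] by (simp add: sums_iff)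
    qed
  qed simp
  ultimately show "?a sums Re ?S" using summ by (simp add: sums_iff)
  \<comment> \<open>Every Abel sum is a series of reals, so the limiting integral is real as
    well.\<close>
  have "Im (s (r m)) = 0" for m
    using sums_Im[OF s_sums[OF r, of m]] by (simp add: sums_iff)
  then show "Im ?S = 0" using tendsto_Im[OF s_lim] by (simp add: LIMSEQ_const_iff)
qed

lemma has_bochner_integral_renewal_fourier:
  fixes \<sigma> :: "real \<Rightarrow> complex" and f :: "real \<Rightarrow> real"
  assumes int: "integrable lborel \<sigma>" and bdd: "\<And>t. cmod (\<sigma> t) \<le> C" and supp: "\<And>t. R < \<bar>t\<bar> \<Longrightarrow> \<sigma> t = 0"
    and f: "\<And>x. complex_of_real (f x) = fourier \<sigma> x" and f_nonneg: "\<And>x. 0 \<le> f x"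
  shows "has_bochner_integral (renewal_measure M) (\<lambda>x. f (x - y)) (Re (CLBINT t. iexp (- (t * y)) * \<sigma> t / (1 - char M t)))"
    (is "has_bochner_integral _ _ (Re ?S)")
proof -
  have f_eq: "f = (\<lambda>x. Re (fourier \<sigma> x))" using f by (metis Re_complex_of_real)
  have "continuous_on UNIV f"
    unfolding f_eq using isCont_fourier[OF int]
    by (auto intro!: continuous_at_imp_continuous_on bounded_linear.isCont[OF bounded_linear_Re])
  then have [measurable]: "f \<in> borel_measurable borel" by (rule borel_measurable_continuous_onI)
  have f_le: "f x \<le> (LBINT t. cmod (\<sigma> t))" for x
    using norm_fourier_le[of \<sigma> x] f[of x] by (metis abs_le_D1 norm_of_real)
  note sums = sums_conv_power_fourier(1)[OF int bdd supp f f_nonneg, of R y]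
  have "(\<integral>\<^sup>+x. ennreal (f (x - y)) \<partial>renewal_measure M) = (\<Sum>n. \<integral>\<^sup>+x. ennreal (f (x - y)) \<partial>conv_power M n)"
    by (rule nn_integral_renewal_measure) measurable
  also have "\<dots> = (\<Sum>n. ennreal (\<integral>x. f (x - y) \<partial>conv_power M n))"
  proof (intro suminf_cong nn_integral_eq_integral)
    fix n
    interpret N: real_distribution "conv_power M n" by (rule real_distribution_conv_power) unfold_locales
    show "integrable (conv_power M n) (\<lambda>x. f (x - y))"
      by (rule N.integrable_const_bound[where B = "LBINT t. cmod (\<sigma> t)"]) (use f_le f_nonneg in auto)
  qed (use f_nonneg in auto)
  also have "\<dots> = ennreal (Re ?S)"
    using sums by (subst suminf_ennreal2) (auto simp: sums_iff f_nonneg intro!: integral_nonneg_AE)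
  finally have nn: "(\<integral>\<^sup>+x. ennreal (f (x - y)) \<partial>renewal_measure M) = ennreal (Re ?S)" .
  have "0 \<le> Re ?S"
    using suminf_nonneg[OF sums_summable[OF sums]] sums_unique[OF sums] f_nonneg by simp
  with nn show ?thesis
    by (intro has_bochner_integral_nn_integral) (auto simp: f_nonneg)
qed

lemma integrable_renewal_fejer:
  assumes a: "0 < a" shows "integrable (renewal_measure M) (\<lambda>x. fejer a (x - y))"
proof -
  have "has_bochner_integral (renewal_measure M) (\<lambda>x. fejer a (x - y))
      (Re (CLBINT t. iexp (- (t * y)) * of_real (tent a t) / (1 - char M t)))"
    using a integrable_tent[OF a] tent_nonneg tent_le_1[OF a] tent_outside[OF a] fejer_nonneg[OF a]
    by (intro has_bochner_integral_renewal_fourier[where C = 1 and R = a]) (auto simp: fourier_tent)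
  then show ?thesis by (simp add: has_bochner_integral_iff)
qed

lemma emeasure_renewal_neg: "emeasure (renewal_measure M) {..<0} = 0"
proof -
  have M: "real_distribution M" by unfold_locales
  have "emeasure (conv_power M n) {..<0} = 0" for n
  proof -
    interpret N: real_distribution "conv_power M n" by (rule real_distribution_conv_power[OF M])
    have "AE x in conv_power M n. x \<notin> {..<0}" using AE_nonneg_conv_power[OF M nonneg] by eventually_elim auto
    then show ?thesis by (subst (asm) AE_iff_null_sets[symmetric]) auto
  qed
  moreover have "sets (conv_power M n) = sets borel" for n by (cases n) simp_all
  ultimately show ?thesis
    using nn_integral_renewal_measure[of "indicator {..<0}"] by simp
qed

text \<open>Local finiteness comes from the Fejer kernel: it is integrable against the renewal
  measure and bounded below on a compact interval.\<close>

lemma emeasure_renewal_Icc: "emeasure (renewal_measure M) {-r..r} < \<infinity>"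
proof -
  \<comment> \<open>The kernel is positive on the interval of radius \<open>1 / a\<close>;
    \<open>max 1\<close> makes this radius positive and at least r.\<close>
  define a where "a = 1 / max 1 r"
  have a: "0 < a" "r \<le> 1 / a" by (auto simp: a_def)
  obtain \<kappa> where \<kappa>: "0 < \<kappa>" "\<And>x. x \<in> {-(1/a)..1/a} \<Longrightarrow> \<kappa> \<le> fejer a x"
  proof -
    have "\<exists>x\<in>{-(1/a)..1/a}. \<forall>z\<in>{-(1/a)..1/a}. fejer a x \<le> fejer a z"
      using a by (intro continuous_attains_inf continuous_at_imp_continuous_on ballI isCont_fejer) auto
    then obtain x where x: "x \<in> {-(1/a)..1/a}" "\<And>z. z \<in> {-(1/a)..1/a} \<Longrightarrow> fejer a x \<le> fejer a z" by blast
    have "0 < fejer a x" using x(1) by (intro fejer_pos a(1)) auto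
    then show ?thesis using x(2) by (rule that)
  qed
  have "emeasure (renewal_measure M) {-r..r} = (\<integral>\<^sup>+x. indicator {-r..r} x \<partial>renewal_measure M)" by simp
  also have "\<dots> \<le> (\<integral>\<^sup>+x. ennreal (fejer a (x - 0) / \<kappa>) \<partial>renewal_measure M)"
  proof (intro nn_integral_mono)
    fix x
    show "indicator {-r..r} x \<le> ennreal (fejer a (x - 0) / \<kappa>)"
    proof (cases "x \<in> {-r..r}")
      case True
      then have "\<kappa> \<le> fejer a x" using a by (intro \<kappa>(2)) auto
      then have "1 \<le> fejer a x / \<kappa>" using \<kappa>(1) by simp
      then show ?thesis using True by (simp add: ennreal_1[symmetric] ennreal_leI del: ennreal_1)
    qed simp
  qed
  also have "\<dots> = ennreal (\<integral>x. fejer a (x - 0) / \<kappa> \<partial>renewal_measure M)"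
    using \<kappa>(1) fejer_nonneg[OF a(1)] integrable_renewal_fejer[OF a(1), of 0]
    by (intro nn_integral_eq_integral) auto
  also have "\<dots> < \<infinity>" by simp
  finally show ?thesis .
qed

lemma emeasure_renewal_atMost: "emeasure (renewal_measure M) {..y} < \<infinity>"
proof -
  have "emeasure (renewal_measure M) {..y} \<le> emeasure (renewal_measure M) ({..<0} \<union> {-\<bar>y\<bar>..\<bar>y\<bar>})"
    by (intro emeasure_mono) auto
  also have "\<dots> \<le> emeasure (renewal_measure M) {..<0} + emeasure (renewal_measure M) {-\<bar>y\<bar>..\<bar>y\<bar>}"
    by (intro emeasure_subadditive) auto
  also have "\<dots> < \<infinity>" using emeasure_renewal_neg emeasure_renewal_Icc by simp
  finally show ?thesis .
qed

lemma renewal_function_eq: "renewal_function M y = measure (renewal_measure M) {..y}"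
proof -
  have "emeasure (renewal_measure M) {..y} = (\<Sum>n. emeasure (conv_power M n) {..y})"
  proof -
    have "sets (conv_power M n) = sets borel" for n
      by (cases n) simp_all
    then show ?thesis using nn_integral_renewal_measure[of "indicator {..y}"] by simp
  qed
  also have "\<dots> = (\<Sum>n. ennreal (cdf (conv_power M n) y))"
  proof (intro suminf_cong)
    fix n
    interpret N: real_distribution "conv_power M n" by (rule real_distribution_conv_power) unfold_locales
    show "emeasure (conv_power M n) {..y} = ennreal (cdf (conv_power M n) y)"
      by (simp add: cdf_def N.emeasure_eq_measure)
  qed
  finally have eq: "emeasure (renewal_measure M) {..y} = (\<Sum>n. ennreal (cdf (conv_power M n) y))" .
  have nn: "0 \<le> cdf (conv_power M n) y" for n by (simp add: cdf_def)
  have "(\<Sum>n. ennreal (cdf (conv_power M n) y)) \<noteq> \<infinity>"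
    using eq emeasure_renewal_atMost[of y] by auto
  then have "summable (\<lambda>n. cdf (conv_power M n) y)"
    using nn by (intro summable_suminf_not_top) auto
  then have "emeasure (renewal_measure M) {..y} = ennreal (renewal_function M y)"
    unfolding eq renewal_function_def using nn by (intro suminf_ennreal2) auto
  moreover have "0 \<le> renewal_function M y"
    unfolding renewal_function_def using nn \<open>summable _\<close> by (intro suminf_nonneg) auto
  ultimately show ?thesis by (simp add: measure_def)
qed

lemma renewal_function_diff:
  assumes "0 < h"
  shows "renewal_function M (y + h) - renewal_function M (y - h) = measure (renewal_measure M) {y - h<..y + h}"
proof -
  have "measure (renewal_measure M) ({..y + h} - {..y - h}) = measure (renewal_measure M) {..y + h} - measure (renewal_measure M) {..y - h}"
    using assms emeasure_renewal_atMost by (intro measure_Diff) (auto simp: less_top)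
  moreover have "{..y + h} - {..y - h} = {y - h<..y + h}" by auto
  ultimately show ?thesis by (simp add: renewal_function_eq)
qed

end

section \<open>From test functions with compactly supported transform to intervals\<close>

lemma fourier_shift: "fourier (\<lambda>t. \<sigma> (t - \<theta>)) x = iexp (\<theta> * x) * fourier \<sigma> x"
proof -
  have "fourier (\<lambda>t. \<sigma> (t - \<theta>)) x = (CLBINT t. iexp ((\<theta> + 1 * t) * x) * \<sigma> (\<theta> + 1 * t - \<theta>))"
    unfolding fourier_def by (subst lborel_integral_real_affine[where c = 1 and t = \<theta>]) simp_all
  also have "\<dots> = (CLBINT t. iexp (\<theta> * x) * (iexp (t * x) * \<sigma> t))"
    by (intro Bochner_Integration.integral_cong) (auto simp: algebra_simps exp_add)
  finally show ?thesis by (simp only: integral_mult_right_zero fourier_def)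
qed

lemma fourier_add:
  "integrable lborel \<sigma> \<Longrightarrow> integrable lborel \<tau> \<Longrightarrow> fourier (\<lambda>t. \<sigma> t + \<tau> t) x = fourier \<sigma> x + fourier \<tau> x"
  unfolding fourier_def distrib_left by (intro Bochner_Integration.integral_add integrable_iexp_mult)

lemma fourier_cmult: "fourier (\<lambda>t. c * \<sigma> t) x = c * fourier \<sigma> x"
  unfolding fourier_def by (subst integral_mult_right_zero[symmetric]) (simp add: mult_ac)

lemma lipschitz_compact_support:
  fixes \<sigma> :: "real \<Rightarrow> complex"
  assumes lip: "\<And>s t. cmod (\<sigma> s - \<sigma> t) \<le> L * \<bar>s - t\<bar>" and supp: "\<And>t. R < \<bar>t\<bar> \<Longrightarrow> \<sigma> t = 0"
  shows "continuous_on UNIV \<sigma>" "integrable lborel \<sigma>" "cmod (\<sigma> t) \<le> L * (2 * \<bar>R\<bar> + 1)"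
proof -
  have L: "0 \<le> L" using order_trans[OF norm_ge_zero lip[of 0 1]] by simp
  have "L-lipschitz_on UNIV \<sigma>"
    using lip L by (intro lipschitz_onI) (auto simp: dist_norm)
  then show cont: "continuous_on UNIV \<sigma>" by (rule lipschitz_on_continuous_on)
  have "integrable lborel (\<lambda>t. indicator {-R..R} t *\<^sub>R \<sigma> t)"
    using cont by (intro borel_integrable_compact) (auto intro: continuous_on_subset)
  moreover have "(\<lambda>t. indicator {-R..R} t *\<^sub>R \<sigma> t) = \<sigma>"
    using supp by (force simp: indicator_def)
  ultimately show "integrable lborel \<sigma>" by simp
  show "cmod (\<sigma> t) \<le> L * (2 * \<bar>R\<bar> + 1)"
  proof (cases "R < \<bar>t\<bar>")
    case False
    have "cmod (\<sigma> t) = cmod (\<sigma> t - \<sigma> (\<bar>R\<bar> + 1))" using supp[of "\<bar>R\<bar> + 1"] by simp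
    also have "\<dots> \<le> L * \<bar>t - (\<bar>R\<bar> + 1)\<bar>" by (rule lip)
    also have "\<dots> \<le> L * (2 * \<bar>R\<bar> + 1)" using False L by (intro mult_left_mono) auto
    finally show ?thesis .
  qed (use supp L in simp)
qed

text \<open>The renewal measure seen from \<open>y j\<close> is tilted by a Fejer kernel and
  normalised to a probability measure \<open>P j\<close>. The hypothesis determines the limits of
  the characteristic functions, which are those of the normalised Fejer law \<open>Q\<close>. Weak
  convergence is then tested on the indicator divided by the kernel, which undoes the
  tilting.\<close>

lemma (in transient_law) renewal_interval_limit:
  assumes h: "0 < h" and w: "\<And>j::nat. 0 < w j" and D: "0 \<le> D"
    and smooth: "\<And>\<sigma> f L R. (\<And>s t. cmod (\<sigma> s - \<sigma> t) \<le> L * \<bar>s - t\<bar>) \<Longrightarrow> (\<And>t. R < \<bar>t\<bar> \<Longrightarrow> \<sigma> t = 0) \<Longrightarrow>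
        (\<And>x. complex_of_real (f x) = fourier \<sigma> x) \<Longrightarrow> (\<And>x. 0 \<le> f x) \<Longrightarrow>
        (\<lambda>j. w j * (\<integral>x. f (x - y j) \<partial>renewal_measure M)) \<longlonglongrightarrow> D * Re (\<sigma> 0)"
  shows "(\<lambda>j. w j * measure (renewal_measure M) {y j - h<..y j + h}) \<longlonglongrightarrow> D * h / pi"
proof -
  define U where "U = renewal_measure M"
  have [measurable_cong, simp]: "sets U = sets borel" by (simp add: U_def)
  have [simp]: "space U = UNIV" by (simp add: U_def)
  \<comment> \<open>With this width the kernel is positive on the whole of \<open>{-h..h}\<close>,
    as the division by it requires.\<close>
  define a where "a = 1 / h"
  have a: "0 < a" "1 / a = h" using h by (auto simp: a_def)
  note [measurable] = borel_measurable_fejer[OF a(1)]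
  obtain \<kappa> where \<kappa>: "0 < \<kappa>" "\<And>x. x \<in> {-h..h} \<Longrightarrow> \<kappa> \<le> fejer a x"
  proof -
    have "\<exists>x\<in>{-h..h}. \<forall>z\<in>{-h..h}. fejer a x \<le> fejer a z"
      using a h by (intro continuous_attains_inf continuous_at_imp_continuous_on ballI isCont_fejer) auto
    then obtain x where x: "x \<in> {-h..h}" "\<And>z. z \<in> {-h..h} \<Longrightarrow> fejer a x \<le> fejer a z" by blast
    have "0 < fejer a x" using x(1) a(2) by (intro fejer_pos a(1)) auto
    then show ?thesis using x(2) by (rule that)
  qed
  have int_fejer: "integrable U (\<lambda>x. fejer a (x - y j))" for j
    unfolding U_def by (rule integrable_renewal_fejer[OF a(1)])
  define \<tau> where "\<tau> t = complex_of_real (tent a t)" for t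
  have \<tau>_lip: "cmod (\<tau> s - \<tau> t) \<le> (1/a) * \<bar>s - t\<bar>" for s t
    using tent_lipschitz[OF a(1), of s t] by (simp add: \<tau>_def flip: of_real_diff)
  have \<tau>_int: "integrable lborel (\<lambda>t. \<tau> (t - \<theta>))" for \<theta>
  proof -
    have "integrable lborel \<tau>" unfolding \<tau>_def[abs_def] using integrable_tent[OF a(1)] by simp
    from lborel_integrable_real_affine[OF this, of 1 "-\<theta>"] show ?thesis by simp
  qed
  have \<tau>_supp: "a < \<bar>t\<bar> \<Longrightarrow> \<tau> t = 0" for t using tent_outside[OF a(1), of t] by (simp add: \<tau>_def)
  have \<tau>_fourier: "fourier \<tau> x = of_real (fejer a x)" for x
    unfolding \<tau>_def[abs_def] by (rule fourier_tent[OF a(1)])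
  define m where "m j = w j * (\<integral>x. fejer a (x - y j) \<partial>U)" for j
  have m_lim: "m \<longlonglongrightarrow> D"
    using smooth[of \<tau> "1/a" a "fejer a", OF \<tau>_lip \<tau>_supp] fejer_nonneg[OF a(1)]
    by (simp add: m_def[abs_def] \<tau>_fourier U_def) (simp add: \<tau>_def)
  have trig: "(\<lambda>j. w j * (\<integral>x. (1 + Re (z * iexp (\<theta> * (x - y j)))) * fejer a (x - y j) \<partial>U)) \<longlonglongrightarrow> D * (1 + Re z * tent a \<theta>)"
    if z: "cmod z = 1" for z \<theta>
  proof -
    \<comment> \<open>Multiplying the kernel by a cosine translates its transform, hence a tent plus
      two weighted translates.\<close>
    define \<sigma> where "\<sigma> t = \<tau> t + ((z/2) * \<tau> (t - \<theta>) + (cnj z/2) * \<tau> (t - (-\<theta>)))" for t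
    have "cmod (\<sigma> s - \<sigma> t) \<le> (2/a) * \<bar>s - t\<bar>" for s t
    proof -
      have "\<sigma> s - \<sigma> t = (\<tau> s - \<tau> t) + ((z/2) * (\<tau> (s - \<theta>) - \<tau> (t - \<theta>)) + (cnj z/2) * (\<tau> (s - (-\<theta>)) - \<tau> (t - (-\<theta>))))"
        by (simp add: \<sigma>_def algebra_simps)
      also have "cmod \<dots> \<le> cmod (\<tau> s - \<tau> t) + (cmod ((z/2) * (\<tau> (s - \<theta>) - \<tau> (t - \<theta>))) + cmod ((cnj z/2) * (\<tau> (s - (-\<theta>)) - \<tau> (t - (-\<theta>)))))"
        by (intro order_trans[OF norm_triangle_ineq] add_left_mono norm_triangle_ineq)
      also have "\<dots> \<le> (1/a) * \<bar>s - t\<bar> + ((1/2) * ((1/a) * \<bar>s - t\<bar>) + (1/2) * ((1/a) * \<bar>s - t\<bar>))"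
        unfolding norm_mult using z \<tau>_lip[of s t] \<tau>_lip[of "s - \<theta>" "t - \<theta>"] \<tau>_lip[of "s - (-\<theta>)" "t - (-\<theta>)"]
        by (intro add_mono) (auto simp: norm_divide)
      finally show ?thesis by simp
    qed
    moreover have "\<sigma> t = 0" if "a + \<bar>\<theta>\<bar> < \<bar>t\<bar>" for t
      using that \<tau>_supp[of t] \<tau>_supp[of "t - \<theta>"] \<tau>_supp[of "t - (-\<theta>)"] by (simp add: \<sigma>_def)
    moreover have "complex_of_real ((1 + Re (z * iexp (\<theta> * x))) * fejer a x) = fourier \<sigma> x" for x
    proof -
      have "fourier \<sigma> x = fourier \<tau> x + ((z/2) * fourier (\<lambda>t. \<tau> (t - \<theta>)) x + (cnj z/2) * fourier (\<lambda>t. \<tau> (t - (-\<theta>))) x)"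
        unfolding \<sigma>_def[abs_def] using \<tau>_int \<tau>_int[of 0]
        by (simp only: fourier_add fourier_cmult integrable_mult_right Bochner_Integration.integrable_add diff_zero)
      also have "\<dots> = of_real (fejer a x) * (1 + (z * iexp (\<theta> * x) + cnj (z * iexp (\<theta> * x))) / 2)"
        unfolding fourier_shift[where \<sigma> = \<tau>] \<tau>_fourier by (simp add: exp_cnj algebra_simps add_divide_distrib)
      also have "(z * iexp (\<theta> * x) + cnj (z * iexp (\<theta> * x))) / 2 = of_real (Re (z * iexp (\<theta> * x)))"
        by (subst complex_add_cnj) simp
      finally show ?thesis by (simp add: mult.commute)
    qed
    moreover have "0 \<le> (1 + Re (z * iexp (\<theta> * x))) * fejer a x" for x
    proof -
      have "cmod (z * iexp (\<theta> * x)) = 1" using z norm_exp_i_times[of "\<theta> * x"] by (simp add: norm_mult del: of_real_mult)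
      then have "- 1 \<le> Re (z * iexp (\<theta> * x))" using abs_Re_le_cmod[of "z * iexp (\<theta> * x)"] by linarith
      then show ?thesis using fejer_nonneg[OF a(1)] by (intro mult_nonneg_nonneg) auto
    qed
    ultimately have "(\<lambda>j. w j * (\<integral>x. (1 + Re (z * iexp (\<theta> * (x - y j)))) * fejer a (x - y j) \<partial>U)) \<longlonglongrightarrow> D * Re (\<sigma> 0)"
      unfolding U_def by (intro smooth[of \<sigma> "2/a" "a + \<bar>\<theta>\<bar>"]) auto
    moreover have "Re (\<sigma> 0) = 1 + Re z * tent a \<theta>"
      by (simp add: \<sigma>_def \<tau>_def tent_even)
    ultimately show ?thesis by simp
  qed
  show ?thesis
  proof (cases "D = 0")
    \<comment> \<open>The masses \<open>m j\<close> tend to 0 and cannot serve for normalisation;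
      here bounding the indicator by a multiple of the kernel is enough.\<close>
    case True
    have le: "w j * measure U {y j - h<..y j + h} \<le> m j / \<kappa>" for j
    proof -
      have "measure U {y j - h<..y j + h} = (\<integral>x. indicator {y j - h<..y j + h} x \<partial>U)" by simp
      also have "\<dots> \<le> (\<integral>x. fejer a (x - y j) / \<kappa> \<partial>U)"
      proof (rule integral_mono')
        show "integrable U (\<lambda>x. fejer a (x - y j) / \<kappa>)" using int_fejer by simp
        fix x
        show "indicator {y j - h<..y j + h} x \<le> fejer a (x - y j) / \<kappa>"
          using \<kappa> fejer_nonneg[OF a(1), of "x - y j"] by (auto simp: indicator_def)
        show "0 \<le> fejer a (x - y j) / \<kappa>" using \<kappa> fejer_nonneg[OF a(1)] by simp
      qed
      finally have "w j * measure U {y j - h<..y j + h} \<le> w j * (\<integral>x. fejer a (x - y j) / \<kappa> \<partial>U)"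
        using w[of j] by (intro mult_left_mono) auto
      then show ?thesis by (simp add: m_def)
    qed
    have "(\<lambda>j. m j / \<kappa>) \<longlonglongrightarrow> 0 / \<kappa>" using m_lim True \<kappa> by (intro tendsto_intros) auto
    then have lim0: "(\<lambda>j. m j / \<kappa>) \<longlonglongrightarrow> 0" by simp
    have "0 \<le> w j * measure U {y j - h<..y j + h}" for j using w[of j] by simp
    with le have "\<forall>j. norm (w j * measure U {y j - h<..y j + h}) \<le> m j / \<kappa>" by auto
    from Lim_null_comparison[OF always_eventually[OF this] lim0]
    have "(\<lambda>j. w j * measure U {y j - h<..y j + h}) \<longlonglongrightarrow> 0" .
    then show ?thesis unfolding U_def True by simp
  next
    case False
    then have D: "0 < D" using D by simp
    then have "\<forall>\<^sub>F j in sequentially. 0 < m j" using m_lim by (intro order_tendstoD(1))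
    then obtain J where J: "\<And>j. J \<le> j \<Longrightarrow> 0 < m j" by (auto simp: eventually_sequentially)
    have m_pos: "0 < m (j + J)" for j by (rule J) simp
    define d where "d j x = w (j + J) * fejer a (x - y (j + J)) / m (j + J)" for j x
    have d_nonneg: "0 \<le> d j x" for j x
      using w[of "j + J"] m_pos[of j] fejer_nonneg[OF a(1)] by (simp add: d_def)
    have [measurable]: "d j \<in> borel_measurable borel" for j unfolding d_def by measurable
    have int_d: "integrable U (d j)" for j
      unfolding d_def using int_fejer[of "j + J"] by simp
    have d_1: "(\<integral>x. d j x \<partial>U) = 1" for j
    proof -
      have "(\<integral>x. d j x \<partial>U) = (\<integral>x. (w (j + J) / m (j + J)) * fejer a (x - y (j + J)) \<partial>U)"
        by (simp add: d_def)
      also have "\<dots> = m (j + J) / m (j + J)" unfolding integral_mult_right_zero by (simp add: m_def)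
      finally show ?thesis using m_pos[of j] by simp
    qed
    define P where "P j = distr (density U (\<lambda>x. ennreal (d j x))) borel (\<lambda>x. x - y (j + J))" for j
    have P: "real_distribution (P j)" for j
    proof -
      have "emeasure (density U (\<lambda>x. ennreal (d j x))) (space (density U (\<lambda>x. ennreal (d j x)))) = 1"
        using int_d[of j] d_nonneg d_1[of j] by (simp add: emeasure_density nn_integral_eq_integral)
      then have "prob_space (density U (\<lambda>x. ennreal (d j x)))" by (rule prob_spaceI)
      then have "prob_space (P j)" unfolding P_def by (rule prob_space.prob_space_distr) measurable
      then show ?thesis by (auto simp: real_distribution_def real_distribution_axioms_def P_def)
    qed
    have P_int: "(\<integral>x. g x \<partial>P j) = (\<integral>x. d j x *\<^sub>R g (x - y (j + J)) \<partial>U)"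
      if [measurable]: "g \<in> borel_measurable borel" for g :: "real \<Rightarrow> 'b::{banach, second_countable_topology}" and j
      unfolding P_def using d_nonneg by (subst integral_distr) (auto intro!: integral_density)
    have Re_lim: "(\<lambda>j. Re (z * char (P j) \<theta>)) \<longlonglongrightarrow> Re z * tent a \<theta>" if z: "cmod z = 1" for z \<theta>
    proof -
      have eq: "Re (z * char (P j) \<theta>) =
          w (j + J) * (\<integral>x. (1 + Re (z * iexp (\<theta> * (x - y (j + J))))) * fejer a (x - y (j + J)) \<partial>U) / m (j + J) - 1" for j
      proof -
        interpret P: real_distribution "P j" by (rule P)
        have "integrable (P j) (\<lambda>x. iexp (\<theta> * x))" by (rule P.integrable_iexp) auto
        then have "Re (z * char (P j) \<theta>) = (\<integral>x. Re (z * iexp (\<theta> * x)) \<partial>P j)"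
          unfolding char_def by (subst integral_Re) (auto simp del: of_real_mult)
        also have "\<dots> = (\<integral>x. (1 + Re (z * iexp (\<theta> * x))) - 1 \<partial>P j)" by simp
        also have "\<dots> = (\<integral>x. 1 + Re (z * iexp (\<theta> * x)) \<partial>P j) - 1"
        proof (subst Bochner_Integration.integral_diff)
          show "integrable (P j) (\<lambda>x. 1 + Re (z * iexp (\<theta> * x)))"
            using \<open>integrable (P j) (\<lambda>x. iexp (\<theta> * x))\<close>
            by (intro Bochner_Integration.integrable_add integrable_Re integrable_mult_right) auto
        qed (use P.prob_space in auto)
        also have "(\<integral>x. 1 + Re (z * iexp (\<theta> * x)) \<partial>P j) = (\<integral>x. d j x *\<^sub>R (1 + Re (z * iexp (\<theta> * (x - y (j + J))))) \<partial>U)"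
          by (rule P_int) measurable
        also have "\<dots> = (\<integral>x. (w (j + J) / m (j + J)) * ((1 + Re (z * iexp (\<theta> * (x - y (j + J))))) * fejer a (x - y (j + J))) \<partial>U)"
          by (intro Bochner_Integration.integral_cong) (auto simp: d_def)
        also have "\<dots> = (w (j + J) / m (j + J)) * (\<integral>x. (1 + Re (z * iexp (\<theta> * (x - y (j + J))))) * fejer a (x - y (j + J)) \<partial>U)"
          by (rule integral_mult_right_zero)
        finally show ?thesis by simp
      qed
      have "(\<lambda>j. w (j + J) * (\<integral>x. (1 + Re (z * iexp (\<theta> * (x - y (j + J))))) * fejer a (x - y (j + J)) \<partial>U) / m (j + J) - 1)
          \<longlonglongrightarrow> D * (1 + Re z * tent a \<theta>) / D - 1"
        using D by (intro tendsto_intros LIMSEQ_ignore_initial_segment[OF trig[OF z]] LIMSEQ_ignore_initial_segment[OF m_lim]) auto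
      then show ?thesis unfolding eq using D by simp
    qed
    define Q where "Q = density lborel (\<lambda>x. ennreal (fejer a x / (2 * pi)))"
    have int_f: "(LBINT x. fejer a x) = 2 * pi"
      using Re_fourier_fejer[OF a(1), of 0] by (simp add: fourier_def)
    have "emeasure Q (space Q) = 1"
      unfolding Q_def using integrable_fejer[OF a(1)] fejer_nonneg[OF a(1)] int_f
      by (simp add: emeasure_density nn_integral_eq_integral)
    then interpret Q: real_distribution Q
      by (intro real_distribution.intro prob_spaceI) (auto simp: real_distribution_axioms_def Q_def)
    have Q_int: "(\<integral>x. g x \<partial>Q) = (LBINT x. (fejer a x / (2 * pi)) *\<^sub>R g x)"
      if [measurable]: "g \<in> borel_measurable borel" for g :: "real \<Rightarrow> 'b::{banach, second_countable_topology}"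
      unfolding Q_def using fejer_nonneg[OF a(1)] by (intro integral_density) auto
    have char_Q: "char Q \<theta> = of_real (tent a \<theta>)" for \<theta>
    proof -
      have "char Q \<theta> = (CLBINT x. (fejer a x / (2 * pi)) *\<^sub>R iexp (\<theta> * x))"
        unfolding char_def by (rule Q_int) measurable
      also have "\<dots> = (CLBINT x. (iexp (x * \<theta>) * of_real (fejer a x)) / of_real (2 * pi))"
        by (intro Bochner_Integration.integral_cong) (auto simp: scaleR_conv_of_real mult_ac)
      also have "\<dots> = fourier (\<lambda>x. of_real (fejer a x)) \<theta> / of_real (2 * pi)"
        unfolding fourier_def by (rule integral_divide_zero)
      finally show ?thesis by (simp add: fourier_fejer[OF a(1)])
    qed
    have "(\<lambda>j. char (P j) \<theta>) \<longlonglongrightarrow> char Q \<theta>" for \<theta>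
    proof -
      have "(\<lambda>j. Re (char (P j) \<theta>)) \<longlonglongrightarrow> tent a \<theta>" using Re_lim[of 1 \<theta>] by simp
      moreover have "(\<lambda>j. Im (char (P j) \<theta>)) \<longlonglongrightarrow> 0" using Re_lim[of "-\<i>" \<theta>] by simp
      ultimately show ?thesis by (simp add: tendsto_complex_iff char_Q)
    qed
    then have weak: "weak_conv_m P Q" by (intro levy_continuity P Q.real_distribution_axioms)
    \<comment> \<open>Bounded because the kernel is at least \<kappa> on \<open>{-h..h}\<close>, and
      discontinuous at most at the two endpoints, which are null for \<open>Q\<close>.\<close>
    define g where "g x = indicator {-h<..h} x / fejer a x" for x
    have g_bdd: "norm (g x) \<le> 1 / \<kappa>" for x
      using \<kappa>(1) \<kappa>(2)[of x] by (auto simp: g_def indicator_def intro!: divide_left_mono)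
    have [measurable]: "g \<in> borel_measurable borel" unfolding g_def by measurable
    have "(\<lambda>j. \<integral>x. g x \<partial>P j) \<longlonglongrightarrow> (\<integral>x. g x \<partial>Q)"
    proof (rule weak_conv_imp_bdd_ae_continuous_conv[OF P Q.real_distribution_axioms weak _ g_bdd])
      have "isCont g x" if "x \<noteq> -h" "x \<noteq> h" for x
      proof (cases "x \<in> {-h<..<h}")
        case True
        have "0 < fejer a x" using True a(2) by (intro fejer_pos a(1)) auto
        then have "isCont (\<lambda>x. 1 / fejer a x) x" by (intro continuous_intros isCont_fejer[OF a(1)]) auto
        moreover have "\<forall>\<^sub>F z in nhds x. 1 / fejer a z = g z"
          by (rule eventually_mono[OF eventually_nhds_in_open[of "{-h<..<h}"]]) (use True in \<open>auto simp: g_def\<close>)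
        ultimately show ?thesis by (simp add: isCont_cong)
      next
        case False
        have "\<forall>\<^sub>F z in nhds x. 0 = g z"
          by (rule eventually_mono[OF eventually_nhds_in_open[of "- {-h..h}"]]) (use False that in \<open>auto simp: g_def\<close>)
        moreover have "isCont (\<lambda>x. 0::real) x" by simp
        ultimately show ?thesis by (simp add: isCont_cong)
      qed
      then have sub: "{x. \<not> isCont g x} \<subseteq> {-h, h}" by auto
      have "{-h, h} \<in> null_sets lborel" by (simp add: null_sets_def emeasure_lborel_countable)
      then have "emeasure Q {-h, h} = 0"
        unfolding Q_def by (subst emeasure_density) (auto intro!: nn_integral_null_set)
      then have "{-h, h} \<in> null_sets Q" by (auto simp: null_sets_def)
      moreover have "{x. \<not> isCont g x} \<in> sets Q" using finite_subset[OF sub] by (simp add: finite_imp_closed borel_closed)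
      ultimately show "emeasure Q {x. \<not> isCont g x} = 0"
        using sub null_sets_subset[of "{-h, h}" Q "{x. \<not> isCont g x}"] by (auto simp: null_sets_def)
    qed measurable
    moreover have "(\<integral>x. g x \<partial>P j) = w (j + J) * measure U {y (j + J) - h<..y (j + J) + h} / m (j + J)" for j
    proof -
      have "(\<integral>x. g x \<partial>P j) = (\<integral>x. (w (j + J) / m (j + J)) * indicator {y (j + J) - h<..y (j + J) + h} x \<partial>U)"
      proof (subst P_int, measurable, intro Bochner_Integration.integral_cong refl)
        fix x
        show "d j x *\<^sub>R g (x - y (j + J)) = (w (j + J) / m (j + J)) * indicator {y (j + J) - h<..y (j + J) + h} x"
          using \<kappa>(1) \<kappa>(2)[of "x - y (j + J)"] by (auto simp: d_def g_def indicator_def)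
      qed
      then show ?thesis by simp
    qed
    moreover have "(\<integral>x. g x \<partial>Q) = h / pi"
    proof -
      have "(\<integral>x. g x \<partial>Q) = (LBINT x. (1 / (2 * pi)) * indicator {-h<..h} x)"
      proof (subst Q_int, measurable, intro Bochner_Integration.integral_cong refl)
        fix x
        show "(fejer a x / (2 * pi)) *\<^sub>R g x = (1 / (2 * pi)) * indicator {-h<..h} x"
          using \<kappa>(1) \<kappa>(2)[of x] by (auto simp: g_def indicator_def)
      qed
      then show ?thesis using h by simp
    qed
    ultimately have "(\<lambda>j. w (j + J) * measure U {y (j + J) - h<..y (j + J) + h} / m (j + J)) \<longlonglongrightarrow> h / pi" by simp
    from tendsto_mult[OF this LIMSEQ_ignore_initial_segment[OF m_lim, of J]]
    have "(\<lambda>j. w (j + J) * measure U {y (j + J) - h<..y (j + J) + h}) \<longlonglongrightarrow> h / pi * D"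
      using m_pos by (simp add: less_imp_neq[symmetric])
    from LIMSEQ_offset[OF this] show ?thesis by (simp add: U_def mult.commute)
  qed
qed

section \<open>Characteristic functions with semistable tails\<close>

lemma two_power_eq_max:
  assumes "0 < b" "b \<le> a" "x \<noteq> 0"
  shows "two_power a b x = max (\<bar>x\<bar> powr (-a)) (\<bar>x\<bar> powr (-b))"
proof (cases "\<bar>x\<bar> \<le> 1")
  case True
  then have "\<bar>x\<bar> powr (-b) \<le> \<bar>x\<bar> powr (-a)" using assms by (intro powr_mono') auto
  then show ?thesis using True by (simp add: two_power_def)
next
  case False
  then have "\<bar>x\<bar> powr (-a) \<le> \<bar>x\<bar> powr (-b)" using assms by (intro powr_mono) auto
  then show ?thesis using False by (simp add: two_power_def)
qed

locale semistable_renewal = semistable_tail \<alpha> l1 c k MR hR "\<lambda>x. 1 - cdf M x" + real_distribution M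
  for \<alpha> :: real and l1 :: "real \<Rightarrow> real" and c :: real and k :: "nat \<Rightarrow> nat"
    and MR hR :: "real \<Rightarrow> real" and M :: "real measure" +
  fixes a0 b0 :: real
  assumes alpha: "1/2 < \<alpha>" "\<alpha> < 1"
    and a0: "0 < a0" "\<And>x. 0 < x \<Longrightarrow> a0 \<le> MR x"
    and b0: "\<And>x. 0 < x \<Longrightarrow> MR x \<le> b0"
    and MR_right_cont: "\<And>x. 0 < x \<Longrightarrow> continuous (at_right x) MR"
    and M_nonneg: "AE x in M. 0 \<le> x"
    and M_char_ne_1: "\<And>t. t \<noteq> 0 \<Longrightarrow> char M t \<noteq> 1"
begin

abbreviation "T \<equiv> \<lambda>x. 1 - cdf M x"

text \<open>Potter exponents around \<open>\<alpha>\<close>: \<open>\<beta>1 < 1\<close> makes \<open>W\<close> integrable at \<open>0\<close>, and \<open>\<beta>2 > 1/2\<close> makes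
  \<open>W\<^sup>2\<close> integrable at infinity.\<close>
definition \<beta>1 :: real where "\<beta>1 = (\<alpha> + 1) / 2"
definition \<beta>2 :: real where "\<beta>2 = (\<alpha> + 1/2) / 2"
abbreviation "W \<equiv> two_power \<beta>1 \<beta>2"

lemma \<beta>: "0 < \<beta>2" "\<beta>2 < \<alpha>" "\<alpha> < \<beta>1" "\<beta>1 < 1" "1 < 2 * \<beta>2" "\<beta>2 \<le> \<beta>1"
  using alpha by (auto simp: \<beta>1_def \<beta>2_def field_simps)

lemma W_eq: "x \<noteq> 0 \<Longrightarrow> W x = max (\<bar>x\<bar> powr (-\<beta>1)) (\<bar>x\<bar> powr (-\<beta>2))"
  using \<beta> by (intro two_power_eq_max) auto

lemma W_pos: "x \<noteq> 0 \<Longrightarrow> 0 < W x"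
  by (simp add: W_eq less_max_iff_disj)

lemma T_measurable [measurable]: "T \<in> borel_measurable borel"
  by (intro borel_measurable_diff borel_measurable_const borel_measurable_mono monoI cdf_nondecreasing)

sublocale M: halfline_measure M T
proof unfold_locales
  show "emeasure M {..<0} = 0"
  proof -
    have "AE x in M. x \<notin> {..<0}" using M_nonneg by eventually_elim auto
    then show ?thesis by (subst (asm) AE_iff_null_sets[symmetric]) auto
  qed
  fix x :: real
  have "measure M (UNIV - {..x}) = 1 - cdf M x"
    using prob_compl[of "{..x}"] by (simp add: cdf_def)
  moreover have "UNIV - {..x} = {x<..}" by auto
  ultimately show "emeasure M {x<..} = ennreal (1 - cdf M x)" by (simp add: emeasure_eq_measure)
  show "0 \<le> 1 - cdf M x" using cdf_bounded_prob by simp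
  fix r :: real
  show "integrable lborel (\<lambda>x. indicator {0<..r} x * T x)"
  proof (rule Bochner_Integration.integrable_bound)
    show "integrable lborel (\<lambda>x. indicator {0<..r} x * 1 :: real)"
      by (cases "0 \<le> r") (auto intro!: integrable_mult_left integrable_real_indicator)
    show "AE x in lborel. norm (indicator {0<..r} x * T x) \<le> norm (indicator {0<..r} x * 1 :: real)"
      using T_nonneg T_le_1 by (intro AE_I2) (auto simp: indicator_def)
  qed measurable
qed auto

lemma M_exponent: "M.exponent t = char M t - 1"
  unfolding M.exponent_def char_def
  by (subst Bochner_Integration.integral_diff) (use integrable_iexp prob_space in auto)

section \<open>Potter-type bounds for the tail and the characteristic function\<close>

lemma T_le_inverse_B: "\<exists>C>0. \<forall>x>0. B x * T x \<le> C"
proof -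
  obtain b y0 where b: "0 < b" and y0: "0 < y0" "\<And>y. y0 \<le> y \<Longrightarrow> B y * T y \<le> b"
    using T_bounds by blast
  have "B x * T x \<le> max b (B y0)" if x: "0 < x" for x
  proof (cases "y0 \<le> x")
    case False
    have "B x * T x \<le> B y0 * 1"
      using T_nonneg[of x] T_le_1[of x] B_mono[OF x, of y0] B_ge_1[OF x] False y0(1) B_ge_1[OF y0(1)] by (intro mult_mono) auto
    then show ?thesis by simp
  qed (use y0 in force)
  then show ?thesis using b by (intro exI[of _ "max b (B y0)"]) auto
qed

text \<open>The majorant for rescaled tails: \<open>B (y * x) * T (y * x)\<close> is bounded for all
  arguments, so only the ratio of \<open>B y\<close> to \<open>B (y * x)\<close> matters.\<close>

lemma tail_scaled_bound: "\<exists>C>0. \<exists>y0>0. \<forall>y\<ge>y0. \<forall>x>0. B y * T (y * x) \<le> C * W x"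
proof -
  obtain C1 where C1: "0 < C1" "\<And>x. 0 < x \<Longrightarrow> B x * T x \<le> C1" using T_le_inverse_B by blast
  obtain C2 y0 where C2: "0 < C2" and y0: "0 < y0"
    and B: "\<And>y x. y0 \<le> y \<Longrightarrow> 0 < x \<Longrightarrow> B y \<le> C2 * max (x powr -\<beta>1) (x powr -\<beta>2) * B (y * x)"
    using B_scaled_ge[OF \<beta>(1-3)] by blast
  have "B y * T (y * x) \<le> (C2 * C1) * W x" if y: "y0 \<le> y" and x: "0 < x" for y x
  proof -
    have yx: "0 < y * x" using y x y0 by simp
    have "B y * T (y * x) \<le> C2 * W x * B (y * x) * T (y * x)"
      using B[OF y x] T_nonneg x by (intro mult_right_mono) (auto simp: W_eq)
    also have "\<dots> = C2 * W x * (B (y * x) * T (y * x))" by simp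
    also have "\<dots> \<le> C2 * W x * C1"
      using C1(2)[OF yx] C2 W_pos[of x] x by (intro mult_left_mono) auto
    finally show ?thesis by (simp add: mult_ac)
  qed
  then show ?thesis using C1(1) C2 y0 by (intro exI[of _ "C2 * C1"]) auto
qed

lemma B_scaled_W:
  assumes "0 < \<delta>"
  shows "\<exists>C>0. \<exists>y0>0. \<forall>y\<ge>y0. \<forall>u. u \<noteq> 0 \<longrightarrow> \<delta> \<le> y / \<bar>u\<bar> \<longrightarrow> B (y / \<bar>u\<bar>) \<le> C * W u * B y"
proof -
  obtain C y0 where C: "0 < C" and y0: "0 < y0"
    and B: "\<And>y x. y0 \<le> y \<Longrightarrow> 0 < x \<Longrightarrow> \<delta> \<le> y * x \<Longrightarrow> B (y * x) \<le> C * max (x powr \<beta>1) (x powr \<beta>2) * B y"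
    using B_scaled_le[OF \<beta>(1-3) assms] by blast
  have "B (y / \<bar>u\<bar>) \<le> C * W u * B y" if "y0 \<le> y" "u \<noteq> 0" "\<delta> \<le> y / \<bar>u\<bar>" for y u
    using B[of y "1 / \<bar>u\<bar>"] that by (simp add: W_eq powr_divide powr_minus_divide)
  then show ?thesis using C y0 by blast
qed

lemma integrable_W_Ioc: "integrable lborel (\<lambda>x. indicator {0<..R} x * W x)"
proof (rule Bochner_Integration.integrable_bound)
  \<comment> \<open>\<open>W\<close> is not integrable at infinity because
    \<open>\<beta>2 < 1\<close>. On \<open>{0<..R}\<close> its exponent there can be replaced by 2
    at the cost of a factor \<open>R\<^sup>2\<close>.\<close>
  show "integrable lborel (\<lambda>x. max 1 (R\<^sup>2) * two_power \<beta>1 2 x)"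
    using \<beta> by (intro integrable_mult_right integrable_two_power) auto
  show "AE x in lborel. norm (indicator {0<..R} x * W x) \<le> norm (max 1 (R\<^sup>2) * two_power \<beta>1 2 x)"
  proof (rule AE_I2)
    fix x
    show "norm (indicator {0<..R} x * W x) \<le> norm (max 1 (R\<^sup>2) * two_power \<beta>1 2 x)"
    proof (cases "x \<in> {0<..R}")
      case x: True
      show ?thesis
      proof (cases "x \<le> 1")
        case True
        have "1 * x powr - \<beta>1 \<le> max 1 (R\<^sup>2) * x powr - \<beta>1" by (intro mult_right_mono) auto
        then show ?thesis using x True by (simp add: two_power_def abs_mult)
      next
        case False
        have "x powr -\<beta>2 \<le> x powr 0" using False \<beta> by (intro powr_mono) auto
        also have "\<dots> \<le> R\<^sup>2 * x powr -2"
        proof -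
          have "x\<^sup>2 \<le> R\<^sup>2" using x by (intro power_mono) auto
          then show ?thesis using x False by (simp add: powr_minus_divide)
        qed
        also have "\<dots> \<le> max 1 (R\<^sup>2) * x powr -2" by (intro mult_right_mono) auto
        finally show ?thesis using x False by (simp add: two_power_def abs_mult)
      qed
    qed simp
  qed
qed measurable

lemma cum_tail_rescale:
  assumes "0 < y"
  shows "M.cum_tail y = y * (LBINT x. indicator {0<..1} x * T (y * x))"
proof -
  have "M.cum_tail y = \<bar>y\<bar> *\<^sub>R (LBINT x. indicator {0<..y} (0 + y * x) * T (0 + y * x))"
    unfolding M.cum_tail_def using assms by (intro lborel_integral_real_affine) auto
  also have "(LBINT x. indicator {0<..y} (0 + y * x) * T (0 + y * x)) = (LBINT x. indicator {0<..1} x * T (y * x))"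
    using assms by (intro Bochner_Integration.integral_cong) (auto simp: indicator_def zero_less_mult_iff)
  finally show ?thesis using assms by simp
qed

text \<open>Karamata-type bound: since \<open>\<beta>1 < 1\<close>, the truncated mean divided by y
  has the same order \<open>1 / B y\<close> as the tail.\<close>

lemma cum_tail_bound: "\<exists>C>0. \<exists>y0>0. \<forall>y\<ge>y0. B y * (M.cum_tail y / y) \<le> C"
proof -
  obtain C y0 where C: "0 < C" and y0: "0 < y0" and le: "\<And>y x. y0 \<le> y \<Longrightarrow> 0 < x \<Longrightarrow> B y * T (y * x) \<le> C * W x"
    using tail_scaled_bound by blast
  define K where "K = C * (LBINT x. indicator {0<..1} x * W x)"
  have "B y * (M.cum_tail y / y) \<le> K" if y: "y0 \<le> y" for y
  proof -
    have ypos: "0 < y" using y y0 by simp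
    have "B y * (M.cum_tail y / y) = (LBINT x. B y * (indicator {0<..1} x * T (y * x)))"
      using ypos by (simp add: cum_tail_rescale)
    also have "\<dots> \<le> (LBINT x. C * (indicator {0<..1} x * W x))"
    proof (rule integral_mono')
      show "integrable lborel (\<lambda>x. C * (indicator {0<..1} x * W x))"
        by (intro integrable_mult_right integrable_W_Ioc)
      fix x
      show "B y * (indicator {0<..1} x * T (y * x)) \<le> C * (indicator {0<..1} x * W x)"
        using le[OF y, of x] by (auto simp: indicator_def)
      show "0 \<le> C * (indicator {0<..1} x * W x)" using C by (simp add: two_power_nonneg)
    qed
    finally show ?thesis by (simp add: K_def)
  qed
  moreover have "K < \<bar>K\<bar> + 1" by simp
  ultimately show ?thesis using y0 by (intro exI[of _ "\<bar>K\<bar> + 1"]) force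
qed

lemma char_increment: "\<exists>C>0. \<exists>y0>0. \<forall>y\<ge>y0. \<forall>t s. \<bar>s\<bar> = 1/y \<longrightarrow> B y * cmod (char M (t + s) - char M t) \<le> C"
proof -
  obtain C y0 where C: "0 < C" and y0: "0 < y0" and le: "\<And>y. y0 \<le> y \<Longrightarrow> B y * (M.cum_tail y / y) \<le> C"
    using cum_tail_bound by blast
  have "B y * cmod (char M (t + s) - char M t) \<le> 2 * C" if y: "y0 \<le> y" and s: "\<bar>s\<bar> = 1/y" for y t s
  proof -
    have "cmod (char M (t + s) - char M t) \<le> 2 * (M.cum_tail y / y)"
      using M.exponent_diff[of s t] s y y0 by (cases "s = 0") (auto simp: M_exponent)
    then have "B y * cmod (char M (t + s) - char M t) \<le> B y * (2 * (M.cum_tail y / y))"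
      using B_ge_1[of y] y y0 by (intro mult_left_mono) auto
    also have "\<dots> = 2 * (B y * (M.cum_tail y / y))" by simp
    also have "\<dots> \<le> 2 * C" using le[OF y] by (intro mult_left_mono) auto
    finally show ?thesis .
  qed
  then show ?thesis using C y0 by (intro exI[of _ "2 * C"]) auto
qed

text \<open>The tail oscillates, so neighbouring scales may carry no mass between them. For a large
  enough fixed r, however, the Potter bound forces mass of order \<open>1 / B y\<close> between
  \<open>y / r\<close> and y, and \<open>exponent_Re_lower\<close> turns this mass into a lower
  bound.\<close>

lemma char_lower_near_0: "\<exists>c0>0. \<exists>t0>0. \<forall>t. 0 < \<bar>t\<bar> \<longrightarrow> \<bar>t\<bar> \<le> t0 \<longrightarrow> c0 / B (1/\<bar>t\<bar>) \<le> cmod (1 - char M t)"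
proof -
  obtain b a y1 where ab: "0 < b" "0 < a" "0 < y1"
    and T: "\<And>y. y1 \<le> y \<Longrightarrow> a \<le> B y * T y \<and> B y * T y \<le> b"
    using T_bounds by blast
  obtain C y2 where C: "1 \<le> C" and y2: "0 < y2"
    and P: "\<And>y r. y2 \<le> y \<Longrightarrow> 1 \<le> r \<Longrightarrow> r powr \<beta>2 * B y \<le> C * B (r * y)"
    using Potter[OF \<beta>(1-3)] by blast
  \<comment> \<open>Large enough that \<open>B y * T (y / r) \<ge> b + 1\<close>, whereas
    \<open>B y * T y \<le> b\<close>; the summand 2 ensures \<open>r > 1\<close>.\<close>
  define r where "r = (C * (b + 1) / a + 2) powr (1/\<beta>2)"
  have pos: "0 < C * (b + 1) / a" using ab C by simp
  have r1: "1 < r" unfolding r_def using pos \<beta> by (intro gr_one_powr) auto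
  have rp: "C * (b + 1) / a \<le> r powr \<beta>2" unfolding r_def using pos \<beta> by (simp add: powr_powr)
  define t0 where "t0 = 1 / (r * max y1 y2)"
  have t0: "0 < t0" using r1 ab by (simp add: t0_def less_max_iff_disj)
  define c0 where "c0 = 1 - cos (1/r)"
  have "1/r < 1" using r1 by simp
  then have "cos (1/r) < cos 0" using r1 pi_gt3 by (intro cos_monotone_0_pi) (simp, simp, linarith)
  then have c0: "0 < c0" by (simp add: c0_def)
  have "c0 / B (1/\<bar>t\<bar>) \<le> cmod (1 - char M t)" if t: "0 < \<bar>t\<bar>" "\<bar>t\<bar> \<le> t0" for t
  proof -
    define y where "y = 1 / \<bar>t\<bar>"
    have "r * max y1 y2 \<le> y" using t t0 r1 ab unfolding y_def t0_def by (simp add: field_simps less_max_iff_disj)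
    then have "max y1 y2 \<le> y / r" using r1 by (intro mult_imp_le_div_pos) (simp_all only: mult.commute)
    then have z: "y1 \<le> y / r" "y2 \<le> y / r" by auto
    have ypos: "0 < y" using t by (simp add: y_def)
    have "y / r \<le> y" using r1 ypos by (simp add: field_simps)
    then have y1: "y1 \<le> y" using z by simp
    have By: "0 < B y" using B_ge_1[OF ypos] by simp
    have "r powr \<beta>2 * B (y / r) \<le> C * B y" using P[OF z(2), of r] r1 by simp
    then have "r powr \<beta>2 * a * B (y / r) \<le> a * (C * B y)" using ab by (simp add: mult_ac)
    moreover have "C * (b + 1) * B (y / r) \<le> r powr \<beta>2 * a * B (y / r)"
      using rp ab B_ge_1[of "y / r"] ypos r1 by (intro mult_right_mono) (auto simp: field_simps)
    ultimately have "C * ((b + 1) * B (y / r)) \<le> C * (a * B y)" by (simp add: mult_ac)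
    then have "(b + 1) * B (y / r) \<le> a * B y" using C by simp
    then have "b + 1 \<le> a * B y / B (y / r)" using B_ge_1[of "y / r"] ypos r1 by (simp add: field_simps)
    also have "\<dots> \<le> B y * T (y / r)"
    proof -
      have "a * B y \<le> (B (y / r) * T (y / r)) * B y" using T[OF z(1)] By by (intro mult_right_mono) auto
      then have "a * B y \<le> (B y * T (y / r)) * B (y / r)" by (simp only: mult_ac)
      then show ?thesis using B_ge_1[of "y / r"] ypos r1 by (intro mult_imp_div_pos_le) auto
    qed
    finally have "1 \<le> B y * (T (y / r) - T y)" using T[OF y1] by (simp add: algebra_simps)
    then have "c0 * 1 \<le> c0 * (B y * (T (y / r) - T y))" using c0 by (intro mult_left_mono) auto
    also have "\<dots> = B y * (c0 * (T (y / r) - T y))" by simp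
    also have "\<dots> \<le> B y * (- Re (char M t - 1))"
    proof (intro mult_left_mono)
      show "c0 * (T (y / r) - T y) \<le> - Re (char M t - 1)"
        using M.exponent_Re_lower[of t "1/r"] t r1 unfolding M_exponent c0_def y_def by (simp add: mult.commute)
    qed (use By in simp)
    also have "\<dots> \<le> B y * cmod (1 - char M t)"
      using complex_Re_le_cmod[of "1 - char M t"] By by (intro mult_left_mono) auto
    finally show ?thesis using By by (simp add: y_def field_simps)
  qed
  then show ?thesis using c0 t0 by blast
qed

text \<open>Away from 0 the characteristic function differs from 1 and compactness gives a positive
  minimum, so the constant depends on R.\<close>

lemma char_lower: "\<exists>c0>0. \<forall>t. 0 < \<bar>t\<bar> \<longrightarrow> \<bar>t\<bar> \<le> R \<longrightarrow> c0 / B (1/\<bar>t\<bar>) \<le> cmod (1 - char M t)"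
proof -
  obtain c1 t0 where c1: "0 < c1" and t0: "0 < t0"
    and near: "\<And>t. 0 < \<bar>t\<bar> \<Longrightarrow> \<bar>t\<bar> \<le> t0 \<Longrightarrow> c1 / B (1/\<bar>t\<bar>) \<le> cmod (1 - char M t)"
    using char_lower_near_0 by blast
  \<comment> \<open>\<open>max R t0\<close> keeps the compact set nonempty when R is small.\<close>
  define K where "K = {-max R t0..-t0} \<union> {t0..max R t0}"
  have "\<exists>t\<in>K. \<forall>s\<in>K. cmod (1 - char M t) \<le> cmod (1 - char M s)"
    unfolding K_def
    by (intro continuous_attains_inf compact_Un compact_Icc continuous_on_norm continuous_on_diff continuous_on_const
        continuous_at_imp_continuous_on ballI isCont_char) auto
  then obtain t1 where t1: "t1 \<in> K" "\<And>s. s \<in> K \<Longrightarrow> cmod (1 - char M t1) \<le> cmod (1 - char M s)" by blast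
  define m where "m = cmod (1 - char M t1)"
  have "t1 \<noteq> 0" using t1(1) t0 by (auto simp: K_def)
  then have m: "0 < m" using M_char_ne_1[of t1] by (simp add: m_def)
  have "min c1 m / B (1/\<bar>t\<bar>) \<le> cmod (1 - char M t)" if t: "0 < \<bar>t\<bar>" "\<bar>t\<bar> \<le> R" for t
  proof -
    have B1: "1 \<le> B (1/\<bar>t\<bar>)" using t by (intro B_ge_1) auto
    show ?thesis
    proof (cases "\<bar>t\<bar> \<le> t0")
      case True
      have "min c1 m / B (1/\<bar>t\<bar>) \<le> c1 / B (1/\<bar>t\<bar>)" using B1 by (intro divide_right_mono) auto
      then show ?thesis using near[OF t(1) True] by linarith
    next
      case False
      have "min c1 m / B (1/\<bar>t\<bar>) \<le> m / 1" using B1 c1 m by (intro frac_le) auto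
      moreover have "t \<in> K" using False t by (auto simp: K_def)
      ultimately show ?thesis using t1(2)[of t] by (simp add: m_def)
    qed
  qed
  then show ?thesis using c1 m by (intro exI[of _ "min c1 m"]) auto
qed

text \<open>The majorant of the rescaled renewal integrand over the support of a test function,
  whose width in the variable u grows like y.\<close>

lemma inverse_char_bound:
  "\<exists>C>0. \<exists>y0>0. \<forall>y\<ge>y0. \<forall>u. u \<noteq> 0 \<longrightarrow> \<bar>u\<bar> \<le> R * y \<longrightarrow> 1 / (B y * cmod (1 - char M (u / y))) \<le> C * W u"
proof -
  \<comment> \<open>A positive radius, so that \<open>1 / R'\<close> is an admissible lower bound
    for \<open>y / \<bar>u\<bar>\<close> in \<open>B_scaled_W\<close>.\<close>
  define R' where "R' = max 1 R"
  obtain c0 where c0: "0 < c0"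
    and lower: "\<And>t. 0 < \<bar>t\<bar> \<Longrightarrow> \<bar>t\<bar> \<le> R' \<Longrightarrow> c0 / B (1/\<bar>t\<bar>) \<le> cmod (1 - char M t)"
    using char_lower by blast
  obtain C y0 where C: "0 < C" and y0: "0 < y0"
    and B: "\<And>y u. y0 \<le> y \<Longrightarrow> u \<noteq> 0 \<Longrightarrow> 1/R' \<le> y / \<bar>u\<bar> \<Longrightarrow> B (y / \<bar>u\<bar>) \<le> C * W u * B y"
  proof -
    have "0 < 1/R'" by (simp add: R'_def less_max_iff_disj)
    from B_scaled_W[OF this] show ?thesis using that by metis
  qed
  have "1 / (B y * cmod (1 - char M (u / y))) \<le> (C / c0) * W u" if y: "y0 \<le> y" and u: "u \<noteq> 0" "\<bar>u\<bar> \<le> R * y" for y u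
  proof -
    have ypos: "0 < y" using y y0 by simp
    have "R * y \<le> R' * y" using ypos by (intro mult_right_mono) (auto simp: R'_def)
    then have uR: "\<bar>u\<bar> \<le> R' * y" using u by simp
    have uy: "0 < \<bar>u / y\<bar>" "\<bar>u / y\<bar> \<le> R'" "1 / \<bar>u / y\<bar> = y / \<bar>u\<bar>" "1/R' \<le> y / \<bar>u\<bar>"
      using u ypos uR by (auto simp: abs_divide field_simps R'_def less_max_iff_disj)
    have By: "0 < B y" "0 < B (y / \<bar>u\<bar>)" using B_ge_1[OF ypos] B_ge_1[of "y / \<bar>u\<bar>"] ypos u by auto
    have "1 / (B y * cmod (1 - char M (u / y))) \<le> 1 / (B y * (c0 / B (y / \<bar>u\<bar>)))"
    proof (intro divide_left_mono mult_left_mono)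
      show "c0 / B (y / \<bar>u\<bar>) \<le> cmod (1 - char M (u / y))" using lower[OF uy(1,2)] unfolding uy(3) .
      with divide_pos_pos[OF c0 By(2)] have "0 < cmod (1 - char M (u / y))" by (rule less_le_trans)
      then show "0 < B y * cmod (1 - char M (u / y)) * (B y * (c0 / B (y / \<bar>u\<bar>)))" using By c0 by simp
    qed (use By in auto)
    also have "\<dots> = B (y / \<bar>u\<bar>) / (c0 * B y)" by simp
    also have "\<dots> \<le> (C * W u * B y) / (c0 * B y)" using B[OF y u(1) uy(4)] By c0 by (intro divide_right_mono) auto
    also have "\<dots> = (C / c0) * W u" using By by simp
    finally show ?thesis .
  qed
  then show ?thesis using C c0 y0 by (intro exI[of _ "C / c0"]) auto
qed

text \<open>The rescaled bound at the single level \<open>y0\<close> suffices: the singularity at 0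
  has exponent \<open>\<beta>1 < 1\<close>, and on a bounded range of u the exponent at infinity may
  be raised to 2.\<close>

sublocale transient_law M
proof
  fix R :: real
  obtain C y0 where C: "0 < C" and y0: "0 < y0"
    and le: "\<And>y u. y0 \<le> y \<Longrightarrow> u \<noteq> 0 \<Longrightarrow> \<bar>u\<bar> \<le> R * y \<Longrightarrow> 1 / (B y * cmod (1 - char M (u / y))) \<le> C * W u"
    using inverse_char_bound by blast
  let ?f = "\<lambda>t. indicator {-R..R} t / cmod (1 - char M t)"
  have By: "0 < B y0" using B_ge_1[OF y0] by simp
  have cb: "integrable lborel (\<lambda>u. (1 + (R * y0)\<^sup>2) * two_power \<beta>1 2 u)"
    using \<beta> by (intro integrable_mult_right integrable_two_power) auto
  have "integrable lborel (\<lambda>u. ?f (0 + (1/y0) * u))"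
  proof (rule Bochner_Integration.integrable_bound[OF integrable_mult_right[OF cb, of "B y0 * C"]])
    show "AE u in lborel. norm (?f (0 + (1/y0) * u)) \<le> norm (B y0 * C * ((1 + (R * y0)\<^sup>2) * two_power \<beta>1 2 u))"
      using AE_lborel_singleton[of 0]
    proof eventually_elim
      case (elim u)
      show ?case
      proof (cases "\<bar>u\<bar> \<le> R * y0")
        case True
        have "W u \<le> (1 + (R * y0)\<^sup>2) * two_power \<beta>1 2 u"
        proof (cases "\<bar>u\<bar> \<le> 1")
          case True
          have "1 * \<bar>u\<bar> powr -\<beta>1 \<le> (1 + (R * y0)\<^sup>2) * \<bar>u\<bar> powr -\<beta>1" by (intro mult_right_mono) auto
          then show ?thesis using True by (simp add: two_power_def)
        next
          case False
          have "\<bar>u\<bar> powr -\<beta>2 \<le> \<bar>u\<bar> powr 0" using False \<beta> by (intro powr_mono) auto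
          also have "\<dots> \<le> (1 + (R * y0)\<^sup>2) * \<bar>u\<bar> powr -2"
          proof -
            have "\<bar>u\<bar>\<^sup>2 \<le> (R * y0)\<^sup>2" using True by (intro power_mono) auto
            then show ?thesis using elim by (simp add: powr_minus_divide)
          qed
          finally show ?thesis using False by (simp add: two_power_def)
        qed
        then have "B y0 * (C * W u) \<le> B y0 * (C * ((1 + (R * y0)\<^sup>2) * two_power \<beta>1 2 u))"
          using C By by (intro mult_left_mono) auto
        moreover have "1 / cmod (1 - char M (u / y0)) = B y0 * (1 / (B y0 * cmod (1 - char M (u / y0))))"
          using By by simp
        moreover have "B y0 * (1 / (B y0 * cmod (1 - char M (u / y0)))) \<le> B y0 * (C * W u)"
          using le[of y0 u] elim True By by (intro mult_left_mono) auto
        ultimately have "1 / cmod (1 - char M (u / y0)) \<le> B y0 * C * ((1 + (R * y0)\<^sup>2) * two_power \<beta>1 2 u)" by simp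
        moreover have "norm (?f (0 + (1/y0) * u)) \<le> 1 / cmod (1 - char M (u / y0))"
          by (auto simp: indicator_def)
        moreover have "B y0 * C * ((1 + (R * y0)\<^sup>2) * two_power \<beta>1 2 u) \<le> norm (B y0 * C * ((1 + (R * y0)\<^sup>2) * two_power \<beta>1 2 u))"
          by simp
        ultimately show ?thesis by linarith
      next
        case False
        then have "u / y0 \<notin> {-R..R}" using y0 by (auto simp: field_simps abs_le_iff)
        then show ?thesis by simp
      qed
    qed
  qed measurable
  then show "integrable lborel ?f"
    using y0 by (subst (asm) lborel_integrable_real_affine_iff) auto
qed (use M_nonneg M_char_ne_1 in auto)

end

section \<open>Semistable Levy exponents\<close>

lemma filterlim_powr_neg_at_right_0:
  "0 < a \<Longrightarrow> filterlim (\<lambda>x::real. x powr (-a)) at_top (at_right 0)"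
proof -
  assume a: "0 < a"
  have "filterlim (\<lambda>x::real. - ln x) at_top (at_right 0)"
    using ln_at_0 by (simp add: filterlim_uminus_at_bot)
  then have "filterlim (\<lambda>x::real. a * - ln x) at_top (at_right 0)"
    by (intro filterlim_tendsto_pos_mult_at_top[OF tendsto_const a])
  from filterlim_compose[OF exp_at_top this]
  show ?thesis
    by (rule filterlim_cong[THEN iffD1, rotated -1, OF _ refl refl])
      (rule eventually_mono[OF eventually_at_right_less[of 0]], simp add: powr_def)
qed

locale semistable_levy =
  fixes \<alpha> c a0 b0 :: real and MR :: "real \<Rightarrow> real"
  assumes \<alpha>: "0 < \<alpha>" "\<alpha> < 1" and c_gt_1: "1 < c"
    and MR_ge: "0 < a0" "\<And>x. 0 < x \<Longrightarrow> a0 \<le> MR x"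
    and MR_le: "\<And>x. 0 < x \<Longrightarrow> MR x \<le> b0"
    and MR_rc: "\<And>x. 0 < x \<Longrightarrow> continuous (at_right x) MR"
    and MR_per: "\<And>x. 0 < x \<Longrightarrow> MR (c powr (1/\<alpha>) * x) = MR x"
    and MR_anti: "antimono_on {0<..} (\<lambda>x. MR x * x powr (-\<alpha>))"
begin

definition levy_tail :: "real \<Rightarrow> real \<Rightarrow> real" where
  "levy_tail s x = x powr (-\<alpha>) * MR (s powr (1/\<alpha>) * x)"

lemma levy_tail_scale:
  assumes "0 < s" "0 < r" "0 < x"
  shows "levy_tail (s * r) x = r * levy_tail s (r powr (1/\<alpha>) * x)"
  using assms \<alpha> by (simp add: levy_tail_def powr_mult powr_powr powr_minus mult_ac)

lemma levy_tail_periodic: "0 < s \<Longrightarrow> 0 < x \<Longrightarrow> levy_tail (c * s) x = levy_tail s x"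
  using MR_per[of "s powr (1/\<alpha>) * x"] c_gt_1 by (simp add: levy_tail_def powr_mult mult.assoc)

lemma levy_tail_ge: "0 < s \<Longrightarrow> 0 < x \<Longrightarrow> a0 * x powr (-\<alpha>) \<le> levy_tail s x"
  using MR_ge by (simp add: levy_tail_def mult.commute)

lemma levy_tail_le: "0 < s \<Longrightarrow> 0 < x \<Longrightarrow> levy_tail s x \<le> b0 * x powr (-\<alpha>)"
  using MR_le by (simp add: levy_tail_def mult.commute)

lemma a0_le_b0: "a0 \<le> b0" "0 < b0"
  using MR_ge(1) order_trans[OF MR_ge(2) MR_le, of 1] by auto

lemma levy_tail_nonneg: "0 < s \<Longrightarrow> 0 < x \<Longrightarrow> 0 \<le> levy_tail s x"
  using levy_tail_ge[of s x] MR_ge(1) by (auto intro: order_trans[rotated])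

lemma levy_tail_antimono:
  assumes "0 < s" "0 < x" "x \<le> y" shows "levy_tail s y \<le> levy_tail s x"
proof -
  define d where "d = s powr (1/\<alpha>)"
  have d: "0 < d" using assms by (simp add: d_def)
  have eq: "levy_tail s z = d powr \<alpha> * (MR (d * z) * (d * z) powr (-\<alpha>))" if "0 < z" for z
    using that d by (simp add: levy_tail_def powr_mult powr_minus d_def)
  have "MR (d * y) * (d * y) powr (-\<alpha>) \<le> MR (d * x) * (d * x) powr (-\<alpha>)"
    using assms d MR_anti by (auto simp: monotone_on_def)
  then show ?thesis using assms by (simp add: eq mult_left_mono)
qed

lemma levy_tail_right_cont:
  assumes "0 < s" "0 < x" shows "continuous (at_right x) (levy_tail s)"
proof -
  define d where "d = s powr (1/\<alpha>)"
  have d: "0 < d" using assms by (simp add: d_def)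
  have "filterlim (\<lambda>x. d * x) (at_right (d * x)) (at_right x)"
    unfolding filterlim_at
    using d by (auto intro!: tendsto_intros eventually_mono[OF eventually_at_right_less[of x]])
  moreover have "(MR \<longlongrightarrow> MR (d * x)) (at_right (d * x))"
    using MR_rc[of "d * x"] assms d by (simp add: continuous_within)
  ultimately have "((\<lambda>x. MR (d * x)) \<longlongrightarrow> MR (d * x)) (at_right x)"
    by (rule filterlim_compose[rotated])
  then show ?thesis
    unfolding continuous_within levy_tail_def d_def[symmetric] using assms by (intro tendsto_intros) auto
qed

lemma levy_measure_props:
  assumes s: "0 < s"
  shows "sets (levy_measure \<alpha> MR s) = sets borel" "emeasure (levy_measure \<alpha> MR s) {..0} = 0"
    "0 < x \<Longrightarrow> emeasure (levy_measure \<alpha> MR s) {x<..} = ennreal (levy_tail s x)"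
proof -
  have top: "filterlim (levy_tail s) at_top (at_right 0)"
  proof (rule filterlim_at_top_mono)
    show "filterlim (\<lambda>x. a0 * x powr (-\<alpha>)) at_top (at_right 0)"
      by (intro filterlim_tendsto_pos_mult_at_top[OF tendsto_const MR_ge(1)] filterlim_powr_neg_at_right_0 \<alpha>)
    show "\<forall>\<^sub>F x in at_right 0. a0 * x powr - \<alpha> \<le> levy_tail s x"
      by (rule eventually_mono[OF eventually_at_right_less[of 0]]) (rule levy_tail_ge[OF s])
  qed
  have zero: "(levy_tail s \<longlongrightarrow> 0) at_top"
  proof (rule tendsto_sandwich[of "\<lambda>_. 0" _ _ "\<lambda>x. b0 * x powr (-\<alpha>)"])
    have "((\<lambda>x. b0 * x powr (-\<alpha>)) \<longlongrightarrow> b0 * 0) at_top"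
      using \<alpha> by (intro tendsto_intros tendsto_neg_powr filterlim_ident) auto
    then show "((\<lambda>x. b0 * x powr (-\<alpha>)) \<longlongrightarrow> 0) at_top" by simp
    show "\<forall>\<^sub>F x in at_top. 0 \<le> levy_tail s x"
      by (rule eventually_mono[OF eventually_gt_at_top[of 0]]) (rule levy_tail_nonneg[OF s])
    show "\<forall>\<^sub>F x in at_top. levy_tail s x \<le> b0 * x powr - \<alpha>"
      by (rule eventually_mono[OF eventually_gt_at_top[of 0]]) (rule levy_tail_le[OF s])
  qed simp
  have eq: "levy_measure \<alpha> MR s = tail_measure (levy_tail s)"
    by (simp add: levy_measure_def levy_tail_def[abs_def])
  note tm = tail_measure[of "levy_tail s", OF levy_tail_antimono[OF s] levy_tail_right_cont[OF s] top zero]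
  show "sets (levy_measure \<alpha> MR s) = sets borel" "emeasure (levy_measure \<alpha> MR s) {..0} = 0"
    "0 < x \<Longrightarrow> emeasure (levy_measure \<alpha> MR s) {x<..} = ennreal (levy_tail s x)"
    unfolding eq by (rule tm(1), assumption+, rule tm(2), assumption+, rule tm(3))
qed

lemma levy_measure_periodic: "0 < s \<Longrightarrow> levy_measure \<alpha> MR (c * s) = levy_measure \<alpha> MR s"
  unfolding levy_measure_def tail_measure_def levy_tail_def[symmetric]
  using levy_tail_periodic by (simp cong: conj_cong)

lemma levy_tail_measurable:
  assumes "0 < s" shows "(\<lambda>x. indicator {0<..r} x * levy_tail s x) \<in> borel_measurable borel"
proof -
  have "mono_on {0<..r} (\<lambda>x. - levy_tail s x)"
    using levy_tail_antimono[OF assms] by (auto simp: mono_on_def)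
  from borel_measurable_mono_on_fnc[OF this]
  have "(\<lambda>x. indicator {0<..r} x *\<^sub>R - levy_tail s x) \<in> borel_measurable borel"
    by (subst (asm) borel_measurable_restrict_space_iff) auto
  then have "(\<lambda>x. - (indicator {0<..r} x *\<^sub>R - levy_tail s x)) \<in> borel_measurable borel" by measurable
  then show ?thesis by simp
qed

lemma integrable_powr_Ioc: "integrable lborel (\<lambda>x. indicator {0<..r} x * x powr (-\<alpha>))"
proof -
  have "(\<lambda>x. x powr (-\<alpha>)) absolutely_integrable_on {0<..max 0 r}"
    using \<alpha> by (intro nonnegative_absolutely_integrable_1 integrable_on_powr_from_0') auto
  then have "integrable lborel (\<lambda>x. indicator {0<..max 0 r} x *\<^sub>R (x powr (-\<alpha>)))"
    unfolding set_integrable_def by (subst (asm) integrable_completion) measurable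
  moreover have "{0<..max 0 r} = {0<..r}" by auto
  ultimately show ?thesis by simp
qed

lemma integrable_levy_tail:
  assumes s: "0 < s" shows "integrable lborel (\<lambda>x. indicator {0<..r} x * levy_tail s x)"
proof (rule Bochner_Integration.integrable_bound[OF integrable_mult_right[OF integrable_powr_Ioc[of r], of b0]])
  show "AE x in lborel. norm (indicator {0<..r} x * levy_tail s x) \<le> norm (b0 * (indicator {0<..r} x * x powr - \<alpha>))"
    using levy_tail_le[OF s] levy_tail_nonneg[OF s] a0_le_b0 by (intro AE_I2) (auto simp: indicator_def)
qed (use levy_tail_measurable[OF s] in simp)

lemma halfline_levy_measure:
  assumes s: "0 < s" shows "halfline_measure (levy_measure \<alpha> MR s) (levy_tail s)"
proof -
  note lp = levy_measure_props[OF s]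
  have sp: "space (levy_measure \<alpha> MR s) = UNIV" using sets_eq_imp_space_eq[OF lp(1)] by simp
  show ?thesis
  proof
    define C where "C = insert {..0} (range (\<lambda>n. {1 / real (Suc n)<..}))"
    show "\<exists>C. countable C \<and> C \<subseteq> sets (levy_measure \<alpha> MR s) \<and> \<Union>C = space (levy_measure \<alpha> MR s)
        \<and> (\<forall>a\<in>C. emeasure (levy_measure \<alpha> MR s) a \<noteq> \<infinity>)"
    proof (intro exI[of _ C] conjI)
      show "\<Union>C = space (levy_measure \<alpha> MR s)"
      proof (intro antisym subsetI)
        fix x :: real
        show "x \<in> \<Union>C"
        proof (cases "x \<le> 0")
          case False
          then obtain n where "inverse (real (Suc n)) < x" using reals_Archimedean[of x] by auto
          then show ?thesis by (auto simp: C_def inverse_eq_divide)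
        qed (auto simp: C_def)
      qed (simp add: sp)
      show "\<forall>a\<in>C. emeasure (levy_measure \<alpha> MR s) a \<noteq> \<infinity>"
        using lp(2) lp(3)[of "1 / real (Suc _)"] by (auto simp: C_def)
    qed (auto simp: C_def lp)
    have "emeasure (levy_measure \<alpha> MR s) {..<0} \<le> emeasure (levy_measure \<alpha> MR s) {..0}"
      by (intro emeasure_mono) (auto simp: lp)
    then show "emeasure (levy_measure \<alpha> MR s) {..<0} = 0" using lp(2) by simp
  qed (use lp levy_tail_nonneg[OF s] integrable_levy_tail[OF s] in auto)
qed

definition psi :: "real \<Rightarrow> real \<Rightarrow> complex" where
  "psi s t = (CLINT x|levy_measure \<alpha> MR s. iexp (t * x) - 1)"

lemma psi_eq: "0 < s \<Longrightarrow> halfline_measure.exponent (levy_measure \<alpha> MR s) t = psi s t"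
  by (simp add: halfline_measure.exponent_def[OF halfline_levy_measure] psi_def)

lemma psi_periodic: "0 < s \<Longrightarrow> psi (c * s) = psi s"
  by (simp add: psi_def[abs_def] levy_measure_periodic)

text \<open>The tails lie between two fixed multiples of \<open>x powr (-\<alpha>)\<close>, so the
  mass between \<open>\<kappa> / \<bar>t\<bar>\<close> and \<open>1 / \<bar>t\<bar>\<close> is
  bounded below uniformly in the parameter s.\<close>

lemma psi_lower: "\<exists>\<kappa>>0. \<forall>s>0. \<forall>t. \<kappa> * \<bar>t\<bar> powr \<alpha> \<le> - Re (psi s t)"
proof -
  \<comment> \<open>With \<open>\<kappa> powr (-\<alpha>) = q\<close> the lower tail bound at
    \<open>\<kappa> / \<bar>t\<bar>\<close> beats the upper one at \<open>1 / \<bar>t\<bar>\<close>,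
    since \<open>a0 * q - b0 \<ge> 1\<close>; the summand 2 ensures \<open>q > 1\<close>.\<close>
  define q where "q = (b0 + 1) / a0 + 2"
  have q: "1 < q" "b0 + 1 \<le> a0 * q" using a0_le_b0 MR_ge(1) by (auto simp: q_def field_simps)
  define \<kappa> where "\<kappa> = q powr (-1/\<alpha>)"
  have "q powr (-1/\<alpha>) < q powr 0" using q \<alpha> by (intro powr_less_mono) (auto simp: field_simps)
  then have \<kappa>: "0 < \<kappa>" "\<kappa> < 1" "\<kappa> powr (-\<alpha>) = q" using q \<alpha> by (auto simp: \<kappa>_def powr_powr)
  have "cos \<kappa> < cos 0" using \<kappa> pi_gt3 by (intro cos_monotone_0_pi) auto
  then have pos: "0 < 1 - cos \<kappa>" by simp
  have "(1 - cos \<kappa>) * \<bar>t\<bar> powr \<alpha> \<le> - Re (psi s t)" if s: "0 < s" for s t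
  proof (cases "t = 0")
    case False
    interpret N: halfline_measure "levy_measure \<alpha> MR s" "levy_tail s" by (rule halfline_levy_measure[OF s])
    have "\<bar>t\<bar> powr \<alpha> * 1 \<le> \<bar>t\<bar> powr \<alpha> * (a0 * q - b0)" using q by (intro mult_left_mono) auto
    also have "\<dots> = a0 * (\<kappa> / \<bar>t\<bar>) powr (-\<alpha>) - b0 * (1 / \<bar>t\<bar>) powr (-\<alpha>)"
      using False \<kappa> by (simp add: powr_divide powr_minus_divide algebra_simps flip: \<kappa>(3))
    also have "\<dots> \<le> levy_tail s (\<kappa> / \<bar>t\<bar>) - levy_tail s (1 / \<bar>t\<bar>)"
      using levy_tail_ge[OF s, of "\<kappa> / \<bar>t\<bar>"] levy_tail_le[OF s, of "1 / \<bar>t\<bar>"] False \<kappa> by (intro diff_mono) auto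
    finally have "(1 - cos \<kappa>) * \<bar>t\<bar> powr \<alpha> \<le> (1 - cos \<kappa>) * (levy_tail s (\<kappa> / \<bar>t\<bar>) - levy_tail s (1 / \<bar>t\<bar>))"
      using pos by (intro mult_left_mono) auto
    also have "\<dots> \<le> - Re (psi s t)" using N.exponent_Re_lower[OF False \<kappa>(1,2)] by (simp add: psi_eq[OF s])
    finally show ?thesis .
  qed (simp add: psi_def)
  then show ?thesis using pos by blast
qed

text \<open>The modulus of continuity is a truncated mean, and the common upper tail bound makes it
  of order \<open>\<bar>r\<bar> powr \<alpha>\<close> uniformly in s.\<close>

lemma psi_increment: "\<exists>C>0. \<forall>s>0. \<forall>t r. cmod (psi s (t + r) - psi s t) \<le> C * \<bar>r\<bar> powr \<alpha>"
proof -
  define K where "K = (LBINT x. indicator {0<..1} x * x powr (-\<alpha>))"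
  have K: "0 \<le> K" unfolding K_def by (intro integral_nonneg_AE) auto
  have "cmod (psi s (t + r) - psi s t) \<le> (2 * b0 * K + 1) * \<bar>r\<bar> powr \<alpha>" if s: "0 < s" for s t r
  proof (cases "r = 0")
    case False
    interpret N: halfline_measure "levy_measure \<alpha> MR s" "levy_tail s" by (rule halfline_levy_measure[OF s])
    define q where "q = 1 / \<bar>r\<bar>"
    have q: "0 < q" using False by (simp add: q_def)
    have "N.cum_tail q \<le> (LBINT x. b0 * (indicator {0<..q} x * x powr (-\<alpha>)))"
      unfolding N.cum_tail_def
      using levy_tail_le[OF s] a0_le_b0
      by (intro integral_mono integrable_levy_tail[OF s] integrable_mult_right integrable_powr_Ioc) (auto simp: indicator_def)
    also have "\<dots> = b0 * (LBINT x. indicator {0<..q} x * x powr (-\<alpha>))" by simp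
    also have "(LBINT x. indicator {0<..q} x * x powr (-\<alpha>)) = \<bar>q\<bar> *\<^sub>R (LBINT x. indicator {0<..q} (0 + q * x) * (0 + q * x) powr (-\<alpha>))"
      using q by (intro lborel_integral_real_affine) auto
    also have "(LBINT x. indicator {0<..q} (0 + q * x) * (0 + q * x) powr (-\<alpha>)) = (LBINT x. q powr (-\<alpha>) * (indicator {0<..1} x * x powr (-\<alpha>)))"
      using q by (intro Bochner_Integration.integral_cong) (auto simp: indicator_def powr_mult zero_less_mult_iff)
    also have "\<dots> = q powr (-\<alpha>) * K" by (simp add: K_def)
    finally have "\<bar>r\<bar> * N.cum_tail q \<le> \<bar>r\<bar> * (b0 * (q * (q powr (-\<alpha>) * K)))"
      using q by (intro mult_left_mono) auto
    also have "\<dots> = b0 * K * \<bar>r\<bar> powr \<alpha>" using False by (simp add: q_def powr_divide powr_minus_divide)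
    finally have "2 * (\<bar>r\<bar> * N.cum_tail (1/\<bar>r\<bar>)) \<le> 2 * b0 * K * \<bar>r\<bar> powr \<alpha>" by (simp add: q_def)
    moreover have "cmod (psi s (t + r) - psi s t) \<le> 2 * (\<bar>r\<bar> * N.cum_tail (1/\<bar>r\<bar>))"
      using N.exponent_diff[OF False, of t] by (simp add: psi_eq[OF s])
    moreover have "0 \<le> \<bar>r\<bar> powr \<alpha>" by simp
    ultimately show ?thesis unfolding distrib_right by linarith
  qed simp
  moreover have "0 < 2 * b0 * K + 1" using K a0_le_b0 by (simp add: add_nonneg_pos)
  ultimately show ?thesis by blast
qed

lemma isCont_psi:
  assumes s: "0 < s" shows "isCont (psi s) t"
proof -
  obtain C where C: "\<And>t r. cmod (psi s (t + r) - psi s t) \<le> C * \<bar>r\<bar> powr \<alpha>" using psi_increment s by blast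
  have "((\<lambda>r::real. C * \<bar>r\<bar> powr \<alpha>) \<longlongrightarrow> C * \<bar>0\<bar> powr \<alpha>) (at 0)"
    using \<alpha> by (intro tendsto_intros tendsto_powr') auto
  then have g: "((\<lambda>r::real. C * \<bar>r\<bar> powr \<alpha>) \<longlongrightarrow> 0) (at 0)" using \<alpha> by simp
  have "((\<lambda>r. psi s (t + r) - psi s t) \<longlongrightarrow> 0) (at 0)"
    by (rule Lim_null_comparison[OF _ g]) (use C in simp)
  then show ?thesis by (simp add: isCont_iff LIM_zero_iff)
qed

text \<open>The Levy measures are given through their tails, and the tails scale. The truncated
  integrals therefore scale exactly by substitution, and the truncation errors vanish as R
  grows.\<close>

lemma psi_scale:
  assumes s: "0 < s" and r: "0 < r" shows "psi (s * r) t = r * psi s (t * r powr (-1/\<alpha>))"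
proof -
  define d where "d = r powr (1/\<alpha>)"
  define t' where "t' = t * r powr (-1/\<alpha>)"
  have d: "0 < d" "d * t' = t" using r by (auto simp: d_def t'_def powr_minus field_simps)
  have sr: "0 < s * r" using s r by simp
  interpret N: halfline_measure "levy_measure \<alpha> MR s" "levy_tail s" by (rule halfline_levy_measure[OF s])
  interpret N': halfline_measure "levy_measure \<alpha> MR (s * r)" "levy_tail (s * r)" by (rule halfline_levy_measure[OF sr])
  define I where "I s t R = (CLBINT u. indicator {0<..R} u *\<^sub>R (\<i> * of_real t * iexp (t * u) * of_real (levy_tail s u)))" for s t R :: real
  have I: "I (s * r) t R = r * I s t' (d * R)" if R: "0 < R" for R
  proof -
    have "I s t' (d * R) = \<bar>d\<bar> *\<^sub>R (CLBINT u. indicator {0<..d * R} (0 + d * u) *\<^sub>R (\<i> * of_real t' * iexp (t' * (0 + d * u)) * of_real (levy_tail s (0 + d * u))))"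
      unfolding I_def using d by (intro lborel_integral_real_affine) auto
    then have "of_real r * I s t' (d * R) = (CLBINT u. of_real (r * d) * (indicator {0<..d * R} (0 + d * u) *\<^sub>R (\<i> * of_real t' * iexp (t' * (0 + d * u)) * of_real (levy_tail s (0 + d * u)))))"
      using d by (subst integral_mult_right_zero) (simp add: scaleR_conv_of_real mult.assoc)
    also have "\<dots> = I (s * r) t R"
      unfolding I_def
    proof (intro Bochner_Integration.integral_cong refl)
      fix u
      show "of_real (r * d) * (indicator {0<..d * R} (0 + d * u) *\<^sub>R (\<i> * of_real t' * iexp (t' * (0 + d * u)) * of_real (levy_tail s (0 + d * u)))) =
          indicator {0<..R} u *\<^sub>R (\<i> * of_real t * iexp (t * u) * of_real (levy_tail (s * r) u))"
      proof (cases "u \<in> {0<..R}")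
        case True
        have e: "t' * (d * u) = t * u" using d(2) by (metis mult.assoc mult.commute)
        have "of_real (r * d) * (\<i> * of_real t' * iexp (t * u) * of_real (levy_tail s (d * u)))
           = \<i> * of_real (d * t') * iexp (t * u) * of_real (r * levy_tail s (d * u))"
          by simp
        also have "\<dots> = \<i> * of_real t * iexp (t * u) * of_real (levy_tail (s * r) u)"
          using levy_tail_scale[OF s r, of u] True unfolding d(2) by (simp add: d_def)
        finally have fin: "of_real (r * d) * (\<i> * of_real t' * iexp (t * u) * of_real (levy_tail s (d * u)))
           = \<i> * of_real t * iexp (t * u) * of_real (levy_tail (s * r) u)" .
        have ind: "indicator {0<..d * R} (d * u) = (1::real)" "indicator {0<..R} u = (1::real)"
          using True d by (auto simp: indicator_def)
        show ?thesis unfolding add_0_left e ind scaleR_one by (rule fin)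
      next
        case False
        then have "d * u \<notin> {0<..d * R}" using d by (auto simp: zero_less_mult_iff)
        then show ?thesis using False by simp
      qed
    qed
    finally show ?thesis by simp
  qed
  have bound: "cmod (psi (s * r) t - r * psi s t') \<le> 4 * levy_tail (s * r) R" if R: "0 < R" for R
  proof -
    have 1: "cmod (psi (s * r) t - I (s * r) t R) \<le> 2 * levy_tail (s * r) R"
      using N'.exponent_truncate[OF R, of t] by (simp add: psi_eq[OF sr] I_def)
    have "cmod (psi s t' - I s t' (d * R)) \<le> 2 * levy_tail s (d * R)"
      using N.exponent_truncate[of "d * R" t'] R d by (simp add: psi_eq[OF s] I_def)
    then have "r * cmod (psi s t' - I s t' (d * R)) \<le> r * (2 * levy_tail s (d * R))"
      using r by (intro mult_left_mono) auto
    then have 2: "cmod (r * psi s t' - r * I s t' (d * R)) \<le> 2 * levy_tail (s * r) R"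
      using r levy_tail_scale[OF s r R] by (simp add: norm_mult d_def flip: right_diff_distrib)
    have "psi (s * r) t - r * psi s t' = (psi (s * r) t - I (s * r) t R) - (r * psi s t' - r * I s t' (d * R))"
      by (simp add: I[OF R])
    then have "cmod (psi (s * r) t - r * psi s t') \<le> cmod (psi (s * r) t - I (s * r) t R) + cmod (r * psi s t' - r * I s t' (d * R))"
      by (metis norm_triangle_ineq4)
    with 1 2 show ?thesis by linarith
  qed
  have "((\<lambda>R. 4 * (b0 * R powr (-\<alpha>))) \<longlongrightarrow> 4 * (b0 * 0)) at_top"
    using \<alpha> by (intro tendsto_intros tendsto_neg_powr filterlim_ident) auto
  moreover have "\<forall>\<^sub>F R in at_top. cmod (psi (s * r) t - r * psi s t') \<le> 4 * (b0 * R powr (-\<alpha>))"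
    using eventually_gt_at_top[of 0]
    by eventually_elim (use bound levy_tail_le[OF sr] in \<open>force intro: order_trans\<close>)
  ultimately have "cmod (psi (s * r) t - r * psi s t') \<le> 4 * (b0 * 0)"
    by (rule tendsto_lowerbound) simp
  then show ?thesis by (simp add: t'_def)
qed

end

section \<open>Convergence of exponents\<close>

text \<open>Translation by the half-period \<open>pi / x\<close> multiplies the transform at x by
  -1. Averaging the two forms replaces the size of \<open>f\<close> by its increments.\<close>

lemma half_shift:
  assumes f: "integrable lborel f" and x: "x \<noteq> 0"
  shows "fourier f x = fourier (\<lambda>t. (f t - f (t + pi / x)) / 2) x"
proof -
  have int: "integrable lborel (\<lambda>t. f (t + pi / x))"
    using lborel_integrable_real_affine[OF f, of 1 "pi / x"] by (simp add: add.commute)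
  have "fourier (\<lambda>t. f (t - (- (pi / x)))) x = iexp (- (pi / x) * x) * fourier f x"
    by (rule fourier_shift)
  also have "iexp (- (pi / x) * x) = -1" using x by (simp add: exp_minus)
  finally have "fourier (\<lambda>t. f (t + pi / x)) x = - fourier f x" by simp
  moreover have "fourier (\<lambda>t. (1/2) * (f t + (-1) * f (t + pi / x))) x = (1/2) * (fourier f x + (-1) * fourier (\<lambda>t. f (t + pi / x)) x)"
    using f int by (simp only: fourier_cmult fourier_add integrable_mult_right)
  moreover have "(\<lambda>t. (1/2) * (f t + (-1) * f (t + pi / x))) = (\<lambda>t. (f t - f (t + pi / x)) / 2)"
    by auto
  ultimately show ?thesis by simp
qed

lemma exp_ge_power: "0 \<le> x \<Longrightarrow> 0 < n \<Longrightarrow> (x / real n) ^ n \<le> exp x"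
proof -
  assume x: "0 \<le> x" and n: "0 < n"
  have "x / real n \<le> exp (x / real n)" using exp_ge_add_one_self[of "x / real n"] by linarith
  then have "(x / real n) ^ n \<le> exp (x / real n) ^ n"
    using x by (intro power_mono) auto
  also have "\<dots> = exp x" using n by (simp add: exp_of_nat_mult[symmetric])
  finally show ?thesis .
qed

lemma integrable_exp_neg_powr:
  assumes \<kappa>: "0 < \<kappa>" and a: "0 < a"
  shows "integrable lborel (\<lambda>t::real. exp (- (\<kappa> * \<bar>t\<bar> powr a)))"
proof -
  \<comment> \<open>The n-th order lower bound for the exponential then gives decay faster than
    \<open>\<bar>t\<bar> powr (-2)\<close>.\<close>
  obtain n :: nat where n: "2 / a < real n" using reals_Archimedean2 by blast
  have n0: "0 < n" using n a by (cases n) (auto simp: divide_less_0_iff)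
  have na: "2 < real n * a" using n a by (simp add: field_simps)
  define K where "K = (real n / \<kappa>) ^ n"
  have K: "0 < K" using n0 \<kappa> by (simp add: K_def)
  have int: "integrable lborel (\<lambda>t. (1 + K) * two_power (1/2) 2 t)"
    by (intro integrable_mult_right integrable_two_power) auto
  show ?thesis
  proof (rule Bochner_Integration.integrable_bound[OF int])
    show "AE t in lborel. norm (exp (- (\<kappa> * \<bar>t\<bar> powr a))) \<le> norm ((1 + K) * two_power (1/2) 2 t)"
      using AE_lborel_singleton[of 0]
    proof eventually_elim
      case (elim t)
      have "exp (- (\<kappa> * \<bar>t\<bar> powr a)) \<le> (1 + K) * two_power (1/2) 2 t"
      proof (cases "\<bar>t\<bar> \<le> 1")
        case True
        have "exp (- (\<kappa> * \<bar>t\<bar> powr a)) \<le> 1 * 1" using \<kappa> by simp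
        also have "\<dots> \<le> (1 + K) * two_power (1/2) 2 t"
          using True elim powr_mono2'[of "-1/2" "\<bar>t\<bar>" 1] K by (intro mult_mono) (auto simp: two_power_def)
        finally show ?thesis .
      next
        case False
        have "\<bar>t\<bar> powr 2 \<le> \<bar>t\<bar> powr (a * real n)" using False na by (intro powr_mono) (auto simp: mult.commute)
        also have "\<dots> = (\<bar>t\<bar> powr a) ^ n" using False by (simp add: powr_powr[symmetric] powr_realpow)
        also have "\<dots> = K * (\<kappa> * \<bar>t\<bar> powr a / real n) ^ n"
          using \<kappa> n0 by (simp add: K_def power_divide power_mult_distrib)
        also have "\<dots> \<le> K * exp (\<kappa> * \<bar>t\<bar> powr a)"
          using K \<kappa> n0 by (intro mult_left_mono exp_ge_power) auto
        finally have "exp (- (\<kappa> * \<bar>t\<bar> powr a)) \<le> K * \<bar>t\<bar> powr (-2)"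
          using elim by (simp add: exp_minus powr_minus_divide field_simps)
        also have "\<dots> \<le> (1 + K) * \<bar>t\<bar> powr (-2)" by (intro mult_right_mono) auto
        finally show ?thesis using False by (simp add: two_power_def)
      qed
      then show ?case using K two_power_nonneg[of "1/2" 2 t] by (simp add: abs_of_nonneg)
    qed
  qed auto
qed

text \<open>With both bases in the unit disc, the m-th powers differ by at most m times the
  difference of the bases, and this is \<open>m n * z n\<close> times a factor tending to 0. The
  bound on the bases is what characteristic functions provide.\<close>

lemma tendsto_one_plus_power_exp:
  fixes z :: "nat \<Rightarrow> complex" and m :: "nat \<Rightarrow> nat"
  assumes m: "filterlim m at_top sequentially" and lim: "(\<lambda>n. of_nat (m n) * z n) \<longlonglongrightarrow> w"
    and le: "\<And>n. cmod (1 + z n) \<le> 1"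
  shows "(\<lambda>n. (1 + z n) ^ m n) \<longlonglongrightarrow> exp w"
proof -
  define f where "f x = (if x = 0 then 0 else (exp x - 1) / x - 1)" for x :: complex
  have "((\<lambda>h. (exp (0 + h) - exp 0) / h) \<longlongrightarrow> exp 0) (at (0::complex))"
    using DERIV_exp[of "0::complex"] by (simp add: DERIV_def)
  then have "((\<lambda>h. (exp h - 1) / h) \<longlongrightarrow> 1) (at (0::complex))" by simp
  from tendsto_diff[OF this tendsto_const[of 1]]
  have "((\<lambda>h. (exp h - 1) / h - 1) \<longlongrightarrow> 0) (at (0::complex))" by simp
  then have "(f \<longlongrightarrow> 0) (at 0)"
    by (rule Lim_transform_eventually) (auto simp: f_def eventually_at_filter)
  then have f0: "isCont f 0" by (simp add: isCont_def f_def)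
  have m': "filterlim (\<lambda>n. of_nat (m n) :: complex) at_infinity sequentially"
    using filterlim_compose[OF tendsto_of_nat m] .
  have "(\<lambda>n. of_nat (m n) * z n / of_nat (m n)) \<longlonglongrightarrow> 0"
    by (rule tendsto_divide_0[OF lim m'])
  moreover have "\<forall>\<^sub>F n in sequentially. of_nat (m n) * z n / of_nat (m n) = z n"
    using m[unfolded filterlim_at_top, rule_format, of 1] by eventually_elim auto
  ultimately have z0: "z \<longlonglongrightarrow> 0" by (rule Lim_transform_eventually)
  have "(\<lambda>n. of_nat (m n) * z n * f (z n)) \<longlonglongrightarrow> w * f 0"
    by (intro tendsto_mult lim isCont_tendsto_compose[OF f0 z0])
  then have "(\<lambda>n. cmod (of_nat (m n) * z n * f (z n))) \<longlonglongrightarrow> 0"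
    by (intro tendsto_norm_zero) (simp add: f_def)
  moreover have eq: "of_nat (m n) * z n * f (z n) = of_nat (m n) * (exp (z n) - (1 + z n))" for n
    by (simp add: f_def field_simps)
  ultimately have lim0: "(\<lambda>n. real (m n) * cmod ((1 + z n) - exp (z n))) \<longlonglongrightarrow> 0"
    by (simp add: norm_mult norm_minus_commute)
  have "(\<lambda>n. (1 + z n) ^ m n - exp (z n) ^ m n) \<longlonglongrightarrow> 0"
  proof (rule Lim_null_comparison[OF always_eventually lim0], rule allI)
    fix n
    have "Re (1 + z n) \<le> 1" using complex_Re_le_cmod[of "1 + z n"] le[of n] by linarith
    then have "cmod (exp (z n)) \<le> 1" by simp
    then show "norm ((1 + z n) ^ m n - exp (z n) ^ m n) \<le> real (m n) * cmod (1 + z n - exp (z n))"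
      by (intro norm_power_diff le)
  qed
  moreover have "(\<lambda>n. exp (z n) ^ m n) \<longlonglongrightarrow> exp w"
    using tendsto_exp[OF lim] by (simp add: exp_of_nat_mult)
  ultimately show ?thesis using tendsto_add[of "\<lambda>n. (1 + z n) ^ m n - exp (z n) ^ m n" 0 sequentially "\<lambda>n. exp (z n) ^ m n" "exp w"] by simp
qed

text \<open>Truncation at 1 is subadditive, so the truncated mean of a sum is at most the sum of the
  truncated means. This yields tightness without moments.\<close>

lemma nn_integral_min_conv_power:
  assumes M: "real_distribution M"
  shows "(\<integral>\<^sup>+x. ennreal (min 1 (s * x)) \<partial>conv_power M n) \<le> of_nat n * (\<integral>\<^sup>+x. ennreal (min 1 (s * x)) \<partial>M)"
proof (induction n)
  case 0
  show ?case by (simp add: nn_integral_return)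
next
  case (Suc n)
  interpret M: real_distribution M by fact
  interpret N: real_distribution "conv_power M n" by (rule real_distribution_conv_power[OF M])
  have le: "ennreal (min 1 (s * (x + y))) \<le> ennreal (min 1 (s * x)) + ennreal (min 1 (s * y))" for x y :: real
  proof -
    \<comment> \<open>Negative values are cut off by \<open>ennreal\<close>; \<open>max 0\<close>
      makes this explicit, so that the inequality holds for all reals.\<close>
    have "ennreal (min 1 (s * (x + y))) \<le> ennreal (max 0 (min 1 (s * x)) + max 0 (min 1 (s * y)))"
      by (intro ennreal_leI) (auto simp: min_def max_def distrib_left)
    also have "\<dots> = ennreal (max 0 (min 1 (s * x))) + ennreal (max 0 (min 1 (s * y)))" by (intro ennreal_plus) auto
    finally show ?thesis by (simp add: max_def ennreal_neg split: if_splits)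
  qed
  have "(\<integral>\<^sup>+x. ennreal (min 1 (s * x)) \<partial>conv_power M (Suc n)) = (\<integral>\<^sup>+x. \<integral>\<^sup>+y. ennreal (min 1 (s * (x + y))) \<partial>conv_power M n \<partial>M)"
    unfolding conv_power.simps by (intro nn_integral_convolution) (auto intro: M.finite_measure_axioms N.finite_measure_axioms)
  also have "\<dots> \<le> (\<integral>\<^sup>+x. \<integral>\<^sup>+y. ennreal (min 1 (s * x)) + ennreal (min 1 (s * y)) \<partial>conv_power M n \<partial>M)"
    by (intro nn_integral_mono le)
  also have "\<dots> = (\<integral>\<^sup>+x. ennreal (min 1 (s * x)) \<partial>M) + (\<integral>\<^sup>+y. ennreal (min 1 (s * y)) \<partial>conv_power M n)"
    using N.emeasure_space_1 M.emeasure_space_1 by (simp add: nn_integral_add)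
  also have "\<dots> \<le> (\<integral>\<^sup>+x. ennreal (min 1 (s * x)) \<partial>M) + of_nat n * (\<integral>\<^sup>+x. ennreal (min 1 (s * x)) \<partial>M)"
    by (intro add_left_mono Suc)
  finally show ?case by (simp add: distrib_right)
qed

context semistable_renewal
begin

sublocale L: semistable_levy \<alpha> c a0 b0 MR
  using alpha c a0 b0 MR_right_cont MR_periodic MR_mono by unfold_locales auto

lemma countable_exceptional:
  assumes "0 < lam"
  shows "countable {x. 0 < x \<and> (\<not> isCont MR (lam powr (1/\<alpha>) * x) \<or> (\<exists>m::int. lam * x powr \<alpha> = c powr m))}"
proof (rule countable_subset)
  let ?d = "lam powr (1/\<alpha>)"
  show "{x. 0 < x \<and> (\<not> isCont MR (?d * x) \<or> (\<exists>m::int. lam * x powr \<alpha> = c powr m))}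
    \<subseteq> (\<lambda>z. z / ?d) ` {x. 0 < x \<and> \<not> isCont MR x} \<union> range (\<lambda>m::int. (c powr m / lam) powr (1/\<alpha>))"
  proof (intro subsetI, elim CollectE conjE disjE exE)
    fix x assume x: "0 < x" "\<not> isCont MR (?d * x)"
    then show "x \<in> (\<lambda>z. z / ?d) ` {x. 0 < x \<and> \<not> isCont MR x} \<union> range (\<lambda>m::int. (c powr m / lam) powr (1/\<alpha>))"
      using assms by (intro UnI1 image_eqI[of _ _ "?d * x"]) auto
  next
    fix x and m :: int assume x: "0 < x" "lam * x powr \<alpha> = c powr m"
    have "x = (x powr \<alpha>) powr (1/\<alpha>)" using x alpha by (simp add: powr_powr)
    also have "x powr \<alpha> = c powr m / lam" using x assms by (simp add: field_simps)
    finally show "x \<in> (\<lambda>z. z / ?d) ` {x. 0 < x \<and> \<not> isCont MR x} \<union> range (\<lambda>m::int. (c powr m / lam) powr (1/\<alpha>))"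
      by blast
  qed
  show "countable ((\<lambda>z. z / ?d) ` {x. 0 < x \<and> \<not> isCont MR x} \<union> range (\<lambda>m::int. (c powr m / lam) powr (1/\<alpha>)))"
    using countable_discont by auto
qed

lemma AE_isCont_nongeometric:
  assumes "0 < lam"
  shows "AE x in lborel. 0 < x \<longrightarrow> isCont MR (lam powr (1/\<alpha>) * x) \<and> (\<forall>m::int. lam * x powr \<alpha> \<noteq> c powr m)"
  using AE_not_in[OF countable_imp_null_set_lborel[OF countable_exceptional[OF assms]]]
  by eventually_elim auto

text \<open>On a bounded range the rescaled tails converge almost everywhere under an integrable
  majorant. Beyond R, the truncation identity leaves errors controlled by the tails at R.\<close>

lemma exponent_limit:
  assumes y: "filterlim y at_top sequentially" "\<And>j. 0 < y j"
    and N: "filterlim N at_top sequentially"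
    and lam: "(\<lambda>j. B (y j) / k (N j)) \<longlonglongrightarrow> lam" "0 < lam"
  shows "(\<lambda>j. of_real (B (y j)) * (char M (t / y j) - 1)) \<longlonglongrightarrow> L.psi lam t"
proof -
  obtain C y0 where C: "0 < C" and y0: "0 < y0" and tb: "\<And>y x. y0 \<le> y \<Longrightarrow> 0 < x \<Longrightarrow> B y * T (y * x) \<le> C * W x"
    using tail_scaled_bound by blast
  interpret N: halfline_measure "levy_measure \<alpha> MR lam" "L.levy_tail lam" by (rule L.halfline_levy_measure[OF lam(2)])
  have ev: "\<forall>\<^sub>F j in sequentially. y0 \<le> y j" using y(1) unfolding filterlim_at_top by blast
  define S where "S j = of_real (B (y j)) * (char M (t / y j) - 1)" for j
  define I where "I j R = (CLBINT v. indicator {0<..R} v *\<^sub>R (\<i> * of_real t * iexp (t * v) * of_real (B (y j) * T (y j * v))))" for j R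
  define J where "J R = (CLBINT v. indicator {0<..R} v *\<^sub>R (\<i> * of_real t * iexp (t * v) * of_real (L.levy_tail lam v)))" for R
  have SI: "cmod (S j - I j R) \<le> 2 * (B (y j) * T (y j * R))" if R: "0 < R" for j R
  proof -
    have By: "0 < B (y j)" using B_ge_1[OF y(2)[of j]] by simp
    have yR: "0 < y j * R" using y(2)[of j] R by simp
    let ?f = "\<lambda>u. indicator {0<..y j * R} u *\<^sub>R (\<i> * of_real (t / y j) * iexp (t / y j * u) * of_real (T u))"
    have "(CLBINT u. ?f u) = \<bar>y j\<bar> *\<^sub>R (CLBINT v. ?f (0 + y j * v))"
      using y(2)[of j] by (intro lborel_integral_real_affine) auto
    then have "of_real (B (y j)) * (CLBINT u. ?f u) = (CLBINT v. of_real (B (y j) * y j) * ?f (0 + y j * v))"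
      using y(2)[of j] by (subst integral_mult_right_zero) (simp add: scaleR_conv_of_real mult.assoc)
    also have "\<dots> = I j R"
      unfolding I_def
    proof (intro Bochner_Integration.integral_cong refl)
      fix v
      show "of_real (B (y j) * y j) * ?f (0 + y j * v) = indicator {0<..R} v *\<^sub>R (\<i> * of_real t * iexp (t * v) * of_real (B (y j) * T (y j * v)))"
      proof (cases "v \<in> {0<..R}")
        case True
        then have "y j * v \<in> {0<..y j * R}" using y(2)[of j] by auto
        moreover have "t / y j * (y j * v) = t * v" using y(2)[of j] by simp
        ultimately show ?thesis using True y(2)[of j] by (simp del: of_real_mult of_real_divide) (simp add: mult_ac)
      next
        case False
        then have "y j * v \<notin> {0<..y j * R}" using y(2)[of j] by (auto simp: zero_less_mult_iff)
        then show ?thesis using False by simp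
      qed
    qed
    finally have "S j - I j R = of_real (B (y j)) * (M.exponent (t / y j) - (CLBINT u. ?f u))"
      by (simp add: S_def M_exponent algebra_simps)
    then have "cmod (S j - I j R) = B (y j) * cmod (M.exponent (t / y j) - (CLBINT u. ?f u))"
      using By by (simp add: norm_mult)
    also have "\<dots> \<le> B (y j) * (2 * T (y j * R))"
      using By M.exponent_truncate[OF yR, of "t / y j"] by (intro mult_left_mono) auto
    finally show ?thesis by (simp only: mult.left_commute)
  qed
  have JP: "cmod (L.psi lam t - J R) \<le> 2 * L.levy_tail lam R" if "0 < R" for R
    using N.exponent_truncate[OF that, of t] by (simp add: L.psi_eq[OF lam(2)] J_def)
  have IJ: "(\<lambda>j. I j R) \<longlonglongrightarrow> J R" for R
  proof -
    obtain j0 where j0: "\<And>j. j0 \<le> j \<Longrightarrow> y0 \<le> y j" using ev by (auto simp: eventually_sequentially)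
    have "(\<lambda>j. I (j + j0) R) \<longlonglongrightarrow> J R"
      unfolding I_def J_def
    proof (rule integral_dominated_convergence[where w = "\<lambda>v. \<bar>t\<bar> * C * (indicator {0<..R} v * W v)"])
      show "integrable lborel (\<lambda>v. \<bar>t\<bar> * C * (indicator {0<..R} v * W v))"
        by (intro integrable_mult_right integrable_W_Ioc)
      show "(\<lambda>v. indicator {0<..R} v *\<^sub>R (\<i> * of_real t * iexp (t * v) * of_real (L.levy_tail lam v))) \<in> borel_measurable lborel"
      proof -
        have "(\<lambda>v. \<i> * of_real t * iexp (t * v) * of_real (indicator {0<..R} v * L.levy_tail lam v)) \<in> borel_measurable borel"
          using L.levy_tail_measurable[OF lam(2), of R] by measurable
        moreover have "(\<lambda>v. \<i> * of_real t * iexp (t * v) * of_real (indicator {0<..R} v * L.levy_tail lam v))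
          = (\<lambda>v. indicator {0<..R} v *\<^sub>R (\<i> * of_real t * iexp (t * v) * of_real (L.levy_tail lam v)))"
          by (auto simp: indicator_def)
        ultimately show ?thesis by simp
      qed
      show "AE v in lborel. (\<lambda>j. indicator {0<..R} v *\<^sub>R (\<i> * of_real t * iexp (t * v) * of_real (B (y (j + j0)) * T (y (j + j0) * v))))
          \<longlonglongrightarrow> indicator {0<..R} v *\<^sub>R (\<i> * of_real t * iexp (t * v) * of_real (L.levy_tail lam v))"
        using AE_isCont_nongeometric[OF lam(2)]
      proof eventually_elim
        case (elim v)
        show ?case
        proof (cases "v \<in> {0<..R}")
          case True
          have "(\<lambda>j. B (y j) * T (y j * v)) \<longlonglongrightarrow> L.levy_tail lam v"
            unfolding L.levy_tail_def using True elim by (intro B_T_scaled_limit[OF y N lam]) auto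
          from LIMSEQ_ignore_initial_segment[OF this, of j0]
          show ?thesis by (intro tendsto_intros)
        qed simp
      qed
      fix j
      show "AE v in lborel. norm (indicator {0<..R} v *\<^sub>R (\<i> * of_real t * iexp (t * v) * of_real (B (y (j + j0)) * T (y (j + j0) * v))))
          \<le> \<bar>t\<bar> * C * (indicator {0<..R} v * W v)"
      proof (rule AE_I2)
        fix v
        show "norm (indicator {0<..R} v *\<^sub>R (\<i> * of_real t * iexp (t * v) * of_real (B (y (j + j0)) * T (y (j + j0) * v))))
          \<le> \<bar>t\<bar> * C * (indicator {0<..R} v * W v)"
        proof (cases "v \<in> {0<..R}")
          case True
          have nn: "0 \<le> B (y (j + j0)) * T (y (j + j0) * v)"
            using B_ge_1[OF y(2)[of "j + j0"]] T_nonneg[of "y (j + j0) * v"] by (intro mult_nonneg_nonneg) auto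
          have "norm (indicator {0<..R} v *\<^sub>R (\<i> * of_real t * iexp (t * v) * of_real (B (y (j + j0)) * T (y (j + j0) * v))))
             = \<bar>t\<bar> * (B (y (j + j0)) * T (y (j + j0) * v))"
            using True norm_exp_i_times[of "t * v"]
            unfolding norm_scaleR norm_mult[of _ "of_real (B (y (j + j0)) * T (y (j + j0) * v))"] norm_of_real abs_of_nonneg[OF nn]
            by (simp add: norm_mult)
          also have "\<dots> \<le> \<bar>t\<bar> * (C * W v)"
            using True j0[of "j + j0"] tb[of "y (j + j0)" v] by (intro mult_left_mono) auto
          finally show ?thesis using True by simp
        qed simp
      qed
    qed measurable
    then show ?thesis by (rule LIMSEQ_offset)
  qed
  have "S \<longlonglongrightarrow> L.psi lam t"
  proof (rule tendstoI)
    \<comment> \<open>R is fixed first: the prelimit error is of order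
      \<open>R powr (-\<beta>2)\<close> uniformly in large j, the error of the limit of order
      \<open>R powr (-\<alpha>)\<close>.\<close>
    fix e :: real assume e: "0 < e"
    have "((\<lambda>R. 2 * (C * R powr (-\<beta>2)) + 2 * (b0 * R powr (-\<alpha>))) \<longlongrightarrow> 2 * (C * 0) + 2 * (b0 * 0)) at_top"
      using \<beta> alpha by (intro tendsto_intros tendsto_neg_powr filterlim_ident) auto
    then have "\<forall>\<^sub>F R in at_top. 2 * (C * R powr (-\<beta>2)) + 2 * (b0 * R powr (-\<alpha>)) < e/2"
      using e by (intro order_tendstoD(2)) auto
    with eventually_ge_at_top[of 1] have "\<forall>\<^sub>F R in at_top. 1 \<le> R \<and> 2 * (C * R powr (-\<beta>2)) + 2 * (b0 * R powr (-\<alpha>)) < e/2"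
      by eventually_elim auto
    then obtain R where R: "1 \<le> R" "2 * (C * R powr (-\<beta>2)) + 2 * (b0 * R powr (-\<alpha>)) < e/2"
      by (auto simp: eventually_at_top_linorder)
    have WR: "W R = R powr (-\<beta>2)" using R(1) by (auto simp: two_power_def)
    have "\<forall>\<^sub>F j in sequentially. dist (I j R) (J R) < e/2" using IJ e by (intro tendstoD) auto
    with ev show "\<forall>\<^sub>F j in sequentially. dist (S j) (L.psi lam t) < e"
    proof eventually_elim
      case (elim j)
      have "dist (S j) (L.psi lam t) \<le> dist (S j) (I j R) + (dist (I j R) (J R) + dist (J R) (L.psi lam t))"
        by (metis dist_triangle add_left_mono order_trans)
      moreover have "dist (S j) (I j R) \<le> 2 * (C * R powr (-\<beta>2))"
        using SI[of R j] tb[OF elim(1), of R] R(1) by (simp add: dist_norm WR)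
      moreover have "dist (J R) (L.psi lam t) \<le> 2 * (b0 * R powr (-\<alpha>))"
        using JP[of R] L.levy_tail_le[OF lam(2), of R] R(1) by (simp add: dist_norm norm_minus_commute)
      ultimately show ?case using elim(2) R(2) by linarith
    qed
  qed
  then show ?thesis by (simp add: S_def[abs_def])
qed

end

section \<open>Semistable laws and their densities\<close>

text \<open>Mean value estimate on a half-plane containing both points, where the derivative is
  bounded by the larger of the two exponentials, hence by their sum.\<close>

lemma norm_exp_diff_le:
  fixes a b :: complex
  shows "cmod (exp a - exp b) \<le> cmod (a - b) * (exp (Re a) + exp (Re b))"
proof -
  have "cmod (exp a - exp b) \<le> (exp (Re a) + exp (Re b)) * cmod (a - b)"
  proof (rule field_differentiable_bound[where S = "{z. Re z \<le> max (Re a) (Re b)}" and f' = exp])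
    show "convex {z. Re z \<le> max (Re a) (Re b)}" by (rule convex_halfspace_Re_le)
    fix z assume "z \<in> {z. Re z \<le> max (Re a) (Re b)}"
    then have "exp (Re z) \<le> exp (max (Re a) (Re b))" by simp
    also have "\<dots> \<le> exp (Re a) + exp (Re b)" by (simp add: max_def)
    finally show "cmod (exp z) \<le> exp (Re a) + exp (Re b)" by simp
  qed (auto intro: DERIV_subset[OF DERIV_exp])
  then show ?thesis by (simp only: mult.commute)
qed

context semistable_levy
begin

abbreviation cf :: "real \<Rightarrow> real \<Rightarrow> complex" where
  "cf s t \<equiv> exp (psi s t)"

text \<open>A witness of \<open>psi_lower\<close>, fixed once so that all \<open>cf s\<close> share
  the same majorant.\<close>

definition \<kappa> :: real where
  "\<kappa> = (SOME \<kappa>. 0 < \<kappa> \<and> (\<forall>s>0. \<forall>t. \<kappa> * \<bar>t\<bar> powr \<alpha> \<le> - Re (psi s t)))"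

lemma \<kappa>: "0 < \<kappa>" "0 < s \<Longrightarrow> \<kappa> * \<bar>t\<bar> powr \<alpha> \<le> - Re (psi s t)"
  using someI_ex[OF psi_lower] unfolding \<kappa>_def[symmetric] by blast+

lemma norm_cf_le: "0 < s \<Longrightarrow> cmod (cf s t) \<le> exp (- (\<kappa> * \<bar>t\<bar> powr \<alpha>))"
  using \<kappa>(2)[of s t] by simp

lemma integrable_cf_bound: "integrable lborel (\<lambda>t. exp (- (\<kappa> * \<bar>t\<bar> powr \<alpha>)))"
  using integrable_exp_neg_powr[OF \<kappa>(1) \<alpha>(1)] .

lemma continuous_cf: "0 < s \<Longrightarrow> continuous_on UNIV (cf s)"
  by (intro continuous_on_exp continuous_at_imp_continuous_on ballI isCont_psi)

lemma integrable_cf: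
  assumes s: "0 < s" shows "integrable lborel (cf s)"
proof (rule Bochner_Integration.integrable_bound[OF integrable_cf_bound])
  show "cf s \<in> borel_measurable lborel"
    using borel_measurable_continuous_onI[OF continuous_cf[OF s]] by simp
  show "AE t in lborel. norm (cf s t) \<le> norm (exp (- (\<kappa> * \<bar>t\<bar> powr \<alpha>)))"
    using norm_cf_le[OF s] by (intro AE_I2) simp
qed

text \<open>Fourier inversion written down before it is known that \<open>cf s\<close> is a
  characteristic function; periodicity, continuity and decay follow from the formula alone.\<close>

definition g :: "real \<Rightarrow> real \<Rightarrow> real" where
  "g s x = Re (fourier (cf s) (-x)) / (2 * pi)"

lemma g_periodic: "0 < s \<Longrightarrow> g (c * s) = g s"
  by (simp add: g_def[abs_def] psi_periodic)

lemma g_periodic_int: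
  assumes s: "0 < s" shows "g (c powr of_int m * s) = g s"
proof -
  have nat: "g (c powr real n * s) = g s" if "0 < s" for n s
  proof (induction n)
    case (Suc n)
    have "c powr real (Suc n) * s = c * (c powr real n * s)" using c_gt_1 by (simp add: powr_add)
    then show ?case using g_periodic[of "c powr real n * s"] Suc that c_gt_1 by (simp add: mult.assoc)
  qed (use c_gt_1 in simp)
  show ?thesis
  proof (cases "0 \<le> m")
    case True
    then show ?thesis using nat[OF s, of "nat m"] by simp
  next
    case False
    have "g (c powr real (nat (-m)) * (c powr of_int m * s)) = g (c powr of_int m * s)"
      using s c_gt_1 by (intro nat) auto
    moreover have "c powr real (nat (-m)) * (c powr of_int m * s) = s"
      using False c_gt_1 by (simp add: mult.assoc[symmetric] powr_add[symmetric])
    ultimately show ?thesis by simp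
  qed
qed

text \<open>Levy uniqueness and uniqueness of continuous densities resolve the definite
  descriptions, once some law V with this characteristic function is known; it is constructed from
  the given tail.\<close>

lemma semistable_density_eq:
  assumes s: "0 < s" and V: "real_distribution V" "\<And>t. char V t = cf s t"
  shows "semistable_density \<alpha> MR s = g s" and "0 \<le> g s x"
proof -
  interpret V: real_distribution V by (rule V)
  have char_V: "char V = cf s" using V(2) by auto
  have law: "semistable_law \<alpha> MR s = V"
    unfolding semistable_law_def
  proof (rule the_equality)
    show "real_distribution V \<and> (\<forall>t. char V t = exp (CLINT x|levy_measure \<alpha> MR s. iexp (t * x) - 1))"
      using V by (simp add: psi_def)
    fix V' assume "real_distribution V' \<and> (\<forall>t. char V' t = exp (CLINT x|levy_measure \<alpha> MR s. iexp (t * x) - 1))"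
    then show "V' = V" using V(1) char_V by (intro Levy_uniqueness) (auto simp: psi_def)
  qed
  have int: "integrable lborel (char V)" unfolding char_V by (rule integrable_cf[OF s])
  have g_eq: "g s = (\<lambda>x. Re (fourier (char V) (-x)) / (2 * pi))" by (simp add: g_def[abs_def] char_V)
  have g: "continuous_on UNIV (g s)" "\<And>x. 0 \<le> g s x" "V = density lborel (\<lambda>x. ennreal (g s x))"
    unfolding g_eq by (rule V.density_fourier[OF int])+
  show "0 \<le> g s x" by (rule g(2))
  show "semistable_density \<alpha> MR s = g s"
    unfolding semistable_density_def law
  proof (rule the_equality)
    show "continuous_on UNIV (g s) \<and> (\<forall>x. 0 \<le> g s x) \<and> V = density lborel (\<lambda>x. ennreal (g s x))"
      using g by blast
    fix f assume f: "continuous_on UNIV f \<and> (\<forall>x. 0 \<le> f x) \<and> V = density lborel (\<lambda>x. ennreal (f x))"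
    have [measurable]: "f \<in> borel_measurable borel" "g s \<in> borel_measurable borel"
      using f g by (auto intro: borel_measurable_continuous_onI)
    have "density lborel (\<lambda>x. ennreal (f x)) = density lborel (\<lambda>x. ennreal (g s x))" using f g(3) by simp
    then have "AE x in lborel. ennreal (f x) = ennreal (g s x)"
      by (subst (asm) sigma_finite_measure.density_unique_iff[OF sigma_finite_lborel]) measurable
    then have "AE x in lborel. f x = g s x"
      by eventually_elim (use f g(2) in auto)
    then show "f = g s" using f g(1) by (intro AE_lborel_continuous_eq) auto
  qed
qed

lemma cf_increment:
  "\<exists>C>0. \<forall>s>0. \<forall>t r. cmod (cf s t - cf s (t + r)) \<le> C * \<bar>r\<bar> powr \<alpha> * (exp (- (\<kappa> * \<bar>t\<bar> powr \<alpha>)) + exp (- (\<kappa> * \<bar>t + r\<bar> powr \<alpha>)))"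
proof -
  obtain C where C: "0 < C" "\<And>s t r. 0 < s \<Longrightarrow> cmod (psi s (t + r) - psi s t) \<le> C * \<bar>r\<bar> powr \<alpha>"
    using psi_increment by blast
  have "cmod (cf s t - cf s (t + r)) \<le> C * \<bar>r\<bar> powr \<alpha> * (exp (- (\<kappa> * \<bar>t\<bar> powr \<alpha>)) + exp (- (\<kappa> * \<bar>t + r\<bar> powr \<alpha>)))"
    if s: "0 < s" for s t r
  proof -
    have "cmod (cf s t - cf s (t + r)) \<le> cmod (psi s t - psi s (t + r)) * (exp (Re (psi s t)) + exp (Re (psi s (t + r))))"
      by (rule norm_exp_diff_le)
    also have "\<dots> \<le> (C * \<bar>r\<bar> powr \<alpha>) * (exp (- (\<kappa> * \<bar>t\<bar> powr \<alpha>)) + exp (- (\<kappa> * \<bar>t + r\<bar> powr \<alpha>)))"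
      using C(2)[OF s, of t r] \<kappa>(2)[OF s, of t] \<kappa>(2)[OF s, of "t + r"] C(1)
      by (intro mult_mono add_mono) (auto simp: norm_minus_commute)
    finally show ?thesis .
  qed
  then show ?thesis using C(1) by blast
qed

text \<open>The half-period difference turns Holder continuity of order \<alpha> into decay
  \<open>x powr (-\<alpha>)\<close>. With the extra factor in the potential this becomes
  \<open>x powr (-2 * \<alpha>)\<close>, which is integrable at infinity.\<close>

lemma g_bounds: "\<exists>C>0. \<forall>s>0. \<forall>x. \<bar>g s x\<bar> \<le> C \<and> (0 < x \<longrightarrow> \<bar>g s x\<bar> \<le> C * x powr (-\<alpha>))"
proof -
  obtain C where C: "0 < C" "\<And>s t r. 0 < s \<Longrightarrow> cmod (cf s t - cf s (t + r)) \<le> C * \<bar>r\<bar> powr \<alpha> * (exp (- (\<kappa> * \<bar>t\<bar> powr \<alpha>)) + exp (- (\<kappa> * \<bar>t + r\<bar> powr \<alpha>)))"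
    using cf_increment by blast
  define I where "I = (LBINT t. exp (- (\<kappa> * \<bar>t\<bar> powr \<alpha>)))"
  have I: "0 \<le> I" unfolding I_def by (intro integral_nonneg_AE) auto
  have g_le: "\<bar>g s x\<bar> \<le> cmod (fourier (cf s) (-x))" for s x
  proof -
    have "\<bar>g s x\<bar> = \<bar>Re (fourier (cf s) (-x))\<bar> / (2 * pi)" by (simp add: g_def)
    also have "\<dots> \<le> \<bar>Re (fourier (cf s) (-x))\<bar> / 1" using pi_gt3 by (intro divide_left_mono) auto
    also have "\<dots> \<le> cmod (fourier (cf s) (-x))" using abs_Re_le_cmod by simp
    finally show ?thesis .
  qed
  have b1: "\<bar>g s x\<bar> \<le> I" if s: "0 < s" for s x
  proof -
    have "\<bar>g s x\<bar> \<le> (LBINT t. cmod (cf s t))" by (rule order_trans[OF g_le norm_fourier_le])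
    also have "\<dots> \<le> I"
      unfolding I_def by (intro integral_mono integrable_cf_bound integrable_norm integrable_cf s norm_cf_le)
    finally show ?thesis .
  qed
  have b2: "\<bar>g s x\<bar> \<le> C * pi powr \<alpha> * I * x powr (-\<alpha>)" if s: "0 < s" and x: "0 < x" for s x
  proof -
    define r where "r = pi / (-x)"
    have r: "\<bar>r\<bar> powr \<alpha> = pi powr \<alpha> * x powr (-\<alpha>)"
      using x by (simp add: r_def powr_divide powr_minus_divide)
    have int_r: "integrable lborel (\<lambda>t. exp (- (\<kappa> * \<bar>t + r\<bar> powr \<alpha>)))"
      using lborel_integrable_real_affine[OF integrable_cf_bound, of 1 r] by (simp add: add.commute)
    have I_r: "(LBINT t. exp (- (\<kappa> * \<bar>t + r\<bar> powr \<alpha>))) = I"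
      unfolding I_def using lborel_integral_real_affine[of 1 "\<lambda>t. exp (- (\<kappa> * \<bar>t\<bar> powr \<alpha>))" r] by (simp add: add.commute)
    have "fourier (cf s) (-x) = fourier (\<lambda>t. (cf s t - cf s (t + r)) / 2) (-x)"
      unfolding r_def using x by (intro half_shift integrable_cf[OF s]) auto
    then have "\<bar>g s x\<bar> \<le> (LBINT t. cmod ((cf s t - cf s (t + r)) / 2))"
      using g_le[of s x] norm_fourier_le[of "\<lambda>t. (cf s t - cf s (t + r)) / 2" "-x"] by simp
    also have "\<dots> \<le> (LBINT t. (C * \<bar>r\<bar> powr \<alpha> / 2) * (exp (- (\<kappa> * \<bar>t\<bar> powr \<alpha>)) + exp (- (\<kappa> * \<bar>t + r\<bar> powr \<alpha>))))"
    proof (rule integral_mono')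
      show "integrable lborel (\<lambda>t. (C * \<bar>r\<bar> powr \<alpha> / 2) * (exp (- (\<kappa> * \<bar>t\<bar> powr \<alpha>)) + exp (- (\<kappa> * \<bar>t + r\<bar> powr \<alpha>))))"
        by (intro integrable_mult_right Bochner_Integration.integrable_add integrable_cf_bound int_r)
      fix t
      show "cmod ((cf s t - cf s (t + r)) / 2) \<le> (C * \<bar>r\<bar> powr \<alpha> / 2) * (exp (- (\<kappa> * \<bar>t\<bar> powr \<alpha>)) + exp (- (\<kappa> * \<bar>t + r\<bar> powr \<alpha>)))"
        using C(2)[OF s, of t r] by (simp add: norm_divide)
      show "0 \<le> (C * \<bar>r\<bar> powr \<alpha> / 2) * (exp (- (\<kappa> * \<bar>t\<bar> powr \<alpha>)) + exp (- (\<kappa> * \<bar>t + r\<bar> powr \<alpha>)))"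
        using C(1) by (intro mult_nonneg_nonneg add_nonneg_nonneg) auto
    qed
    also have "\<dots> = (C * \<bar>r\<bar> powr \<alpha> / 2) * (I + I)"
      using integrable_cf_bound int_r by (simp add: I_r) (simp add: I_def)
    finally show ?thesis by (simp add: r mult_ac)
  qed
  define D where "D = I + C * pi powr \<alpha> * I + 1"
  have nn: "0 \<le> C * pi powr \<alpha> * I" using C(1) I by simp
  have "0 < D" using I nn by (simp add: D_def)
  moreover have "\<bar>g s x\<bar> \<le> D" if "0 < s" for s x using b1[OF that, of x] nn by (simp add: D_def)
  moreover have "\<bar>g s x\<bar> \<le> D * x powr (-\<alpha>)" if "0 < s" "0 < x" for s x
  proof -
    have "C * pi powr \<alpha> * I * x powr (-\<alpha>) \<le> D * x powr (-\<alpha>)" using I by (intro mult_right_mono) (auto simp: D_def)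
    then show ?thesis using b2[OF that] by linarith
  qed
  ultimately show ?thesis by blast
qed

lemma psi_1: "0 < s \<Longrightarrow> psi s t = s * psi 1 (t * s powr (-1/\<alpha>))"
  using psi_scale[of 1 s t] by simp

text \<open>By scaling, every exponent is expressed through the single continuous function
  \<open>psi 1\<close>, which gives continuity in the parameter.\<close>

lemma g_tendsto:
  assumes sn: "sn \<longlonglongrightarrow> s" and pos: "\<And>n::nat. 0 < sn n" "0 < s"
  shows "(\<lambda>n. g (sn n) x) \<longlonglongrightarrow> g s x"
proof -
  have "(\<lambda>n. fourier (cf (sn n)) (-x)) \<longlonglongrightarrow> fourier (cf s) (-x)"
    unfolding fourier_def
  proof (rule integral_dominated_convergence[OF _ _ integrable_cf_bound])
    show "(\<lambda>t. iexp (t * - x) * cf s t) \<in> borel_measurable lborel"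
      using borel_measurable_continuous_onI[OF continuous_cf[OF pos(2)]] by measurable
    show "(\<lambda>t. iexp (t * - x) * cf (sn n) t) \<in> borel_measurable lborel" for n
      using borel_measurable_continuous_onI[OF continuous_cf[OF pos(1)[of n]]] by measurable
    show "AE t in lborel. norm (iexp (t * - x) * cf (sn n) t) \<le> exp (- (\<kappa> * \<bar>t\<bar> powr \<alpha>))" for n
      by (intro AE_I2) (simp only: norm_mult norm_exp_i_times mult_1_left norm_cf_le[OF pos(1)])
    show "AE t in lborel. (\<lambda>n. iexp (t * - x) * cf (sn n) t) \<longlonglongrightarrow> iexp (t * - x) * cf s t"
    proof (rule AE_I2)
      fix t
      have "(\<lambda>n. t * sn n powr (-1/\<alpha>)) \<longlonglongrightarrow> t * s powr (-1/\<alpha>)"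
        using pos by (intro tendsto_intros sn) auto
      then have "(\<lambda>n. psi 1 (t * sn n powr (-1/\<alpha>))) \<longlonglongrightarrow> psi 1 (t * s powr (-1/\<alpha>))"
        by (rule isCont_tendsto_compose[OF isCont_psi[of 1, OF zero_less_one]])
      then have "(\<lambda>n. of_real (sn n) * psi 1 (t * sn n powr (-1/\<alpha>))) \<longlonglongrightarrow> of_real s * psi 1 (t * s powr (-1/\<alpha>))"
        by (intro tendsto_mult tendsto_of_real sn)
      then have "(\<lambda>n. psi (sn n) t) \<longlonglongrightarrow> psi s t" using psi_1[OF pos(1)] psi_1[OF pos(2)] by simp
      then show "(\<lambda>n. iexp (t * - x) * cf (sn n) t) \<longlonglongrightarrow> iexp (t * - x) * cf s t"
        by (intro tendsto_intros)
    qed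
  qed
  then show ?thesis unfolding g_def by (intro tendsto_intros) auto
qed

text \<open>The parameter varies with x, so joint measurability is needed; it becomes visible after
  scaling to the fixed function \<open>psi 1\<close>.\<close>

lemma g_measurable:
  assumes [measurable]: "p \<in> borel_measurable borel"
  shows "(\<lambda>x. if 0 < p x then g (p x) x else 0) \<in> borel_measurable borel"
proof -
  have [measurable]: "psi 1 \<in> borel_measurable borel"
    using isCont_psi[of 1] by (intro borel_measurable_continuous_onI continuous_at_imp_continuous_on) auto
  have "(\<lambda>x. if 0 < p x then g (p x) x else 0) =
      (\<lambda>x. if 0 < p x then Re (CLBINT t. iexp (t * -x) * exp (p x * psi 1 (t * p x powr (-1/\<alpha>)))) / (2 * pi) else 0)"
  proof
    fix x
    show "(if 0 < p x then g (p x) x else 0) =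
        (if 0 < p x then Re (CLBINT t. iexp (t * -x) * exp (p x * psi 1 (t * p x powr (-1/\<alpha>)))) / (2 * pi) else 0)"
      by (cases "0 < p x") (simp_all only: g_def fourier_def psi_1[of "p x"] if_True if_False)
  qed
  also have "\<dots> \<in> borel_measurable borel" by measurable
  finally show ?thesis .
qed

end

context semistable_renewal
begin

text \<open>The law is a weak limit of normalised sums of the given variables. Their characteristic
  functions converge by \<open>exponent_limit\<close>, and tightness provides a law whose
  characteristic function is the limit.\<close>

lemma semistable_law_exists:
  assumes lam: "0 < lam"
  shows "\<exists>V. real_distribution V \<and> (\<forall>t. char V t = exp (L.psi lam t))"
proof -
  have M: "real_distribution M" by unfold_locales
  \<comment> \<open>Normalising by \<open>A (k n) * d\<close> makes \<open>B (y n) / k n\<close>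
    converge to \<open>d powr \<alpha>\<close>, which is \<open>lam\<close>.\<close>
  define d where "d = lam powr (1/\<alpha>)"
  have d: "0 < d" "d powr \<alpha> = lam" using lam alpha by (auto simp: d_def powr_powr)
  obtain C y0 where C: "0 < C" and y0: "0 < y0" and cum: "\<And>y. y0 \<le> y \<Longrightarrow> B y * (M.cum_tail y / y) \<le> C"
    using cum_tail_bound by blast
  obtain C2 y2 where C2: "0 < C2" and y2: "0 < y2"
    and sc: "\<And>y x. y2 \<le> y \<Longrightarrow> 0 < x \<Longrightarrow> B y \<le> C2 * max (x powr -\<beta>1) (x powr -\<beta>2) * B (y * x)"
    using B_scaled_ge[OF \<beta>(1-3)] by blast
  have "filterlim (\<lambda>n. A (k n) * d) at_top sequentially"
    using filterlim_tendsto_pos_mult_at_top[OF tendsto_const d(1) A_k_at_top] by (simp add: mult.commute)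
  then have "\<forall>\<^sub>F n in sequentially. max y0 y2 \<le> A (k n) * d" unfolding filterlim_at_top by blast
  then obtain J where J: "\<And>n. J \<le> n \<Longrightarrow> max y0 y2 \<le> A (k n) * d" by (auto simp: eventually_sequentially)
  define y where "y n = A (k (n + J)) * d" for n
  have y_ge: "y0 \<le> y n" "y2 \<le> y n" for n using J[of "n + J"] by (auto simp: y_def)
  have y_pos: "0 < y n" for n using y_ge[of n] y0 by simp
  have J_top: "filterlim (\<lambda>n. n + J) at_top sequentially" by (rule filterlim_subseq) (simp add: strict_mono_def)
  have kJ: "filterlim (\<lambda>n. real (k (n + J))) at_top sequentially"
    using filterlim_compose[OF k_at_top J_top] .
  have y_top: "filterlim y at_top sequentially"
    using filterlim_compose[OF \<open>filterlim (\<lambda>n. A (k n) * d) at_top sequentially\<close> J_top] by (simp add: y_def[abs_def])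
  have "(\<lambda>n. B (A (k (n + J)) * d) / k (n + J)) \<longlonglongrightarrow> d powr \<alpha>"
    using filterlim_compose[OF B_A_ratio[OF d(1)] kJ] .
  then have lam_lim: "(\<lambda>n. B (y n) / k (n + J)) \<longlonglongrightarrow> lam" by (simp add: y_def d(2))
  \<comment> \<open>The number of summands is asymptotic to \<open>B (y n)\<close>, so that
    \<open>m n * (char M (t / y n) - 1)\<close> has the limit \<open>L.psi lam t\<close>.\<close>
  define m where "m n = nat \<lfloor>B (y n)\<rfloor>" for n
  have B1: "1 \<le> B (y n)" for n by (rule B_ge_1[OF y_pos])
  have m_le: "real (m n) \<le> B (y n)" "B (y n) - 1 \<le> real (m n)" for n using B1[of n] unfolding m_def by linarith+
  have By_top: "filterlim (\<lambda>n. B (y n)) at_top sequentially" using filterlim_compose[OF B_at_top y_top] .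
  have m_top: "filterlim m at_top sequentially"
    unfolding filterlim_at_top
  proof
    fix Z
    have "\<forall>\<^sub>F n in sequentially. real Z + 1 \<le> B (y n)" using By_top unfolding filterlim_at_top by blast
    then show "\<forall>\<^sub>F n in sequentially. Z \<le> m n"
    proof eventually_elim
      case (elim n)
      then have "real Z \<le> real (m n)" using m_le(2)[of n] by linarith
      then show ?case by simp
    qed
  qed
  have inv0: "(\<lambda>n. 1 / B (y n)) \<longlonglongrightarrow> 0"
    by (rule tendsto_divide_0[OF tendsto_const filterlim_at_top_imp_at_infinity[OF By_top]])
  have mB: "(\<lambda>n. real (m n) / B (y n)) \<longlonglongrightarrow> 1"
  proof (rule tendsto_sandwich[of "\<lambda>n. 1 - 1 / B (y n)" _ _ "\<lambda>_. 1"])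
    have "1 - 1 / B (y n) \<le> real (m n) / B (y n)" for n
    proof -
      have "(B (y n) - 1) / B (y n) \<le> real (m n) / B (y n)" using m_le(2)[of n] B1[of n] by (intro divide_right_mono) auto
      then show ?thesis using B1[of n] by (simp add: diff_divide_distrib)
    qed
    then show "\<forall>\<^sub>F n in sequentially. 1 - 1 / B (y n) \<le> real (m n) / B (y n)" by simp
    have "real (m n) / B (y n) \<le> 1" for n using m_le(1)[of n] B1[of n] by simp
    then show "\<forall>\<^sub>F n in sequentially. real (m n) / B (y n) \<le> 1" by simp
    show "(\<lambda>n. 1 - 1 / B (y n)) \<longlonglongrightarrow> 1" using tendsto_diff[OF tendsto_const inv0, of 1] by simp
  qed simp
  define P where "P n = distr (conv_power M (m n)) borel (\<lambda>x. x / y n)" for n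
  have P: "real_distribution (P n)" for n
  proof -
    interpret N: real_distribution "conv_power M (m n)" by (rule real_distribution_conv_power[OF M])
    show ?thesis unfolding P_def real_distribution_def real_distribution_axioms_def
      by (intro conjI N.prob_space_distr) auto
  qed
  have char_P: "char (P n) t = (1 + (char M (t / y n) - 1)) ^ m n" for n t
  proof -
    interpret N: real_distribution "conv_power M (m n)" by (rule real_distribution_conv_power[OF M])
    have "char (P n) t = char (conv_power M (m n)) (t / y n)"
      unfolding char_def P_def by (subst integral_distr) auto
    then show ?thesis by (simp add: char_conv_power[OF M])
  qed
  have char_lim: "(\<lambda>n. char (P n) t) \<longlonglongrightarrow> exp (L.psi lam t)" for t
    unfolding char_P
  proof (rule tendsto_one_plus_power_exp[OF m_top])
    show "cmod (1 + (char M (t / y n) - 1)) \<le> 1" for n using cmod_char_le_1 by simp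
    have "(\<lambda>n. of_real (real (m n) / B (y n)) * (of_real (B (y n)) * (char M (t / y n) - 1))) \<longlonglongrightarrow> of_real 1 * L.psi lam t"
      by (intro tendsto_mult tendsto_of_real mB exponent_limit[OF y_top y_pos J_top lam_lim lam])
    moreover have "of_real (real (m n) / B (y n)) * (of_real (B (y n)) * (char M (t / y n) - 1)) = of_nat (m n) * (char M (t / y n) - 1)" for n
      using B1[of n] by simp
    ultimately show "(\<lambda>n. of_nat (m n) * (char M (t / y n) - 1)) \<longlonglongrightarrow> L.psi lam t" by simp
  qed
  \<comment> \<open>The mass above R is at most the truncated mean at scale \<open>y n * R\<close>,
    hence of order \<open>R powr (-\<beta>2)\<close> uniformly in n. The left endpoint -1 is
    harmless because the laws live on the half-line.\<close>
  have tight: "tight P"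
    unfolding tight_def
  proof (intro conjI allI impI P)
    fix \<epsilon> :: real assume \<epsilon>: "0 < \<epsilon>"
    have "((\<lambda>R. C * C2 * R powr (-\<beta>2)) \<longlongrightarrow> C * C2 * 0) at_top"
      using \<beta> by (intro tendsto_intros tendsto_neg_powr filterlim_ident) auto
    then have "\<forall>\<^sub>F R in at_top. C * C2 * R powr (-\<beta>2) < \<epsilon>" using \<epsilon> by (intro order_tendstoD(2)) auto
    with eventually_ge_at_top[of 1] have "\<forall>\<^sub>F R in at_top. 1 \<le> R \<and> C * C2 * R powr (-\<beta>2) < \<epsilon>"
      by eventually_elim auto
    then obtain R where R: "1 \<le> R" "C * C2 * R powr (-\<beta>2) < \<epsilon>" by (auto simp: eventually_at_top_linorder)
    show "\<exists>a b. a < b \<and> (\<forall>n. 1 - \<epsilon> < measure (P n) {a<..b})"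
    proof (rule exI[of _ "-1"], rule exI[of _ R], intro conjI allI)
      fix n
      interpret N: real_distribution "conv_power M (m n)" by (rule real_distribution_conv_power[OF M])
      interpret P: real_distribution "P n" by (rule P)
      define s where "s = 1 / (R * y n)"
      have s: "0 < s" "1 / s = y n * R" using R y_pos[of n] by (auto simp: s_def)
      have yR: "y0 \<le> y n * R" "0 < y n * R"
        using y_ge(1)[of n] R(1) y_pos[of n] mult_mono[of "y0" "y n" 1 R] by auto
      have "emeasure (P n) (- {-1<..R}) = emeasure (conv_power M (m n)) {x. x / y n \<notin> {-1<..R}}"
        unfolding P_def by (subst emeasure_distr) (auto simp: vimage_def)
      also have "\<dots> = (\<integral>\<^sup>+x. indicator {x. x / y n \<notin> {-1<..R}} x \<partial>conv_power M (m n))"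
      proof (rule nn_integral_indicator[symmetric])
        have "{x. x / y n \<notin> {-1<..R}} \<in> sets borel" by measurable
        then show "{x. x / y n \<notin> {-1<..R}} \<in> sets (conv_power M (m n))" by simp
      qed
      also have "\<dots> \<le> (\<integral>\<^sup>+x. ennreal (min 1 (s * x)) \<partial>conv_power M (m n))"
      proof (rule nn_integral_mono_AE)
        show "AE x in conv_power M (m n). indicator {x. x / y n \<notin> {-1<..R}} x \<le> ennreal (min 1 (s * x))"
          using AE_nonneg_conv_power[OF M nonneg]
        proof eventually_elim
          case (elim x)
          have "-1 < x / y n" using elim y_pos[of n] by (auto intro: less_le_trans[of _ 0])
          moreover have "1 \<le> s * x" if "R < x / y n" using that y_pos[of n] R(1) by (simp add: s_def field_simps)
          ultimately show ?case by (auto simp: indicator_def min_def)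
        qed
      qed
      also have "\<dots> \<le> of_nat (m n) * (\<integral>\<^sup>+x. ennreal (min 1 (s * x)) \<partial>M)"
        by (rule nn_integral_min_conv_power[OF M])
      also have "\<dots> = ennreal (real (m n) * (s * M.cum_tail (1/s)))"
        unfolding M.nn_integral_min[OF s(1)] using s M.cum_tail_nonneg
        by (subst ennreal_mult) (auto simp: ennreal_of_nat_eq_real_of_nat)
      finally have le: "measure (P n) (- {-1<..R}) \<le> real (m n) * (s * M.cum_tail (1/s))"
        using s M.cum_tail_nonneg by (simp add: P.emeasure_eq_measure)
      have "real (m n) * (s * M.cum_tail (1/s)) \<le> B (y n) * (M.cum_tail (y n * R) / (y n * R))"
        unfolding s(2) using m_le(1)[of n] M.cum_tail_nonneg[of "y n * R"] yR
        by (intro mult_mono) (auto simp: s_def mult.commute)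
      also have "\<dots> \<le> (C2 * R powr (-\<beta>2) * B (y n * R)) * (M.cum_tail (y n * R) / (y n * R))"
      proof (intro mult_right_mono)
        have "R powr (-\<beta>1) \<le> R powr (-\<beta>2)" using R(1) \<beta> by (intro powr_mono) auto
        then show "B (y n) \<le> C2 * R powr (-\<beta>2) * B (y n * R)"
          using sc[OF y_ge(2)[of n], of R] R(1) by (simp add: max_def split: if_splits)
      qed (use M.cum_tail_nonneg[of "y n * R"] yR in auto)
      also have "\<dots> = C2 * R powr (-\<beta>2) * (B (y n * R) * (M.cum_tail (y n * R) / (y n * R)))" by (simp only: mult.assoc)
      also have "\<dots> \<le> C2 * R powr (-\<beta>2) * C" using cum[OF yR(1)] C2 by (intro mult_left_mono) auto
      also have "\<dots> < \<epsilon>" using R(2) by (simp add: mult_ac)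
      finally have "measure (P n) (- {-1<..R}) < \<epsilon>" using le by linarith
      moreover have "measure (P n) (UNIV - {-1<..R}) = 1 - measure (P n) {-1<..R}"
        using P.prob_compl[of "{-1<..R}"] by simp
      ultimately show "1 - \<epsilon> < measure (P n) {-1<..R}" by (simp add: Compl_eq_Diff_UNIV)
    qed (use R in simp)
  qed
  from tight_imp_convergent_subsubsequence[OF tight, of id]
  obtain r V where r: "strict_mono r" and V: "real_distribution V" and weak: "weak_conv_m (P \<circ> id \<circ> r) V"
    by (auto simp: strict_mono_id)
  have "char V t = exp (L.psi lam t)" for t
  proof (rule LIMSEQ_unique)
    show "(\<lambda>n. char ((P \<circ> id \<circ> r) n) t) \<longlonglongrightarrow> char V t"
      using P V weak by (intro levy_continuity1) (auto simp: o_def)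
    show "(\<lambda>n. char ((P \<circ> id \<circ> r) n) t) \<longlonglongrightarrow> exp (L.psi lam t)"
      using LIMSEQ_subseq_LIMSEQ[OF char_lim r] by (simp add: o_def)
  qed
  then show ?thesis using V by blast
qed

lemma semistable_density_eq_g:
  assumes "0 < s" shows "semistable_density \<alpha> MR s = L.g s" and "0 \<le> L.g s x"
proof -
  obtain V where V: "real_distribution V" "\<And>t. char V t = exp (L.psi s t)"
    using semistable_law_exists[OF assms] by blast
  show "semistable_density \<alpha> MR s = L.g s" by (rule L.semistable_density_eq(1)[OF assms V])
  show "0 \<le> L.g s x" by (rule L.semistable_density_eq(2)[OF assms V])
qed

end

section \<open>The potential of the semistable process\<close>

lemma powr_neg_at_right_0_tendsto_exp:
  assumes "0 < m" "0 < (a::real)"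
  shows "((\<lambda>x. exp (- (m * x powr (-a)))) \<longlongrightarrow> 0) (at_right 0)"
proof -
  have "filterlim (\<lambda>x. m * x powr (-a)) at_top (at_right 0)"
    by (intro filterlim_tendsto_pos_mult_at_top[OF tendsto_const assms(1)] filterlim_powr_neg_at_right_0 assms)
  then have "filterlim (\<lambda>x. - (m * x powr (-a))) at_bot (at_right 0)"
    by (simp add: filterlim_uminus_at_bot)
  from filterlim_compose[OF exp_at_bot this] show ?thesis .
qed

text \<open>The substitution \<open>s = x powr (- \<alpha>)\<close> in \<open>\<integral> exp (- s * w) ds = 1 / w\<close>.\<close>
lemma stable_kernel_real:
  fixes a m :: real
  assumes a: "0 < a" and m: "0 < m"
  shows "set_integrable lborel {0<..} (\<lambda>x. a * x powr (-a - 1) * exp (- (m * x powr (-a))))"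
    "(LBINT x:{0<..}. a * x powr (-a - 1) * exp (- (m * x powr (-a)))) = 1 / m"
proof -
  let ?f = "\<lambda>x. a * x powr (-a - 1) * exp (- (m * x powr (-a)))"
  let ?F = "\<lambda>x. exp (- (m * x powr (-a))) / m"
  have der: "DERIV ?F x :> ?f x" if "0 < x" for x
    using that m by (auto intro!: derivative_eq_intros simp: powr_diff field_simps)
  have top: "((\<lambda>x. exp (- (m * x powr (-a))) / m) \<longlongrightarrow> exp (- (m * 0)) / m) at_top"
    using a m by (intro tendsto_intros tendsto_neg_powr filterlim_ident) auto
  have bot: "((\<lambda>x. exp (- (m * x powr (-a))) / m) \<longlongrightarrow> 0 / m) (at_right 0)"
    using m by (intro tendsto_divide powr_neg_at_right_0_tendsto_exp a m tendsto_const) auto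
  have cont: "isCont ?f x" if "0 < x" for x using that by (intro continuous_intros) auto
  note ftc = interval_integral_FTC_nonneg[of 0 \<infinity> ?F ?f 0 "1 / m"]
  have e: "einterval 0 \<infinity> = {0::real<..}" by (auto simp: einterval_def)
  have B: "((?F \<circ> real_of_ereal) \<longlongrightarrow> 1 / m) (at_left \<infinity>)"
    using top by (simp add: at_left_PInf filterlim_filtermap o_def tendsto_compose_filtermap[symmetric])
  have A: "((?F \<circ> real_of_ereal) \<longlongrightarrow> 0) (at_right 0)"
    using bot by (simp add: zero_ereal_def at_right_ereal tendsto_compose_filtermap[symmetric] filterlim_filtermap o_def)
  have 1: "set_integrable lborel (einterval 0 \<infinity>) ?f"
    by (rule interval_integral_FTC_nonneg(1)[of 0 \<infinity> ?F ?f 0 "1/m"]) (use der cont A B a in auto)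
  have 2: "(LBINT x=0..\<infinity>. ?f x) = 1 / m - 0"
    by (rule interval_integral_FTC_nonneg(2)[of 0 \<infinity> ?F ?f 0 "1/m"]) (use der cont A B a in auto)
  show "set_integrable lborel {0<..} ?f" using 1 by (simp add: e)
  show "(LBINT x:{0<..}. ?f x) = 1 / m" using 2 by (simp add: interval_lebesgue_integral_def e)
qed

text \<open>The antiderivative runs from 0 at the origin, since \<open>Re w > 0\<close>, to
  \<open>1 / w\<close> at infinity; absolute integrability is the real case with
  \<open>Re w\<close>.\<close>

lemma stable_kernel_complex:
  fixes a :: real and w :: complex
  assumes a: "0 < a" and w: "0 < Re w"
  shows "set_integrable lborel {0<..} (\<lambda>x. of_real (a * x powr (-a - 1)) * exp (- (of_real (x powr (-a)) * w)))"
    "(CLBINT x:{0<..}. of_real (a * x powr (-a - 1)) * exp (- (of_real (x powr (-a)) * w))) = 1 / w"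
proof -
  let ?f = "\<lambda>x. of_real (a * x powr (-a - 1)) * exp (- (of_real (x powr (-a)) * w))"
  let ?F = "\<lambda>x::real. exp (- (of_real (x powr (-a)) * w)) / w"
  have w0: "w \<noteq> 0" using w by auto
  have e: "einterval 0 \<infinity> = {0::real<..}" by (auto simp: einterval_def)
  have nf: "norm (?f x) = a * x powr (-a - 1) * exp (- (Re w * x powr (-a)))" for x
    using a by (simp add: norm_mult mult.commute)
  have [measurable]: "?f \<in> borel_measurable borel" by measurable
  show si: "set_integrable lborel {0<..} ?f"
    unfolding set_integrable_def
  proof (rule Bochner_Integration.integrable_bound[OF stable_kernel_real(1)[OF a w, unfolded set_integrable_def]])
    show "AE x in lborel. norm (indicator {0<..} x *\<^sub>R ?f x) \<le> norm (indicator {0<..} x *\<^sub>R (a * x powr (-a - 1) * exp (- (Re w * x powr (-a)))))"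
      using a by (intro AE_I2) (simp add: nf norm_scaleR abs_mult del: of_real_mult)
  qed measurable
  have der: "(?F has_vector_derivative ?f x) (at x)" if x: "0 < x" for x
  proof -
    have d: "((\<lambda>x. x powr (-a)) has_real_derivative - a * x powr (-a - 1)) (at x)"
      using x by (auto intro!: derivative_eq_intros)
    then have "((\<lambda>x. complex_of_real (x powr (-a))) has_vector_derivative of_real (- a * x powr (-a - 1))) (at x)"
      by (intro has_vector_derivative_of_real) (simp add: has_real_derivative_iff_has_vector_derivative)
    moreover have "((\<lambda>z. exp (- (z * w)) / w) has_field_derivative - exp (- (of_real (x powr (-a)) * w))) (at (of_real (x powr (-a))))"
      using w0 by (auto intro!: derivative_eq_intros)
    ultimately have "((\<lambda>z. exp (- (z * w)) / w) \<circ> (\<lambda>x. complex_of_real (x powr (-a))) has_vector_derivative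
        of_real (- a * x powr (-a - 1)) * - exp (- (of_real (x powr (-a)) * w))) (at x)"
      by (rule field_vector_diff_chain_at)
    then show ?thesis by (simp add: o_def)
  qed
  have cont: "isCont ?f x" if "0 < x" for x using that by (intro continuous_intros) auto
  have "((\<lambda>x. exp (- (of_real (x powr (-a)) * w)) / w) \<longlongrightarrow> exp (- (of_real 0 * w)) / w) at_top"
    using a w0 by (intro tendsto_intros tendsto_neg_powr filterlim_ident) auto
  then have B: "((?F \<circ> real_of_ereal) \<longlongrightarrow> 1 / w) (at_left \<infinity>)"
    by (simp add: at_left_PInf filterlim_filtermap o_def tendsto_compose_filtermap[symmetric])
  have "((\<lambda>x. exp (- (of_real (x powr (-a)) * w))) \<longlongrightarrow> 0) (at_right 0)"
    by (rule tendsto_norm_zero_cancel) (use powr_neg_at_right_0_tendsto_exp[OF w a] in \<open>simp add: mult.commute\<close>)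
  then have "((\<lambda>x. exp (- (of_real (x powr (-a)) * w)) / w) \<longlongrightarrow> 0 / w) (at_right 0)"
    using w0 by (intro tendsto_divide tendsto_const) auto
  then have A: "((?F \<circ> real_of_ereal) \<longlongrightarrow> 0) (at_right 0)"
    by (simp add: zero_ereal_def at_right_ereal tendsto_compose_filtermap[symmetric] filterlim_filtermap o_def)
  have "(CLBINT x=0..\<infinity>. ?f x) = 1 / w - 0"
    by (rule interval_integral_FTC_integrable[of 0 \<infinity> ?F ?f 0 "1/w"]) (use der cont A B si in \<open>auto simp: e\<close>)
  then show "(CLBINT x:{0<..}. ?f x) = 1 / w" by (simp add: interval_lebesgue_integral_def e)
qed

lemma powr_neg_le_two_power:
  assumes "0 < a" "v \<noteq> 0" "\<bar>v\<bar> \<le> R" "1 \<le> R"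
  shows "\<bar>v\<bar> powr (-a) \<le> R powr (2 * a) * two_power a (2 * a) v"
proof (cases "\<bar>v\<bar> \<le> 1")
  case True
  have "1 * \<bar>v\<bar> powr (-a) \<le> R powr (2 * a) * \<bar>v\<bar> powr (-a)"
    using assms by (intro mult_right_mono ge_one_powr_ge_zero) auto
  then show ?thesis using True by (simp add: two_power_def)
next
  case False
  have "\<bar>v\<bar> powr (-a) \<le> \<bar>v\<bar> powr 0" using False assms by (intro powr_mono) auto
  also have "\<dots> \<le> (R / \<bar>v\<bar>) powr (2 * a)" using assms by (simp add: ge_one_powr_ge_zero)
  also have "\<dots> = R powr (2 * a) * \<bar>v\<bar> powr (- (2 * a))" using assms by (simp add: powr_divide powr_minus_divide)
  finally show ?thesis using False by (simp add: two_power_def)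
qed

context semistable_renewal
begin

text \<open>The half-period difference of \<open>1 / - L.psi lam\<close>, which is not integrable
  itself. The translation is by \<open>- pi\<close> because the transform is taken at -1.\<close>

definition potential_kernel :: "real \<Rightarrow> real \<Rightarrow> complex" where
  "potential_kernel lam u = (1 / - L.psi lam u - 1 / - L.psi lam (u - pi)) / 2"

text \<open>Its integral over x is \<open>potential_kernel lam u\<close>; its transform in u at -1
  is, by scaling, a multiple of the density at x. Fubini between these two readings identifies the
  constant.\<close>

definition potential_integrand :: "real \<Rightarrow> real \<Rightarrow> real \<Rightarrow> complex" where
  "potential_integrand lam x u = of_real (\<alpha> * x powr (-\<alpha> - 1)) *
     (exp (- (of_real (x powr (-\<alpha>)) * - L.psi lam u)) - exp (- (of_real (x powr (-\<alpha>)) * - L.psi lam (u - pi)))) / 2"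

abbreviation "E \<equiv> two_power \<alpha> (2 * \<alpha>)"

lemma psi_measurable: "0 < lam \<Longrightarrow> L.psi lam \<in> borel_measurable borel"
  using L.isCont_psi by (intro borel_measurable_continuous_onI continuous_at_imp_continuous_on) auto

lemma Re_neg_psi_pos: "0 < lam \<Longrightarrow> u \<noteq> 0 \<Longrightarrow> 0 < Re (- L.psi lam u)"
proof -
  assume "0 < lam" "u \<noteq> 0"
  then have "0 < L.\<kappa> * \<bar>u\<bar> powr \<alpha>" using L.\<kappa>(1) by simp
  also have "\<dots> \<le> Re (- L.psi lam u)" using L.\<kappa>(2)[OF \<open>0 < lam\<close>] by simp
  finally show ?thesis .
qed

lemma norm_potential_integrand_le:
  assumes lam: "0 < lam" and u: "u \<noteq> 0" "u \<noteq> pi" and x: "0 < x"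
  shows "cmod (potential_integrand lam x u) \<le> \<alpha> * x powr (-\<alpha> - 1) *
      (exp (- (L.\<kappa> * \<bar>u\<bar> powr \<alpha> * x powr (-\<alpha>))) + exp (- (L.\<kappa> * \<bar>u - pi\<bar> powr \<alpha> * x powr (-\<alpha>))))"
    (is "_ \<le> ?A * (?e1 + ?e2)")
proof -
  have e: "cmod (exp (- (of_real (x powr (-\<alpha>)) * - L.psi lam v))) \<le> exp (- (L.\<kappa> * \<bar>v\<bar> powr \<alpha> * x powr (-\<alpha>)))" for v
    using mult_right_mono[OF L.\<kappa>(2)[OF lam, of v], of "x powr (-\<alpha>)"] by (simp add: mult.commute)
  have A: "0 \<le> ?A" using alpha by simp
  have "cmod (potential_integrand lam x u) = ?A * cmod (exp (- (of_real (x powr (-\<alpha>)) * - L.psi lam u)) - exp (- (of_real (x powr (-\<alpha>)) * - L.psi lam (u - pi)))) / 2"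
    unfolding potential_integrand_def norm_divide norm_mult norm_of_real abs_of_nonneg[OF A] by simp
  also have "\<dots> \<le> ?A * (?e1 + ?e2) / 2"
    using e[of u] e[of "u - pi"] A
    by (intro divide_right_mono mult_left_mono order_trans[OF norm_triangle_ineq4] add_mono) auto
  also have "\<dots> \<le> ?A * (?e1 + ?e2)"
  proof -
    have "0 \<le> ?A * (?e1 + ?e2)" by (intro mult_nonneg_nonneg[OF A] add_nonneg_nonneg) auto
    then show ?thesis by linarith
  qed
  finally show ?thesis .
qed

text \<open>The increment of the exponent over a half-period is bounded, whereas its real part grows
  like \<open>\<bar>u\<bar> powr \<alpha>\<close>. The factor s from the mean value estimate is
  exchanged for \<open>\<bar>u\<bar> powr (-\<alpha>)\<close>, giving up half of the exponential
  decay.\<close>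

lemma norm_potential_integrand_le_far:
  "\<exists>C>0. \<forall>lam>0. \<forall>u x. 2 * pi \<le> \<bar>u\<bar> \<longrightarrow> 0 < x \<longrightarrow>
     cmod (potential_integrand lam x u) \<le> C * \<bar>u\<bar> powr (-\<alpha>) *
       (\<alpha> * x powr (-\<alpha> - 1) * exp (- (L.\<kappa> * (\<bar>u\<bar>/2) powr \<alpha> / 2 * x powr (-\<alpha>))))"
proof -
  obtain C where C: "0 < C" "\<And>s t r. 0 < s \<Longrightarrow> cmod (L.psi s (t + r) - L.psi s t) \<le> C * \<bar>r\<bar> powr \<alpha>"
    using L.psi_increment by blast
  define K where "K = C * pi powr \<alpha> * (2 / L.\<kappa>) * 2 powr \<alpha>"
  have K: "0 < K" using C L.\<kappa>(1) by (simp add: K_def)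
  have "cmod (potential_integrand lam x u) \<le> K * \<bar>u\<bar> powr (-\<alpha>) * (\<alpha> * x powr (-\<alpha> - 1) * exp (- (L.\<kappa> * (\<bar>u\<bar>/2) powr \<alpha> / 2 * x powr (-\<alpha>))))"
    if lam: "0 < lam" and u: "2 * pi \<le> \<bar>u\<bar>" and x: "0 < x" for lam u x
  proof -
    define s where "s = x powr (-\<alpha>)"
    have s: "0 < s" using x by (simp add: s_def)
    define m where "m = L.\<kappa> * (\<bar>u\<bar>/2) powr \<alpha>"
    have u0: "0 < \<bar>u\<bar>" using u pi_gt3 by linarith
    have m: "0 < m" using L.\<kappa>(1) u0 by (simp add: m_def)
    have Rm: "Re (L.psi lam v) \<le> - m" if "\<bar>u\<bar>/2 \<le> \<bar>v\<bar>" for v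
    proof -
      have "m \<le> L.\<kappa> * \<bar>v\<bar> powr \<alpha>" unfolding m_def using that L.\<kappa>(1) alpha by (intro mult_left_mono powr_mono2) auto
      then show ?thesis using L.\<kappa>(2)[OF lam, of v] by linarith
    qed
    \<comment> \<open>This is what \<open>2 * pi \<le> \<bar>u\<bar>\<close> is for: both arguments
      have modulus at least \<open>\<bar>u\<bar> / 2\<close>.\<close>
    have v: "\<bar>u\<bar>/2 \<le> \<bar>u - pi\<bar>" using u pi_gt3 by linarith
    have ee: "exp (Re (of_real s * L.psi lam v)) \<le> exp (- (s * m))" if "\<bar>u\<bar>/2 \<le> \<bar>v\<bar>" for v
      using mult_left_mono[OF Rm[OF that], of s] s by simp
    have "cmod (exp (of_real s * L.psi lam u) - exp (of_real s * L.psi lam (u - pi)))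
        \<le> cmod (of_real s * L.psi lam u - of_real s * L.psi lam (u - pi)) * (exp (Re (of_real s * L.psi lam u)) + exp (Re (of_real s * L.psi lam (u - pi))))"
      by (rule norm_exp_diff_le)
    also have "\<dots> \<le> (s * (C * pi powr \<alpha>)) * (exp (- (s * m)) + exp (- (s * m)))"
    proof (intro mult_mono add_mono ee v)
      have "cmod (of_real s * L.psi lam u - of_real s * L.psi lam (u - pi)) = s * cmod (L.psi lam (u + - pi) - L.psi lam u)"
        using s by (simp add: norm_mult norm_minus_commute flip: right_diff_distrib)
      also have "\<dots> \<le> s * (C * pi powr \<alpha>)" using C(2)[OF lam, of u "-pi"] s by (intro mult_left_mono) auto
      finally show "cmod (of_real s * L.psi lam u - of_real s * L.psi lam (u - pi)) \<le> s * (C * pi powr \<alpha>)" .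
    qed (use s C u0 in auto)
    also have "\<dots> = 2 * (C * pi powr \<alpha>) * (s * exp (- (s * m)))" by simp
    \<comment> \<open>The linear factor is absorbed by half of the exponential, and
      \<open>1 / m\<close> supplies the gain in u.\<close>
    also have "s * exp (- (s * m)) \<le> (2 / m) * exp (- (m / 2 * s))"
    proof -
      have "s * m / 2 \<le> exp (s * m / 2)" using exp_ge_add_one_self[of "s * m / 2"] by linarith
      then have "(s * m / 2) * exp (- (s * m)) \<le> exp (s * m / 2) * exp (- (s * m))" by (intro mult_right_mono) auto
      also have "\<dots> = exp (- (m / 2 * s))" by (simp add: exp_add[symmetric] mult.commute)
      finally show ?thesis using m by (simp add: field_simps)
    qed
    finally have le: "cmod (exp (of_real s * L.psi lam u) - exp (of_real s * L.psi lam (u - pi))) \<le> 2 * (C * pi powr \<alpha>) * ((2 / m) * exp (- (m / 2 * s)))"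
      using C by simp
    have A: "0 \<le> \<alpha> * x powr (-\<alpha> - 1)" using alpha by simp
    have "cmod (potential_integrand lam x u) = \<alpha> * x powr (-\<alpha> - 1) * cmod (exp (of_real s * L.psi lam u) - exp (of_real s * L.psi lam (u - pi))) / 2"
      unfolding potential_integrand_def norm_divide norm_mult norm_of_real abs_of_nonneg[OF A] s_def by simp
    also have "\<dots> \<le> \<alpha> * x powr (-\<alpha> - 1) * (2 * (C * pi powr \<alpha>) * ((2 / m) * exp (- (m / 2 * s)))) / 2"
      by (intro divide_right_mono mult_left_mono le A) auto
    also have "\<dots> = (C * pi powr \<alpha> * (2 / m)) * (\<alpha> * x powr (-\<alpha> - 1) * exp (- (m / 2 * s)))" by simp
    also have "C * pi powr \<alpha> * (2 / m) = K * \<bar>u\<bar> powr (-\<alpha>)"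
      using u0 by (simp add: K_def m_def powr_divide powr_minus_divide)
    finally show ?thesis by (simp add: m_def s_def)
  qed
  then show ?thesis using K by blast
qed

text \<open>Near the singularities 0 and pi the two exponentials are integrated separately. Far out,
  the refined estimate gives the decay \<open>\<bar>u\<bar> powr (-2 * \<alpha>)\<close> that Fubini
  needs.\<close>

lemma potential_integral_bound:
  assumes lam: "0 < lam"
  shows "\<exists>C>0. \<forall>u. u \<noteq> 0 \<longrightarrow> u \<noteq> pi \<longrightarrow>
     (LBINT x:{0<..}. cmod (potential_integrand lam x u)) \<le> C * (E u + E (u - pi))"
proof -
  obtain C where C: "0 < C" and far: "\<And>u x. 2 * pi \<le> \<bar>u\<bar> \<Longrightarrow> 0 < x \<Longrightarrow>
     cmod (potential_integrand lam x u) \<le> C * \<bar>u\<bar> powr (-\<alpha>) * (\<alpha> * x powr (-\<alpha> - 1) * exp (- (L.\<kappa> * (\<bar>u\<bar>/2) powr \<alpha> / 2 * x powr (-\<alpha>))))"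
    using norm_potential_integrand_le_far lam by blast
  define K1 where "K1 = C * 2 * 2 powr \<alpha> / L.\<kappa>"
  \<comment> \<open>For \<open>\<bar>u\<bar> < 2 * pi\<close> both \<open>\<bar>u\<bar>\<close> and
    \<open>\<bar>u - pi\<bar>\<close> are at most \<open>3 * pi\<close>.\<close>
  define K2 where "K2 = (3 * pi) powr (2 * \<alpha>) / L.\<kappa>"
  have K: "0 < K1" "0 < K2" using C L.\<kappa>(1) by (auto simp: K1_def K2_def)
  have "(LBINT x:{0<..}. cmod (potential_integrand lam x u)) \<le> (K1 + K2) * (E u + E (u - pi))" if u: "u \<noteq> 0" "u \<noteq> pi" for u
  proof (cases "2 * pi \<le> \<bar>u\<bar>")
    case True
    define m where "m = L.\<kappa> * (\<bar>u\<bar>/2) powr \<alpha> / 2"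
    have m: "0 < m" using L.\<kappa>(1) u by (simp add: m_def)
    note sk = stable_kernel_real[OF L.\<alpha>(1) m]
    have "(LBINT x:{0<..}. cmod (potential_integrand lam x u)) \<le> (LBINT x:{0<..}. C * \<bar>u\<bar> powr (-\<alpha>) * (\<alpha> * x powr (-\<alpha> - 1) * exp (- (m * x powr (-\<alpha>)))))"
      unfolding set_lebesgue_integral_def
    proof (rule integral_mono')
      show "integrable lborel (\<lambda>x. indicator {0<..} x *\<^sub>R (C * \<bar>u\<bar> powr (-\<alpha>) * (\<alpha> * x powr (-\<alpha> - 1) * exp (- (m * x powr (-\<alpha>))))))"
        using set_integrable_mult_right[OF sk(1)] unfolding set_integrable_def by simp
      fix x
      show "indicator {0<..} x *\<^sub>R cmod (potential_integrand lam x u) \<le> indicator {0<..} x *\<^sub>R (C * \<bar>u\<bar> powr (-\<alpha>) * (\<alpha> * x powr (-\<alpha> - 1) * exp (- (m * x powr (-\<alpha>)))))"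
        using far[OF True, of x] by (auto simp: indicator_def m_def)
      show "0 \<le> indicator {0<..} x *\<^sub>R (C * \<bar>u\<bar> powr (-\<alpha>) * (\<alpha> * x powr (-\<alpha> - 1) * exp (- (m * x powr (-\<alpha>)))))"
        using C alpha by (auto simp: indicator_def)
    qed
    also have "\<dots> = C * \<bar>u\<bar> powr (-\<alpha>) * (1 / m)" using sk(2) by simp
    also have "\<dots> = K1 * (\<bar>u\<bar> powr (-\<alpha>) * \<bar>u\<bar> powr (-\<alpha>))"
      using u by (simp add: m_def K1_def powr_divide powr_minus_divide mult_ac)
    also have "\<dots> = K1 * E u"
      using True pi_gt3 by (simp add: two_power_def powr_add[symmetric])
    also have "\<dots> \<le> (K1 + K2) * (E u + E (u - pi))"
      using K by (intro mult_mono) (auto simp: two_power_nonneg)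
    finally show ?thesis .
  next
    case False
    define m1 where "m1 = L.\<kappa> * \<bar>u\<bar> powr \<alpha>"
    define m2 where "m2 = L.\<kappa> * \<bar>u - pi\<bar> powr \<alpha>"
    have m: "0 < m1" "0 < m2" using L.\<kappa>(1) u by (auto simp: m1_def m2_def)
    note sk1 = stable_kernel_real[OF L.\<alpha>(1) m(1)] and sk2 = stable_kernel_real[OF L.\<alpha>(1) m(2)]
    have "(LBINT x:{0<..}. cmod (potential_integrand lam x u)) \<le>
      (LBINT x:{0<..}. \<alpha> * x powr (-\<alpha> - 1) * exp (- (m1 * x powr (-\<alpha>))) + \<alpha> * x powr (-\<alpha> - 1) * exp (- (m2 * x powr (-\<alpha>))))"
      unfolding set_lebesgue_integral_def
    proof (rule integral_mono')
      show "integrable lborel (\<lambda>x. indicator {0<..} x *\<^sub>R (\<alpha> * x powr (-\<alpha> - 1) * exp (- (m1 * x powr (-\<alpha>))) + \<alpha> * x powr (-\<alpha> - 1) * exp (- (m2 * x powr (-\<alpha>)))))"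
        using set_integral_add(1)[OF sk1(1) sk2(1)] unfolding set_integrable_def by simp
      fix x
      show "indicator {0<..} x *\<^sub>R cmod (potential_integrand lam x u) \<le> indicator {0<..} x *\<^sub>R (\<alpha> * x powr (-\<alpha> - 1) * exp (- (m1 * x powr (-\<alpha>))) + \<alpha> * x powr (-\<alpha> - 1) * exp (- (m2 * x powr (-\<alpha>))))"
        using norm_potential_integrand_le[OF lam u, of x] by (auto simp: indicator_def m1_def m2_def distrib_left)
      show "0 \<le> indicator {0<..} x *\<^sub>R (\<alpha> * x powr (-\<alpha> - 1) * exp (- (m1 * x powr (-\<alpha>))) + \<alpha> * x powr (-\<alpha> - 1) * exp (- (m2 * x powr (-\<alpha>))))"
        using alpha by (auto simp: indicator_def)
    qed
    also have "\<dots> = 1 / m1 + 1 / m2" using set_integral_add(2)[OF sk1(1) sk2(1)] sk1(2) sk2(2) by simp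
    also have "\<dots> = (\<bar>u\<bar> powr (-\<alpha>) + \<bar>u - pi\<bar> powr (-\<alpha>)) / L.\<kappa>"
      by (simp add: m1_def m2_def powr_minus_divide add_divide_distrib mult.commute)
    also have "\<dots> \<le> ((3 * pi) powr (2 * \<alpha>) * E u + (3 * pi) powr (2 * \<alpha>) * E (u - pi)) / L.\<kappa>"
      using u False pi_gt3 alpha L.\<kappa>(1) by (intro divide_right_mono add_mono powr_neg_le_two_power) auto
    also have "\<dots> = K2 * (E u + E (u - pi))" by (simp add: K2_def distrib_left add_divide_distrib)
    also have "\<dots> \<le> (K1 + K2) * (E u + E (u - pi))"
      using K by (intro mult_right_mono) (auto simp: two_power_nonneg)
    finally show ?thesis .
  qed
  moreover have "0 < K1 + K2" using K by simp
  ultimately show ?thesis by blast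
qed

lemma integrable_E_sum: "integrable lborel (\<lambda>u. C * (E u + E (u - pi)))"
proof -
  have E: "integrable lborel E" using alpha by (intro integrable_two_power) auto
  from lborel_integrable_real_affine[OF this, of 1 "-pi"] have "integrable lborel (\<lambda>u. E (u - pi))" by simp
  then show ?thesis using E by (intro integrable_mult_right Bochner_Integration.integrable_add)
qed

text \<open>The substitution \<open>u = x * t\<close> removes x from the oscillating factor, and the
  half-period difference at -1 then produces \<open>potential_integrand\<close>.\<close>

lemma g_self_similar:
  assumes lam: "0 < lam" and x: "0 < x"
  shows "complex_of_real (2 * pi * \<alpha> * (L.g (lam * x powr (-\<alpha>)) x * x powr (-\<alpha>))) =
    of_real (Re (CLBINT u. iexp (-u) * potential_integrand lam x u))"
proof -
  define s where "s = x powr (-\<alpha>)"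
  have s: "0 < s" "0 < lam * s" "s powr (-1/\<alpha>) = x" using x lam alpha by (auto simp: s_def powr_powr)
  let ?f = "\<lambda>u. exp (of_real s * L.psi lam u)"
  have cf: "L.cf (lam * s) t = ?f (x * t)" for t
    using L.psi_scale[OF lam s(1), of t] s(3) by (simp add: mult.commute)
  have int: "integrable lborel ?f"
  proof -
    have "integrable lborel (\<lambda>t. ?f (0 + x * t))" using L.integrable_cf[OF s(2)] by (simp add: cf)
    then show ?thesis using x by (subst (asm) lborel_integrable_real_affine_iff) auto
  qed
  have "fourier ?f (-1) = \<bar>x\<bar> *\<^sub>R (CLBINT t. iexp ((0 + x * t) * -1) * ?f (0 + x * t))"
    unfolding fourier_def using x by (intro lborel_integral_real_affine) auto
  also have "\<dots> = of_real x * fourier (L.cf (lam * s)) (-x)"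
    unfolding fourier_def cf using x by (simp add: scaleR_conv_of_real mult.commute)
  finally have f1: "fourier (L.cf (lam * s)) (-x) = fourier ?f (-1) / of_real x" using x by simp
  have "fourier ?f (-1) = fourier (\<lambda>t. (?f t - ?f (t + pi / -1)) / 2) (-1)"
    by (rule half_shift[OF int]) simp
  then have f2: "fourier ?f (-1) = (CLBINT u. iexp (-u) * ((?f u - ?f (u - pi)) / 2))"
    by (simp add: fourier_def)
  have "x powr (-\<alpha> - 1) = s / x" using x by (simp add: s_def powr_diff)
  then have "(CLBINT u. iexp (-u) * potential_integrand lam x u) = (CLBINT u. of_real (\<alpha> * s / x) * (iexp (-u) * ((?f u - ?f (u - pi)) / 2)))"
    by (intro Bochner_Integration.integral_cong) (auto simp: potential_integrand_def s_def[symmetric])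
  also have "\<dots> = of_real (\<alpha> * s / x) * fourier ?f (-1)"
    unfolding f2 by (rule integral_mult_right_zero)
  also have "\<dots> = of_real (\<alpha> * s) * fourier (L.cf (lam * s)) (-x)" unfolding f1 by simp
  finally have "Re (CLBINT u. iexp (-u) * potential_integrand lam x u) = \<alpha> * s * Re (fourier (L.cf (lam * s)) (-x))"
    by simp
  then show ?thesis by (simp add: L.g_def s_def)
qed

text \<open>Fubini holds only for the half-period difference; its absolute integrability in both
  variables is the content of \<open>potential_integral_bound\<close>.\<close>

lemma potential_identity:
  assumes lam: "0 < lam"
  shows "(CLBINT u. iexp (-u) * potential_kernel lam u) =
     (CLBINT x:{0<..}. (CLBINT u. iexp (-u) * potential_integrand lam x u))"
    and "set_integrable lborel {0<..} (\<lambda>x. CLBINT u. iexp (-u) * potential_integrand lam x u)"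
proof -
  note [measurable] = psi_measurable[OF lam]
  obtain C where C: "0 < C" and bd: "\<And>u. u \<noteq> 0 \<Longrightarrow> u \<noteq> pi \<Longrightarrow> (LBINT x:{0<..}. cmod (potential_integrand lam x u)) \<le> C * (E u + E (u - pi))"
    using potential_integral_bound[OF lam] by blast
  let ?h = "\<lambda>u x. indicator {0<..} x *\<^sub>R (iexp (-u) * potential_integrand lam x u)"
  have hm [measurable]: "(\<lambda>(u, x). ?h u x) \<in> borel_measurable (lborel \<Otimes>\<^sub>M lborel)"
    unfolding potential_integrand_def by measurable
  have AEu: "AE u in lborel. u \<noteq> 0 \<and> u \<noteq> pi"
    using AE_lborel_singleton[of 0] AE_lborel_singleton[of pi] by eventually_elim auto
  have nh: "norm (?h u x) = indicator {0<..} x *\<^sub>R cmod (potential_integrand lam x u)" for u x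
    using norm_exp_i_times[of "-u"] by (simp add: norm_mult)
  have xint: "set_integrable lborel {0<..} (\<lambda>x. potential_integrand lam x u)"
     "(CLBINT x:{0<..}. potential_integrand lam x u) = potential_kernel lam u" if u: "u \<noteq> 0" "u \<noteq> pi" for u
  proof -
    have u': "u - pi \<noteq> 0" using u by simp
    note k1 = stable_kernel_complex[OF L.\<alpha>(1) Re_neg_psi_pos[OF lam u(1)]]
    note k2 = stable_kernel_complex[OF L.\<alpha>(1) Re_neg_psi_pos[OF lam u']]
    have eq: "potential_integrand lam x u = (of_real (\<alpha> * x powr (-\<alpha> - 1)) * exp (- (of_real (x powr (-\<alpha>)) * - L.psi lam u))
        - of_real (\<alpha> * x powr (-\<alpha> - 1)) * exp (- (of_real (x powr (-\<alpha>)) * - L.psi lam (u - pi)))) / 2" for x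
      unfolding potential_integrand_def right_diff_distrib by simp
    show "set_integrable lborel {0<..} (\<lambda>x. potential_integrand lam x u)"
      unfolding eq by (intro set_integrable_divide set_integral_diff(1) k1(1) k2(1))
    show "(CLBINT x:{0<..}. potential_integrand lam x u) = potential_kernel lam u"
      unfolding eq set_integral_divide_zero set_integral_diff(2)[OF k1(1) k2(1)] k1(2) k2(2) potential_kernel_def by simp
  qed
  have prod: "integrable (lborel \<Otimes>\<^sub>M lborel) (\<lambda>(u, x). ?h u x)"
  proof (rule lborel_pair.Fubini_integrable[OF hm])
    show "integrable lborel (\<lambda>u. \<integral>x. norm (case (u, x) of (u, x) \<Rightarrow> ?h u x) \<partial>lborel)"
    proof (rule Bochner_Integration.integrable_bound[OF integrable_E_sum[of C]])
      show "(\<lambda>u. \<integral>x. norm (case (u, x) of (u, x) \<Rightarrow> ?h u x) \<partial>lborel) \<in> borel_measurable lborel" by measurable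
      show "AE u in lborel. norm (\<integral>x. norm (case (u, x) of (u, x) \<Rightarrow> ?h u x) \<partial>lborel) \<le> norm (C * (E u + E (u - pi)))"
        using AEu
      proof eventually_elim
        case (elim u)
        have "(\<integral>x. norm (case (u, x) of (u, x) \<Rightarrow> ?h u x) \<partial>lborel) = (LBINT x:{0<..}. cmod (potential_integrand lam x u))"
          unfolding set_lebesgue_integral_def prod.case nh ..
        moreover have "0 \<le> (LBINT x:{0<..}. cmod (potential_integrand lam x u))"
          unfolding set_lebesgue_integral_def by (intro integral_nonneg_AE) auto
        ultimately show ?case using bd[of u] elim by simp
      qed
    qed
    show "AE u in lborel. integrable lborel (\<lambda>x. case (u, x) of (u, x) \<Rightarrow> ?h u x)"
      using AEu
    proof eventually_elim
      case (elim u)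
      have "integrable lborel (\<lambda>x. iexp (-u) * (indicator {0<..} x *\<^sub>R potential_integrand lam x u))"
        using xint(1)[of u] elim unfolding set_integrable_def by (intro integrable_mult_right) auto
      then show ?case by simp
    qed
  qed
  have "(CLBINT u. iexp (-u) * potential_kernel lam u) = (CLBINT u. (CLBINT x. ?h u x))"
  proof (rule integral_cong_AE)
    show "AE u in lborel. iexp (-u) * potential_kernel lam u = (CLBINT x. ?h u x)"
      using AEu
    proof eventually_elim
      case (elim u)
      have "(CLBINT x. ?h u x) = (CLBINT x. iexp (-u) * (indicator {0<..} x *\<^sub>R potential_integrand lam x u))" by simp
      also have "\<dots> = iexp (-u) * potential_kernel lam u"
        unfolding integral_mult_right_zero using xint(2)[of u] elim unfolding set_lebesgue_integral_def by simp
      finally show ?case by simp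
    qed
  qed (unfold potential_kernel_def, measurable)
  also have "\<dots> = (CLBINT x. (CLBINT u. ?h u x))"
    by (rule lborel_pair.Fubini_integral[OF prod, symmetric])
  also have "\<dots> = (CLBINT x:{0<..}. (CLBINT u. iexp (-u) * potential_integrand lam x u))"
    unfolding set_lebesgue_integral_def by simp
  finally show "(CLBINT u. iexp (-u) * potential_kernel lam u) = (CLBINT x:{0<..}. (CLBINT u. iexp (-u) * potential_integrand lam x u))" .
  show "set_integrable lborel {0<..} (\<lambda>x. CLBINT u. iexp (-u) * potential_integrand lam x u)"
    using lborel_pair.integrable_snd[OF prod] unfolding set_integrable_def by simp
qed

definition potential :: "real \<Rightarrow> real" where
  "potential lam = \<alpha> * (LBINT x:{0<..}. L.g (lam * x powr (-\<alpha>)) x * x powr (-\<alpha>))"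

lemma potential_eq: "0 < lam \<Longrightarrow> 2 * pi * potential lam = Re (CLBINT u. iexp (-u) * potential_kernel lam u)"
proof -
  assume lam: "0 < lam"
  let ?G = "\<lambda>x. CLBINT u. iexp (-u) * potential_integrand lam x u"
  have "Re (CLBINT u. iexp (-u) * potential_kernel lam u) = (LBINT x. Re (indicator {0<..} x *\<^sub>R ?G x))"
    unfolding potential_identity(1)[OF lam] set_lebesgue_integral_def
    using potential_identity(2)[OF lam] unfolding set_integrable_def by (rule integral_Re[symmetric])
  also have "\<dots> = (LBINT x. (2 * pi * \<alpha>) * (indicator {0<..} x *\<^sub>R (L.g (lam * x powr (-\<alpha>)) x * x powr (-\<alpha>))))"
  proof (intro Bochner_Integration.integral_cong refl)
    fix x
    show "Re (indicator {0<..} x *\<^sub>R ?G x) = (2 * pi * \<alpha>) * (indicator {0<..} x *\<^sub>R (L.g (lam * x powr (-\<alpha>)) x * x powr (-\<alpha>)))"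
    proof (cases "0 < x")
      case True
      from g_self_similar[OF lam True] have "Re (?G x) = 2 * pi * \<alpha> * (L.g (lam * x powr (-\<alpha>)) x * x powr (-\<alpha>))"
        by (simp only: of_real_eq_iff)
      then show ?thesis using True by simp
    qed simp
  qed
  also have "\<dots> = 2 * pi * potential lam"
    unfolding integral_mult_right_zero potential_def set_lebesgue_integral_def by simp
  finally show ?thesis by simp
qed

end

section \<open>Asymptotics of the renewal function along subsequences\<close>

context semistable_renewal
begin

abbreviation "E' \<equiv> two_power \<beta>1 (2 * \<beta>2)"

text \<open>The singularities 0 and pi are more than 2 apart, so at most one factor is large at a
  time. Away from both, the product is split by the inequality of arithmetic and geometric means,
  which doubles the exponent to \<open>2 * \<beta>2 > 1\<close>.\<close>

lemma W_mult_le: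
  assumes "u \<noteq> 0" "u \<noteq> pi" shows "W u * W (u - pi) \<le> E' u + E' (u - pi)"
proof -
  have W1: "W v \<le> 1" if "1 < \<bar>v\<bar>" for v
  proof -
    have "\<bar>v\<bar> powr (-\<beta>2) \<le> \<bar>v\<bar> powr 0" using that \<beta> by (intro powr_mono) auto
    moreover have "v \<noteq> 0" using that by auto
    ultimately show ?thesis using that by (simp add: two_power_def)
  qed
  consider "\<bar>u\<bar> \<le> 1" "1 < \<bar>u - pi\<bar>" | "\<bar>u - pi\<bar> \<le> 1" "1 < \<bar>u\<bar>" | "1 < \<bar>u\<bar>" "1 < \<bar>u - pi\<bar>"
    using pi_gt3 by linarith
  then show ?thesis
  proof cases
    case 1
    have "W u * W (u - pi) \<le> W u * 1" using W1[OF 1(2)] by (intro mult_left_mono) (auto simp: two_power_nonneg)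
    also have "\<dots> = E' u" using 1 by (simp add: two_power_def)
    finally show ?thesis using two_power_nonneg[of \<beta>1 "2 * \<beta>2" "u - pi"] by linarith
  next
    case 2
    have "W u * W (u - pi) \<le> 1 * W (u - pi)" using W1[OF 2(2)] by (intro mult_right_mono) (auto simp: two_power_nonneg)
    also have "\<dots> = E' (u - pi)" using 2 by (simp add: two_power_def)
    finally show ?thesis using two_power_nonneg[of \<beta>1 "2 * \<beta>2" u] by linarith
  next
    case 3
    have sq: "W v * W v = E' v" if "1 < \<bar>v\<bar>" for v
      using that by (simp add: two_power_def powr_add[symmetric])
    have "0 \<le> (W u - W (u - pi)) * (W u - W (u - pi))" by simp
    then have "2 * (W u * W (u - pi)) \<le> W u * W u + W (u - pi) * W (u - pi)" by (simp add: algebra_simps)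
    moreover have "0 \<le> E' u" "0 \<le> E' (u - pi)" by (rule two_power_nonneg)+
    ultimately show ?thesis using sq[OF 3(1)] sq[OF 3(2)] by linarith
  qed
qed

text \<open>Handles the increment of the test function, which contributes
  \<open>1 / \<bar>v\<bar>\<close> instead of a second factor \<open>W\<close>; this is enough
  because \<open>1 + \<beta>2 \<ge> 2 * \<beta>2\<close>.\<close>

lemma min_W_le:
  assumes "v \<noteq> 0" shows "min 1 (1 / \<bar>v\<bar>) * W v \<le> E' v"
proof (cases "\<bar>v\<bar> \<le> 1")
  case True
  have "min 1 (1 / \<bar>v\<bar>) * W v \<le> 1 * W v" by (intro mult_right_mono) (auto simp: two_power_nonneg)
  then show ?thesis using True by (simp add: two_power_def)
next
  case False
  have "min 1 (1 / \<bar>v\<bar>) * W v \<le> (1 / \<bar>v\<bar>) * W v" by (intro mult_right_mono) (auto simp: two_power_nonneg)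
  also have "\<dots> = \<bar>v\<bar> powr (-1) * \<bar>v\<bar> powr (-\<beta>2)" using False by (simp add: two_power_def powr_minus_divide)
  also have "\<dots> = \<bar>v\<bar> powr (-1 + -\<beta>2)" by (rule powr_add[symmetric])
  also have "\<dots> \<le> \<bar>v\<bar> powr (- (2 * \<beta>2))" using False \<beta> by (intro powr_mono) auto
  finally show ?thesis using False by (simp add: two_power_def)
qed

lemma integrable_E'_sum: "integrable lborel (\<lambda>u. C * (E' u + E' (u - pi)))"
proof -
  have E: "integrable lborel E'" using \<beta> by (intro integrable_two_power) auto
  from lborel_integrable_real_affine[OF this, of 1 "-pi"] have "integrable lborel (\<lambda>u. E' (u - pi))" by simp
  then show ?thesis using E by (intro integrable_mult_right Bochner_Integration.integrable_add)
qed

text \<open>The integrand only decays like \<open>\<bar>u\<bar> powr (- \<alpha>)\<close>; \<open>half_shift\<close> replaces it by a difference with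
  two such factors, which can be dominated since \<open>\<alpha> > 1/2\<close>.\<close>
lemma renewal_fourier_limit:
  fixes \<sigma> :: "real \<Rightarrow> complex" and y :: "nat \<Rightarrow> real"
  assumes y: "filterlim y at_top sequentially" "\<And>j. 0 < y j"
    and N: "filterlim N at_top sequentially"
    and lam: "(\<lambda>j. B (y j) / k (N j)) \<longlonglongrightarrow> lam" "0 < lam"
    and lip: "\<And>s t. cmod (\<sigma> s - \<sigma> t) \<le> Lc * \<bar>s - t\<bar>" and supp: "\<And>t. R < \<bar>t\<bar> \<Longrightarrow> \<sigma> t = 0"
  shows "(\<lambda>j. of_real (y j / B (y j)) * (CLBINT t. iexp (- (t * y j)) * \<sigma> t / (1 - char M t)))
    \<longlonglongrightarrow> \<sigma> 0 * (CLBINT u. iexp (-u) * potential_kernel lam u)"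
proof -
  note [measurable] = psi_measurable[OF lam(2)]
  have Lc: "0 \<le> Lc" using order_trans[OF norm_ge_zero lip[of 0 1]] by simp
  define R' where "R' = \<bar>R\<bar> + 1"
  have R': "0 < R'" and supp': "\<And>t. R' < \<bar>t\<bar> \<Longrightarrow> \<sigma> t = 0" using supp by (auto simp: R'_def)
  note ls = lipschitz_compact_support[of \<sigma> Lc R', OF lip supp']
  define Cs where "Cs = Lc * (2 * \<bar>R'\<bar> + 1)"
  have Cs: "0 \<le> Cs" "\<And>t. cmod (\<sigma> t) \<le> Cs" using ls(3) Lc R' by (auto simp: Cs_def)
  have [measurable]: "\<sigma> \<in> borel_measurable borel" by (rule borel_measurable_continuous_onI[OF ls(1)])
  \<comment> \<open>The renewal integrand in the variable \<open>u = t * y j\<close>, with the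
    normalisation \<open>y j / B (y j)\<close> absorbed.\<close>
  define H where "H j u = \<sigma> (u / y j) / (of_real (B (y j)) * (1 - char M (u / y j)))" for j u
  have Hm [measurable]: "H j \<in> borel_measurable borel" for j unfolding H_def by measurable
  have By: "0 < B (y j)" for j using B_ge_1[OF y(2)[of j]] by simp
  have int_F: "integrable lborel (\<lambda>t. \<sigma> t / (1 - char M t))"
  proof (rule Bochner_Integration.integrable_bound[OF integrable_mult_right[OF integrable_inverse[of R'], of Cs]])
    show "AE t in lborel. norm (\<sigma> t / (1 - char M t)) \<le> norm (Cs * (indicator {-R'..R'} t / cmod (1 - char M t)))"
    proof (rule AE_I2)
      fix t
      show "norm (\<sigma> t / (1 - char M t)) \<le> norm (Cs * (indicator {-R'..R'} t / cmod (1 - char M t)))"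
      proof (cases "\<bar>t\<bar> \<le> R'")
        case True
        then have "t \<in> {-R'..R'}" by auto
        then show ?thesis using Cs by (simp add: norm_divide divide_right_mono)
      qed (use supp' in auto)
    qed
  qed measurable
  have H_int: "integrable lborel (H j)" for j
  proof -
    have "integrable lborel (\<lambda>u. \<sigma> (0 + (1 / y j) * u) / (1 - char M (0 + (1 / y j) * u)))"
      using lborel_integrable_real_affine[OF int_F, of "1 / y j" 0] y(2)[of j] by simp
    then have "integrable lborel (\<lambda>u. of_real (1 / B (y j)) * (\<sigma> (u / y j) / (1 - char M (u / y j))))"
      by (intro integrable_mult_right) simp
    then show ?thesis by (simp add: H_def[abs_def] mult.commute)
  qed
  have S_eq: "of_real (y j / B (y j)) * (CLBINT t. iexp (- (t * y j)) * \<sigma> t / (1 - char M t)) =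
      (CLBINT u. iexp (-u) * ((H j u - H j (u - pi)) / 2))" for j
  proof -
    have "(CLBINT t. iexp (- (t * y j)) * \<sigma> t / (1 - char M t)) =
        \<bar>1 / y j\<bar> *\<^sub>R (CLBINT u. iexp (- ((0 + (1 / y j) * u) * y j)) * \<sigma> (0 + (1 / y j) * u) / (1 - char M (0 + (1 / y j) * u)))"
      using y(2)[of j] by (intro lborel_integral_real_affine) auto
    also have "\<dots> = of_real (1 / y j) * (CLBINT u. iexp (-u) * (\<sigma> (u / y j) / (1 - char M (u / y j))))"
      using y(2)[of j] less_imp_neq[OF y(2)[of j]] by (simp add: scaleR_conv_of_real)
    finally have "of_real (y j / B (y j)) * (CLBINT t. iexp (- (t * y j)) * \<sigma> t / (1 - char M t)) =
        of_real (1 / B (y j)) * (CLBINT u. iexp (-u) * (\<sigma> (u / y j) / (1 - char M (u / y j))))"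
      using y(2)[of j] by simp
    also have "\<dots> = (CLBINT u. of_real (1 / B (y j)) * (iexp (-u) * (\<sigma> (u / y j) / (1 - char M (u / y j)))))"
      by (rule integral_mult_right_zero[symmetric])
    also have "\<dots> = fourier (H j) (-1)"
      unfolding fourier_def by (intro Bochner_Integration.integral_cong) (auto simp: H_def)
    also have "\<dots> = fourier (\<lambda>t. (H j t - H j (t + pi / -1)) / 2) (-1)"
      by (rule half_shift[OF H_int]) simp
    finally show ?thesis by (simp add: fourier_def)
  qed
  \<comment> \<open>The radius is enlarged by pi because one of u and \<open>u - pi\<close> may
    leave the scaled support while the other is inside.\<close>
  obtain C1 y1 where C1: "0 < C1" and y1: "0 < y1"
    and inv: "\<And>y u. y1 \<le> y \<Longrightarrow> u \<noteq> 0 \<Longrightarrow> \<bar>u\<bar> \<le> (R' + pi) * y \<Longrightarrow> 1 / (B y * cmod (1 - char M (u / y))) \<le> C1 * W u"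
    using inverse_char_bound[of "R' + pi"] by blast
  obtain C2 y2 where C2: "0 < C2" and y2: "0 < y2"
    and inc: "\<And>y t s. y2 \<le> y \<Longrightarrow> \<bar>s\<bar> = 1/y \<Longrightarrow> B y * cmod (char M (t + s) - char M t) \<le> C2"
    using char_increment by blast
  obtain C3 y3 where C3: "0 < C3" and y3: "0 < y3"
    and sc: "\<And>y u. y3 \<le> y \<Longrightarrow> u \<noteq> 0 \<Longrightarrow> 1 \<le> y / \<bar>u\<bar> \<Longrightarrow> B (y / \<bar>u\<bar>) \<le> C3 * W u * B y"
    using B_scaled_W[of 1] by auto
  obtain C4 y4 where C4: "0 < C4" and y4: "0 < y4"
    and sc4: "\<And>y x. y4 \<le> y \<Longrightarrow> 0 < x \<Longrightarrow> B y \<le> C4 * max (x powr -\<beta>1) (x powr -\<beta>2) * B (y * x)"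
    using B_scaled_ge[OF \<beta>(1-3)] by blast
  \<comment> \<open>The half-period shift is \<open>pi / y\<close>, so \<open>char_increment\<close>
    is applied at the level \<open>y / pi\<close>; this constant compares \<open>B y\<close> with
    \<open>B (y / pi)\<close>.\<close>
  define c5 where "c5 = C4 * max ((1/pi) powr -\<beta>1) ((1/pi) powr -\<beta>2)"
  have c5: "0 < c5" using C4 by (simp add: c5_def less_max_iff_disj)
  define K1 where "K1 = Cs * C1 * C1 * (c5 * C2)"
  define K2 where "K2 = Lc * pi * (R' + pi + 1) * C1"
  have K: "0 \<le> K1" "0 \<le> K2" using Cs C1 C2 c5 Lc R' by (auto simp: K1_def K2_def)
  have ev: "\<forall>\<^sub>F j in sequentially. max 1 (max y1 (max (pi * y2) y4)) \<le> y j"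
    using y(1) unfolding filterlim_at_top by blast
  then obtain J where J: "\<And>j. J \<le> j \<Longrightarrow> max 1 (max y1 (max (pi * y2) y4)) \<le> y j"
    by (auto simp: eventually_sequentially)
  have dom: "cmod ((H j u - H j (u - pi)) / 2) \<le> (K1 + K2) * (E' u + E' (u - pi))"
    if j: "J \<le> j" and u: "u \<noteq> 0" "u \<noteq> pi" for j u
  proof -
    have yj: "1 \<le> y j" "y1 \<le> y j" "pi * y2 \<le> y j" "y4 \<le> y j" using J[OF j] by auto
    have ypos: "0 < y j" using y(2) .
    have nnE: "0 \<le> E' u + E' (u - pi)" by (intro add_nonneg_nonneg two_power_nonneg)
    show ?thesis
    proof (cases "\<bar>u\<bar> \<le> R' * y j \<or> \<bar>u - pi\<bar> \<le> R' * y j")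
      case False
      then have "R' < \<bar>u / y j\<bar>" "R' < \<bar>(u - pi) / y j\<bar>"
        using ypos by (auto simp: abs_divide pos_less_divide_eq)
      then have "\<sigma> (u / y j) = 0" "\<sigma> ((u - pi) / y j) = 0" by (auto intro!: supp')
      then show ?thesis using nnE K by (simp add: H_def)
    next
      case True
      have pi_le: "pi \<le> pi * y j" using yj(1) by simp
      have "\<bar>u\<bar> \<le> R' * y j + pi" "\<bar>u - pi\<bar> \<le> R' * y j + pi" using True pi_gt3 by linarith+
      then have ub: "\<bar>u\<bar> \<le> (R' + pi) * y j" "\<bar>u - pi\<bar> \<le> (R' + pi) * y j"
        using pi_le by (simp_all only: distrib_right)
      define q1 where "q1 = of_real (B (y j)) * (1 - char M (u / y j))"
      define q2 where "q2 = of_real (B (y j)) * (1 - char M ((u - pi) / y j))"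
      have u': "u - pi \<noteq> 0" using u by simp
      have t0: "u / y j \<noteq> 0" "(u - pi) / y j \<noteq> 0" using u u' ypos by auto
      have q0: "q1 \<noteq> 0" "q2 \<noteq> 0"
        using char_ne_1[OF t0(1)] char_ne_1[OF t0(2)] By[of j] by (auto simp: q1_def q2_def)
      have i1: "1 / cmod q1 \<le> C1 * W u" using inv[OF yj(2) u(1) ub(1)] By[of j] by (simp add: q1_def norm_mult)
      have i2: "1 / cmod q2 \<le> C1 * W (u - pi)" using inv[OF yj(2) u' ub(2)] By[of j] by (simp add: q2_def norm_mult)
      have dq: "cmod (q2 - q1) \<le> c5 * C2"
      proof -
        have "cmod (q2 - q1) = cmod (of_real (B (y j)) * (char M (u / y j) - char M (u / y j + (- pi / y j))))"
          by (simp add: q1_def q2_def diff_divide_distrib algebra_simps)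
        also have "\<dots> = B (y j) * cmod (char M (u / y j + (- pi / y j)) - char M (u / y j))"
          using By[of j] by (simp add: norm_mult norm_minus_commute)
        also have "\<dots> \<le> (c5 * B (y j / pi)) * cmod (char M (u / y j + (- pi / y j)) - char M (u / y j))"
          using sc4[OF yj(4), of "1/pi"] by (intro mult_right_mono) (auto simp: c5_def)
        also have "\<dots> = c5 * (B (y j / pi) * cmod (char M (u / y j + (- pi / y j)) - char M (u / y j)))" by simp
        also have "\<dots> \<le> c5 * C2"
        proof (intro mult_left_mono inc)
          show "y2 \<le> y j / pi" using yj(3) by (simp add: pos_le_divide_eq mult.commute)
        qed (use ypos c5 in \<open>auto simp: abs_divide\<close>)
        finally show ?thesis .
      qed
      \<comment> \<open>The increment of a product: the first term carries two reciprocal factors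
        and so \<open>W u * W (u - pi)\<close>; the second carries one, together with the Lipschitz
        increment of \<sigma>.\<close>
      have Heq: "H j u - H j (u - pi) = \<sigma> (u / y j) * ((q2 - q1) * (1 / q1) * (1 / q2)) + (\<sigma> (u / y j) - \<sigma> ((u - pi) / y j)) * (1 / q2)"
        using q0 unfolding H_def q1_def[symmetric] q2_def[symmetric] by (simp add: field_simps)
      have t1: "cmod (\<sigma> (u / y j) * ((q2 - q1) * (1 / q1) * (1 / q2))) \<le> K1 * (W u * W (u - pi))"
      proof -
        have "cmod (\<sigma> (u / y j) * ((q2 - q1) * (1 / q1) * (1 / q2))) = cmod (\<sigma> (u / y j)) * (cmod (q2 - q1) * (1 / cmod q1) * (1 / cmod q2))"
          by (simp only: norm_mult norm_divide norm_one)
        also have "\<dots> \<le> Cs * ((c5 * C2) * (C1 * W u) * (C1 * W (u - pi)))"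
          using Cs dq i1 i2 c5 C2 C1 by (intro mult_mono mult_nonneg_nonneg) (auto simp: two_power_nonneg)
        finally show ?thesis by (simp add: K1_def mult_ac)
      qed
      have t2: "cmod ((\<sigma> (u / y j) - \<sigma> ((u - pi) / y j)) * (1 / q2)) \<le> K2 * (min 1 (1 / \<bar>u - pi\<bar>) * W (u - pi))"
      proof -
        have "cmod (\<sigma> (u / y j) - \<sigma> ((u - pi) / y j)) \<le> Lc * (pi * (1 / y j))"
          using lip[of "u / y j" "(u - pi) / y j"] ypos by (simp add: diff_divide_distrib abs_divide)
        \<comment> \<open>The Lipschitz gain \<open>1 / y\<close> is converted into decay in u,
          since on the scaled support \<open>\<bar>u - pi\<bar>\<close> is at most a multiple of
          y.\<close>
        also have "1 / y j \<le> (R' + pi + 1) * min 1 (1 / \<bar>u - pi\<bar>)"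
        proof -
          have "1 / y j \<le> 1" using yj(1) by simp
          also have "\<dots> \<le> (R' + pi + 1) * 1" using R' pi_gt3 by simp
          finally have a: "1 / y j \<le> (R' + pi + 1) * 1" .
          have "\<bar>u - pi\<bar> \<le> (R' + pi + 1) * y j" using ub(2) ypos by (simp add: distrib_right)
          then have b: "1 / y j \<le> (R' + pi + 1) * (1 / \<bar>u - pi\<bar>)"
            using u' ypos by (simp add: field_simps)
          from a b show ?thesis by (simp add: min_def)
        qed
        finally have "cmod (\<sigma> (u / y j) - \<sigma> ((u - pi) / y j)) \<le> Lc * (pi * ((R' + pi + 1) * min 1 (1 / \<bar>u - pi\<bar>)))"
          using Lc by (simp add: mult_left_mono)
        then have "cmod (\<sigma> (u / y j) - \<sigma> ((u - pi) / y j)) * (1 / cmod q2) \<le> (Lc * (pi * ((R' + pi + 1) * min 1 (1 / \<bar>u - pi\<bar>)))) * (C1 * W (u - pi))"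
          using i2 Lc R' by (intro mult_mono mult_nonneg_nonneg) auto
        then show ?thesis by (simp add: norm_mult norm_divide K2_def mult_ac)
      qed
      have "cmod ((H j u - H j (u - pi)) / 2) \<le> cmod (H j u - H j (u - pi))" by (simp add: norm_divide)
      also have "\<dots> \<le> K1 * (W u * W (u - pi)) + K2 * (min 1 (1 / \<bar>u - pi\<bar>) * W (u - pi))"
        unfolding Heq by (rule order_trans[OF norm_triangle_ineq add_mono[OF t1 t2]])
      also have "\<dots> \<le> K1 * (E' u + E' (u - pi)) + K2 * (E' u + E' (u - pi))"
      proof (intro add_mono mult_left_mono K W_mult_le u)
        show "min 1 (1 / \<bar>u - pi\<bar>) * W (u - pi) \<le> E' u + E' (u - pi)"
          using min_W_le[OF u'] two_power_nonneg[of \<beta>1 "2 * \<beta>2" u] by linarith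
      qed
      finally show ?thesis by (simp add: distrib_right)
    qed
  qed
  have H_lim: "(\<lambda>j. H j v) \<longlonglongrightarrow> \<sigma> 0 * (1 / - L.psi lam v)" if v: "v \<noteq> 0" for v
  proof -
    have "(\<lambda>j. v / y j) \<longlonglongrightarrow> 0"
      by (rule tendsto_divide_0[OF tendsto_const filterlim_at_top_imp_at_infinity[OF y(1)]])
    then have s: "(\<lambda>j. \<sigma> (v / y j)) \<longlonglongrightarrow> \<sigma> 0"
      using ls(1) by (intro isCont_tendsto_compose[of 0 \<sigma>]) (auto simp: continuous_on_eq_continuous_at)
    have e: "(\<lambda>j. - (of_real (B (y j)) * (char M (v / y j) - 1))) \<longlonglongrightarrow> - L.psi lam v"
      by (intro tendsto_minus exponent_limit[OF y N lam])
    have "- L.psi lam v \<noteq> 0" using Re_neg_psi_pos[OF lam(2) v] by auto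
    from tendsto_divide[OF s e this] show ?thesis by (simp add: H_def right_diff_distrib)
  qed
  have "(\<lambda>j. CLBINT u. iexp (-u) * ((H (j + J) u - H (j + J) (u - pi)) / 2)) \<longlonglongrightarrow> (CLBINT u. iexp (-u) * (\<sigma> 0 * potential_kernel lam u))"
  proof (rule integral_dominated_convergence[OF _ _ integrable_E'_sum[of "K1 + K2"]])
    show "(\<lambda>u. iexp (-u) * (\<sigma> 0 * potential_kernel lam u)) \<in> borel_measurable lborel" unfolding potential_kernel_def by measurable
    show "(\<lambda>u. iexp (-u) * ((H (j + J) u - H (j + J) (u - pi)) / 2)) \<in> borel_measurable lborel" for j by measurable
    show "AE u in lborel. (\<lambda>j. iexp (-u) * ((H (j + J) u - H (j + J) (u - pi)) / 2)) \<longlonglongrightarrow> iexp (-u) * (\<sigma> 0 * potential_kernel lam u)"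
      using AE_lborel_singleton[of 0] AE_lborel_singleton[of pi]
    proof eventually_elim
      case (elim u)
      have "(\<lambda>j. iexp (-u) * ((H j u - H j (u - pi)) / 2)) \<longlonglongrightarrow> iexp (-u) * ((\<sigma> 0 * (1 / - L.psi lam u) - \<sigma> 0 * (1 / - L.psi lam (u - pi))) / 2)"
        using elim by (intro tendsto_mult tendsto_divide tendsto_diff tendsto_const H_lim) auto
      also have "(\<sigma> 0 * (1 / - L.psi lam u) - \<sigma> 0 * (1 / - L.psi lam (u - pi))) / 2 = \<sigma> 0 * potential_kernel lam u"
        by (simp only: potential_kernel_def right_diff_distrib times_divide_eq_right)
      finally show ?case by (rule LIMSEQ_ignore_initial_segment)
    qed
    show "AE u in lborel. norm (iexp (-u) * ((H (j + J) u - H (j + J) (u - pi)) / 2)) \<le> (K1 + K2) * (E' u + E' (u - pi))" for j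
      using AE_lborel_singleton[of 0] AE_lborel_singleton[of pi]
    proof eventually_elim
      case (elim u)
      have "norm (iexp (-u) * ((H (j + J) u - H (j + J) (u - pi)) / 2)) = cmod ((H (j + J) u - H (j + J) (u - pi)) / 2)"
        by (simp only: norm_mult norm_exp_i_times mult_1)
      then show ?case using dom[of "j + J" u] elim by simp
    qed
  qed
  from LIMSEQ_offset[OF this]
  have "(\<lambda>j. CLBINT u. iexp (-u) * ((H j u - H j (u - pi)) / 2)) \<longlonglongrightarrow> (CLBINT u. \<sigma> 0 * (iexp (-u) * potential_kernel lam u))"
    by (simp only: mult.left_commute)
  then show ?thesis unfolding S_eq integral_mult_right_zero .
qed

lemma potential_nonneg: "0 < lam \<Longrightarrow> 0 \<le> potential lam"
  unfolding potential_def set_lebesgue_integral_def using alpha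
  by (intro mult_nonneg_nonneg integral_nonneg_AE AE_I2) (auto simp: indicator_def semistable_density_eq_g(2))

lemma renewal_limit:
  fixes y :: "nat \<Rightarrow> real"
  assumes y: "filterlim y at_top sequentially" "\<And>j. 0 < y j"
    and N: "filterlim N at_top sequentially"
    and lam: "(\<lambda>j. B (y j) / k (N j)) \<longlonglongrightarrow> lam" "0 < lam" and h: "0 < h"
  shows "(\<lambda>j. y j / B (y j) * (renewal_function M (y j + h) - renewal_function M (y j - h))) \<longlonglongrightarrow> 2 * h * potential lam"
proof -
  define I where "I = (CLBINT u. iexp (-u) * potential_kernel lam u)"
  have lim: "(\<lambda>j. complex_of_real (y j / B (y j) * (\<integral>x. f (x - y j) \<partial>renewal_measure M))) \<longlonglongrightarrow> \<sigma> 0 * I"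
    if lip: "\<And>s t. cmod (\<sigma> s - \<sigma> t) \<le> Lc * \<bar>s - t\<bar>" and supp: "\<And>t. R < \<bar>t\<bar> \<Longrightarrow> \<sigma> t = 0"
      and f: "\<And>x. complex_of_real (f x) = fourier \<sigma> x" "\<And>x. 0 \<le> f x"
    for \<sigma> f Lc R
  proof -
    note ls = lipschitz_compact_support[of \<sigma> Lc R, OF lip supp]
    have "complex_of_real (\<integral>x. f (x - y j) \<partial>renewal_measure M) = (CLBINT t. iexp (- (t * y j)) * \<sigma> t / (1 - char M t))" for j
      using has_bochner_integral_renewal_fourier[OF ls(2,3) supp f, of R "y j"]
        Im_renewal_fourier[OF ls(2,3) supp f, of R "y j"]
      by (simp add: has_bochner_integral_iff complex_eq_iff)
    then show ?thesis
      using renewal_fourier_limit[OF y N lam lip supp] by (simp add: I_def)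
  qed
  \<comment> \<open>Testing with a Fejer kernel: the prelimits are real and its transform is 1 at 0,
    so the constant is real.\<close>
  have "Im I = 0"
  proof -
    have "(\<lambda>j. complex_of_real (y j / B (y j) * (\<integral>x. fejer 1 (x - y j) \<partial>renewal_measure M))) \<longlonglongrightarrow> complex_of_real (tent 1 0) * I"
    proof (rule lim)
      show "cmod (complex_of_real (tent 1 s) - complex_of_real (tent 1 t)) \<le> 1 * \<bar>s - t\<bar>" for s t
        using tent_lipschitz[of 1 s t] by (simp flip: of_real_diff)
      show "1 < \<bar>t\<bar> \<Longrightarrow> complex_of_real (tent 1 t) = 0" for t using tent_outside[of 1 t] by simp
    qed (simp_all add: fourier_tent fejer_nonneg)
    from tendsto_Im[OF this] have "(\<lambda>j::nat. 0::real) \<longlonglongrightarrow> Im I" by simp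
    then show ?thesis by (simp add: LIMSEQ_const_iff)
  qed
  moreover have "Re I = 2 * pi * potential lam" using potential_eq[OF lam(2)] by (simp add: I_def)
  ultimately have I: "I = of_real (2 * pi * potential lam)" by (simp add: complex_eq_iff)
  \<comment> \<open>The factor \<open>2 * pi\<close> of Fourier inversion cancels against
    \<open>h / pi\<close>, the mass of \<open>{-h..h}\<close> divided by the kernel under the
    normalised Fejer law, and leaves \<open>2 * h\<close>.\<close>
  have "(\<lambda>j. y j / B (y j) * measure (renewal_measure M) {y j - h<..y j + h}) \<longlonglongrightarrow> (2 * pi * potential lam) * h / pi"
  proof (rule renewal_interval_limit[OF h])
    show "0 < y j / B (y j)" for j using y(2)[of j] B_ge_1[OF y(2)[of j]] by simp
    show "0 \<le> 2 * pi * potential lam" using potential_nonneg[OF lam(2)] by simp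
    fix \<sigma> :: "real \<Rightarrow> complex" and f :: "real \<Rightarrow> real" and Lc R
    assume "\<And>s t. cmod (\<sigma> s - \<sigma> t) \<le> Lc * \<bar>s - t\<bar>" "\<And>t. R < \<bar>t\<bar> \<Longrightarrow> \<sigma> t = 0"
      "\<And>x. complex_of_real (f x) = fourier \<sigma> x" "\<And>x. 0 \<le> f x"
    from tendsto_Re[OF lim[OF this]]
    have "(\<lambda>j. y j / B (y j) * (\<integral>x. f (x - y j) \<partial>renewal_measure M)) \<longlonglongrightarrow> Re (\<sigma> 0 * I)"
      by (simp only: Re_complex_of_real)
    also have "Re (\<sigma> 0 * I) = Re (\<sigma> 0) * (2 * pi * potential lam)"
      by (simp only: I times_complex.sel Re_complex_of_real Im_complex_of_real mult_zero_right diff_zero)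
    finally show "(\<lambda>j. y j / B (y j) * (\<integral>x. f (x - y j) \<partial>renewal_measure M)) \<longlonglongrightarrow> 2 * pi * potential lam * Re (\<sigma> 0)"
      by (simp only: mult.commute)
  qed
  then show ?thesis unfolding renewal_function_diff[OF h] by (simp add: mult_ac)
qed

end

section \<open>The position parameter\<close>

context semistable_tail
begin

lemma position_eq:
  assumes "1 \<le> n" "real (k (n - 1)) < z" "z \<le> real (k n)"
  shows "position k z = z / k n"
proof -
  have "(THE n. 1 \<le> n \<and> k (n - 1) < z \<and> z \<le> k n) = n"
  proof (rule the_equality)
    fix m assume m: "1 \<le> m \<and> real (k (m - 1)) < z \<and> z \<le> real (k m)"
    show "m = n"
    proof (rule ccontr)
      assume "m \<noteq> n"
      then consider "m \<le> n - 1" | "n \<le> m - 1" by linarith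
      then show False
      proof cases
        case 1
        then have "k m \<le> k (n - 1)" using strict_mono_less_eq[OF k(2)] by blast
        then show False using m assms by linarith
      next
        case 2
        then have "k n \<le> k (m - 1)" using strict_mono_less_eq[OF k(2)] by blast
        then show False using m assms by linarith
      qed
    qed
  qed (use assms in auto)
  then show ?thesis by (simp add: position_def)
qed

text \<open>The \<open>LEAST\<close> form turns the definite description into an expression whose
  measurability is accessible.\<close>

lemma position_Least:
  assumes z: "0 < z"
  shows "position k z = z / k (LEAST n. z \<le> real (k n))" and "0 < position k z"
proof -
  obtain m where "z \<le> real m" using real_arch_simple by blast
  then have ex: "z \<le> real (k m)" using k_ge[of m] by (meson of_nat_le_iff order_trans)
  define n where "n = (LEAST n. z \<le> real (k n))"
  have n: "z \<le> real (k n)" unfolding n_def by (rule LeastI[of "\<lambda>n. z \<le> real (k n)", OF ex])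
  then have n1: "1 \<le> n" using z k(1) by (cases "n = 0") auto
  have "\<not> z \<le> real (k (n - 1))"
    using n1 not_less_Least[of "n - 1" "\<lambda>n. z \<le> real (k n)"] by (simp add: n_def)
  then have "position k z = z / k n" using n n1 by (intro position_eq) auto
  then show "position k z = z / k (LEAST n. z \<le> real (k n))" "0 < position k z"
    using z n by (simp_all add: n_def)
qed

text \<open>At nonpositive arguments the description has no witness, so the value there is set to
  0.\<close>

lemma position_measurable: "(\<lambda>z. if 0 < z then position k z else 0) \<in> borel_measurable borel"
proof -
  have "(\<lambda>z. if 0 < z then position k z else 0) = (\<lambda>z. if 0 < z then z / k (LEAST n. z \<le> real (k n)) else 0)"
    using position_Least(1) by auto
  also have "\<dots> \<in> borel_measurable borel" by measurable
  finally show ?thesis .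
qed

text \<open>If \<kappa> lies strictly between \<open>c powr m\<close> and
  \<open>c powr (m + 1)\<close>, the bracketing index is eventually \<open>N j + m + 1\<close>. At a
  power of c the position jumps, so these \<kappa> are excluded.\<close>

lemma position_limit:
  assumes N: "filterlim N at_top sequentially"
    and lam: "(\<lambda>j. v j / k (N j)) \<longlonglongrightarrow> \<kappa>" "0 < \<kappa>" and ne: "\<And>m::int. \<kappa> \<noteq> c powr m"
  shows "\<exists>m::int. (\<lambda>j. position k (v j)) \<longlonglongrightarrow> c powr m * \<kappa>"
proof -
  define m where "m = \<lfloor>log c \<kappa>\<rfloor>"
  have m: "c powr m < \<kappa>" "\<kappa> < c powr (m + 1)"
    using floor_log_eq_powr_iff[OF lam(2) c, of m] ne[of m] by (auto simp: m_def)
  have N1: "\<forall>\<^sub>F j in sequentially. Suc (nat \<bar>m\<bar>) \<le> N j" using N by (simp add: filterlim_at_top)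
  have lim: "(\<lambda>j. k (nat (int (N j) + i)) / real (k (N j))) \<longlonglongrightarrow> c powr i" for i
    using filterlim_compose[OF k_shift_int N] .
  have "\<forall>\<^sub>F j in sequentially. 0 < v j / k (N j) - k (nat (int (N j) + m)) / real (k (N j))"
    using m(1) by (intro order_tendstoD(1)[OF tendsto_diff[OF lam(1) lim]]) simp
  moreover have "\<forall>\<^sub>F j in sequentially. 0 < k (nat (int (N j) + (m + 1))) / real (k (N j)) - v j / k (N j)"
    using m(2) by (intro order_tendstoD(1)[OF tendsto_diff[OF lim lam(1)]]) simp
  ultimately have "\<forall>\<^sub>F j in sequentially. (v j / k (N j)) / (k (nat (int (N j) + (m + 1))) / real (k (N j))) = position k (v j)"
    using N1
  proof eventually_elim
    case (elim j)
    define n where "n = nat (int (N j) + (m + 1))"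
    have kN: "0 < k (N j)" using elim(3) by (intro k_pos) simp
    have n: "1 \<le> n" "n - 1 = nat (int (N j) + m)" using elim(3) by (auto simp: n_def)
    have "real (k (n - 1)) < v j" using elim(1) kN unfolding n(2) by (simp add: field_simps)
    moreover have "v j \<le> real (k n)" using elim(2) kN unfolding n_def by (simp add: field_simps)
    ultimately have "position k (v j) = v j / k n" using n by (intro position_eq)
    then show ?case using kN by (simp add: n_def)
  qed
  moreover have "(\<lambda>j. (v j / k (N j)) / (k (nat (int (N j) + (m + 1))) / real (k (N j)))) \<longlonglongrightarrow> \<kappa> / c powr (m + 1)"
    using c by (intro tendsto_divide lam(1) lim) auto
  ultimately have "(\<lambda>j. position k (v j)) \<longlonglongrightarrow> \<kappa> / c powr (m + 1)" by (rule Lim_transform_eventually[rotated])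
  also have "\<kappa> / c powr (m + 1) = c powr of_int (- (m + 1)) * \<kappa>"
    by (simp only: of_int_minus powr_minus_divide) simp
  finally show ?thesis by blast
qed

end

context semistable_renewal
begin

lemma AE_not_geometric:
  assumes lam: "0 < lam" shows "AE x in lborel. 0 < x \<longrightarrow> (\<forall>m::int. lam * x powr (-\<alpha>) \<noteq> c powr m)"
proof (rule AE_I')
  have "countable ((\<lambda>m::int. (c powr m / lam) powr (-1/\<alpha>)) ` UNIV)" by simp
  moreover have "{x. 0 < x \<and> (\<exists>m::int. lam * x powr (-\<alpha>) = c powr m)} \<subseteq> (\<lambda>m::int. (c powr m / lam) powr (-1/\<alpha>)) ` UNIV"
  proof safe
    fix x m assume x: "0 < x" "lam * x powr (-\<alpha>) = c powr of_int m"
    have "(c powr of_int m / lam) powr (-1/\<alpha>) = x" using lam x(1) alpha by (simp add: x(2)[symmetric] powr_powr)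
    then show "x \<in> range (\<lambda>m::int. (c powr m / lam) powr (-1/\<alpha>))" by (metis rangeI)
  qed
  ultimately have "countable {x. 0 < x \<and> (\<exists>m::int. lam * x powr (-\<alpha>) = c powr m)}" by (rule countable_subset[rotated])
  then show "{x. 0 < x \<and> (\<exists>m::int. lam * x powr (-\<alpha>) = c powr m)} \<in> null_sets lborel" by (rule countable_imp_null_set_lborel)
qed auto

text \<open>The integer m in the limit of the position varies with x, but for each fixed x the
  density converges by periodicity, except at countably many x. The density bounds give the
  majorant: bounded near 0, decaying at infinity.\<close>

lemma position_integral_limit:
  fixes v :: "nat \<Rightarrow> real"
  assumes v: "\<And>j. 0 < v j" and N: "filterlim N at_top sequentially"
    and lam: "(\<lambda>j. v j / k (N j)) \<longlonglongrightarrow> lam" "0 < lam"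
  shows "(\<lambda>j. \<alpha> * (LBINT x:{0<..}. semistable_density \<alpha> MR (position k (v j * x powr (-\<alpha>))) x * x powr (-\<alpha>))) \<longlonglongrightarrow> potential lam"
proof -
  obtain C where C: "0 < C" "\<And>s x. 0 < s \<Longrightarrow> \<bar>L.g s x\<bar> \<le> C" "\<And>s x. 0 < s \<Longrightarrow> 0 < x \<Longrightarrow> \<bar>L.g s x\<bar> \<le> C * x powr (-\<alpha>)"
    using L.g_bounds by blast
  define q where "q z = (if 0 < z then position k z else 0)" for z
  have [measurable]: "q \<in> borel_measurable borel" unfolding q_def[abs_def] by (rule position_measurable)
  have meas: "(\<lambda>x. indicator {0<..} x * (L.g (p x) x * x powr (-\<alpha>))) \<in> borel_measurable borel"
    if p: "\<And>x. 0 < x \<Longrightarrow> 0 < p x" and [measurable]: "p' \<in> borel_measurable borel" and p': "\<And>x. 0 < x \<Longrightarrow> p' x = p x" for p p'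
  proof -
    note L.g_measurable[of p', measurable]
    have "(\<lambda>x. indicator {0<..} x * (L.g (p x) x * x powr (-\<alpha>))) = (\<lambda>x. indicator {0<..} x * ((if 0 < p' x then L.g (p' x) x else 0) * x powr (-\<alpha>)))"
      using p p' by (auto simp: indicator_def)
    also have "\<dots> \<in> borel_measurable borel" by measurable
    finally show ?thesis .
  qed
  have pos: "0 < position k (v j * x powr (-\<alpha>))" if "0 < x" for j x
    using v[of j] that by (intro position_Least(2)) simp
  have eq: "(LBINT x:{0<..}. semistable_density \<alpha> MR (position k (v j * x powr (-\<alpha>))) x * x powr (-\<alpha>)) =
      (LBINT x. indicator {0<..} x * (L.g (position k (v j * x powr (-\<alpha>))) x * x powr (-\<alpha>)))" for j
    unfolding set_lebesgue_integral_def
    using pos by (intro Bochner_Integration.integral_cong) (auto simp: indicator_def semistable_density_eq_g(1))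
  have "(\<lambda>j. LBINT x. indicator {0<..} x * (L.g (position k (v j * x powr (-\<alpha>))) x * x powr (-\<alpha>))) \<longlonglongrightarrow>
      (LBINT x. indicator {0<..} x * (L.g (lam * x powr (-\<alpha>)) x * x powr (-\<alpha>)))"
  proof (rule integral_dominated_convergence)
    show "integrable lborel (\<lambda>x. C * E x)" using alpha by (intro integrable_mult_right integrable_two_power) auto
    show "(\<lambda>x. indicator {0<..} x * (L.g (lam * x powr (-\<alpha>)) x * x powr (-\<alpha>))) \<in> borel_measurable lborel"
      using meas[of "\<lambda>x. lam * x powr (-\<alpha>)" "\<lambda>x. lam * x powr (-\<alpha>)"] lam(2) by simp
    show "(\<lambda>x. indicator {0<..} x * (L.g (position k (v j * x powr (-\<alpha>))) x * x powr (-\<alpha>))) \<in> borel_measurable lborel" for j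
    proof -
      have 1: "(\<lambda>x. q (v j * x powr (-\<alpha>))) \<in> borel_measurable borel" by measurable
      have 2: "q (v j * x powr (-\<alpha>)) = position k (v j * x powr (-\<alpha>))" if "0 < x" for x
        using that v[of j] by (simp add: q_def)
      show ?thesis using meas[OF pos 1 2] by simp
    qed
    show "AE x in lborel. norm (indicator {0<..} x * (L.g (position k (v j * x powr (-\<alpha>))) x * x powr (-\<alpha>))) \<le> C * E x" for j
    proof (rule AE_I2)
      fix x :: real
      show "norm (indicator {0<..} x * (L.g (position k (v j * x powr (-\<alpha>))) x * x powr (-\<alpha>))) \<le> C * E x"
      proof (cases "0 < x")
        case True
        note b = C(2,3)[OF pos[OF True, of j], of x]
        show ?thesis
        proof (cases "x \<le> 1")
          case x1: True
          have "\<bar>L.g (position k (v j * x powr (-\<alpha>))) x\<bar> * x powr (-\<alpha>) \<le> C * x powr (-\<alpha>)" using b by (intro mult_right_mono) auto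
          then show ?thesis using True x1 by (simp add: two_power_def abs_mult)
        next
          case x1: False
          have "\<bar>L.g (position k (v j * x powr (-\<alpha>))) x\<bar> * x powr (-\<alpha>) \<le> (C * x powr (-\<alpha>)) * x powr (-\<alpha>)"
            using b True by (intro mult_right_mono) auto
          also have "\<dots> = C * x powr (- (2 * \<alpha>))" by (simp add: powr_add[symmetric])
          finally show ?thesis using True x1 by (simp add: two_power_def abs_mult)
        qed
      qed (use C two_power_nonneg[of \<alpha> "2 * \<alpha>" x] in auto)
    qed
    show "AE x in lborel. (\<lambda>j. indicator {0<..} x * (L.g (position k (v j * x powr (-\<alpha>))) x * x powr (-\<alpha>))) \<longlonglongrightarrow>
        indicator {0<..} x * (L.g (lam * x powr (-\<alpha>)) x * x powr (-\<alpha>))"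
      using AE_not_geometric[OF lam(2)]
    proof eventually_elim
      case (elim x)
      show ?case
      proof (cases "0 < x")
        case True
        have \<kappa>: "0 < lam * x powr (-\<alpha>)" using lam True by simp
        have "(\<lambda>j. v j / k (N j) * x powr (-\<alpha>)) \<longlonglongrightarrow> lam * x powr (-\<alpha>)" by (intro tendsto_intros lam)
        then have "(\<lambda>j. v j * x powr (-\<alpha>) / k (N j)) \<longlonglongrightarrow> lam * x powr (-\<alpha>)" by simp
        from position_limit[OF N this \<kappa>] elim True
        obtain m :: int where m: "(\<lambda>j. position k (v j * x powr (-\<alpha>))) \<longlonglongrightarrow> c powr m * (lam * x powr (-\<alpha>))" by blast
        have "(\<lambda>j. L.g (position k (v j * x powr (-\<alpha>))) x) \<longlonglongrightarrow> L.g (c powr m * (lam * x powr (-\<alpha>))) x"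
          using c \<kappa> by (intro L.g_tendsto[OF m] pos True) auto
        then show ?thesis unfolding L.g_periodic_int[OF \<kappa>] by (intro tendsto_intros)
      qed simp
    qed
  qed
  then show ?thesis unfolding potential_def eq by (intro tendsto_mult_left) (simp add: set_lebesgue_integral_def)
qed

end

section \<open>The local renewal theorem\<close>

lemma (in semistable_tail) ell_pos: "0 < y \<Longrightarrow> 0 < ell \<alpha> l1 y"
  using Sup_level_set[of y] by (simp add: ell_def level_set_def)

text \<open>If the expectation of \<open>cos (t * X)\<close> equals its maximum 1, then
  \<open>t * X\<close> lies almost surely in the multiples of \<open>2 * pi\<close>.\<close>

lemma (in prob_space) char_eq_1_imp_arithmetic:
  assumes X [measurable]: "X \<in> borel_measurable M" and t: "t \<noteq> 0" and char: "char (distr M borel X) t = 1"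
  shows "arithmetic_rv M X"
proof -
  have int: "integrable M (\<lambda>\<omega>. iexp (t * X \<omega>))"
    by (rule integrable_const_bound[of _ 1]) (auto simp only: norm_exp_i_times, measurable)
  have "char (distr M borel X) t = (CLINT \<omega>|M. iexp (t * X \<omega>))"
    unfolding char_def by (subst integral_distr) auto
  then have "Re (CLINT \<omega>|M. iexp (t * X \<omega>)) = 1" using char by simp
  then have "(\<integral>\<omega>. cos (t * X \<omega>) \<partial>M) = 1"
    by (subst (asm) integral_Re[symmetric, OF int]) (simp add: Re_exp)
  moreover have int_cos: "integrable M (\<lambda>\<omega>. cos (t * X \<omega>))"
    by (rule integrable_const_bound[of _ 1]) (auto simp: abs_cos_le_one)
  ultimately have "(\<integral>\<omega>. 1 - cos (t * X \<omega>) \<partial>M) = 0" by (simp add: prob_space)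
  moreover have "integrable M (\<lambda>\<omega>. 1 - cos (t * X \<omega>))" using int_cos by simp
  ultimately have "AE \<omega> in M. 1 - cos (t * X \<omega>) = 0"
    by (subst (asm) integral_nonneg_eq_0_iff_AE) auto
  then have "AE \<omega> in M. \<exists>m::int. X \<omega> = of_int m * (2 * pi / \<bar>t\<bar>)"
  proof eventually_elim
    case (elim \<omega>)
    then have "cos (\<bar>t\<bar> * X \<omega>) = 1" by (cases "0 \<le> t") auto
    then obtain n :: int where "\<bar>t\<bar> * X \<omega> = of_int n * 2 * pi" using cos_one_2pi_int by blast
    then show ?case using t by (intro exI[of _ n]) (simp add: field_simps)
  qed
  then show ?thesis using t unfolding arithmetic_rv_def by (intro exI[of _ "2 * pi / \<bar>t\<bar>"]) auto
qed

text \<open>The selection r need not be increasing: a sequence along which \<open>D\<close> stays at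
  least \<epsilon> in modulus is contradicted by a single selected term.\<close>

lemma tendsto_0_at_top_subseqI:
  fixes D :: "real \<Rightarrow> real"
  assumes sub: "\<And>y. filterlim y at_top sequentially \<Longrightarrow> (\<And>j::nat. 0 < y j) \<Longrightarrow> \<exists>r::nat \<Rightarrow> nat. (\<lambda>j. D (y (r j))) \<longlonglongrightarrow> 0"
  shows "(D \<longlongrightarrow> 0) at_top"
proof (rule ccontr)
  assume "\<not> (D \<longlongrightarrow> 0) at_top"
  then obtain \<epsilon> where \<epsilon>: "0 < \<epsilon>" "\<not> (\<forall>\<^sub>F y in at_top. dist (D y) 0 < \<epsilon>)" unfolding tendsto_iff by blast
  have "\<exists>y. real (Suc n) \<le> y \<and> \<epsilon> \<le> \<bar>D y\<bar>" for n
    using \<epsilon>(2) unfolding eventually_at_top_linorder by (auto simp: not_less)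
  then obtain y where y: "\<And>n. real (Suc n) \<le> y n" "\<And>n. \<epsilon> \<le> \<bar>D (y n)\<bar>" by metis
  have ge: "real n \<le> y n" "0 < y n" for n using y(1)[of n] by simp_all
  have "filterlim y at_top sequentially"
    by (rule filterlim_at_top_mono[OF filterlim_real_sequentially]) (simp add: ge)
  from sub[OF this ge(2)] obtain r :: "nat \<Rightarrow> nat" where "(\<lambda>j. D (y (r j))) \<longlonglongrightarrow> 0" by blast
  then have "\<forall>\<^sub>F j in sequentially. dist (D (y (r j))) 0 < \<epsilon>" using \<epsilon>(1) by (rule tendstoD)
  then obtain j where "dist (D (y (r j))) 0 < \<epsilon>" using eventually_happens'[OF sequentially_bot] by blast
  then show False using y(2)[of "r j"] by simp
qed

context semistable_renewal
begin

text \<open>With \<open>N j\<close> the index bracketing \<open>B (y j)\<close>, the ratio lies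
  between 1 and \<open>k (N j + 1) / k (N j)\<close>, hence eventually in a compact interval away
  from 0.\<close>

lemma ex_subseq_ratio:
  fixes y :: "nat \<Rightarrow> real"
  assumes y: "filterlim y at_top sequentially" "\<And>j. 0 < y j"
  shows "\<exists>N r lam. filterlim N at_top sequentially \<and> strict_mono (r::nat \<Rightarrow> nat) \<and> 0 < lam \<and> (\<lambda>j. B (y (r j)) / k (N j)) \<longlonglongrightarrow> lam"
proof -
  have By: "1 \<le> B (y j)" for j by (rule B_ge_1[OF y(2)])
  obtain N where N: "\<And>j. real (k (N j)) \<le> B (y j)" "\<And>j. B (y j) < real (k (N j + 1))"
    using ex_k_bracket[OF By] by metis
  have By_top: "filterlim (\<lambda>j. B (y j)) at_top sequentially" using filterlim_compose[OF B_at_top y(1)] .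
  have N_top: "filterlim N at_top sequentially"
    unfolding filterlim_at_top
  proof
    fix Z
    have "\<forall>\<^sub>F j in sequentially. real (k Z) \<le> B (y j)" using By_top unfolding filterlim_at_top by blast
    then show "\<forall>\<^sub>F j in sequentially. Z \<le> N j"
    proof eventually_elim
      case (elim j)
      then have "k Z < k (N j + 1)" using N(2)[of j] by linarith
      then show ?case using strict_mono_less[OF k(2)] by simp
    qed
  qed
  have "\<forall>\<^sub>F n in sequentially. real (k (n + 1)) / real (k n) < c + 1" using order_tendstoD(2)[OF k(3)] by simp
  from eventually_compose_filterlim[OF this N_top]
  have "\<forall>\<^sub>F j in sequentially. B (y j) / k (N j) \<in> {1..c + 1}"
    using N_top[unfolded filterlim_at_top, rule_format, of 1]
  proof eventually_elim
    case (elim j)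
    have kN: "0 < real (k (N j))" using elim k_pos by simp
    have "B (y j) / k (N j) \<le> real (k (N j + 1)) / k (N j)" using N(2)[of j] by (intro divide_right_mono) auto
    then show ?case using elim N(1)[of j] kN by simp
  qed
  then obtain J where J: "\<And>j. J \<le> j \<Longrightarrow> B (y j) / k (N j) \<in> {1..c + 1}" by (auto simp: eventually_sequentially)
  define w where "w j = B (y (j + J)) / k (N (j + J))" for j
  have "seq_compact {1..c + 1}" using compact_Icc[of 1 "c + 1"] by (simp only: compact_eq_seq_compact_metric)
  moreover have "\<forall>j. w j \<in> {1..c + 1}" unfolding w_def using J by (intro allI) simp
  ultimately obtain lam r where r: "lam \<in> {1..c + 1}" "strict_mono (r :: nat \<Rightarrow> nat)" "(w \<circ> r) \<longlonglongrightarrow> lam"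
    by (rule seq_compactE)
  define r' where "r' j = r j + J" for j
  have r': "strict_mono r'" using r(2) by (simp add: r'_def strict_mono_def)
  show ?thesis
  proof (intro exI conjI)
    show "filterlim (\<lambda>j. N (r' j)) at_top sequentially" using filterlim_compose[OF N_top filterlim_subseq[OF r']] .
    show "(\<lambda>j. B (y (r' j)) / k (N (r' j))) \<longlonglongrightarrow> lam" using r(3) by (simp add: r'_def w_def[abs_def] o_def)
  qed (use r r' in auto)
qed

lemma local_renewal_theorem:
  assumes h: "0 < h"
  shows "((\<lambda>y. \<bar>y powr (1 - \<alpha>) * ell \<alpha> l1 y / (2 * h) * (renewal_function M (y + h) - renewal_function M (y - h)) -
      \<alpha> * (LBINT x:{0<..}. semistable_density \<alpha> MR (position k (B y * x powr (-\<alpha>))) x * x powr (-\<alpha>))\<bar>) \<longlongrightarrow> 0) at_top"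
    (is "(?D \<longlongrightarrow> 0) at_top")
proof (rule tendsto_0_at_top_subseqI)
  fix y :: "nat \<Rightarrow> real" assume y: "filterlim y at_top sequentially" "\<And>j. 0 < y j"
  obtain N r lam where N: "filterlim N at_top sequentially" and r: "strict_mono (r :: nat \<Rightarrow> nat)"
    and lam: "0 < lam" "(\<lambda>j. B (y (r j)) / k (N j)) \<longlonglongrightarrow> lam"
    using ex_subseq_ratio[OF y] by blast
  define z where "z j = y (r j)" for j
  have z: "filterlim z at_top sequentially" "\<And>j. 0 < z j"
    using filterlim_compose[OF y(1) filterlim_subseq[OF r]] y(2) by (simp_all add: z_def[abs_def])
  have Bz: "0 < B (z j)" for j using B_ge_1[OF z(2)[of j]] by simp
  have lam': "(\<lambda>j. B (z j) / k (N j)) \<longlonglongrightarrow> lam" using lam(2) by (simp only: z_def)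
  \<comment> \<open>The normalisation in the statement is \<open>y / B y\<close>, because
    \<open>B y = y powr \<alpha> / ell \<alpha> l1 y\<close>.\<close>
  have norm: "z j powr (1 - \<alpha>) * ell \<alpha> l1 (z j) = z j / B (z j)" for j
    using z(2)[of j] ell_pos[OF z(2)[of j]] by (simp add: asym_inv_def powr_diff)
  have "(\<lambda>j. z j / B (z j) * (renewal_function M (z j + h) - renewal_function M (z j - h)) / (2 * h)) \<longlonglongrightarrow> 2 * h * potential lam / (2 * h)"
    using h by (intro tendsto_divide renewal_limit[OF z N lam' lam(1) h] tendsto_const) auto
  moreover have "2 * h * potential lam / (2 * h) = potential lam" using h by simp
  ultimately have "(\<lambda>j. z j powr (1 - \<alpha>) * ell \<alpha> l1 (z j) / (2 * h) * (renewal_function M (z j + h) - renewal_function M (z j - h))) \<longlonglongrightarrow> potential lam"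
    by (simp only: norm times_divide_eq_left)
  from tendsto_rabs_zero[OF tendsto_diff[OF this position_integral_limit[OF Bz N lam' lam(1)], unfolded diff_self]]
  have "(\<lambda>j. ?D (z j)) \<longlonglongrightarrow> 0" .
  then show "\<exists>r::nat \<Rightarrow> nat. (\<lambda>j. ?D (y (r j))) \<longlonglongrightarrow> 0" unfolding z_def by (intro exI[of _ r])
qed

end

theorem theorem5:
  fixes \<alpha> c :: real
    and k :: "nat \<Rightarrow> nat"
    and l1 MR hR F :: "real \<Rightarrow> real"
    and P :: "'a measure"
    and X :: "nat \<Rightarrow> 'a \<Rightarrow> real"
    and h :: real
  assumes alpha: "1/2 < \<alpha>" "\<alpha> < 1"
    and c: "1 < c"
    and k: "k 0 = 0" "strict_mono k" "(\<lambda>n. real (k (n + 1)) / real (k n)) \<longlonglongrightarrow> c"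
    and l1: "slowly_varying l1"
    and MR_pos: "\<And>x. 0 < x \<Longrightarrow> 0 < MR x"
    and MR_bounded: "\<exists>b. \<forall>x>0. MR x \<le> b"
    and MR_bounded_away: "\<exists>a>0. \<forall>x>0. a \<le> MR x"
    and MR_right_cont: "\<And>x. 0 < x \<Longrightarrow> continuous (at_right x) MR"
    and MR_nonconst: "\<not> (\<exists>C. \<forall>x>0. MR x = C)"
    and MR_periodic: "\<And>x. 0 < x \<Longrightarrow> MR (c powr (1/\<alpha>) * x) = MR x"
    and MR_mono: "antimono_on {0<..} (\<lambda>x. MR x * x powr (-\<alpha>))"
    and P: "prob_space P"
    and X_indep: "prob_space.indep_vars P (\<lambda>_. borel) X UNIV"
    and X_ident: "\<And>n. distr P borel (X n) = distr P borel (X 0)"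
    and X_nonneg: "AE \<omega> in P. 0 \<le> X 0 \<omega>"
    and X_nonarith: "\<not> arithmetic_rv P (X 0)"
    and F: "F = cdf (distr P borel (X 0))"
    and F_tail: "\<forall>\<^sub>F x in at_top. 1 - F x = ell \<alpha> l1 x / x powr \<alpha> * (MR (delta \<alpha> l1 k x) + hR x)"
    and hR_right_cont: "\<And>x. 0 < x \<Longrightarrow> continuous (at_right x) hR"
    and hR_lim: "\<And>x. 0 < x \<Longrightarrow> isCont MR x \<Longrightarrow> (\<lambda>n. hR (norming \<alpha> l1 (k n) * x)) \<longlonglongrightarrow> 0"
    and h: "0 < h"
  shows "((\<lambda>y. \<bar>y powr (1 - \<alpha>) * ell \<alpha> l1 y / (2 * h) *
                  (renewal_function (distr P borel (X 0)) (y + h) -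
                   renewal_function (distr P borel (X 0)) (y - h)) -
                \<alpha> * (LBINT x:{0<..}.
                  semistable_density \<alpha> MR (position k (asym_inv \<alpha> l1 y * x powr (-\<alpha>))) x *
                  x powr (-\<alpha>))\<bar>) \<longlongrightarrow> 0) at_top"
proof -
  define M where "M = distr P borel (X 0)"
  interpret P: prob_space P by (rule P)
  have X0 [measurable]: "X 0 \<in> borel_measurable P" using X_indep unfolding P.indep_vars_def by simp
  interpret M: prob_space M unfolding M_def by (rule P.prob_space_distr) simp
  interpret M: real_distribution M by unfold_locales (simp_all add: M_def)
  obtain a0 where a0: "0 < a0" "\<And>x. 0 < x \<Longrightarrow> a0 \<le> MR x" using MR_bounded_away by blast
  obtain b0 where b0: "\<And>x. 0 < x \<Longrightarrow> MR x \<le> b0" using MR_bounded by blast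
  have F_eq: "F = cdf M" by (simp add: F M_def)
  interpret semistable_renewal \<alpha> l1 c k MR hR M a0 b0
  proof unfold_locales
    show "0 < \<alpha>" using alpha by simp
    show "slowly_varying l1" "1 < c" "k 0 = 0" "strict_mono k" "(\<lambda>n. real (k (n + 1)) / real (k n)) \<longlonglongrightarrow> c" "1/2 < \<alpha>" "\<alpha> < 1"
      by (fact l1 c k alpha)+
    show "antimono_on {0<..} (\<lambda>x. MR x * x powr (-\<alpha>))" by (fact MR_mono)
    show "\<forall>\<^sub>F x in at_top. 1 - cdf M x = ell \<alpha> l1 x / x powr \<alpha> * (MR (delta \<alpha> l1 k x) + hR x)"
      using F_tail by (simp only: F_eq)
    show "((\<lambda>x. 1 - cdf M x) \<longlongrightarrow> 0) at_top" using tendsto_diff[OF tendsto_const M.cdf_lim_at_top_prob, of 1] by simp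
    show "AE x in M. 0 \<le> x" unfolding M_def using X_nonneg by (subst AE_distr_iff) auto
    \<comment> \<open>Nonarithmeticity enters here.\<close>
    show "char M t \<noteq> 1" if "t \<noteq> 0" for t
      using P.char_eq_1_imp_arithmetic[OF X0 that] X_nonarith by (auto simp: M_def)
    show "0 \<le> 1 - cdf M x" "1 - cdf M x \<le> 1" for x
      using M.cdf_bounded_prob[of x] M.cdf_nonneg[of x] by simp_all
    show "1 - cdf M y \<le> 1 - cdf M x" if "x \<le> y" for x y using M.cdf_nondecreasing[OF that] by simp
  qed (use MR_pos MR_periodic MR_right_cont hR_lim a0 b0 in auto)
  show ?thesis using local_renewal_theorem[OF h] by (simp only: M_def)
qed

end
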